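(* Let $X$ and $Y$ be UMD Banach spaces, $d\ge1$, $p\in(1,\infty)$ with $1/p+1/p'=1$, let $\mathscr D$ be a system of dyadic cubes in $\mathbb R^d$, and let $b\in\mathrm{BMO}_d(\mathbb R^d;\mathscr L(X,Y))$. Then the symmetrised paraproduct $\Lambda_b$ extends to a bounded linear operator from $L^p(\mathbb R^d;X)$ to $L^p(\mathbb R^d;Y)$ with $$\|\Lambda_b\|_{\mathscr L(L^p(\mathbb R^d;X),L^p(\mathbb R^d;Y))}\le c_d\,(pp'+\beta_{p,X}\beta_{p,Y})\,\|b\|_{\mathrm{BMO}_d(\mathbb R^d;\mathscr L(X,Y))}\le c_d'\,\beta_{p,X}\beta_{p,Y}\,\|b\|_{\mathrm{BMO}_d(\mathbb R^d;\mathscr L(X,Y))},$$ where $c_d$ is the constant (depending only on $d$) in the dyadic $H^1$-$\mathrm{BMO}$ duality inequality, and $c_d'$ depends only on $d$.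
   Context: **Notation.** $\mathscr L(X,Y)$ is the space of bounded linear operators from $X$ to $Y$ with the operator norm. $L^p(\mathbb R^d;X)$ and $L^1_{\rm loc}(\mathbb R^d;\mathscr L(X,Y))$ are Bochner spaces; subscript $c$ means compact support. $X$ is UMD if for some (equivalently all) $p\in(1,\infty)$ there is a finite $\beta$ with $\|\sum_k\epsilon_kd_k\|_{L^p(X)}\le\beta\|\sum_kd_k\|_{L^p(X)}$ for all finite $X$-valued $L^p$-martingale difference sequences $(d_k)$ and all signs $\epsilon_k\in\{-1,+1\}$; the least such $\beta$ is the UMD constant $\beta_{p,X}$. **Dyadic system.** $\mathscr D=\bigcup_{k\in\mathbb Z}\mathscr D_k$, where each $\mathscr D_k$ is a partition of $\mathbb R^d$ into axes-parallel, left-closed, right-open cubes of side-length $2^{-k}$, and $\mathscr D_{k+1}$ refines $\mathscr D_k$. For a locally integrable $f$ with values in a Banach space, $\langle f\rangle_Q=\frac1{|Q|}\int_Qf$, $\mathbb E_kf=\sum_{Q\in\mathscr D_k}1_Q\langle f\rangle_Q$ and $\mathbb D_kf=\mathbb E_kf-\mathbb E_{k-1}f$. **Dyadic BMO and $H^1$.** For a Banach space $F$, $\mathrm{BMO}_d(\mathbb R^d;F)$ is the space of $b\in L^1_{\rm loc}(\mathbb R^d;F)$ with $\|b\|_{\mathrm{BMO}_d(\mathbb R^d;F)}=\sup_{Q\in\mathscr D}\frac1{|Q|}\int_Q\|b-\langle b\rangle_Q\|_F<\infty$. For a Banach space $E$, $H^1_d(\mathbb R^d;E)$ is the space of $h\in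 L^1(\mathbb R^d;E)$ with $\|h\|_{H^1_d(\mathbb R^d;E)}=\big\|\sup_{k\in\mathbb Z}\|\mathbb E_kh\|_E\big\|_{L^1(\mathbb R^d)}<\infty$. **$H^1$-$\mathrm{BMO}$ duality (known result, Bourgain).** There is a constant $c_d$, depending only on $d$, such that for every Banach space $E$, every $b\in\mathrm{BMO}_d(\mathbb R^d;E^* )$ and every $h\in H^1_d(\mathbb R^d;E)$, $$\Big|\lim_{N\to\infty}\int_{\mathbb R^d}\min\Big\{1,\frac N{\|b(x)\|_{E^*}}\Big\}\langle b(x),h(x)\rangle\,dx\Big|\le c_d\,\|b\|_{\mathrm{BMO}_d(\mathbb R^d;E^* )}\|h\|_{H^1_d(\mathbb R^d;E)}.$$ This is the constant $c_d$ in the claim. **Symmetrised paraproduct.** Formally $\Lambda_b=\Pi_b+\Pi_{b^*}^*$, where $\Pi_bf=\sum_{k\in\mathbb Z}\mathbb D_kb\,\mathbb E_{k-1}f$ and $b^*$ is the pointwise adjoint function $b^*(s)=b(s)^*\in\mathscr L(Y^*,X^* )$. Rigorously, $\Lambda_b$ is defined by the bilinear form $$\langle\Lambda_bf,g\rangle=\sum_{k\in\mathbb Z}\int_{\mathbb R^d}\Big(\big\langle b(s)\,\mathbb E_{k-1}f(s),\mathbb D_kg(s)\big\rangle+\big\langle b(s)\,\mathbb D_kf(s),\mathbb E_{k-1}g(s)\big\rangle\Big)\,ds$$ (pointwise pairing between $Y$ and $Y^*$) for all $f\in L^p_c(\mathbb R^d;X)$ and $g\in L^{p'}_c(\mathbb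 R^d;Y^* )$ with finite martingale difference expansions, i.e. $f=\sum_k\mathbb D_kf$ and $g=\sum_k\mathbb D_kg$ with only finitely many nonzero terms (so that the sum above is finite); such $f$, $g$ are dense in $L^p(\mathbb R^d;X)$ and $L^{p'}(\mathbb R^d;Y^* )$. "$\Lambda_b$ extends to a bounded operator" means that there is a bounded operator from $L^p(\mathbb R^d;X)$ to $L^p(\mathbb R^d;Y)$ inducing this bilinear form. *)

theory Defs
  imports "HOL-Probability.Probability"
begin

text \<open>
  Scalars are real throughout, and the dual of \<open>Y\<close> is \<open>'y \<Rightarrow>\<^sub>L real\<close>.  The Bochner
  theory of HOL-Analysis requires second countable (hence separable) target spaces, which would
  exclude non-separable Banach spaces and, above all, most spaces of operators; so strong
  measurability and the Bochner integral are set up here for arbitrary normed targets.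
\<close>


section \<open>Bochner integration with values in an arbitrary normed space\<close>

definition strongly_measurable :: "'a measure \<Rightarrow> ('a \<Rightarrow> 'b::real_normed_vector) \<Rightarrow> bool" where
  "strongly_measurable M f \<longleftrightarrow>
     (\<exists>s. (\<forall>n. simple_function M (s n)) \<and> (AE x in M. (\<lambda>n. s n x) \<longlonglongrightarrow> f x))"

text \<open>The library's \<open>has_bochner_integral\<close>, with Borel measurability replaced by strong
  measurability.\<close>

definition has_Bochner_integral ::
    "'a measure \<Rightarrow> ('a \<Rightarrow> 'b::real_normed_vector) \<Rightarrow> 'b \<Rightarrow> bool" where
  "has_Bochner_integral M f I \<longleftrightarrow> strongly_measurable M f \<and>
     (\<exists>s. (\<forall>n. Bochner_Integration.simple_bochner_integrable M (s n)) \<and>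
          (\<lambda>n. \<integral>\<^sup>+ x. ennreal (norm (f x - s n x)) \<partial>M) \<longlonglongrightarrow> 0 \<and>
          (\<lambda>n. Bochner_Integration.simple_bochner_integral M (s n)) \<longlonglongrightarrow> I)"

definition Bochner_integral :: "'a measure \<Rightarrow> ('a \<Rightarrow> 'b::real_normed_vector) \<Rightarrow> 'b" where
  "Bochner_integral M f =
     (if \<exists>I. has_Bochner_integral M f I then THE I. has_Bochner_integral M f I else 0)"


section \<open>Bochner spaces\<close>

text \<open>Elements are functions; equality in \<open>L\<^sup>p\<close> is equality almost everywhere.\<close>

definition Lp :: "real \<Rightarrow> 'a measure \<Rightarrow> ('a \<Rightarrow> 'b::real_normed_vector) set" where
  "Lp p M = {f. strongly_measurable M f \<and> (\<integral>\<^sup>+ x. ennreal (norm (f x) powr p) \<partial>M) < \<infinity>}"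

definition Lp_norm :: "real \<Rightarrow> 'a measure \<Rightarrow> ('a \<Rightarrow> 'b::real_normed_vector) \<Rightarrow> real" where
  "Lp_norm p M f = enn2real (\<integral>\<^sup>+ x. ennreal (norm (f x) powr p) \<partial>M) powr (1 / p)"

definition L1_loc :: "('a::euclidean_space \<Rightarrow> 'b::real_normed_vector) set" where
  "L1_loc = {f. strongly_measurable lebesgue f \<and>
     (\<forall>K. compact K \<longrightarrow> (\<integral>\<^sup>+ x\<in>K. ennreal (norm (f x)) \<partial>lebesgue) < \<infinity>)}"

definition Lp_c :: "real \<Rightarrow> ('a::euclidean_space \<Rightarrow> 'b::real_normed_vector) set" where
  "Lp_c p = {f \<in> Lp p lebesgue. \<exists>K. compact K \<and> (AE x in lebesgue. x \<notin> K \<longrightarrow> f x = 0)}"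

text \<open>A bounded linear operator between \<open>L\<^sup>p\<close> spaces, given on representatives.\<close>

definition bounded_Lp_operator ::
    "real \<Rightarrow> 'a measure \<Rightarrow> (('a \<Rightarrow> 'x::real_normed_vector) \<Rightarrow> ('a \<Rightarrow> 'y::real_normed_vector)) \<Rightarrow> bool"
  where
  "bounded_Lp_operator p M T \<longleftrightarrow>
     (\<forall>f\<in>Lp p M. T f \<in> Lp p M) \<and>
     (\<forall>f\<in>Lp p M. \<forall>g\<in>Lp p M. (AE x in M. f x = g x) \<longrightarrow> (AE x in M. T f x = T g x)) \<and>
     (\<forall>f\<in>Lp p M. \<forall>g\<in>Lp p M. AE x in M. T (\<lambda>x. f x + g x) x = T f x + T g x) \<and>
     (\<forall>f\<in>Lp p M. \<forall>r. AE x in M. T (\<lambda>x. r *\<^sub>R f x) x = r *\<^sub>R T f x) \<and>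
     (\<exists>C. \<forall>f\<in>Lp p M. Lp_norm p M (T f) \<le> C * Lp_norm p M f)"

definition Lp_operator_norm ::
    "real \<Rightarrow> 'a measure \<Rightarrow> (('a \<Rightarrow> 'x::real_normed_vector) \<Rightarrow> ('a \<Rightarrow> 'y::real_normed_vector)) \<Rightarrow> real"
  where
  "Lp_operator_norm p M T =
     Inf {C. 0 \<le> C \<and> (\<forall>f\<in>Lp p M. Lp_norm p M (T f) \<le> C * Lp_norm p M f)}"


section \<open>UMD spaces\<close>

text \<open>The \<open>d k\<close>, \<open>k < n\<close>, are the increments of an \<open>L\<^sup>p\<close>-martingale starting at \<open>0\<close>;
  the first one, \<open>d 0\<close>, need not have mean zero.\<close>

definition martingale_difference_sequence ::
    "real \<Rightarrow> 'w measure \<Rightarrow> (nat \<Rightarrow> 'w measure) \<Rightarrow> nat \<Rightarrow> (nat \<Rightarrow> 'w \<Rightarrow> 'x::banach) \<Rightarrow> bool" where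
  "martingale_difference_sequence p M F n d \<longleftrightarrow>
     filtration (space M) F \<and> (\<forall>k. subalgebra M (F k)) \<and>
     (\<forall>k<n. d k \<in> Lp p (restr_to_subalg M (F k))) \<and>
     (\<forall>k. Suc k < n \<longrightarrow>
        (\<forall>A\<in>sets (F k). Bochner_integral M (\<lambda>w. indicat_real A w *\<^sub>R d (Suc k) w) = 0))"

text \<open>A definition cannot quantify over the type of the sample space, so all probability measures
  (on arbitrary sigma-algebras) over the type \<open>real\<close> are used.  This includes the Lebesgue
  measure on the unit interval, on which every finite sequence of strongly measurable functions
  on any probability space has a copy with the same joint distribution, so the constant is that
  of arbitrary probability spaces.\<close>

definition UMD_bound :: "'x::banach itself \<Rightarrow> real \<Rightarrow> real \<Rightarrow> bool" where
  "UMD_bound X p \<beta> \<longleftrightarrow> 0 \<le> \<beta> \<and>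
     (\<forall>(M::real measure) F n (d :: nat \<Rightarrow> real \<Rightarrow> 'x) (\<epsilon> :: nat \<Rightarrow> real).
        prob_space M \<longrightarrow> martingale_difference_sequence p M F n d \<longrightarrow> (\<forall>k. \<epsilon> k \<in> {-1, 1}) \<longrightarrow>
        Lp_norm p M (\<lambda>w. \<Sum>k<n. \<epsilon> k *\<^sub>R d k w) \<le> \<beta> * Lp_norm p M (\<lambda>w. \<Sum>k<n. d k w))"

text \<open>Finiteness of the UMD constant for one exponent in \<open>(1, \<infinity>)\<close> is equivalent to finiteness for
  all of them; the latter form is taken as the definition.\<close>

definition UMD :: "'x::banach itself \<Rightarrow> bool" where
  "UMD X \<longleftrightarrow> (\<forall>p>1. \<exists>\<beta>. UMD_bound X p \<beta>)"

definition UMD_const :: "real \<Rightarrow> 'x::banach itself \<Rightarrow> real" where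
  "UMD_const p X = Inf {\<beta>. UMD_bound X p \<beta>}"


section \<open>Dyadic systems, dyadic BMO and \<open>H\<^sup>1\<close>\<close>

definition half_open_cube :: "real ^ 'd \<Rightarrow> real \<Rightarrow> (real ^ 'd) set" where
  "half_open_cube a l = {x. \<forall>i. a $ i \<le> x $ i \<and> x $ i < a $ i + l}"

text \<open>\<^const>\<open>refines\<close> includes that both collections are partitions.\<close>

definition dyadic_system :: "(int \<Rightarrow> (real ^ 'd) set set) \<Rightarrow> bool" where
  "dyadic_system \<D> \<longleftrightarrow>
     (\<forall>k. (\<forall>Q\<in>\<D> k. \<exists>a. Q = half_open_cube a (2 powi (- k))) \<and> refines UNIV (\<D> (k + 1)) (\<D> k))"

definition average :: "('a::euclidean_space \<Rightarrow> 'b::real_normed_vector) \<Rightarrow> 'a set \<Rightarrow> 'b" where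
  "average f Q =
     (1 / measure lebesgue Q) *\<^sub>R Bochner_integral lebesgue (\<lambda>x. indicat_real Q x *\<^sub>R f x)"

text \<open>For a partition \<open>\<D> k\<close> the sum has exactly one term.\<close>

definition dyadic_E ::
    "(int \<Rightarrow> 'a::euclidean_space set set) \<Rightarrow> int \<Rightarrow> ('a \<Rightarrow> 'b::real_normed_vector) \<Rightarrow> 'a \<Rightarrow> 'b" where
  "dyadic_E \<D> k f x = (\<Sum>Q\<in>{Q \<in> \<D> k. x \<in> Q}. average f Q)"

definition dyadic_D ::
    "(int \<Rightarrow> 'a::euclidean_space set set) \<Rightarrow> int \<Rightarrow> ('a \<Rightarrow> 'b::real_normed_vector) \<Rightarrow> 'a \<Rightarrow> 'b" where
  "dyadic_D \<D> k f x = dyadic_E \<D> k f x - dyadic_E \<D> (k - 1) f x"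

definition BMO_enorm ::
    "(int \<Rightarrow> 'a::euclidean_space set set) \<Rightarrow> ('a \<Rightarrow> 'b::real_normed_vector) \<Rightarrow> ennreal" where
  "BMO_enorm \<D> b = (SUP Q\<in>(\<Union>k. \<D> k).
     (\<integral>\<^sup>+ x\<in>Q. ennreal (norm (b x - average b Q)) \<partial>lebesgue) / emeasure lebesgue Q)"

definition BMO ::
    "(int \<Rightarrow> 'a::euclidean_space set set) \<Rightarrow> ('a \<Rightarrow> 'b::real_normed_vector) set" where
  "BMO \<D> = {b \<in> L1_loc. BMO_enorm \<D> b < \<infinity>}"

definition BMO_norm ::
    "(int \<Rightarrow> 'a::euclidean_space set set) \<Rightarrow> ('a \<Rightarrow> 'b::real_normed_vector) \<Rightarrow> real" where
  "BMO_norm \<D> b = enn2real (BMO_enorm \<D> b)"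

definition H1_enorm ::
    "(int \<Rightarrow> 'a::euclidean_space set set) \<Rightarrow> ('a \<Rightarrow> 'b::real_normed_vector) \<Rightarrow> ennreal" where
  "H1_enorm \<D> h = (\<integral>\<^sup>+ x. (SUP k. ennreal (norm (dyadic_E \<D> k h x))) \<partial>lebesgue)"

definition H1 ::
    "(int \<Rightarrow> 'a::euclidean_space set set) \<Rightarrow> ('a \<Rightarrow> 'b::real_normed_vector) set" where
  "H1 \<D> = {h \<in> Lp 1 lebesgue. H1_enorm \<D> h < \<infinity>}"

definition H1_norm ::
    "(int \<Rightarrow> 'a::euclidean_space set set) \<Rightarrow> ('a \<Rightarrow> 'b::real_normed_vector) \<Rightarrow> real" where
  "H1_norm \<D> h = enn2real (H1_enorm \<D> h)"

text \<open>\<open>c\<close> is admissible in the dyadic \<open>H\<^sup>1\<close>-BMO duality inequality on \<open>real ^ 'd\<close> for the Banach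
  space \<open>E\<close>.  Since \<open>c\<close> may depend on the dimension only, one \<open>c\<close> has to serve all dyadic
  systems.  \<open>E\<close> is a type argument because a predicate cannot quantify over types.  Where
  \<open>b x = 0\<close> the value of the minimum is irrelevant.\<close>

definition H1_BMO_duality_constant ::
    "'d::finite itself \<Rightarrow> 'e::banach itself \<Rightarrow> real \<Rightarrow> bool" where
  "H1_BMO_duality_constant d E c \<longleftrightarrow>
     (\<forall>(\<D> :: int \<Rightarrow> (real ^ 'd) set set) (b :: real ^ 'd \<Rightarrow> 'e \<Rightarrow>\<^sub>L real) (h :: real ^ 'd \<Rightarrow> 'e).
        dyadic_system \<D> \<longrightarrow> b \<in> BMO \<D> \<longrightarrow> h \<in> H1 \<D> \<longrightarrow>
        (\<exists>L. (\<lambda>N::nat. LINT x|lebesgue. min 1 (real N / norm (b x)) * blinfun_apply (b x) (h x))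
               \<longlonglongrightarrow> L \<and>
             \<bar>L\<bar> \<le> c * BMO_norm \<D> b * H1_norm \<D> h))"


section \<open>The symmetrised paraproduct\<close>

definition finite_dyadic_expansion ::
    "(int \<Rightarrow> 'a::euclidean_space set set) \<Rightarrow> ('a \<Rightarrow> 'b::real_normed_vector) \<Rightarrow> bool" where
  "finite_dyadic_expansion \<D> f \<longleftrightarrow>
     (let J = {k. \<exists>x. dyadic_D \<D> k f x \<noteq> 0} in
        finite J \<and> (AE x in lebesgue. f x = (\<Sum>k\<in>J. dyadic_D \<D> k f x)))"

text \<open>For \<open>f\<close> and \<open>g\<close> with finite expansions only finitely many terms of the sum are nonzero.\<close>

definition sym_paraproduct_form ::
    "(int \<Rightarrow> 'a::euclidean_space set set) \<Rightarrow> ('a \<Rightarrow> 'x::real_normed_vector \<Rightarrow>\<^sub>L 'y::real_normed_vector) \<Rightarrow>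
     ('a \<Rightarrow> 'x) \<Rightarrow> ('a \<Rightarrow> 'y \<Rightarrow>\<^sub>L real) \<Rightarrow> real" where
  "sym_paraproduct_form \<D> b f g = (\<Sum>\<^sub>\<infinity>k\<in>UNIV. LINT s|lebesgue.
     blinfun_apply (dyadic_D \<D> k g s) (blinfun_apply (b s) (dyadic_E \<D> (k - 1) f s)) +
     blinfun_apply (dyadic_E \<D> (k - 1) g s) (blinfun_apply (b s) (dyadic_D \<D> k f s)))"

text \<open>\<open>T\<close> is a bounded extension of the symmetrised paraproduct of \<open>b\<close> to \<open>L\<^sup>p\<close>.\<close>

definition extends_sym_paraproduct ::
    "real \<Rightarrow> real \<Rightarrow> (int \<Rightarrow> 'a::euclidean_space set set) \<Rightarrow>
     ('a \<Rightarrow> 'x::real_normed_vector \<Rightarrow>\<^sub>L 'y::real_normed_vector) \<Rightarrow>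
     (('a \<Rightarrow> 'x) \<Rightarrow> ('a \<Rightarrow> 'y)) \<Rightarrow> bool" where
  "extends_sym_paraproduct p p' \<D> b T \<longleftrightarrow> bounded_Lp_operator p lebesgue T \<and>
     (\<forall>f\<in>Lp_c p. \<forall>g\<in>Lp_c p'. finite_dyadic_expansion \<D> f \<longrightarrow> finite_dyadic_expansion \<D> g \<longrightarrow>
        (LINT s|lebesgue. blinfun_apply (g s) (T f s)) = sym_paraproduct_form \<D> b f g)"

end

theory Submission
  imports Defs
begin

text \<open>
  For step functions \<open>f\<close> and \<open>g\<close> the form is the pairing of \<open>b\<close> with the kernel
  \<open>h = \<Sum>k. E (k - 1) f \<otimes> D k g + D k f \<otimes> E (k - 1) g\<close>, whose values act as functionals on
  operators \<open>X \<rightarrow> Y\<close>.  Since \<open>h\<close> is almost a telescoping sum,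
  \<open>E j h = E j f \<otimes> E j g - (\<Sum>k\<le>j. D k f \<otimes> D k g)\<close>.  The first term is controlled by Doob's
  maximal inequality; the second one is an average over random signs
  \<open>(\<Sum>k\<le>j. \<epsilon> k D k f) \<otimes> (\<Sum>k\<le>j. \<epsilon> k D k g)\<close>, where the contraction principle removes
  the dependence on \<open>j\<close> and the UMD property of \<open>X\<close> and of the dual of \<open>Y\<close> removes the signs.
  Hence the \<open>H\<^sup>1\<close> norm of \<open>h\<close> is bounded, and duality with BMO bounds the form.

  Reflexivity of \<open>L\<^sup>p\<close> is not needed to obtain an operator with values in \<open>Y\<close>: for a step
  function \<open>f\<close> the form is represented by an explicit function, \<open>b f\<close> plus a step function, whose
  \<open>L\<^sup>p\<close> norm is computed by testing against step functions; the operator is then extended by density.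
\<close>

section \<open>Norming functionals\<close>

text \<open>The values of b are operators, not elements of a dual space, whereas the duality
  inequality pairs a dual-valued BMO function with an H^1 function. So the kernel takes its values
  in the dual of the operator space, and b is composed with the canonical embedding into the bidual,
  an isometry that commutes with averages. Hahn-Banach is needed for this isometry and for test
  functions that norm the values of averages. The term \<open>p * q\<close> is the product of the
  two Doob constants, q on L^p and p on L^q. UMD is used with exponent p for X and with exponent q
  for the dual of Y, where the constant of Y at p remains admissible. Functions with finite
  expansions agree almost everywhere with step functions having zero averages over large cubes. Only
  finitely many generations and cubes matter for these, so the martingale inequalities are needed on
  finite sets of atoms only. For the second inequality of the theorem, UMD constants have to be
  bounded from below: \<open>p * q = p + q\<close>, and the larger of p and q is at most 16 times
  the product of the two constants.\<close>

definition sublinear :: "('a::real_vector \<Rightarrow> real) \<Rightarrow> bool" where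
  "sublinear q \<longleftrightarrow> (\<forall>x y. q (x + y) \<le> q x + q y) \<and> (\<forall>t>0. \<forall>x. q (t *\<^sub>R x) \<le> t * q x)"

lemma sublinear_add: "sublinear q \<Longrightarrow> q (x + y) \<le> q x + q y"
  and sublinear_scaleR: "sublinear q \<Longrightarrow> 0 < t \<Longrightarrow> q (t *\<^sub>R x) \<le> t * q x"
  by (auto simp: sublinear_def)

text \<open>Scaling by 1 / 2 gives \<open>q 0 \<le> 0\<close>, and subadditivity gives the
  converse.\<close>

lemma sublinear_zero: "sublinear q \<Longrightarrow> q 0 = 0"
  using sublinear_add[of q 0 0] sublinear_scaleR[of q "1/2" 0] by simp

lemma sublinear_minus: "sublinear q \<Longrightarrow> - q (- x) \<le> q x"
  using sublinear_add[of q x "- x"] sublinear_zero[of q] by simp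

text \<open>The infimum over the ray in direction y lowers q as far as possible at
  \<open>- y\<close>. Hence a minimal sublinear functional satisfies
  \<open>q (- y) \<le> - q y\<close> for every y, so it is odd and therefore linear. This takes the
  place of extending functionals from subspaces in the Hahn-Banach theorem.\<close>

lemma sublinear_descend:
  fixes q :: "'a::real_vector \<Rightarrow> real"
  assumes q: "sublinear q"
  obtains r where "sublinear r" "\<And>x. r x \<le> q x" "r (- y) \<le> - q y"
proof -
  define g where "g x t = q (x + t *\<^sub>R y) - t * q y" for x t
  define r where "r x = (INF t\<in>{0..}. g x t)" for x
  \<comment> \<open>Finiteness of the infimum: homogeneity is in fact an equality, so t times q y is
    the value of q at t y, and subadditivity bounds it by q (x + t y) + q (- x).\<close>
  have lower: "- q (- x) \<le> g x t" if "0 \<le> t" for x t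
  proof -
    have "q (t *\<^sub>R y) = t * q y"
    proof (cases "t = 0")
      case False
      then have "0 < t" using that by simp
      have "q ((1 / t) *\<^sub>R (t *\<^sub>R y)) \<le> (1 / t) * q (t *\<^sub>R y)"
        by (rule sublinear_scaleR[OF q]) (use \<open>0 < t\<close> in simp)
      then have "t * q y \<le> q (t *\<^sub>R y)" using \<open>0 < t\<close> by (simp add: field_simps)
      then show ?thesis using sublinear_scaleR[OF q \<open>0 < t\<close>, of y] by simp
    qed (simp add: sublinear_zero[OF q])
    then show ?thesis using sublinear_add[OF q, of "x + t *\<^sub>R y" "- x"] by (simp add: g_def)
  qed
  have bdd: "bdd_below (g x ` {0..})" for x by (rule bdd_belowI[of _ "- q (- x)"]) (use lower in auto)
  have le: "r x \<le> g x t" if "0 \<le> t" for x t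
    unfolding r_def by (rule cINF_lower[OF bdd]) (use that in simp)
  have ge: "c \<le> r x" if "\<And>t. 0 \<le> t \<Longrightarrow> c \<le> g x t" for c x
    unfolding r_def by (rule cINF_greatest) (use that in auto)
  have sub: "r (x1 + x2) \<le> r x1 + r x2" for x1 x2
  proof -
    \<comment> \<open>The parameter \<open>t1 + t2\<close> is admissible for the sum; the infimum is
      then taken first in \<open>t1\<close> and afterwards in \<open>t2\<close>.\<close>
    have "r (x1 + x2) - g x2 t2 \<le> g x1 t1" if "0 \<le> t1" "0 \<le> t2" for t1 t2
      using le[of "t1 + t2" "x1 + x2"] that
        sublinear_add[OF q, of "x1 + t1 *\<^sub>R y" "x2 + t2 *\<^sub>R y"]
      by (simp add: g_def algebra_simps)
    then have "r (x1 + x2) - g x2 t2 \<le> r x1" if "0 \<le> t2" for t2 using that by (intro ge) auto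
    then have "r (x1 + x2) - r x1 \<le> g x2 t2" if "0 \<le> t2" for t2 using that by fastforce
    then have "r (x1 + x2) - r x1 \<le> r x2" by (intro ge) auto
    then show ?thesis by simp
  qed
  have scale: "r (s *\<^sub>R x) \<le> s * r x" if "0 < s" for s x
  proof -
    have "r (s *\<^sub>R x) / s \<le> g x t" if "0 \<le> t" for t
    proof -
      have "r (s *\<^sub>R x) \<le> g (s *\<^sub>R x) (s * t)" using that \<open>0 < s\<close> by (intro le) auto
      also have "\<dots> \<le> s * g x t"
        using sublinear_scaleR[OF q \<open>0 < s\<close>, of "x + t *\<^sub>R y"] by (simp add: g_def algebra_simps)
      finally show ?thesis using \<open>0 < s\<close> by (simp add: field_simps)
    qed
    then have "r (s *\<^sub>R x) / s \<le> r x" by (rule ge)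
    then show ?thesis using \<open>0 < s\<close> by (simp add: field_simps)
  qed
  show thesis
  proof (rule that)
    show "sublinear r" using sub scale by (simp add: sublinear_def)
    show "r x \<le> q x" for x using le[of 0 x] by (simp add: g_def)
    show "r (- y) \<le> - q y" using le[of 1 "- y"] by (simp add: g_def sublinear_zero[OF q])
  qed
qed

text \<open>Zorn's lemma yields a minimal sublinear functional below q. A chain is bounded by its
  pointwise infimum, which is finite because every member stays above \<open>- q (- x)\<close>. By
  \<open>sublinear_descend\<close> the minimal functional is odd, and an odd sublinear functional is
  linear.\<close>

lemma sublinear_minimal:
  fixes q :: "'a::real_vector \<Rightarrow> real"
  assumes q: "sublinear q"
  obtains l where "linear l" "\<And>x. l x \<le> q x"
proof -
  define A where "A = {r. sublinear r \<and> (\<forall>x. r x \<le> q x)}"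
  \<comment> \<open>The pointwise order is reversed, so that the maximal element of Zorn's lemma is
    a minimal functional.\<close>
  define P where "P r r' \<longleftrightarrow> (\<forall>x. r' x \<le> r x)" for r r' :: "'a \<Rightarrow> real"
  have "\<exists>m\<in>A. \<forall>a\<in>A. P m a \<longrightarrow> a = m"
  proof (rule predicate_Zorn)
    show "partial_order_on A (relation_of P A)"
    proof (rule partial_order_on_relation_ofI)
      show "P a a" for a by (simp add: P_def)
      show "P a c" if "P a b" "P b c" for a b c
        using that unfolding P_def by (meson order.trans)
      show "a = b" if "P a b" "P b a" for a b
        using that by (auto simp: P_def fun_eq_iff order.antisym)
    qed
    fix C assume C: "C \<in> Chains (relation_of P A)"
    have CA: "C \<subseteq> A" using C by (auto simp: Chains_def relation_of_def)
    have tot: "P r r' \<or> P r' r" if "r \<in> C" "r' \<in> C" for r r'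
      using C that by (auto simp: Chains_def relation_of_def)
    show "\<exists>u\<in>A. \<forall>a\<in>C. P a u"
    proof (cases "C = {}")
      case True
      then show ?thesis using q by (auto simp: A_def)
    next
      case False
      define u where "u x = (INF r\<in>C. r x)" for x
      have bdd: "bdd_below ((\<lambda>r. r x) ` C)" for x
      proof (rule bdd_belowI[of _ "- q (- x)"])
        fix v assume "v \<in> (\<lambda>r. r x) ` C"
        then obtain r where "r \<in> C" "v = r x" by auto
        moreover have "r (- x) \<le> q (- x)" "sublinear r" using CA \<open>r \<in> C\<close> by (auto simp: A_def)
        ultimately show "- q (- x) \<le> v" using sublinear_minus[of r x] by simp
      qed
      have le: "u x \<le> r x" if "r \<in> C" for r x
        unfolding u_def using cINF_lower[OF bdd that] .
      have ge: "c \<le> u x" if "\<And>r. r \<in> C \<Longrightarrow> c \<le> r x" for c x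
        unfolding u_def by (rule cINF_greatest) (use False that in auto)
      have "u (x + y) \<le> u x + u y" for x y
      proof -
        have "u (x + y) - r' y \<le> r x" if rr: "r \<in> C" "r' \<in> C" for r r'
        proof -
          \<comment> \<open>A single member of the chain has to lie below r at x and below r' at y;
            the smaller of the two does.\<close>
          obtain s where s: "s \<in> C" "s x \<le> r x" "s y \<le> r' y"
            using tot[OF rr] rr by (auto simp: P_def)
          have "sublinear s" using CA s(1) by (auto simp: A_def)
          then have "u (x + y) \<le> s x + s y"
            using le[OF s(1), of "x + y"] sublinear_add[of s x y] by linarith
          then show ?thesis using s by simp
        qed
        then have "u (x + y) - r' y \<le> u x" if "r' \<in> C" for r' using that by (intro ge) auto
        then have "u (x + y) - u x \<le> r' y" if "r' \<in> C" for r' using that by fastforce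
        then have "u (x + y) - u x \<le> u y" by (intro ge) auto
        then show ?thesis by simp
      qed
      moreover have "u (t *\<^sub>R x) \<le> t * u x" if "0 < t" for t x
      proof -
        have "u (t *\<^sub>R x) / t \<le> r x" if "r \<in> C" for r
        proof -
          have "sublinear r" using CA that by (auto simp: A_def)
          then have "u (t *\<^sub>R x) \<le> t * r x"
            using le[OF that, of "t *\<^sub>R x"] sublinear_scaleR[of r t x] \<open>0 < t\<close> by linarith
          then show ?thesis using \<open>0 < t\<close> by (simp add: field_simps)
        qed
        then have "u (t *\<^sub>R x) / t \<le> u x" by (rule ge)
        then show ?thesis using \<open>0 < t\<close> by (simp add: field_simps)
      qed
      moreover have "u x \<le> q x" for x
      proof -
        obtain r where "r \<in> C" using False by auto
        then have "u x \<le> r x" "r x \<le> q x" using le CA by (auto simp: A_def)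
        then show ?thesis by simp
      qed
      ultimately have "u \<in> A" by (auto simp: A_def sublinear_def)
      then show ?thesis using le by (auto simp: P_def)
    qed
  qed
  then obtain l where "l \<in> A" and max: "\<And>a. a \<in> A \<Longrightarrow> P l a \<Longrightarrow> a = l" by blast
  then have l: "sublinear l" "l x \<le> q x" for x by (auto simp: A_def)
  have min: "r = l" if "sublinear r" "\<And>x. r x \<le> l x" for r
  proof (rule max)
    show "r \<in> A" using that l(2) unfolding A_def by (auto intro: order.trans[OF that(2)])
    show "P l r" using that by (simp add: P_def)
  qed
  have odd: "l (- y) = - l y" for y
  proof -
    obtain r where "sublinear r" "\<And>x. r x \<le> l x" "r (- y) \<le> - l y"
      using sublinear_descend[OF l(1)] by metis
    then show ?thesis using min[of r] sublinear_minus[OF l(1), of "- y"] by simp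
  qed
  have "linear l"
  proof (rule linearI)
    show "l (x + y) = l x + l y" for x y
      using sublinear_add[OF l(1), of x y] sublinear_add[OF l(1), of "- x" "- y"] odd[of x] odd[of y]
        odd[of "x + y"] by simp
    have pos: "l (t *\<^sub>R x) = t * l x" if "0 < t" for t x
      using sublinear_scaleR[OF l(1) that, of x] sublinear_scaleR[OF l(1) that, of "- x"]
        odd[of x] odd[of "t *\<^sub>R x"] by simp
    show "l (t *\<^sub>R x) = t *\<^sub>R l x" for t x
      using pos[of t x] pos[of "- t" x] odd[of "t *\<^sub>R x"] sublinear_zero[OF l(1)]
      by (cases "t > 0"; cases "t = 0") auto
  qed
  then show thesis using l(2) that by blast
qed

text \<open>Descending from the norm along x first yields r with
  \<open>r (- x) \<le> - norm x\<close>. Every linear functional below r is then forced to take the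
  value \<open>norm x\<close> at x, and being below the norm bounds it by 1.\<close>

lemma norming_functional:
  fixes x :: "'a::real_normed_vector"
  obtains \<phi> :: "'a \<Rightarrow>\<^sub>L real" where "norm \<phi> \<le> 1" "blinfun_apply \<phi> x = norm x"
proof -
  have "sublinear (norm :: 'a \<Rightarrow> real)" by (simp add: sublinear_def norm_triangle_ineq)
  then obtain r where r: "sublinear r" "\<And>z. r z \<le> norm z" "r (- x) \<le> - norm x"
    using sublinear_descend[of norm x] by metis
  obtain l where l: "linear l" "\<And>z. l z \<le> r z" using sublinear_minimal[OF r(1)] by metis
  have abs: "\<bar>l z\<bar> \<le> norm z" for z
    using l(2)[of z] l(2)[of "- z"] r(2)[of z] r(2)[of "- z"] linear_neg[OF l(1), of z] by simp
  have bl: "bounded_linear l"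
    using abs by (intro bounded_linear_intro[of l 1] linear_add[OF l(1)])
      (simp_all add: linear_scale[OF l(1)])
  have "l x = norm x" using l(2)[of "- x"] r(3) linear_neg[OF l(1), of x] abs[of x] by simp
  moreover have "norm (Blinfun l) \<le> 1"
    by (rule norm_blinfun_bound) (use abs bl in \<open>auto simp: bounded_linear_Blinfun_apply\<close>)
  ultimately show thesis using that[of "Blinfun l"] bl by (simp add: bounded_linear_Blinfun_apply)
qed

section \<open>Inequalities for finite sums\<close>

text \<open>For positive arguments this is convexity of the power function; if one of them is 0, it
  reduces to \<open>s powr p \<le> s\<close> for s in the unit interval.\<close>

lemma powr_convex_combination:
  fixes a b t p :: real
  assumes "1 \<le> p" "0 \<le> a" "0 \<le> b" "0 \<le> t" "t \<le> 1"
  shows "(t * a + (1 - t) * b) powr p \<le> t * a powr p + (1 - t) * b powr p"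
proof -
  have z: "(s * c) powr p \<le> s * c powr p" if "0 \<le> s" "s \<le> 1" "0 \<le> c" for s c :: real
  proof -
    have "s powr p \<le> s powr 1"
      using powr_mono'[of 1 p s] that assms by simp
    then show ?thesis using that by (simp add: powr_mult mult_right_mono)
  qed
  show ?thesis
  proof (cases "a = 0 \<or> b = 0")
    case True
    then show ?thesis using z[of t a] z[of "1 - t" b] assms by auto
  next
    case False
    then show ?thesis
      using convex_onD[OF powr_convex[OF assms(1)], of t b a] assms by (simp add: algebra_simps)
  qed
qed

lemma powr_midpoint:
  fixes a b p :: real
  assumes "1 \<le> p" "0 \<le> a" "0 \<le> b"
  shows "((a + b) / 2) powr p \<le> (a powr p + b powr p) / 2"
  using powr_convex_combination[of p a b "1/2"] assms by (simp add: field_simps)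

text \<open>The weights cover the later cases: uniform masses of sign patterns, masses of atoms, and
  counting. With both sums normalised to 1, Young's inequality applies term by term; if one sum
  vanishes, so does every product.\<close>

lemma weighted_Holder_sum:
  fixes w a b :: "'a \<Rightarrow> real"
  assumes p: "1 < p" "1 < q" "1 / p + 1 / q = 1" and S: "finite S"
    and nonneg: "\<And>x. x \<in> S \<Longrightarrow> 0 \<le> w x" "\<And>x. x \<in> S \<Longrightarrow> 0 \<le> a x" "\<And>x. x \<in> S \<Longrightarrow> 0 \<le> b x"
  shows "(\<Sum>x\<in>S. w x * a x * b x)
    \<le> (\<Sum>x\<in>S. w x * a x powr p) powr (1 / p) * (\<Sum>x\<in>S. w x * b x powr q) powr (1 / q)"
proof -
  define A where "A = (\<Sum>x\<in>S. w x * a x powr p)"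
  define B where "B = (\<Sum>x\<in>S. w x * b x powr q)"
  have AB: "0 \<le> A" "0 \<le> B" unfolding A_def B_def by (auto intro!: sum_nonneg simp: nonneg)
  show ?thesis
  proof (cases "A = 0 \<or> B = 0")
    case True
    have "w x * a x * b x = 0" if "x \<in> S" for x
    proof -
      have "w x * a x powr p = 0 \<or> w x * b x powr q = 0"
        using True that S nonneg unfolding A_def B_def
        by (auto simp: sum_nonneg_eq_0_iff)
      then show ?thesis by auto
    qed
    then have "(\<Sum>x\<in>S. w x * a x * b x) = 0" by (intro sum.neutral) auto
    then show ?thesis by simp
  next
    case False
    then have pos: "0 < A" "0 < B" using AB by auto
    define \<alpha> where "\<alpha> = A powr (1 / p)"
    define \<beta> where "\<beta> = B powr (1 / q)"
    have \<alpha>: "0 < \<alpha>" "0 < \<beta>" "\<alpha> powr p = A" "\<beta> powr q = B"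
      using pos p by (auto simp: \<alpha>_def \<beta>_def powr_powr)
    have "(\<Sum>x\<in>S. w x * (a x / \<alpha>) * (b x / \<beta>)) \<le> (\<Sum>x\<in>S. w x * (a x powr p / A / p + b x powr q / B / q))"
    proof (rule sum_mono)
      fix x assume x: "x \<in> S"
      have "(a x / \<alpha>) * (b x / \<beta>) \<le> (a x / \<alpha>) powr p / p + (b x / \<beta>) powr q / q"
        using p nonneg[OF x] \<alpha> by (intro Youngs_inequality) auto
      also have "\<dots> = a x powr p / A / p + b x powr q / B / q"
        using nonneg[OF x] \<alpha> by (simp add: powr_divide)
      finally have "w x * ((a x / \<alpha>) * (b x / \<beta>)) \<le> w x * (a x powr p / A / p + b x powr q / B / q)"
        by (rule mult_left_mono) (rule nonneg(1)[OF x])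
      then show "w x * (a x / \<alpha>) * (b x / \<beta>) \<le> w x * (a x powr p / A / p + b x powr q / B / q)"
        by (simp add: mult.assoc)
    qed
    also have "\<dots> = (\<Sum>x\<in>S. w x * a x powr p) / A / p + (\<Sum>x\<in>S. w x * b x powr q) / B / q"
      by (simp add: sum_divide_distrib sum.distrib[symmetric] field_simps)
    also have "\<dots> = 1" using pos p by (simp add: A_def[symmetric] B_def[symmetric])
    finally have "(\<Sum>x\<in>S. w x * a x * b x) / (\<alpha> * \<beta>) \<le> 1"
      by (simp add: sum_divide_distrib mult.assoc)
    then show ?thesis using \<alpha> by (simp add: A_def[symmetric] B_def[symmetric] \<alpha>_def[symmetric] \<beta>_def[symmetric] divide_le_eq)
  qed
qed

text \<open>Sign sequences of length n are encoded as subsets of \<open>{..<n}\<close>, so a sum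
  over \<open>Pow {..<n}\<close> with weight \<open>1 / 2 ^ n\<close> is an expectation over
  independent symmetric signs.\<close>

definition sign_of :: "nat set \<Rightarrow> nat \<Rightarrow> real" where
  "sign_of A k = (if k \<in> A then 1 else - 1)"

lemma sign_of_cases: "sign_of A k \<in> {- 1, 1}"
  by (simp add: sign_of_def)

lemma sum_sign_of_mult:
  assumes "i < n" "j < n"
  shows "(\<Sum>A\<in>Pow {..<n}. sign_of A i * sign_of A j) = (if i = j then 2 ^ n else 0)"
proof (cases "i = j")
  case True
  have "sign_of A i * sign_of A i = 1" for A by (simp add: sign_of_def)
  then show ?thesis using True by (simp add: card_Pow)
next
  case False
  \<comment> \<open>Toggling the membership of i is an involution of the power set, and it changes
    the sign of the summand because j differs from i.\<close>
  define F where "F A = (if i \<in> A then A - {i} else insert i A)" for A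
  have "(\<Sum>A\<in>Pow {..<n}. sign_of A i * sign_of A j) = (\<Sum>A\<in>Pow {..<n}. - (sign_of A i * sign_of A j))"
    by (rule sum.reindex_bij_witness[of _ F F]) (use assms False in \<open>auto simp: F_def sign_of_def split: if_splits\<close>)
  then show ?thesis using False by (simp add: sum_negf)
qed

text \<open>The short sum is the midpoint of two full sums whose signs agree below i and are
  opposite from i on. Flipping the signs from i on permutes the sign patterns, so convexity of the
  power and averaging over all patterns give the claim.\<close>

lemma sign_contraction:
  fixes x :: "nat \<Rightarrow> 'a::real_normed_vector"
  assumes "1 \<le> p" "i \<le> n"
  shows "(\<Sum>A\<in>Pow {..<n}. norm (\<Sum>k<i. sign_of A k *\<^sub>R x k) powr p)
    \<le> (\<Sum>A\<in>Pow {..<n}. norm (\<Sum>k<n. sign_of A k *\<^sub>R x k) powr p)"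
proof -
  define F where "F A = (A \<inter> {..<i}) \<union> ({i..<n} - A)" for A :: "nat set"
  define s where "s A = (\<Sum>k<n. sign_of A k *\<^sub>R x k)" for A
  have split: "s A = (\<Sum>k<i. sign_of A k *\<^sub>R x k) + (\<Sum>k=i..<n. sign_of A k *\<^sub>R x k)" for A
    using sum.union_disjoint[of "{..<i}" "{i..<n}" "\<lambda>k. sign_of A k *\<^sub>R x k"] assms(2)
    by (simp add: s_def ivl_disj_un ivl_disj_int)
  have s1: "(\<Sum>k<i. sign_of (F A) k *\<^sub>R x k) = (\<Sum>k<i. sign_of A k *\<^sub>R x k)" for A
    by (rule sum.cong) (auto simp: F_def sign_of_def)
  have s2: "(\<Sum>k=i..<n. sign_of (F A) k *\<^sub>R x k) = - (\<Sum>k=i..<n. sign_of A k *\<^sub>R x k)" for A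
    unfolding sum_negf[symmetric] by (rule sum.cong) (auto simp: F_def sign_of_def)
  have "norm (\<Sum>k<i. sign_of A k *\<^sub>R x k) powr p \<le> (norm (s A) powr p + norm (s (F A)) powr p) / 2" for A
  proof -
    have "2 *\<^sub>R (\<Sum>k<i. sign_of A k *\<^sub>R x k) = s A + s (F A)"
      unfolding split s1 s2 by (simp add: scaleR_2)
    then have "2 * norm (\<Sum>k<i. sign_of A k *\<^sub>R x k) \<le> norm (s A) + norm (s (F A))"
      by (metis abs_numeral norm_scaleR norm_triangle_ineq)
    then have "norm (\<Sum>k<i. sign_of A k *\<^sub>R x k) powr p \<le> ((norm (s A) + norm (s (F A))) / 2) powr p"
      using assms by (intro powr_mono2) auto
    also have "\<dots> \<le> (norm (s A) powr p + norm (s (F A)) powr p) / 2"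
      using assms by (intro powr_midpoint) auto
    finally show ?thesis .
  qed
  then have "(\<Sum>A\<in>Pow {..<n}. norm (\<Sum>k<i. sign_of A k *\<^sub>R x k) powr p)
    \<le> (\<Sum>A\<in>Pow {..<n}. (norm (s A) powr p + norm (s (F A)) powr p) / 2)"
    by (rule sum_mono)
  also have "\<dots> = ((\<Sum>A\<in>Pow {..<n}. norm (s A) powr p) + (\<Sum>A\<in>Pow {..<n}. norm (s (F A)) powr p)) / 2"
    by (simp add: sum.distrib sum_divide_distrib[symmetric])
  also have "(\<Sum>A\<in>Pow {..<n}. norm (s (F A)) powr p) = (\<Sum>A\<in>Pow {..<n}. norm (s A) powr p)"
    by (rule sum.reindex_bij_witness[of _ F F]) (use assms in \<open>auto simp: F_def\<close>)
  finally show ?thesis by (simp add: s_def)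
qed

text \<open>The diagonal sum is the average over independent signs of the product of the signed sums.\<close>

lemma diagonal_sum_le_random_signs:
  fixes P :: "'a::real_normed_vector \<Rightarrow> 'b::real_normed_vector \<Rightarrow> 'c::real_normed_vector"
  assumes P: "bounded_bilinear P" "\<And>u v. norm (P u v) \<le> norm u * norm v"
    and p: "1 < p" "1 < q" "1 / p + 1 / q = 1" and "i \<le> n"
  shows "norm (\<Sum>k<i. P (x k) (y k))
    \<le> (\<Sum>A\<in>Pow {..<n}. (1 / 2 ^ n) * norm (\<Sum>k<n. sign_of A k *\<^sub>R x k) powr p) powr (1 / p) *
       (\<Sum>A\<in>Pow {..<n}. (1 / 2 ^ n) * norm (\<Sum>k<n. sign_of A k *\<^sub>R y k) powr q) powr (1 / q)"
proof -
  interpret bounded_bilinear P by fact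
  define X where "X A = (\<Sum>k<i. sign_of A k *\<^sub>R x k)" for A
  define Y where "Y A = (\<Sum>k<i. sign_of A k *\<^sub>R y k)" for A
  have "(\<Sum>A\<in>Pow {..<n}. P (X A) (Y A))
      = (\<Sum>A\<in>Pow {..<n}. \<Sum>k<i. \<Sum>l<i. (sign_of A k * sign_of A l) *\<^sub>R P (x l) (y k))"
    by (simp add: X_def Y_def sum_left sum_right scaleR_left scaleR_right scaleR_sum_right mult.commute)
  also have "\<dots> = (\<Sum>k<i. \<Sum>l<i. (\<Sum>A\<in>Pow {..<n}. sign_of A k * sign_of A l) *\<^sub>R P (x l) (y k))"
    by (subst sum.swap, rule sum.cong[OF refl], subst sum.swap) (simp add: scaleR_sum_left)
  also have "\<dots> = (\<Sum>k<i. \<Sum>l<i. if k = l then 2 ^ n *\<^sub>R P (x l) (y k) else 0)"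
    using assms(6) by (intro sum.cong) (auto simp: sum_sign_of_mult)
  also have "\<dots> = 2 ^ n *\<^sub>R (\<Sum>k<i. P (x k) (y k))"
    by (simp add: sum.delta scaleR_sum_right)
  finally have eq: "(\<Sum>k<i. P (x k) (y k)) = (\<Sum>A\<in>Pow {..<n}. (1 / 2 ^ n) *\<^sub>R P (X A) (Y A))"
    by (simp add: scaleR_sum_right[symmetric])
  have "norm (\<Sum>k<i. P (x k) (y k)) \<le> (\<Sum>A\<in>Pow {..<n}. (1 / 2 ^ n) * norm (X A) * norm (Y A))"
    unfolding eq by (rule order.trans[OF norm_sum sum_mono]) (use P(2) in \<open>auto simp: divide_simps\<close>)
  also have "\<dots> \<le> (\<Sum>A\<in>Pow {..<n}. (1 / 2 ^ n) * norm (X A) powr p) powr (1 / p) *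
       (\<Sum>A\<in>Pow {..<n}. (1 / 2 ^ n) * norm (Y A) powr q) powr (1 / q)"
    using p by (intro weighted_Holder_sum) auto
  also have "\<dots> \<le> (\<Sum>A\<in>Pow {..<n}. (1 / 2 ^ n) * norm (\<Sum>k<n. sign_of A k *\<^sub>R x k) powr p) powr (1 / p) *
       (\<Sum>A\<in>Pow {..<n}. (1 / 2 ^ n) * norm (\<Sum>k<n. sign_of A k *\<^sub>R y k) powr q) powr (1 / q)"
    using p sign_contraction[of p i n x] sign_contraction[of q i n y] assms(6)
    unfolding sum_distrib_left[symmetric] X_def Y_def
    by (intro mult_mono powr_mono2 mult_left_mono) (auto intro!: sum_nonneg divide_nonneg_nonneg)
  finally show ?thesis .
qed

text \<open>A finite form of conditioning: a nonnegative weight that depends only on the class can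
  be pulled out of the class sum, and inside the class sum a may be replaced by u.\<close>

lemma sum_mult_le_by_classes:
  fixes a u \<phi> :: "'a \<Rightarrow> real"
  assumes S: "finite S" and \<phi>: "\<And>x. x \<in> S \<Longrightarrow> 0 \<le> \<phi> x"
    "\<And>x y. x \<in> S \<Longrightarrow> y \<in> S \<Longrightarrow> \<pi> x = \<pi> y \<Longrightarrow> \<phi> x = \<phi> y"
    and le: "\<And>x. x \<in> S \<Longrightarrow> (\<Sum>y\<in>{y\<in>S. \<pi> y = \<pi> x}. a y) \<le> (\<Sum>y\<in>{y\<in>S. \<pi> y = \<pi> x}. u y)"
  shows "(\<Sum>x\<in>S. \<phi> x * a x) \<le> (\<Sum>x\<in>S. \<phi> x * u x)"
proof -
  have "(\<Sum>x\<in>{x\<in>S. \<pi> x = c}. \<phi> x * a x) \<le> (\<Sum>x\<in>{x\<in>S. \<pi> x = c}. \<phi> x * u x)" if c: "c \<in> \<pi> ` S" for c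
  proof -
    obtain z where z: "z \<in> S" "c = \<pi> z" using c by auto
    have "(\<Sum>x\<in>{x\<in>S. \<pi> x = c}. \<phi> x * h x) = \<phi> z * (\<Sum>x\<in>{x\<in>S. \<pi> x = c}. h x)" for h
      unfolding sum_distrib_left
    proof (rule sum.cong)
      fix x assume "x \<in> {x \<in> S. \<pi> x = c}"
      then have "\<phi> x = \<phi> z" using z by (intro \<phi>(2)) auto
      then show "\<phi> x * h x = \<phi> z * h x" by simp
    qed simp
    then show ?thesis using le[OF z(1)] z \<phi>(1) by (simp add: mult_left_mono)
  qed
  then show ?thesis
    unfolding sum.image_gen[OF S, of "\<lambda>x. \<phi> x * a x" \<pi>] sum.image_gen[OF S, of "\<lambda>x. \<phi> x * u x" \<pi>]
    by (rule sum_mono)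
qed

text \<open>If the maximal function \<open>M\<close> increases at step \<open>k + 1\<close>, then \<open>M (k + 1) = m (k + 1)\<close>; hence
  \<open>(M (k + 1) powr (p - 1) - M k powr (p - 1)) * m (k + 1)\<close> is at least \<open>1 / q\<close> times the increment
  of \<open>M powr p\<close>, and in the sum \<open>m (k + 1)\<close> may be replaced by \<open>u\<close>.\<close>

lemma Doob_maximal_finite:
  fixes m :: "nat \<Rightarrow> 'a \<Rightarrow> real" and \<pi> :: "nat \<Rightarrow> 'a \<Rightarrow> 'c"
  assumes p: "1 < p" "1 < q" "1 / p + 1 / q = 1" and S: "finite S"
    and refine: "\<And>j x y. x \<in> S \<Longrightarrow> y \<in> S \<Longrightarrow> \<pi> (Suc j) x = \<pi> (Suc j) y \<Longrightarrow> \<pi> j x = \<pi> j y"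
    and m0: "\<And>j x. x \<in> S \<Longrightarrow> 0 \<le> m j x" and u0: "\<And>x. x \<in> S \<Longrightarrow> 0 \<le> u x"
    and meas: "\<And>j x y. x \<in> S \<Longrightarrow> y \<in> S \<Longrightarrow> \<pi> j x = \<pi> j y \<Longrightarrow> m j x = m j y"
    and le: "\<And>j x. x \<in> S \<Longrightarrow> (\<Sum>y\<in>{y\<in>S. \<pi> j y = \<pi> j x}. m j y) \<le> (\<Sum>y\<in>{y\<in>S. \<pi> j y = \<pi> j x}. u y)"
  shows "(\<Sum>x\<in>S. (MAX j\<in>{..n}. m j x) powr p) \<le> q powr p * (\<Sum>x\<in>S. u x powr p)"
proof -
  define M where "M k x = (MAX j\<in>{..k}. m j x)" for k x
  have M_0: "M 0 x = m 0 x" for x by (simp add: M_def)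
  have M_Suc: "M (Suc k) x = max (m (Suc k) x) (M k x)" for k x
    by (simp add: M_def atMost_Suc)
  have M_nonneg: "0 \<le> M k x" if "x \<in> S" for k x
    using that m0 by (induction k) (auto simp: M_0 M_Suc le_max_iff_disj)
  have M_meas: "M k x = M k y" if "x \<in> S" "y \<in> S" "\<pi> k x = \<pi> k y" for k x y
    using that
  proof (induction k)
    case 0
    then show ?case unfolding M_0 by (rule meas)
  next
    case (Suc k)
    then show ?case using refine[of x y k] meas[of x y "Suc k"] by (simp add: M_Suc)
  qed
  have pq: "(p - 1) * q = p"
  proof -
    have "p * q * (1 / p + 1 / q) = p * q" by (simp only: p(3) mult_1_right)
    then show ?thesis using p(1,2) by (simp add: distrib_left left_diff_distrib)
  qed
  have young: "c powr (p - 1) * a \<le> c powr p / q + a powr p / p" if "0 \<le> a" "0 \<le> c" for a c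
  proof -
    have "(c powr (p - 1)) powr q = c powr p" by (simp add: powr_powr pq)
    then show ?thesis
      using Youngs_inequality[OF p, of a "c powr (p - 1)"] that
      by (simp only: mult.commute[of "c powr (p - 1)" a]) simp
  qed
  \<comment> \<open>Young's inequality for \<open>c powr (p - 1) * a\<close>, rearranged with
    \<open>1 - 1 / p = 1 / q\<close>.\<close>
  have incr: "(a powr p - c powr p) / q \<le> (a powr (p - 1) - c powr (p - 1)) * a"
    if "0 \<le> c" "c \<le> a" for a c
  proof -
    have "a powr (p - 1) * a = a powr p" using that p by (simp add: powr_mult_base mult.commute)
    moreover have "a powr p / p = a powr p - a powr p / q"
    proof -
      have "1 / p = 1 - 1 / q" using p(3) by simp
      then have "a powr p * (1 / p) = a powr p * (1 - 1 / q)" by simp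
      then show ?thesis by (simp add: right_diff_distrib)
    qed
    ultimately show ?thesis using young[of a c] that by (simp add: left_diff_distrib diff_divide_distrib)
  qed
  have main: "(\<Sum>x\<in>S. M k x powr p) \<le> q * (\<Sum>x\<in>S. M k x powr (p - 1) * u x)" for k
  proof (induction k)
    case 0
    have "(\<Sum>x\<in>S. M 0 x powr p) = (\<Sum>x\<in>S. M 0 x powr (p - 1) * m 0 x)"
      using m0 p by (intro sum.cong) (auto simp: M_0 powr_mult_base mult.commute)
    also have "\<dots> \<le> (\<Sum>x\<in>S. M 0 x powr (p - 1) * u x)"
    proof (rule sum_mult_le_by_classes[OF S, where \<pi>="\<pi> 0"])
      show "M 0 x powr (p - 1) = M 0 y powr (p - 1)" if "x \<in> S" "y \<in> S" "\<pi> 0 x = \<pi> 0 y" for x y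
        by (simp only: M_meas[OF that])
    qed (use le in simp_all)
    also have "\<dots> \<le> q * (\<Sum>x\<in>S. M 0 x powr (p - 1) * u x)"
    proof -
      have "1 * (\<Sum>x\<in>S. M 0 x powr (p - 1) * u x) \<le> q * (\<Sum>x\<in>S. M 0 x powr (p - 1) * u x)"
        using p(2) u0 by (intro mult_right_mono sum_nonneg mult_nonneg_nonneg) auto
      then show ?thesis by simp
    qed
    finally show ?case .
  next
    case (Suc k)
    have "(\<Sum>x\<in>S. M (Suc k) x powr p - M k x powr p)
        \<le> (\<Sum>x\<in>S. q * ((M (Suc k) x powr (p - 1) - M k x powr (p - 1)) * m (Suc k) x))"
    proof (rule sum_mono)
      fix x assume x: "x \<in> S"
      show "M (Suc k) x powr p - M k x powr p
        \<le> q * ((M (Suc k) x powr (p - 1) - M k x powr (p - 1)) * m (Suc k) x)"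
      proof (cases "M k x < m (Suc k) x")
        case True
        then have eq: "M (Suc k) x = m (Suc k) x" unfolding M_Suc by (rule max_absorb1[OF less_imp_le])
        have "q * ((m (Suc k) x powr p - M k x powr p) / q)
            \<le> q * ((m (Suc k) x powr (p - 1) - M k x powr (p - 1)) * m (Suc k) x)"
          using p M_nonneg[OF x] True by (intro mult_left_mono incr) auto
        then show ?thesis using p by (simp add: eq)
      next
        case False
        then have "M (Suc k) x = M k x" by (simp add: M_Suc)
        then show ?thesis by simp
      qed
    qed
    also have "\<dots> = q * (\<Sum>x\<in>S. (M (Suc k) x powr (p - 1) - M k x powr (p - 1)) * m (Suc k) x)"
      by (simp add: sum_distrib_left)
    also have "\<dots> \<le> q * (\<Sum>x\<in>S. (M (Suc k) x powr (p - 1) - M k x powr (p - 1)) * u x)"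
    proof (intro mult_left_mono sum_mult_le_by_classes[OF S, where \<pi>="\<pi> (Suc k)"])
      show "0 \<le> M (Suc k) x powr (p - 1) - M k x powr (p - 1)" if "x \<in> S" for x
        using M_nonneg[OF that, of k] p by (auto simp: M_Suc intro!: powr_mono2)
      show "M (Suc k) x powr (p - 1) - M k x powr (p - 1) = M (Suc k) y powr (p - 1) - M k y powr (p - 1)"
        if "x \<in> S" "y \<in> S" "\<pi> (Suc k) x = \<pi> (Suc k) y" for x y
        by (simp only: M_meas[OF that] M_meas[OF that(1,2) refine[OF that]])
    qed (use le p in simp_all)
    finally show ?case
      using Suc by (simp add: sum_subtractf algebra_simps)
  qed
  define A where "A = (\<Sum>x\<in>S. M n x powr p)"
  define U where "U = (\<Sum>x\<in>S. u x powr p)"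
  have AU: "0 \<le> A" "0 \<le> U" by (auto simp: A_def U_def intro!: sum_nonneg)
  have "(\<Sum>x\<in>S. M n x powr (p - 1) * u x) \<le> U powr (1 / p) * A powr (1 / q)"
    using weighted_Holder_sum[OF p S, of "\<lambda>_. 1" u "\<lambda>x. M n x powr (p - 1)"] u0
    by (simp add: powr_powr pq A_def U_def mult.commute[of _ "u _"])
  then have *: "A \<le> q * (U powr (1 / p) * A powr (1 / q))"
  proof -
    have "A \<le> q * (\<Sum>x\<in>S. M n x powr (p - 1) * u x)" using main[of n] by (simp only: A_def)
    also have "\<dots> \<le> q * (U powr (1 / p) * A powr (1 / q))"
      using p(2) by (intro mult_left_mono[OF \<open>_ \<le> U powr (1 / p) * A powr (1 / q)\<close>]) auto
    finally show ?thesis .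
  qed
  \<comment> \<open>As a sum over a finite set, A is a finite number, so
    \<open>A powr (1 / q)\<close> may be cancelled and \<open>A powr (1 / p)\<close>
    remains.\<close>
  have "A \<le> q powr p * U"
  proof (cases "A = 0")
    case False
    then have "0 < A" using AU by simp
    have "A powr (1 / p) * A powr (1 / q) = A"
      using \<open>0 < A\<close> p by (simp add: powr_add[symmetric])
    then have "A powr (1 / p) * A powr (1 / q) \<le> (q * U powr (1 / p)) * A powr (1 / q)" using * by (simp add: mult.assoc)
    then have "A powr (1 / p) \<le> q * U powr (1 / p)" using \<open>0 < A\<close> by simp
    then have "(A powr (1 / p)) powr p \<le> (q * U powr (1 / p)) powr p" using p by (intro powr_mono2) auto
    then show ?thesis using p AU by (simp add: powr_powr powr_mult)
  qed (use AU in simp)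
  then show ?thesis unfolding A_def U_def M_def .
qed

section \<open>Finite martingales\<close>

text \<open>The atoms \<open>x \<in> S\<close> carry the masses \<open>w x\<close>, and the \<open>k\<close>-th sigma-algebra is generated by the label \<open>\<pi> k\<close>.\<close>

definition finite_mds ::
    "'a set \<Rightarrow> ('a \<Rightarrow> real) \<Rightarrow> (nat \<Rightarrow> 'a \<Rightarrow> 'c) \<Rightarrow> nat \<Rightarrow> (nat \<Rightarrow> 'a \<Rightarrow> 'x::real_vector) \<Rightarrow> bool" where
  "finite_mds S w \<pi> n d \<longleftrightarrow> finite S \<and> (\<forall>x\<in>S. 0 < w x) \<and>
     (\<forall>k. \<forall>x\<in>S. \<forall>y\<in>S. \<pi> (Suc k) x = \<pi> (Suc k) y \<longrightarrow> \<pi> k x = \<pi> k y) \<and>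
     (\<forall>k<n. \<forall>x\<in>S. \<forall>y\<in>S. \<pi> k x = \<pi> k y \<longrightarrow> d k x = d k y) \<and>
     (\<forall>k. Suc k < n \<longrightarrow> (\<forall>x\<in>S. (\<Sum>y\<in>{y\<in>S. \<pi> k y = \<pi> k x}. w y *\<^sub>R d (Suc k) y) = 0))"

lemma label_refine_le:
  assumes "\<And>k x y. x \<in> S \<Longrightarrow> y \<in> S \<Longrightarrow> \<pi> (Suc k) x = \<pi> (Suc k) y \<Longrightarrow> \<pi> k x = \<pi> k y"
    and "x \<in> S" "y \<in> S" "j \<le> k" "\<pi> k x = \<pi> k y"
  shows "\<pi> j x = \<pi> j y"
  using assms(4,5)
proof (induction k)
  case (Suc k)
  then show ?case using assms(1)[OF assms(2,3), of k] by (cases "j = Suc k") auto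
qed simp

section \<open>Uniqueness of the Bochner integral, simple functions, and finite point
  measures\<close>

lemma has_Bochner_integral_simple:
  assumes "Bochner_Integration.simple_bochner_integrable M f"
  shows "has_Bochner_integral M f (Bochner_Integration.simple_bochner_integral M f)"
  unfolding has_Bochner_integral_def strongly_measurable_def
proof (intro conjI)
  have "simple_function M f" using assms by (auto elim: simple_bochner_integrable.cases)
  then show "\<exists>s. (\<forall>n. simple_function M (s n)) \<and> (AE x in M. (\<lambda>n. s n x) \<longlonglongrightarrow> f x)"
    by (intro exI[of _ "\<lambda>_. f"]) auto
  show "\<exists>s. (\<forall>n. Bochner_Integration.simple_bochner_integrable M (s n)) \<and>
      (\<lambda>n. \<integral>\<^sup>+ x. ennreal (norm (f x - s n x)) \<partial>M) \<longlonglongrightarrow> 0 \<and>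
      (\<lambda>n. Bochner_Integration.simple_bochner_integral M (s n)) \<longlonglongrightarrow>
        Bochner_Integration.simple_bochner_integral M f"
    by (intro exI[of _ "\<lambda>_. f"]) (use assms in auto)
qed

lemma nn_integral_norm_simple_finite:
  assumes "Bochner_Integration.simple_bochner_integrable M f"
  shows "(\<integral>\<^sup>+ x. ennreal (norm (f x)) \<partial>M) = ennreal (Bochner_Integration.simple_bochner_integral M (\<lambda>x. norm (f x)))"
proof -
  have "Bochner_Integration.simple_bochner_integrable M (\<lambda>x. norm (f x))"
    using simple_bochner_integrable_compose2[of "\<lambda>x y. norm x" M f f] assms by simp
  then show ?thesis by (simp add: simple_bochner_integral_eq_nn_integral)
qed

lemma simple_bochner_integral_bound:
  assumes s: "Bochner_Integration.simple_bochner_integrable M s"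
    and t: "Bochner_Integration.simple_bochner_integrable M t"
  shows "ennreal (norm (Bochner_Integration.simple_bochner_integral M s - Bochner_Integration.simple_bochner_integral M t))
    \<le> (\<integral>\<^sup>+ x. ennreal (norm (s x - t x)) \<partial>M)"
proof -
  have "Bochner_Integration.simple_bochner_integrable M (\<lambda>x. s x - t x)"
    using simple_bochner_integrable_compose2[of "(-)" M s t] assms by simp
  then show ?thesis
    using simple_bochner_integral_norm_bound[of M "\<lambda>x. s x - t x"]
    by (simp add: nn_integral_norm_simple_finite simple_bochner_integral_diff[OF s t] ennreal_leI)
qed

text \<open>Splitting the integral of a sum needs measurable norms. A strongly measurable function
  is only an almost everywhere limit of simple functions, so on an incomplete measure space this is
  not automatic. Taking it as a hypothesis lets the lemma serve both point measures and Lebesgue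
  measure.\<close>

lemma has_Bochner_integral_unique:
  assumes meas: "\<And>s. simple_function M s \<Longrightarrow> (\<lambda>x. norm (f x - s x)) \<in> borel_measurable M"
    and I: "has_Bochner_integral M f I" and J: "has_Bochner_integral M f J"
  shows "I = J"
proof -
  obtain s where s: "\<And>n. Bochner_Integration.simple_bochner_integrable M (s n)"
    "(\<lambda>n. \<integral>\<^sup>+ x. ennreal (norm (f x - s n x)) \<partial>M) \<longlonglongrightarrow> 0"
    "(\<lambda>n. Bochner_Integration.simple_bochner_integral M (s n)) \<longlonglongrightarrow> I"
    using I unfolding has_Bochner_integral_def by blast
  obtain t where t: "\<And>n. Bochner_Integration.simple_bochner_integrable M (t n)"
    "(\<lambda>n. \<integral>\<^sup>+ x. ennreal (norm (f x - t n x)) \<partial>M) \<longlonglongrightarrow> 0"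
    "(\<lambda>n. Bochner_Integration.simple_bochner_integral M (t n)) \<longlonglongrightarrow> J"
    using J unfolding has_Bochner_integral_def by blast
  have sf: "simple_function M (s n)" "simple_function M (t n)" for n
    using s(1)[of n] t(1)[of n] by (auto elim: simple_bochner_integrable.cases)
  have bound: "ennreal (norm (Bochner_Integration.simple_bochner_integral M (s n) - Bochner_Integration.simple_bochner_integral M (t n)))
      \<le> (\<integral>\<^sup>+ x. ennreal (norm (f x - s n x)) \<partial>M) + (\<integral>\<^sup>+ x. ennreal (norm (f x - t n x)) \<partial>M)" for n
  proof -
    have "(\<integral>\<^sup>+ x. ennreal (norm (s n x - t n x)) \<partial>M)
        \<le> (\<integral>\<^sup>+ x. ennreal (norm (f x - s n x)) + ennreal (norm (f x - t n x)) \<partial>M)"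
      by (intro nn_integral_mono) (simp add: ennreal_plus[symmetric] del: ennreal_plus,
          metis norm_minus_commute norm_triangle_sub norm_diff_triangle_ineq add.commute dist_norm dist_triangle3)
    also have "\<dots> = (\<integral>\<^sup>+ x. ennreal (norm (f x - s n x)) \<partial>M) + (\<integral>\<^sup>+ x. ennreal (norm (f x - t n x)) \<partial>M)"
      by (intro nn_integral_add measurable_compose[OF meas[OF sf(1)] measurable_ennreal]
          measurable_compose[OF meas[OF sf(2)] measurable_ennreal])
    finally show ?thesis using simple_bochner_integral_bound[OF s(1)[of n] t(1)[of n]] by (rule order.trans[rotated])
  qed
  have "(\<lambda>n. ennreal (norm (Bochner_Integration.simple_bochner_integral M (s n) - Bochner_Integration.simple_bochner_integral M (t n)))) \<longlonglongrightarrow> ennreal (norm (I - J))"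
    by (intro tendsto_intros s t)
  moreover have "(\<lambda>n. (\<integral>\<^sup>+ x. ennreal (norm (f x - s n x)) \<partial>M) + (\<integral>\<^sup>+ x. ennreal (norm (f x - t n x)) \<partial>M)) \<longlonglongrightarrow> 0 + 0"
    by (intro tendsto_add s t)
  ultimately have "ennreal (norm (I - J)) \<le> 0 + 0"
    by (rule LIMSEQ_le) (use bound in blast)
  then show ?thesis by simp
qed

lemma Bochner_integral_eq:
  assumes "\<And>s. simple_function M s \<Longrightarrow> (\<lambda>x. norm (f x - s x)) \<in> borel_measurable M"
    and "has_Bochner_integral M f I"
  shows "Bochner_integral M f = I"
  unfolding Bochner_integral_def using has_Bochner_integral_unique[OF assms(1)] assms(2)
  by (auto intro: the_equality)

lemma Bochner_integral_point_measure:
  fixes f :: "'a \<Rightarrow> 'b::real_normed_vector"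
  assumes "finite A" "\<And>a. a \<in> A \<Longrightarrow> 0 \<le> w a"
  shows "Bochner_integral (point_measure A (\<lambda>a. ennreal (w a))) f = (\<Sum>a\<in>A. w a *\<^sub>R f a)"
proof -
  let ?M = "point_measure A (\<lambda>a. ennreal (w a))"
  have "emeasure ?M {x \<in> space ?M. f x \<noteq> 0} \<noteq> \<infinity>"
    using assms by (subst emeasure_point_measure_finite) (auto simp: space_point_measure)
  then have sbi: "Bochner_Integration.simple_bochner_integrable ?M f"
    using assms by (intro simple_bochner_integrable.intros) auto
  \<comment> \<open>Every function on finitely many atoms is simple. Partitioning by the points
    instead of the values of f gives the sum over the atoms.\<close>
  have "Bochner_Integration.simple_bochner_integral ?M f
      = (\<Sum>y\<in>id ` space ?M. measure ?M {x \<in> space ?M. id x = y} *\<^sub>R f y)"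
    by (rule simple_bochner_integral_partition[OF sbi]) (use assms in \<open>auto simp: space_point_measure\<close>)
  also have "\<dots> = (\<Sum>a\<in>A. w a *\<^sub>R f a)"
  proof (intro sum.cong)
    fix a assume a: "a \<in> A"
    then have "{x \<in> space ?M. id x = a} = {a}" by (auto simp: space_point_measure)
    then show "measure ?M {x \<in> space ?M. id x = a} *\<^sub>R f a = w a *\<^sub>R f a"
      using assms a by (simp add: measure_point_measure_finite_if)
  qed (simp add: space_point_measure)
  finally have "has_Bochner_integral ?M f (\<Sum>a\<in>A. w a *\<^sub>R f a)"
    using has_Bochner_integral_simple[OF sbi] by simp
  then show ?thesis by (intro Bochner_integral_eq) auto
qed

lemma Lp_norm_point_measure:
  assumes "finite A" "\<And>a. a \<in> A \<Longrightarrow> 0 \<le> w a"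
  shows "Lp_norm p (point_measure A (\<lambda>a. ennreal (w a))) f = (\<Sum>a\<in>A. w a * norm (f a) powr p) powr (1 / p)"
proof -
  have "(\<integral>\<^sup>+ x. ennreal (norm (f x) powr p) \<partial>point_measure A (\<lambda>a. ennreal (w a)))
      = ennreal (\<Sum>a\<in>A. w a * norm (f a) powr p)"
    using assms by (simp add: nn_integral_point_measure_finite ennreal_mult[symmetric] sum_ennreal)
  then show ?thesis using assms by (simp add: Lp_norm_def sum_nonneg)
qed

text \<open>\<open>UMD_bound\<close> speaks about probability measures on the type
  \<open>real\<close> only. So the atoms are numbered, the numbers are read as reals, and the masses
  are divided by the total mass W.\<close>

lemma UMD_bound_finite:
  fixes d :: "nat \<Rightarrow> 'a \<Rightarrow> 'x::banach"
  assumes \<beta>: "UMD_bound TYPE('x) p \<beta>" and p: "1 \<le> p" and mds: "finite_mds S w \<pi> n d"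
    and \<epsilon>: "\<And>k. \<epsilon> k \<in> {- 1, 1}"
  shows "(\<Sum>x\<in>S. w x * norm (\<Sum>k<n. \<epsilon> k *\<^sub>R d k x) powr p) powr (1 / p)
    \<le> \<beta> * (\<Sum>x\<in>S. w x * norm (\<Sum>k<n. d k x) powr p) powr (1 / p)"
proof (cases "S = {}")
  case False
  have S: "finite S" and w: "\<And>x. x \<in> S \<Longrightarrow> 0 < w x"
    and ref: "\<And>k x y. x \<in> S \<Longrightarrow> y \<in> S \<Longrightarrow> \<pi> (Suc k) x = \<pi> (Suc k) y \<Longrightarrow> \<pi> k x = \<pi> k y"
    and meas: "\<And>k x y. k < n \<Longrightarrow> x \<in> S \<Longrightarrow> y \<in> S \<Longrightarrow> \<pi> k x = \<pi> k y \<Longrightarrow> d k x = d k y"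
    and mean: "\<And>k x. Suc k < n \<Longrightarrow> x \<in> S \<Longrightarrow> (\<Sum>y\<in>{y\<in>S. \<pi> k y = \<pi> k x}. w y *\<^sub>R d (Suc k) y) = 0"
    using mds unfolding finite_mds_def by blast+
  obtain g :: "'a \<Rightarrow> nat" where g: "inj_on g S" using finite_imp_inj_to_nat_seg[OF S] by blast
  define e where "e x = real (g x)" for x
  have e: "inj_on e S" using g by (auto simp: inj_on_def e_def)
  define i where "i = inv_into S e"
  have ie: "i (e x) = x" if "x \<in> S" for x using e that by (simp add: i_def)
  have iS: "i r \<in> S" if "r \<in> e ` S" for r using that ie by auto
  define W where "W = sum w S"
  have W: "0 < W" unfolding W_def using w S False by (intro sum_pos) auto
  define v where "v r = w (i r) / W" for r
  have v: "0 \<le> v r" if "r \<in> e ` S" for r using w[OF iS[OF that]] W by (simp add: v_def)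
  define \<Omega> where "\<Omega> = e ` S"
  have \<Omega>: "finite \<Omega>" using S by (simp add: \<Omega>_def)
  define M where "M = point_measure \<Omega> (\<lambda>r. ennreal (v r))"
  have spM: "space M = \<Omega>" "sets M = Pow \<Omega>" by (simp_all add: M_def space_point_measure sets_point_measure)
  define l where "l k r = \<pi> k (i r)" for k r
  \<comment> \<open>The members of \<open>F k\<close> are the unions of classes of the label. A
    coarser class is a union of finer ones, which is what makes this a filtration.\<close>
  define F where "F k = vimage_algebra \<Omega> (l k) (count_space UNIV)" for k
  have spF: "space (F k) = \<Omega>" for k by (simp add: F_def)
  have setsF: "sets (F k) = {l k -` A \<inter> \<Omega> |A. True}" for k
    unfolding F_def by (subst sets_vimage_algebra2) auto
  have sub: "subalgebra M (F k)" for k by (auto simp: subalgebra_def spM spF setsF)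
  have sum_e: "(\<Sum>r\<in>\<Omega>. h (i r)) = (\<Sum>x\<in>S. h x)" for h :: "'a \<Rightarrow> 'z::comm_monoid_add"
    unfolding \<Omega>_def by (subst sum.reindex[OF e]) (simp add: ie)
  have prob: "prob_space M"
  proof (rule prob_spaceI)
    have "(\<Sum>r\<in>\<Omega>. v r) = 1" unfolding v_def sum_e[of "\<lambda>x. w x / W"]
      using W by (simp add: sum_divide_distrib[symmetric] W_def[symmetric])
    then show "emeasure M (space M) = 1"
      unfolding spM(1) unfolding M_def using \<Omega> v
      by (subst emeasure_point_measure_finite) (auto simp: sum_ennreal \<Omega>_def)
  qed
  interpret prob_space M by (rule prob)
  define D where "D k r = d k (i r)" for k r
  have "martingale_difference_sequence p M F n D"
    unfolding martingale_difference_sequence_def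
  proof (intro conjI allI impI)
    show "filtration (space M) F"
    proof
      show "space (F k) = space M" for k by (simp add: spF spM)
      have "l j -` A \<inter> \<Omega> \<in> sets (F k)" if "j \<le> k" for j k A
      proof -
        have "l j -` A \<inter> \<Omega> = l k -` (l k ` (l j -` A \<inter> \<Omega>)) \<inter> \<Omega>"
        proof (intro subset_antisym subsetI)
          fix r assume "r \<in> l k -` (l k ` (l j -` A \<inter> \<Omega>)) \<inter> \<Omega>"
          then obtain r' where r': "r \<in> \<Omega>" "r' \<in> \<Omega>" "l j r' \<in> A" "\<pi> k (i r) = \<pi> k (i r')"
            by (auto simp: l_def)
          have "\<pi> j (i r) = \<pi> j (i r')"
            using label_refine_le[of S \<pi>, OF ref iS iS that r'(4)] r'(1,2) unfolding \<Omega>_def by blast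
          then show "r \<in> l j -` A \<inter> \<Omega>" using r' by (simp add: l_def)
        qed auto
        then show ?thesis by (auto simp: setsF)
      qed
      then show "sets (F j) \<subseteq> sets (F k)" if "j \<le> k" for j k
        using that by (auto simp: setsF[of j])
    qed
    show "subalgebra M (F k)" for k by (rule sub)
    show "D k \<in> Lp p (restr_to_subalg M (F k))" if "k < n" for k
      unfolding Lp_def
    proof (intro CollectI conjI)
      let ?N = "restr_to_subalg M (F k)"
      have "simple_function ?N (D k)"
        unfolding simple_function_def
      proof (intro conjI ballI)
        show "finite (D k ` space ?N)" by (simp add: space_restr_to_subalg spM \<Omega>)
        fix y
        have "D k -` {y} \<inter> \<Omega> = l k -` (l k ` (D k -` {y} \<inter> \<Omega>)) \<inter> \<Omega>"
        proof (intro subset_antisym subsetI)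
          fix r assume "r \<in> l k -` (l k ` (D k -` {y} \<inter> \<Omega>)) \<inter> \<Omega>"
          then obtain r' where r': "r \<in> \<Omega>" "r' \<in> \<Omega>" "D k r' = y" "\<pi> k (i r) = \<pi> k (i r')"
            by (auto simp: l_def)
          have "D k r = D k r'"
            unfolding D_def using meas[OF that iS iS r'(4)] r'(1,2) unfolding \<Omega>_def by blast
          then show "r \<in> D k -` {y} \<inter> \<Omega>" using r' by simp
        qed auto
        then show "D k -` {y} \<inter> space ?N \<in> sets ?N"
          by (auto simp: space_restr_to_subalg sets_restr_to_subalg[OF sub] spM setsF)
      qed
      then show "strongly_measurable ?N (D k)"
        unfolding strongly_measurable_def by (intro exI[of _ "\<lambda>_. D k"]) auto
      define B where "B = (\<Sum>r\<in>\<Omega>. norm (D k r) powr p)"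
      have "(\<integral>\<^sup>+ x. ennreal (norm (D k x) powr p) \<partial>?N) \<le> (\<integral>\<^sup>+ x. ennreal B \<partial>?N)"
        using \<Omega> unfolding B_def
        by (intro nn_integral_mono ennreal_leI member_le_sum) (auto simp: space_restr_to_subalg spM)
      also have "\<dots> = ennreal B"
        using emeasure_space_1 sub by (simp add: emeasure_restr_to_subalg space_restr_to_subalg spM subalgebra_def spF[symmetric, of k])
      finally show "(\<integral>\<^sup>+ x. ennreal (norm (D k x) powr p) \<partial>?N) < \<infinity>"
        by (simp add: order_le_less_trans)
    qed
    show "\<forall>A\<in>sets (F k). Bochner_integral M (\<lambda>w. indicat_real A w *\<^sub>R D (Suc k) w) = 0" if "Suc k < n" for k
    proof
      fix A assume "A \<in> sets (F k)"
      then obtain L where L: "A = l k -` L \<inter> \<Omega>" by (auto simp: setsF)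
      have "Bochner_integral M (\<lambda>w. indicat_real A w *\<^sub>R D (Suc k) w)
          = (\<Sum>r\<in>\<Omega>. v r *\<^sub>R indicat_real A r *\<^sub>R D (Suc k) r)"
        unfolding M_def using \<Omega> v by (intro Bochner_integral_point_measure) (auto simp: \<Omega>_def)
      also have "\<dots> = (\<Sum>r\<in>\<Omega>. (1 / W) *\<^sub>R indicat_real L (\<pi> k (i r)) *\<^sub>R w (i r) *\<^sub>R d (Suc k) (i r))"
        by (intro sum.cong) (auto simp: L v_def D_def l_def indicator_def)
      also have "\<dots> = (\<Sum>x\<in>S. (1 / W) *\<^sub>R indicat_real L (\<pi> k x) *\<^sub>R w x *\<^sub>R d (Suc k) x)"
        by (rule sum_e[of "\<lambda>x. (1 / W) *\<^sub>R indicat_real L (\<pi> k x) *\<^sub>R w x *\<^sub>R d (Suc k) x"])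
      also have "\<dots> = (\<Sum>c\<in>\<pi> k ` S. \<Sum>x\<in>{x\<in>S. \<pi> k x = c}. (1 / W) *\<^sub>R indicat_real L (\<pi> k x) *\<^sub>R w x *\<^sub>R d (Suc k) x)"
        by (rule sum.image_gen[OF S])
      also have "\<dots> = 0"
      proof (rule sum.neutral, rule ballI)
        fix c assume "c \<in> \<pi> k ` S"
        then obtain z where z: "z \<in> S" "c = \<pi> k z" by auto
        have "(\<Sum>x\<in>{x\<in>S. \<pi> k x = c}. (1 / W) *\<^sub>R indicat_real L (\<pi> k x) *\<^sub>R w x *\<^sub>R d (Suc k) x)
            = (1 / W) *\<^sub>R indicat_real L c *\<^sub>R (\<Sum>x\<in>{x\<in>S. \<pi> k x = c}. w x *\<^sub>R d (Suc k) x)"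
          by (simp add: scaleR_sum_right)
        then show "(\<Sum>x\<in>{x\<in>S. \<pi> k x = c}. (1 / W) *\<^sub>R indicat_real L (\<pi> k x) *\<^sub>R w x *\<^sub>R d (Suc k) x) = 0"
          using mean[OF that z(1)] z(2) by simp
      qed
      finally show "Bochner_integral M (\<lambda>w. indicat_real A w *\<^sub>R D (Suc k) w) = 0" .
    qed
  qed
  then have *: "Lp_norm p M (\<lambda>r. \<Sum>k<n. \<epsilon> k *\<^sub>R D k r) \<le> \<beta> * Lp_norm p M (\<lambda>r. \<Sum>k<n. D k r)"
    using \<beta> prob \<epsilon> unfolding UMD_bound_def by blast
  \<comment> \<open>Normalising the masses multiplies both sides of the UMD inequality by the same
    factor.\<close>
  have "Lp_norm p M (\<lambda>r. h (i r)) = (1 / W) powr (1 / p) * (\<Sum>x\<in>S. w x * norm (h x) powr p) powr (1 / p)"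
    for h :: "'a \<Rightarrow> 'x"
  proof -
    have "Lp_norm p M (\<lambda>r. h (i r)) = (\<Sum>r\<in>\<Omega>. w (i r) / W * norm (h (i r)) powr p) powr (1 / p)"
      unfolding M_def using \<Omega> v by (subst Lp_norm_point_measure) (auto simp: \<Omega>_def v_def)
    also have "(\<Sum>r\<in>\<Omega>. w (i r) / W * norm (h (i r)) powr p) = (1 / W) * (\<Sum>x\<in>S. w x * norm (h x) powr p)"
      unfolding sum_e[of "\<lambda>x. w x / W * norm (h x) powr p"] by (simp add: sum_distrib_left)
    also have "((1 / W) * (\<Sum>x\<in>S. w x * norm (h x) powr p)) powr (1 / p)
        = (1 / W) powr (1 / p) * (\<Sum>x\<in>S. w x * norm (h x) powr p) powr (1 / p)"
      by (rule powr_mult)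
    finally show ?thesis .
  qed
  from this[of "\<lambda>x. \<Sum>k<n. \<epsilon> k *\<^sub>R d k x"] this[of "\<lambda>x. \<Sum>k<n. d k x"] * W
  show ?thesis by (simp add: D_def mult.left_commute[of \<beta>])
qed simp

text \<open>The conditional expectation with respect to the partition of S by the label l.\<close>

definition label_mean ::
    "'a set \<Rightarrow> ('a \<Rightarrow> real) \<Rightarrow> ('a \<Rightarrow> 'c) \<Rightarrow> ('a \<Rightarrow> 'x::real_vector) \<Rightarrow> 'a \<Rightarrow> 'x" where
  "label_mean S w l f x =
     (1 / (\<Sum>y\<in>{y\<in>S. l y = l x}. w y)) *\<^sub>R (\<Sum>y\<in>{y\<in>S. l y = l x}. w y *\<^sub>R f y)"

lemma label_mean_cong: "l x = l y \<Longrightarrow> label_mean S w l f x = label_mean S w l f y"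
  by (simp add: label_mean_def)

lemma sum_label_mean:
  assumes "finite S" "\<And>x. x \<in> S \<Longrightarrow> 0 < w x" "x \<in> S"
  shows "(\<Sum>y\<in>{y\<in>S. l y = l x}. w y *\<^sub>R label_mean S w l f y) = (\<Sum>y\<in>{y\<in>S. l y = l x}. w y *\<^sub>R f y)"
proof -
  define C where "C = {y\<in>S. l y = l x}"
  have C: "finite C" "x \<in> C" using assms by (auto simp: C_def)
  have "0 < sum w C" using C assms by (intro sum_pos) (auto simp: C_def)
  have "(\<Sum>y\<in>C. w y *\<^sub>R label_mean S w l f y) = (\<Sum>y\<in>C. w y *\<^sub>R label_mean S w l f x)"
    by (intro sum.cong refl arg_cong2[where f="scaleR"] label_mean_cong) (simp add: C_def)
  also have "\<dots> = sum w C *\<^sub>R label_mean S w l f x" by (simp add: scaleR_sum_left)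
  also have "\<dots> = (\<Sum>y\<in>C. w y *\<^sub>R f y)" using \<open>0 < sum w C\<close> by (simp add: label_mean_def C_def)
  finally show ?thesis by (simp add: C_def)
qed

lemma label_mean_eq_self:
  assumes "finite S" "\<And>x. x \<in> S \<Longrightarrow> 0 < w x" "x \<in> S"
    and const: "\<And>x y. x \<in> S \<Longrightarrow> y \<in> S \<Longrightarrow> l x = l y \<Longrightarrow> f x = f y"
  shows "label_mean S w l f x = f x"
proof -
  have pos: "0 < (\<Sum>y\<in>{y\<in>S. l y = l x}. w y)"
    using assms by (intro sum_pos) auto
  have "(\<Sum>y\<in>{y\<in>S. l y = l x}. w y *\<^sub>R f y) = (\<Sum>y\<in>{y\<in>S. l y = l x}. w y *\<^sub>R f x)"
    by (intro sum.cong refl arg_cong2[where f="scaleR"] const) (use assms in auto)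
  also have "\<dots> = (\<Sum>y\<in>{y\<in>S. l y = l x}. w y) *\<^sub>R f x" by (simp add: scaleR_sum_left)
  finally show ?thesis using pos by (simp add: label_mean_def)
qed

text \<open>Orthogonality of martingale differences: on a class the factor G is a constant that can
  be pulled out, and what is left has mean zero.\<close>

lemma sum_classes_bilinear_eq_0:
  fixes P :: "'a::real_normed_vector \<Rightarrow> 'b::real_normed_vector \<Rightarrow> 'c::real_normed_vector"
  assumes P: "bounded_bilinear P" and S: "finite S"
    and const: "\<And>x y. x \<in> S \<Longrightarrow> y \<in> S \<Longrightarrow> l x = l y \<Longrightarrow> G x = G y"
    and zero: "\<And>x. x \<in> S \<Longrightarrow> (\<Sum>y\<in>{y\<in>S. l y = l x}. w y *\<^sub>R H y) = 0"
  shows "(\<Sum>x\<in>S. w x *\<^sub>R P (G x) (H x)) = 0"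
proof -
  interpret bounded_bilinear P by fact
  have "(\<Sum>x\<in>{x\<in>S. l x = c}. w x *\<^sub>R P (G x) (H x)) = 0" if c: "c \<in> l ` S" for c
  proof -
    obtain z where z: "z \<in> S" "c = l z" using c by auto
    have "(\<Sum>x\<in>{x\<in>S. l x = c}. w x *\<^sub>R P (G x) (H x)) = (\<Sum>x\<in>{x\<in>S. l x = c}. P (G z) (w x *\<^sub>R H x))"
    proof (rule sum.cong)
      fix x assume "x \<in> {x \<in> S. l x = c}"
      then have "G x = G z" using z by (intro const) auto
      then show "w x *\<^sub>R P (G x) (H x) = P (G z) (w x *\<^sub>R H x)" by (simp add: scaleR_right)
    qed simp
    also have "\<dots> = P (G z) (\<Sum>x\<in>{x\<in>S. l x = c}. w x *\<^sub>R H x)" by (rule sum_right[symmetric])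
    also have "\<dots> = 0" using zero[OF z(1)] z(2) by (simp add: zero_right)
    finally show ?thesis .
  qed
  then show ?thesis
    unfolding sum.image_gen[OF S, of "\<lambda>x. w x *\<^sub>R P (G x) (H x)" l] by (rule sum.neutral[OF ballI])
qed

text \<open>The supremum that defines the norm of a functional need not be attained, hence the
  factor \<open>1 - \<eta>\<close>. If no such v existed, \<open>(1 - \<eta>) * norm \<phi>\<close>
  would be a bound smaller than the operator norm.\<close>

lemma blinfun_almost_norming:
  fixes \<phi> :: "'a::real_normed_vector \<Rightarrow>\<^sub>L real"
  assumes "0 < \<eta>"
  obtains v where "norm v \<le> 1" "(1 - \<eta>) * norm \<phi> \<le> blinfun_apply \<phi> v"
proof (cases "\<phi> = 0")
  case False
  have "\<exists>x. \<not> norm (blinfun_apply \<phi> x) \<le> ((1 - \<eta>) * norm \<phi>) * norm x"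
  proof (rule ccontr)
    assume "\<not> ?thesis"
    then have *: "norm (blinfun_apply \<phi> x) \<le> ((1 - \<eta>) * norm \<phi>) * norm x" for x by blast
    have "\<exists>x. blinfun_apply \<phi> x \<noteq> 0" using False by (metis blinfun_eqI zero_blinfun.rep_eq)
    then obtain x where "blinfun_apply \<phi> x \<noteq> 0" by blast
    then have "0 < norm (blinfun_apply \<phi> x)" "0 < norm x" by auto
    then have "0 < ((1 - \<eta>) * norm \<phi>) * norm x" using *[of x] by linarith
    then have "0 < (1 - \<eta>) * norm \<phi>" using \<open>0 < norm x\<close> by (simp only: zero_less_mult_pos2)
    then have "norm \<phi> \<le> (1 - \<eta>) * norm \<phi>" using * by (intro norm_blinfun_bound) auto
    then show False using mult_pos_pos[OF assms, of "norm \<phi>"] False by (simp add: left_diff_distrib)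
  qed
  then obtain x where x: "((1 - \<eta>) * norm \<phi>) * norm x < \<bar>blinfun_apply \<phi> x\<bar>" by (auto simp: not_le)
  then have "x \<noteq> 0" by auto
  define v where "v = (sgn (blinfun_apply \<phi> x) / norm x) *\<^sub>R x"
  have "norm v \<le> 1" using \<open>x \<noteq> 0\<close> by (simp add: v_def abs_sgn_eq)
  moreover have "blinfun_apply \<phi> v = \<bar>blinfun_apply \<phi> x\<bar> / norm x"
    by (simp add: v_def blinfun.scaleR_right abs_sgn mult.commute)
  then have "(1 - \<eta>) * norm \<phi> \<le> blinfun_apply \<phi> v"
    using x \<open>x \<noteq> 0\<close> by (simp add: le_divide_eq)
  ultimately show thesis by (rule that)
qed (use that[of 0] in simp)

text \<open>The UMD inequality passes to the dual space: pairing the transformed martingale with an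
  almost norming \<open>\<phi>\<close> moves the signs onto the martingale differences of \<open>\<phi>\<close>.\<close>

lemma UMD_bound_finite_dual:
  fixes d :: "nat \<Rightarrow> 'a \<Rightarrow> 'y::banach \<Rightarrow>\<^sub>L real"
  assumes \<beta>: "UMD_bound TYPE('y) p \<beta>" and p: "1 < p" "1 < q" "1 / p + 1 / q = 1"
    and mds: "finite_mds S w \<pi> n d" and \<epsilon>: "\<And>k. \<epsilon> k \<in> {- 1, 1}"
  shows "(\<Sum>x\<in>S. w x * norm (\<Sum>k<n. \<epsilon> k *\<^sub>R d k x) powr q) powr (1 / q)
    \<le> \<beta> * (\<Sum>x\<in>S. w x * norm (\<Sum>k<n. d k x) powr q) powr (1 / q)"
proof (cases n)
  case (Suc N)
  have S: "finite S" and w: "\<And>x. x \<in> S \<Longrightarrow> 0 < w x"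
    and ref: "\<And>k x y. x \<in> S \<Longrightarrow> y \<in> S \<Longrightarrow> \<pi> (Suc k) x = \<pi> (Suc k) y \<Longrightarrow> \<pi> k x = \<pi> k y"
    and meas: "\<And>k x y. k < n \<Longrightarrow> x \<in> S \<Longrightarrow> y \<in> S \<Longrightarrow> \<pi> k x = \<pi> k y \<Longrightarrow> d k x = d k y"
    and mean: "\<And>k x. Suc k < n \<Longrightarrow> x \<in> S \<Longrightarrow> (\<Sum>y\<in>{y\<in>S. \<pi> k y = \<pi> k x}. w y *\<^sub>R d (Suc k) y) = 0"
    using mds unfolding finite_mds_def by blast+
  have ref_le: "\<pi> j x = \<pi> j y" if "x \<in> S" "y \<in> S" "j \<le> k" "\<pi> k x = \<pi> k y" for j k x y
    using label_refine_le[of S \<pi> x y j k] ref that by blast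
  have \<beta>0: "0 \<le> \<beta>" using \<beta> by (simp add: UMD_bound_def)
  define G where "G x = (\<Sum>k<n. \<epsilon> k *\<^sub>R d k x)" for x
  define A where "A = (\<Sum>x\<in>S. w x * norm (\<Sum>k<n. d k x) powr q)"
  define B where "B = (\<Sum>x\<in>S. w x * norm (G x) powr q)"
  have AB: "0 \<le> A" "0 \<le> B" unfolding A_def B_def by (auto intro!: sum_nonneg simp: w less_imp_le)
  have pq: "p * (q - 1) = q"
  proof -
    have "p * q * (1 / p + 1 / q) = p * q" by (simp only: p(3) mult_1_right)
    then show ?thesis using p(1,2) by (simp add: distrib_left right_diff_distrib)
  qed
  \<comment> \<open>The last difference has index \<open>N = n - 1\<close>, so the whole signed sum
    is constant on the classes of \<open>\<pi> N\<close>.\<close>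
  have G_meas: "G x = G y" if "x \<in> S" "y \<in> S" "\<pi> N x = \<pi> N y" for x y
    unfolding G_def
  proof (intro sum.cong refl arg_cong2[where f="scaleR"])
    fix k assume "k \<in> {..<n}"
    then show "d k x = d k y" using that ref_le[OF that(1,2) _ that(3), of k] Suc by (intro meas) auto
  qed
  have step: "(1 - \<eta>) * B \<le> \<beta> * A powr (1 / q) * B powr (1 / p)" if \<eta>: "0 < \<eta>" for \<eta>
  proof -
    have "\<forall>\<phi> :: 'y \<Rightarrow>\<^sub>L real. \<exists>v. norm v \<le> 1 \<and> (1 - \<eta>) * norm \<phi> \<le> blinfun_apply \<phi> v"
      using blinfun_almost_norming[OF \<eta>] by metis
    then obtain V where V: "\<And>\<phi> :: 'y \<Rightarrow>\<^sub>L real. norm (V \<phi>) \<le> 1" "\<And>\<phi>. (1 - \<eta>) * norm \<phi> \<le> blinfun_apply \<phi> (V \<phi>)"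
      by metis
    \<comment> \<open>The extremal function for Hoelder's inequality: its p-th power is at most
      \<open>norm (G x) powr q\<close> because \<open>p * (q - 1) = q\<close>.\<close>
    define \<phi> where "\<phi> x = (norm (G x) powr (q - 1)) *\<^sub>R V (G x)" for x
    \<comment> \<open>The martingale generated by \<phi> along the given labels. Since \<phi>
      depends only on G, the conditional mean at N is \<phi> itself, and n differences recover
      it.\<close>
    define E where "E k = label_mean S w (\<pi> k) \<phi>" for k
    define D where "D k x = (if k = 0 then E 0 x else E k x - E (k - 1) x)" for k x
    have E_meas: "E k x = E k y" if "\<pi> k x = \<pi> k y" for k x y
      unfolding E_def using that by (rule label_mean_cong)
    have E_sum: "(\<Sum>y\<in>{y\<in>S. \<pi> k y = \<pi> k x}. w y *\<^sub>R E k y) = (\<Sum>y\<in>{y\<in>S. \<pi> k y = \<pi> k x}. w y *\<^sub>R \<phi> y)"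
      if "x \<in> S" for k x
      unfolding E_def using S w that by (rule sum_label_mean)
    have D_sum: "(\<Sum>k<Suc m. D k x) = E m x" for m x
      by (induction m) (simp_all add: D_def)
    have E_last: "E N x = \<phi> x" if "x \<in> S" for x
      unfolding E_def
    proof (rule label_mean_eq_self[OF S w that])
      show "\<phi> x = \<phi> y" if "x \<in> S" "y \<in> S" "\<pi> N x = \<pi> N y" for x y
        unfolding \<phi>_def by (simp only: G_meas[OF that])
    qed
    have D_mds: "finite_mds S w \<pi> n D"
      unfolding finite_mds_def
    proof (intro conjI allI impI ballI)
      show "D k x = D k y" if "x \<in> S" "y \<in> S" "\<pi> k x = \<pi> k y" for k x y
        using E_meas[OF that(3)] E_meas[of "k - 1" x y] ref[OF that(1,2), of "k - 1"] that(3)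
        by (cases k) (simp_all add: D_def)
      show "(\<Sum>y\<in>{y\<in>S. \<pi> k y = \<pi> k x}. w y *\<^sub>R D (Suc k) y) = 0" if "x \<in> S" for k x
      proof -
        have cl: "\<pi> k ` {y\<in>S. \<pi> k y = \<pi> k x} = {\<pi> k x}" using that by auto
        \<comment> \<open>The indicator of a class of \<open>\<pi> k\<close> is constant on the
          classes of \<open>\<pi> (Suc k)\<close>; hence \<open>E (Suc k)\<close> and \<phi> have
          equal sums over that coarser class.\<close>
        have "(\<Sum>y\<in>S. w y *\<^sub>R (indicat_real {y. \<pi> k y = \<pi> k x} y *\<^sub>R (E (Suc k) y - \<phi> y))) = 0"
        proof (rule sum_classes_bilinear_eq_0[OF bounded_bilinear_scaleR S, where l="\<pi> (Suc k)"])
          show "indicat_real {y. \<pi> k y = \<pi> k x} u = indicat_real {y. \<pi> k y = \<pi> k x} v"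
            if "u \<in> S" "v \<in> S" "\<pi> (Suc k) u = \<pi> (Suc k) v" for u v
            using ref[OF that] by (simp add: indicator_def)
          show "(\<Sum>y\<in>{y\<in>S. \<pi> (Suc k) y = \<pi> (Suc k) u}. w y *\<^sub>R (E (Suc k) y - \<phi> y)) = 0" if "u \<in> S" for u
            using E_sum[OF that, of "Suc k"] by (simp add: scaleR_diff_right sum_subtractf)
        qed
        also have "(\<Sum>y\<in>S. w y *\<^sub>R (indicat_real {y. \<pi> k y = \<pi> k x} y *\<^sub>R (E (Suc k) y - \<phi> y)))
            = (\<Sum>y\<in>{y\<in>S. \<pi> k y = \<pi> k x}. w y *\<^sub>R (E (Suc k) y - \<phi> y))"
          using S by (intro sum.mono_neutral_cong_right) auto
        finally show ?thesis
          using E_sum[OF that, of k] by (simp add: D_def scaleR_diff_right sum_subtractf)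
      qed
    qed (use S w ref in blast)+
    \<comment> \<open>For different indices the later difference has mean zero on every class on
      which the earlier one is constant. Two cases arise because the later one may come from either
      factor.\<close>
    have orth: "(\<Sum>x\<in>S. w x *\<^sub>R blinfun_apply (d i x) (D j x)) = 0" if ij: "i < n" "j < n" "i \<noteq> j" for i j
    proof (cases "i < j")
      case True
      then obtain j' where j': "j = Suc j'" "i \<le> j'" by (cases j) auto
      show ?thesis
      proof (rule sum_classes_bilinear_eq_0[OF bounded_bilinear_blinfun_apply S, where l="\<pi> j'"])
        show "d i x = d i y" if "x \<in> S" "y \<in> S" "\<pi> j' x = \<pi> j' y" for x y
          using meas[OF \<open>i < n\<close> that(1,2) ref_le[OF that(1,2) j'(2) that(3)]] .
        show "(\<Sum>y\<in>{y\<in>S. \<pi> j' y = \<pi> j' x}. w y *\<^sub>R D j y) = 0" if "x \<in> S" for x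
          using D_mds that j' \<open>j < n\<close> unfolding finite_mds_def by blast
      qed
    next
      case False
      then obtain i' where i': "i = Suc i'" "j \<le> i'" using ij(3) by (cases i) auto
      interpret A: bounded_bilinear "\<lambda>v \<phi>. blinfun_apply \<phi> v"
        by (rule bounded_bilinear.flip[OF bounded_bilinear_blinfun_apply])
      show ?thesis
      proof (rule sum_classes_bilinear_eq_0[OF A.bounded_bilinear_axioms S, where l="\<pi> i'"])
        show "D j x = D j y" if "x \<in> S" "y \<in> S" "\<pi> i' x = \<pi> i' y" for x y
        proof -
          have "\<pi> j x = \<pi> j y" by (rule ref_le[OF that(1,2) i'(2) that(3)])
          then show ?thesis using D_mds \<open>j < n\<close> that unfolding finite_mds_def by blast
        qed
        show "(\<Sum>y\<in>{y\<in>S. \<pi> i' y = \<pi> i' x}. w y *\<^sub>R d i y) = 0" if "x \<in> S" for x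
          using mean[of i' x] that i' \<open>i < n\<close> by simp
      qed
    qed
    have expand: "(\<Sum>x\<in>S. w x *\<^sub>R blinfun_apply (\<Sum>i<n. a i *\<^sub>R d i x) (\<Sum>j<n. c j *\<^sub>R D j x))
        = (\<Sum>i<n. (a i * c i) * (\<Sum>x\<in>S. w x *\<^sub>R blinfun_apply (d i x) (D i x)))" for a c :: "nat \<Rightarrow> real"
    proof -
      have "(\<Sum>x\<in>S. w x *\<^sub>R blinfun_apply (\<Sum>i<n. a i *\<^sub>R d i x) (\<Sum>j<n. c j *\<^sub>R D j x))
          = (\<Sum>x\<in>S. \<Sum>j<n. \<Sum>i<n. (a i * c j) * (w x *\<^sub>R blinfun_apply (d i x) (D j x)))"
        by (simp add: blinfun.sum_left blinfun.sum_right blinfun.scaleR_left blinfun.scaleR_right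
            sum_distrib_left mult_ac)
      also have "\<dots> = (\<Sum>j<n. \<Sum>i<n. (a i * c j) * (\<Sum>x\<in>S. w x *\<^sub>R blinfun_apply (d i x) (D j x)))"
        by (subst sum.swap, rule sum.cong[OF refl], subst sum.swap) (simp add: sum_distrib_left)
      also have "\<dots> = (\<Sum>j<n. \<Sum>i<n. if i = j then (a i * c i) * (\<Sum>x\<in>S. w x *\<^sub>R blinfun_apply (d i x) (D i x)) else 0)"
        by (intro sum.cong refl) (auto simp del: real_scaleR_def simp: orth)
      finally show ?thesis by (simp add: sum.delta)
    qed
    have \<phi>_eq: "\<phi> x = (\<Sum>j<n. D j x)" if "x \<in> S" for x
      using D_sum[of x N] E_last[OF that] Suc by simp
    have "(1 - \<eta>) * B \<le> (\<Sum>x\<in>S. w x *\<^sub>R blinfun_apply (G x) (\<phi> x))"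
      unfolding B_def sum_distrib_left
    proof (rule sum_mono)
      fix x assume x: "x \<in> S"
      have "norm (G x) powr q = norm (G x) powr (q - 1) * norm (G x)"
        using p by (simp add: powr_mult_base mult.commute)
      then have "(1 - \<eta>) * (w x * norm (G x) powr q) = (w x * norm (G x) powr (q - 1)) * ((1 - \<eta>) * norm (G x))"
        by simp
      also have "\<dots> \<le> (w x * norm (G x) powr (q - 1)) * blinfun_apply (G x) (V (G x))"
        using w[OF x] V(2) by (intro mult_left_mono) auto
      finally show "(1 - \<eta>) * (w x * norm (G x) powr q) \<le> w x *\<^sub>R blinfun_apply (G x) (\<phi> x)"
        by (simp add: \<phi>_def blinfun.scaleR_right)
    qed
    also have "\<dots> = (\<Sum>x\<in>S. w x *\<^sub>R blinfun_apply (\<Sum>i<n. \<epsilon> i *\<^sub>R d i x) (\<Sum>j<n. 1 *\<^sub>R D j x))"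
      by (intro sum.cong refl) (simp add: \<phi>_eq G_def)
    \<comment> \<open>Only the diagonal terms survive the expansion, and they depend on the product
      of the two coefficients; so the signs can be carried by either factor.\<close>
    also have "\<dots> = (\<Sum>x\<in>S. w x *\<^sub>R blinfun_apply (\<Sum>i<n. 1 *\<^sub>R d i x) (\<Sum>j<n. \<epsilon> j *\<^sub>R D j x))"
      unfolding expand by simp
    also have "\<dots> \<le> (\<Sum>x\<in>S. w x * norm (\<Sum>i<n. d i x) * norm (\<Sum>j<n. \<epsilon> j *\<^sub>R D j x))"
    proof (rule sum_mono)
      fix x assume x: "x \<in> S"
      show "w x *\<^sub>R blinfun_apply (\<Sum>i<n. 1 *\<^sub>R d i x) (\<Sum>j<n. \<epsilon> j *\<^sub>R D j x)
          \<le> w x * norm (\<Sum>i<n. d i x) * norm (\<Sum>j<n. \<epsilon> j *\<^sub>R D j x)"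
        using norm_blinfun[of "\<Sum>i<n. d i x" "\<Sum>j<n. \<epsilon> j *\<^sub>R D j x"] w[OF x]
        by (simp add: mult.assoc abs_le_iff)
    qed
    also have "\<dots> \<le> A powr (1 / q) * (\<Sum>x\<in>S. w x * norm (\<Sum>j<n. \<epsilon> j *\<^sub>R D j x) powr p) powr (1 / p)"
      unfolding A_def using p S w by (intro weighted_Holder_sum) (auto simp: less_imp_le add.commute)
    also have "\<dots> \<le> A powr (1 / q) * (\<beta> * (\<Sum>x\<in>S. w x * norm (\<Sum>j<n. D j x) powr p) powr (1 / p))"
      using UMD_bound_finite[OF \<beta> _ D_mds \<epsilon>] p(1) by (intro mult_left_mono) auto
    also have "(\<Sum>x\<in>S. w x * norm (\<Sum>j<n. D j x) powr p) = (\<Sum>x\<in>S. w x * norm (\<phi> x) powr p)"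
      by (intro sum.cong refl) (simp add: \<phi>_eq)
    also have "A powr (1 / q) * (\<beta> * (\<Sum>x\<in>S. w x * norm (\<phi> x) powr p) powr (1 / p))
        \<le> A powr (1 / q) * (\<beta> * B powr (1 / p))"
    proof (intro mult_left_mono powr_mono2 \<beta>0)
      show "(\<Sum>x\<in>S. w x * norm (\<phi> x) powr p) \<le> B"
        unfolding B_def
      proof (intro sum_mono mult_left_mono)
        fix x assume x: "x \<in> S"
        have "norm (\<phi> x) \<le> norm (G x) powr (q - 1)"
          using V(1)[of "G x"] by (simp add: \<phi>_def mult_left_le)
        then have "norm (\<phi> x) powr p \<le> (norm (G x) powr (q - 1)) powr p"
          using p by (intro powr_mono2) auto
        then show "norm (\<phi> x) powr p \<le> norm (G x) powr q" by (simp add: powr_powr pq mult.commute[of _ p])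
      qed (use w less_imp_le in blast)
    qed (use p w in \<open>auto intro!: sum_nonneg simp: less_imp_le\<close>)
    finally show ?thesis by (simp add: mult_ac)
  qed
  \<comment> \<open>Letting \<eta> tend to 0 removes the loss from the almost norming
    vectors.\<close>
  have "((\<lambda>\<eta>. (1 - \<eta>) * B) \<longlongrightarrow> (1 - 0) * B) (at_right 0)"
    by (intro tendsto_intros)
  then have "(1 - 0) * B \<le> \<beta> * A powr (1 / q) * B powr (1 / p)"
    by (rule tendsto_upperbound)
      (use step in \<open>auto intro: eventually_mono[OF eventually_at_right_less[of "0::real"]]\<close>)
  then have *: "B \<le> \<beta> * A powr (1 / q) * B powr (1 / p)" by simp
  have "B powr (1 / q) \<le> \<beta> * A powr (1 / q)"
  proof (cases "B = 0")
    case False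
    then have "0 < B" using AB by simp
    have "B powr (1 / q) * B powr (1 / p) = B"
      using \<open>0 < B\<close> p by (simp add: powr_add[symmetric] add.commute)
    then have "B powr (1 / q) * B powr (1 / p) \<le> (\<beta> * A powr (1 / q)) * B powr (1 / p)" using * by simp
    then show ?thesis using \<open>0 < B\<close> by simp
  qed (use \<beta>0 in simp)
  then show ?thesis by (simp add: A_def B_def G_def)
qed simp

section \<open>Lower bounds for UMD constants\<close>

text \<open>Every single instance of the inequality passes to the infimum of the admissible
  constants. If the norm on the right is 0, one admissible constant already forces the norm on the
  left to vanish.\<close>

lemma UMD_bound_UMD_const:
  assumes "UMD_bound TYPE('x::banach) p \<beta>"
  shows "UMD_bound TYPE('x) p (UMD_const p TYPE('x))"
  unfolding UMD_bound_def
proof (intro conjI allI impI)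
  let ?B = "{\<beta>. UMD_bound TYPE('x) p \<beta>}"
  have ne: "?B \<noteq> {}" using assms by blast
  show "0 \<le> UMD_const p TYPE('x)"
    unfolding UMD_const_def by (rule cInf_greatest[OF ne]) (simp add: UMD_bound_def)
  fix M :: "real measure" and F n and d :: "nat \<Rightarrow> real \<Rightarrow> 'x" and \<epsilon> :: "nat \<Rightarrow> real"
  assume *: "prob_space M" "martingale_difference_sequence p M F n d" "\<forall>k. \<epsilon> k \<in> {- 1, 1}"
  let ?a = "Lp_norm p M (\<lambda>w. \<Sum>k<n. \<epsilon> k *\<^sub>R d k w)" and ?b = "Lp_norm p M (\<lambda>w. \<Sum>k<n. d k w)"
  have le: "?a \<le> \<beta> * ?b" if "UMD_bound TYPE('x) p \<beta>" for \<beta>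
    using that * unfolding UMD_bound_def by blast
  have "0 \<le> ?b" by (simp add: Lp_norm_def)
  show "?a \<le> UMD_const p TYPE('x) * ?b"
  proof (cases "?b = 0")
    case False
    then have "0 < ?b" using \<open>0 \<le> ?b\<close> by simp
    then have "?a / ?b \<le> UMD_const p TYPE('x)"
      unfolding UMD_const_def using le by (intro cInf_greatest[OF ne]) (simp add: divide_le_eq)
    then show ?thesis using \<open>0 < ?b\<close> by (simp add: divide_le_eq)
  qed (use le[OF assms] in simp)
qed

text \<open>Tested on a single atom, with a martingale of length one.\<close>

lemma UMD_bound_ge_1:
  assumes "UMD_bound TYPE('x::banach) p \<beta>" "1 \<le> p" "(v::'x) \<noteq> 0"
  shows "1 \<le> \<beta>"
proof -
  have mds: "finite_mds {0::nat} (\<lambda>_. 1) (\<lambda>_ x. x) 1 (\<lambda>_ _. v)" by (simp add: finite_mds_def)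
  have "norm v \<le> \<beta> * norm v"
    using UMD_bound_finite[OF assms(1,2) mds, of "\<lambda>_. 1"] assms(2) by (simp add: powr_powr)
  then show ?thesis using assms(3) by simp
qed

text \<open>The atom \<open>j\<close> stands for the dyadic interval \<open>[2\<^sup>-\<^sup>j\<^sup>-\<^sup>1, 2\<^sup>-\<^sup>j)\<close>.  The alternating
  sum of the Haar functions of the nested intervals \<open>[0, 2\<^sup>-\<^sup>k)\<close> is bounded by \<open>2\<close>, but without
  the signs it has the value \<open>j - 1\<close> on the atom \<open>j\<close>.\<close>

lemma UMD_lower_bound:
  fixes v :: "'x::real_normed_vector"
  assumes bound: "\<And>(S::nat set) w (\<pi>::nat \<Rightarrow> nat \<Rightarrow> nat) n (d::nat \<Rightarrow> nat \<Rightarrow> 'x) \<epsilon>.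
      finite_mds S w \<pi> n d \<Longrightarrow> (\<And>k. \<epsilon> k \<in> {- 1, 1}) \<Longrightarrow>
      (\<Sum>x\<in>S. w x * norm (\<Sum>k<n. \<epsilon> k *\<^sub>R d k x) powr r) powr (1 / r)
        \<le> \<beta> * (\<Sum>x\<in>S. w x * norm (\<Sum>k<n. d k x) powr r) powr (1 / r)"
    and r: "2 \<le> r" and \<beta>: "0 \<le> \<beta>" and v: "norm v = 1"
  shows "r \<le> 16 * \<beta>"
proof -
  \<comment> \<open>The sum with the signs removed is \<open>J - 1 \<ge> r\<close> on the atom J.
    Its mass is \<open>(1 / 2) ^ (J + 1)\<close>, and \<open>J + 1 \<le> r + 3 \<le> 3 * r\<close>
    as r is at least 2, so the norm is at least \<open>r / 8\<close>. The alternating sum has norm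
    at most 2; hence the factor 16.\<close>
  define J where "J = nat \<lceil>r\<rceil> + 1"
  define n where "n = J + 1"
  \<comment> \<open>The last atom n stands for the remaining interval at 0 and has the same mass as
    its neighbour, so the total mass is 1.\<close>
  define w :: "nat \<Rightarrow> real" where "w j = (1 / 2) ^ (if j < n then j + 1 else n)" for j
  define c :: "nat \<Rightarrow> nat \<Rightarrow> real" where "c k j = (- 1) ^ k * (if j < k then 0 else if j = k then - 1 else 1)" for k j
  \<comment> \<open>After step k the atoms up to k are separated and all later ones are still
    merged; this is exactly what \<open>c k\<close> can see.\<close>
  define \<pi> where "\<pi> k j = min j (Suc k)" for k j :: nat
  have tail: "(\<Sum>j\<in>{m..n}. w j) = (1 / 2) ^ m" if "m \<le> n" for m
    using that
  proof (induction m rule: inc_induct)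
    case (step m)
    have "{m..n} = insert m {Suc m..n}" using step by auto
    then show ?case using step by (simp add: w_def)
  qed (simp add: w_def)
  have mds: "finite_mds {..n} w \<pi> n (\<lambda>k j. c k j *\<^sub>R v)"
    unfolding finite_mds_def
  proof (intro conjI allI impI ballI)
    show "0 < w j" for j by (simp add: w_def)
    show "\<pi> k x = \<pi> k y" if "\<pi> (Suc k) x = \<pi> (Suc k) y" for k x y
      using that unfolding \<pi>_def by linarith
    have "c k x = c k y" if "\<pi> k x = \<pi> k y" for k x y
      using that unfolding \<pi>_def c_def by (auto simp: min_def split: if_splits)
    then show "c k x *\<^sub>R v = c k y *\<^sub>R v" if "\<pi> k x = \<pi> k y" for k x y
      using that by metis
    fix k x assume k: "Suc k < n" and x: "x \<in> {..n}"
    have "(\<Sum>y\<in>{y\<in>{..n}. \<pi> k y = \<pi> k x}. w y * c (Suc k) y) = 0"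
    proof (cases "x \<le> k")
      case True
      then have "{y\<in>{..n}. \<pi> k y = \<pi> k x} = {x}" using x by (auto simp: \<pi>_def min_def)
      then show ?thesis using True by (simp add: c_def)
    next
      case False
      then have "{y\<in>{..n}. \<pi> k y = \<pi> k x} = insert (Suc k) {Suc (Suc k)..n}"
        using x k by (auto simp: \<pi>_def min_def)
      moreover have "(\<Sum>y\<in>{Suc (Suc k)..n}. w y * c (Suc k) y) = (\<Sum>y\<in>{Suc (Suc k)..n}. w y) * (- 1) ^ Suc k"
        unfolding sum_distrib_right by (rule sum.cong) (auto simp: c_def)
      ultimately show ?thesis using k tail[of "Suc (Suc k)"] by (simp add: c_def w_def)
    qed
    then show "(\<Sum>y\<in>{y\<in>{..n}. \<pi> k y = \<pi> k x}. w y *\<^sub>R c (Suc k) y *\<^sub>R v) = 0"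
      by (simp add: scaleR_sum_left[symmetric])
  qed simp
  have alt: "(\<Sum>k<m. (- 1) ^ k) = (if even m then 0 else 1 :: real)" for m
    by (induction m) (auto simp: minus_one_power_iff)
  have small: "\<bar>\<Sum>k<n. c k j\<bar> \<le> 2" if "j \<le> n" for j
  proof -
    have "(\<Sum>k<n. c k j) = (\<Sum>k<j. (- 1) ^ k) + (if j < n then - ((- 1) ^ j) else 0)"
    proof -
      have "(\<Sum>k<n. c k j) = (\<Sum>k<min n (Suc j). c k j)"
        by (rule sum.mono_neutral_right) (auto simp: c_def)
      also have "\<dots> = (\<Sum>k<j. (- 1) ^ k) + (if j < n then - ((- 1) ^ j) else 0)"
      proof -
        have "(\<Sum>k<j. c k j) = (\<Sum>k<j. (- 1) ^ k)" by (rule sum.cong) (auto simp: c_def)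
        moreover have "min n (Suc j) = (if j < n then Suc j else j)" using that by auto
        ultimately show ?thesis by (simp add: c_def)
      qed
      finally show ?thesis .
    qed
    then show ?thesis unfolding alt by (simp add: minus_one_power_iff)
  qed
  have big: "(\<Sum>k<n. (- 1) ^ k * c k J) = real J - 1"
  proof -
    have "(\<Sum>k<n. (- 1) ^ k * c k J) = (\<Sum>k<J. (- 1) ^ k * c k J) + (- 1) ^ J * c J J"
      by (simp add: n_def)
    also have "(\<Sum>k<J. (- 1) ^ k * c k J) = (\<Sum>k<J. 1)"
      by (rule sum.cong) (auto simp: c_def minus_one_power_iff)
    also have "(- 1) ^ J * c J J = - 1" by (simp add: c_def minus_one_power_iff)
    finally show ?thesis by simp
  qed
  have J: "r \<le> real J - 1" "real J + 1 \<le> r + 3"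
    using r by (simp_all add: J_def) linarith+
  have "(r / 8) = ((1 / 2) powr (3 * r) * r powr r) powr (1 / r)"
    using r by (simp add: powr_mult powr_powr powr_realpow[of "1/2" 3] numeral_eq_Suc)
  also have "\<dots> \<le> (w J * norm (real J - 1) powr r) powr (1 / r)"
  proof (intro powr_mono2 mult_mono)
    have "(1 / 2 :: real) powr (3 * r) \<le> (1 / 2) powr (real (J + 1))"
      using J r by (intro powr_mono') auto
    also have "\<dots> = (1 / 2) ^ (J + 1)" by (rule powr_realpow) simp
    also have "\<dots> = w J" by (simp add: w_def n_def)
    finally show "(1 / 2) powr (3 * r) \<le> w J" .
  qed (use r J in \<open>auto simp: w_def\<close>)
  also have "\<dots> \<le> (\<Sum>j\<in>{..n}. w j * norm (\<Sum>k<n. (- 1) ^ k *\<^sub>R c k j *\<^sub>R v) powr r) powr (1 / r)"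
  proof (intro powr_mono2)
    have "w J * norm (real J - 1) powr r = w J * norm (\<Sum>k<n. (- 1) ^ k *\<^sub>R c k J *\<^sub>R v) powr r"
      by (simp add: scaleR_sum_left[symmetric] big v)
    also have "\<dots> \<le> (\<Sum>j\<in>{..n}. w j * norm (\<Sum>k<n. (- 1) ^ k *\<^sub>R c k j *\<^sub>R v) powr r)"
      by (rule member_le_sum) (auto simp: n_def w_def)
    finally show "w J * norm (real J - 1) powr r \<le> (\<Sum>j\<in>{..n}. w j * norm (\<Sum>k<n. (- 1) ^ k *\<^sub>R c k j *\<^sub>R v) powr r)" .
  qed (use r in \<open>auto simp: w_def\<close>)
  also have "\<dots> \<le> \<beta> * (\<Sum>j\<in>{..n}. w j * norm (\<Sum>k<n. c k j *\<^sub>R v) powr r) powr (1 / r)"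
    by (rule bound[OF mds]) (simp add: minus_one_power_iff)
  also have "\<dots> \<le> \<beta> * (\<Sum>j\<in>{..n}. w j * 2 powr r) powr (1 / r)"
    using r \<beta> small
    by (intro mult_left_mono powr_mono2 sum_mono)
      (auto simp: w_def scaleR_sum_left[symmetric] v intro!: sum_nonneg)
  also have "\<dots> = 2 * \<beta>"
  proof -
    have "(\<Sum>j\<in>{..n}. w j * 2 powr r) = 2 powr r"
      using tail[of 0] by (simp add: sum_distrib_right[symmetric] atLeast0AtMost)
    then show ?thesis using r by (simp add: powr_powr)
  qed
  finally show ?thesis by simp
qed

text \<open>If p is at least 2, the space X is tested with exponent p; otherwise q is at least 2 and
  the dual of Y is tested with exponent q. Both constants are at least 1, so either bound extends to
  the product. With \<open>p * q = p + q\<close> this gives the factor 33, rounded up to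
  100.\<close>

lemma UMD_const_product_lower_bound:
  assumes X: "UMD_bound TYPE('x::banach) p \<beta>X" and Y: "UMD_bound TYPE('y::banach) p \<beta>Y"
    and p: "1 < p" "1 < q" "1 / p + 1 / q = 1" and nontriv: "(x::'x) \<noteq> 0" "(y::'y) \<noteq> 0"
  shows "p * q + \<beta>X * \<beta>Y \<le> 100 * \<beta>X * \<beta>Y"
proof -
  have ge1: "1 \<le> \<beta>X" "1 \<le> \<beta>Y"
    using UMD_bound_ge_1[OF X _ nontriv(1)] UMD_bound_ge_1[OF Y _ nontriv(2)] p by auto
  have pq: "p * q = p + q"
  proof -
    have "p * q * (1 / p + 1 / q) = p * q" by (simp only: p(3) mult_1_right)
    then show ?thesis using p(1,2) by (simp add: distrib_left)
  qed
  have "p \<le> 16 * (\<beta>X * \<beta>Y) \<and> q \<le> 16 * (\<beta>X * \<beta>Y)"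
  proof (cases "2 \<le> p")
    case True
    have v: "norm (x /\<^sub>R norm x) = 1" using nontriv by simp
    have "p \<le> 16 * \<beta>X"
    proof (rule UMD_lower_bound[OF _ True _ v])
      show "0 \<le> \<beta>X" using ge1 by simp
    qed (rule UMD_bound_finite[OF X less_imp_le[OF p(1)]])
    also have "\<dots> \<le> 16 * (\<beta>X * \<beta>Y)" using ge1 by simp
    finally have "p \<le> 16 * (\<beta>X * \<beta>Y)" .
    moreover have "q \<le> p"
    proof -
      have "2 * q \<le> p * q" using True p by (intro mult_right_mono) auto
      then show ?thesis using pq by simp
    qed
    ultimately show ?thesis by simp
  next
    case False
    then have "q * (p - 2) \<le> 0" using p by (intro mult_nonneg_nonpos) auto
    then have "p \<le> q" using pq by (simp add: algebra_simps)
    have "q * (2 - p) + 2 * (p - 1) \<ge> 0" using False p by (intro add_nonneg_nonneg mult_nonneg_nonneg) auto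
    have "2 \<le> q"
    proof (rule ccontr)
      assume "\<not> 2 \<le> q"
      then have "(2 - p) * (2 - q) > 0" using False by (intro mult_pos_pos) auto
      moreover have "(p - 1) * (q - 1) = 1" using pq by (simp add: algebra_simps)
      moreover have "(p - 1) * (q - 1) < 1 * 1"
        using False \<open>\<not> 2 \<le> q\<close> p by (intro mult_strict_mono) auto
      ultimately show False by simp
    qed
    obtain \<phi> :: "'y \<Rightarrow>\<^sub>L real" where "blinfun_apply \<phi> y = norm y" by (rule norming_functional)
    then have "\<phi> \<noteq> 0" using nontriv by auto
    then have v: "norm (\<phi> /\<^sub>R norm \<phi>) = 1" by simp
    have "q \<le> 16 * \<beta>Y"
    proof (rule UMD_lower_bound[OF _ \<open>2 \<le> q\<close> _ v])
      show "0 \<le> \<beta>Y" using ge1 by simp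
    qed (rule UMD_bound_finite_dual[OF Y p])
    also have "\<dots> \<le> 16 * (\<beta>X * \<beta>Y)" using ge1 by simp
    finally show ?thesis using \<open>p \<le> q\<close> by simp
  qed
  moreover have "1 * 1 \<le> \<beta>X * \<beta>Y" using ge1 by (intro mult_mono) auto
  ultimately show ?thesis using pq by simp
qed

section \<open>Strong measurability and \<open>L\<^sup>p\<close>\<close>

lemma strongly_measurable_simple: "simple_function M f \<Longrightarrow> strongly_measurable M f"
  unfolding strongly_measurable_def by (intro exI[of _ "\<lambda>_. f"]) auto

lemma strongly_measurable_cong_AE:
  assumes "strongly_measurable M f" "AE x in M. f x = g x"
  shows "strongly_measurable M g"
proof -
  obtain s where s: "\<And>n. simple_function M (s n)" "AE x in M. (\<lambda>n. s n x) \<longlonglongrightarrow> f x"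
    using assms(1) unfolding strongly_measurable_def by blast
  have "AE x in M. (\<lambda>n. s n x) \<longlonglongrightarrow> g x" using s(2) assms(2) by eventually_elim simp
  then show ?thesis using s(1) unfolding strongly_measurable_def by blast
qed

text \<open>Sequential continuity of P carries the almost everywhere limit over; sums, differences,
  norms and bilinear products are all instances.\<close>

lemma strongly_measurable_compose2:
  assumes f: "strongly_measurable M f" and g: "strongly_measurable M g"
    and P: "\<And>X Y a b. X \<longlonglongrightarrow> a \<Longrightarrow> Y \<longlonglongrightarrow> b \<Longrightarrow> (\<lambda>n. P (X n) (Y n)) \<longlonglongrightarrow> P a b"
  shows "strongly_measurable M (\<lambda>x. P (f x) (g x))"
proof -
  obtain s where s: "\<And>n. simple_function M (s n)" "AE x in M. (\<lambda>n. s n x) \<longlonglongrightarrow> f x"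
    using f unfolding strongly_measurable_def by blast
  obtain t where t: "\<And>n. simple_function M (t n)" "AE x in M. (\<lambda>n. t n x) \<longlonglongrightarrow> g x"
    using g unfolding strongly_measurable_def by blast
  have "AE x in M. (\<lambda>n. P (s n x) (t n x)) \<longlonglongrightarrow> P (f x) (g x)"
    using s(2) t(2) by eventually_elim (rule P)
  moreover have "simple_function M (\<lambda>x. P (s n x) (t n x))" for n
    using s(1) t(1) by (rule simple_function_compose2)
  ultimately show ?thesis
    unfolding strongly_measurable_def by (intro exI[of _ "\<lambda>n x. P (s n x) (t n x)"]) auto
qed

lemma strongly_measurable_compose1:
  assumes "strongly_measurable M f" "\<And>X a. X \<longlonglongrightarrow> a \<Longrightarrow> (\<lambda>n. T (X n)) \<longlonglongrightarrow> T a"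
  shows "strongly_measurable M (\<lambda>x. T (f x))"
  using strongly_measurable_compose2[of M f f "\<lambda>a b. T a"] assms by blast

lemma strongly_measurable_linear:
  "bounded_linear T \<Longrightarrow> strongly_measurable M f \<Longrightarrow> strongly_measurable M (\<lambda>x. T (f x))"
  by (rule strongly_measurable_compose1) (auto intro: bounded_linear.tendsto)

lemma strongly_measurable_bilinear:
  "bounded_bilinear P \<Longrightarrow> strongly_measurable M f \<Longrightarrow> strongly_measurable M g \<Longrightarrow>
    strongly_measurable M (\<lambda>x. P (f x) (g x))"
  by (rule strongly_measurable_compose2) (auto intro: bounded_bilinear.tendsto)

lemma strongly_measurable_norm: "strongly_measurable M f \<Longrightarrow> strongly_measurable M (\<lambda>x. norm (f x))"
  by (rule strongly_measurable_compose1) (auto intro: tendsto_norm)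

lemma strongly_measurable_add:
  "strongly_measurable M f \<Longrightarrow> strongly_measurable M g \<Longrightarrow> strongly_measurable M (\<lambda>x. f x + g x)"
  by (rule strongly_measurable_compose2) (auto intro: tendsto_add)

lemma strongly_measurable_diff:
  "strongly_measurable M f \<Longrightarrow> strongly_measurable M g \<Longrightarrow> strongly_measurable M (\<lambda>x. f x - g x)"
  by (rule strongly_measurable_compose2) (auto intro: tendsto_diff)

lemma strongly_measurable_indicator:
  assumes "A \<in> sets M" "strongly_measurable M f"
  shows "strongly_measurable M (\<lambda>x. indicat_real A x *\<^sub>R f x)"
  by (rule strongly_measurable_bilinear[OF bounded_bilinear_scaleR _ assms(2)])
    (use assms(1) in \<open>auto intro: strongly_measurable_simple\<close>)

text \<open>Completeness of Lebesgue measure: a modification on a null set stays measurable. Through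
  this, norms of strongly measurable functions become Borel measurable.\<close>

lemma borel_measurable_lebesgue_AE:
  fixes f g :: "'a::euclidean_space \<Rightarrow> real"
  assumes g: "g \<in> borel_measurable lebesgue" and eq: "AE x in lebesgue. g x = f x"
  shows "f \<in> borel_measurable lebesgue"
proof (rule measurableI)
  fix B :: "real set" assume B: "B \<in> sets borel"
  have 1: "g -` B \<inter> space lebesgue \<in> sets lebesgue" using g B by (rule measurable_sets)
  have 2: "AE x in lebesgue. x \<in> g -` B \<inter> space lebesgue \<longleftrightarrow> x \<in> f -` B \<inter> space lebesgue"
    using eq by eventually_elim auto
  show "f -` B \<inter> space lebesgue \<in> sets lebesgue"
    by (rule completion.in_sets_AE[OF 2 1]) simp
qed auto

lemma strongly_measurable_real:
  fixes f :: "'a::euclidean_space \<Rightarrow> real"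
  assumes "strongly_measurable lebesgue f"
  shows "f \<in> borel_measurable lebesgue"
proof -
  obtain s where s: "\<And>n. simple_function lebesgue (s n)" "AE x in lebesgue. (\<lambda>n. s n x) \<longlonglongrightarrow> f x"
    using assms unfolding strongly_measurable_def by blast
  have "(\<lambda>x. lim (\<lambda>n. s n x)) \<in> borel_measurable lebesgue"
    using s(1) by (intro borel_measurable_lim_metric borel_measurable_simple_function)
  moreover have "AE x in lebesgue. lim (\<lambda>n. s n x) = f x"
    using s(2) by eventually_elim (rule limI)
  ultimately show ?thesis by (rule borel_measurable_lebesgue_AE)
qed

lemma strongly_measurable_norm_borel:
  fixes f :: "'a::euclidean_space \<Rightarrow> 'b::real_normed_vector"
  shows "strongly_measurable lebesgue f \<Longrightarrow> (\<lambda>x. norm (f x)) \<in> borel_measurable lebesgue"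
  by (rule strongly_measurable_real[OF strongly_measurable_norm])

section \<open>Integrals of p-th powers and the seminorm of L^p\<close>

lemma powr_add_le:
  fixes a b p :: real
  assumes "1 \<le> p" "0 \<le> a" "0 \<le> b"
  shows "(a + b) powr p \<le> 2 powr p * (a powr p + b powr p)"
proof -
  have "a + b = 2 * ((a + b) / 2)" by simp
  then have "(a + b) powr p = (2 * ((a + b) / 2)) powr p" by (rule arg_cong)
  also have "\<dots> = 2 powr p * ((a + b) / 2) powr p" by (rule powr_mult)
  also have "\<dots> \<le> 2 powr p * ((a powr p + b powr p) / 2)"
    using powr_midpoint[OF assms] by (intro mult_left_mono) auto
  also have "\<dots> \<le> 2 powr p * (a powr p + b powr p)" by (intro mult_left_mono) auto
  finally show ?thesis .
qed

lemma powr_norm_add_le: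
  fixes u v :: "'a::real_normed_vector"
  assumes "1 \<le> p"
  shows "norm (u + v) powr p \<le> 2 powr p * (norm u powr p + norm v powr p)"
  using powr_mono2[of p "norm (u + v)" "norm u + norm v"] powr_add_le[OF assms, of "norm u" "norm v"] assms
  by (simp add: norm_triangle_ineq)

lemma nn_integral_powr_add_le:
  fixes f g :: "'a::euclidean_space \<Rightarrow> 'b::real_normed_vector"
  assumes p: "1 \<le> p" and f: "strongly_measurable lebesgue f" and g: "strongly_measurable lebesgue g"
  shows "(\<integral>\<^sup>+ x. ennreal (norm (f x + g x) powr p) \<partial>lebesgue)
    \<le> 2 powr p * ((\<integral>\<^sup>+ x. ennreal (norm (f x) powr p) \<partial>lebesgue) + (\<integral>\<^sup>+ x. ennreal (norm (g x) powr p) \<partial>lebesgue))"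
proof -
  have [measurable]: "(\<lambda>x. norm (f x)) \<in> borel_measurable lebesgue" "(\<lambda>x. norm (g x)) \<in> borel_measurable lebesgue"
    using f g by (auto intro: strongly_measurable_norm_borel)
  have "(\<integral>\<^sup>+ x. ennreal (norm (f x + g x) powr p) \<partial>lebesgue)
      \<le> (\<integral>\<^sup>+ x. ennreal (2 powr p) * (ennreal (norm (f x) powr p) + ennreal (norm (g x) powr p)) \<partial>lebesgue)"
  proof (rule nn_integral_mono)
    show "ennreal (norm (f x + g x) powr p)
        \<le> ennreal (2 powr p) * (ennreal (norm (f x) powr p) + ennreal (norm (g x) powr p))" for x
      using ennreal_leI[OF powr_norm_add_le[OF p, of "f x" "g x"]] by (simp add: ennreal_mult)
  qed
  also have "\<dots> = 2 powr p * ((\<integral>\<^sup>+ x. ennreal (norm (f x) powr p) \<partial>lebesgue) + (\<integral>\<^sup>+ x. ennreal (norm (g x) powr p) \<partial>lebesgue))"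
    by (subst nn_integral_cmult) (auto simp: nn_integral_add)
  finally show ?thesis .
qed

lemma Lp_add:
  fixes f g :: "'a::euclidean_space \<Rightarrow> 'b::real_normed_vector"
  assumes "1 \<le> p" "f \<in> Lp p lebesgue" "g \<in> Lp p lebesgue"
  shows "(\<lambda>x. f x + g x) \<in> Lp p lebesgue"
  using assms nn_integral_powr_add_le[of p f g]
  by (auto simp: Lp_def strongly_measurable_add ennreal_mult_less_top intro: order_le_less_trans)

lemma Lp_linear:
  fixes f :: "'a::euclidean_space \<Rightarrow> 'b::real_normed_vector"
  assumes "0 \<le> p" "f \<in> Lp p lebesgue" "bounded_linear T"
  shows "(\<lambda>x. T (f x)) \<in> Lp p lebesgue"
proof -
  obtain K where K: "0 \<le> K" "\<And>x. norm (T x) \<le> norm x * K"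
    using bounded_linear.nonneg_bounded[OF assms(3)] by blast
  have f: "strongly_measurable lebesgue f" using assms(2) by (simp add: Lp_def)
  note [measurable] = strongly_measurable_norm_borel[OF f]
  have "(\<integral>\<^sup>+ x. ennreal (norm (T (f x)) powr p) \<partial>lebesgue) \<le> (\<integral>\<^sup>+ x. ennreal (K powr p) * ennreal (norm (f x) powr p) \<partial>lebesgue)"
  proof (intro nn_integral_mono)
    fix x
    have "norm (T (f x)) powr p \<le> (norm (f x) * K) powr p" using K assms by (intro powr_mono2) auto
    also have "\<dots> = K powr p * norm (f x) powr p" by (simp add: powr_mult)
    finally show "ennreal (norm (T (f x)) powr p) \<le> ennreal (K powr p) * ennreal (norm (f x) powr p)"
      by (simp add: ennreal_mult[symmetric] ennreal_leI)
  qed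
  also have "\<dots> = K powr p * (\<integral>\<^sup>+ x. ennreal (norm (f x) powr p) \<partial>lebesgue)" by (rule nn_integral_cmult) measurable
  also have "\<dots> < \<infinity>" using assms(2) by (simp add: Lp_def ennreal_mult_less_top)
  finally show ?thesis using strongly_measurable_linear[OF assms(3) f] by (simp add: Lp_def)
qed

lemma Lp_scaleR:
  fixes f :: "'a::euclidean_space \<Rightarrow> 'b::real_normed_vector"
  shows "0 \<le> p \<Longrightarrow> f \<in> Lp p lebesgue \<Longrightarrow> (\<lambda>x. r *\<^sub>R f x) \<in> Lp p lebesgue"
  by (rule Lp_linear) (auto intro: bounded_linear_scaleR_right)

lemma Lp_diff:
  fixes f g :: "'a::euclidean_space \<Rightarrow> 'b::real_normed_vector"
  assumes "1 \<le> p" "f \<in> Lp p lebesgue" "g \<in> Lp p lebesgue"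
  shows "(\<lambda>x. f x - g x) \<in> Lp p lebesgue"
  using Lp_add[OF assms(1,2) Lp_scaleR[of p g "-1"]] assms by simp

lemma Lp_cong_AE:
  assumes "f \<in> Lp p M" "AE x in M. f x = g x"
  shows "g \<in> Lp p M"
proof -
  have "(\<integral>\<^sup>+ x. ennreal (norm (f x) powr p) \<partial>M) = (\<integral>\<^sup>+ x. ennreal (norm (g x) powr p) \<partial>M)"
    by (rule nn_integral_cong_AE) (use assms(2) in \<open>auto elim: eventually_mono\<close>)
  then show ?thesis using assms strongly_measurable_cong_AE[OF _ assms(2)] by (simp add: Lp_def)
qed

lemma Lp_norm_cong_AE:
  assumes "AE x in M. f x = g x"
  shows "Lp_norm p M f = Lp_norm p M g"
proof -
  have "(\<integral>\<^sup>+ x. ennreal (norm (f x) powr p) \<partial>M) = (\<integral>\<^sup>+ x. ennreal (norm (g x) powr p) \<partial>M)"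
    by (rule nn_integral_cong_AE) (use assms in \<open>auto elim: eventually_mono\<close>)
  then show ?thesis by (simp add: Lp_norm_def)
qed

lemma Lp_norm_nonneg [simp]: "0 \<le> Lp_norm p M f"
  by (simp add: Lp_norm_def)

lemma nn_integral_eq_Lp_norm:
  assumes "f \<in> Lp p M" "0 < p"
  shows "(\<integral>\<^sup>+ x. ennreal (norm (f x) powr p) \<partial>M) = ennreal (Lp_norm p M f powr p)"
  using assms by (simp add: Lp_def Lp_norm_def powr_powr ennreal_enn2real)

text \<open>By convexity, if both norms are positive, \<open>(norm f + norm g) / (a + b)\<close> is a convex
  combination of \<open>norm f / a\<close> and \<open>norm g / b\<close>.\<close>

lemma Lp_norm_triangle:
  fixes f g :: "'a::euclidean_space \<Rightarrow> 'b::real_normed_vector"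
  assumes p: "1 \<le> p" and f: "f \<in> Lp p lebesgue" and g: "g \<in> Lp p lebesgue"
  shows "Lp_norm p lebesgue (\<lambda>x. f x + g x) \<le> Lp_norm p lebesgue f + Lp_norm p lebesgue g"
proof -
  let ?a = "Lp_norm p lebesgue f" and ?b = "Lp_norm p lebesgue g" and ?c = "Lp_norm p lebesgue (\<lambda>x. f x + g x)"
  have [measurable]: "(\<lambda>x. norm (f x)) \<in> borel_measurable lebesgue" "(\<lambda>x. norm (g x)) \<in> borel_measurable lebesgue"
    using f g by (auto intro: strongly_measurable_norm_borel simp: Lp_def)
  \<comment> \<open>Strict upper bounds a and b are positive even if a norm vanishes, so dividing by
    them is possible; the gap is closed at the end.\<close>
  have main: "?c \<le> a + b" if ab: "?a < a" "?b < b" for a b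
  proof -
    have pos: "0 < a" "0 < b" using ab Lp_norm_nonneg[of p lebesgue f] Lp_norm_nonneg[of p lebesgue g] by linarith+
    define t where "t = a / (a + b)"
    have t: "0 \<le> t" "t \<le> 1" "1 - t = b / (a + b)" using pos by (auto simp: t_def field_simps)
    define \<alpha> where "\<alpha> = (a + b) powr p * t / a powr p"
    define \<gamma> where "\<gamma> = (a + b) powr p * (1 - t) / b powr p"
    have \<alpha>\<gamma>: "0 \<le> \<alpha>" "0 \<le> \<gamma>" "\<alpha> * a powr p = (a + b) powr p * t" "\<gamma> * b powr p = (a + b) powr p * (1 - t)"
      using t(1,2) pos by (auto simp: \<alpha>_def \<gamma>_def)
    have "norm (f x + g x) powr p \<le> \<alpha> * norm (f x) powr p + \<gamma> * norm (g x) powr p" for x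
    proof -
      have "norm (f x + g x) powr p \<le> (norm (f x) + norm (g x)) powr p"
        using p by (intro powr_mono2 norm_triangle_ineq) auto
      also have "norm (f x) + norm (g x) = (a + b) * (t * (norm (f x) / a) + (1 - t) * (norm (g x) / b))"
        using pos unfolding t(3) unfolding t_def by (simp add: distrib_left)
      also have "\<dots> powr p = (a + b) powr p * (t * (norm (f x) / a) + (1 - t) * (norm (g x) / b)) powr p"
        by (rule powr_mult)
      also have "\<dots> \<le> (a + b) powr p * (t * (norm (f x) / a) powr p + (1 - t) * (norm (g x) / b) powr p)"
        using p t pos by (intro mult_left_mono powr_convex_combination) auto
      also have "\<dots> = \<alpha> * norm (f x) powr p + \<gamma> * norm (g x) powr p"
        using pos by (simp only: powr_divide \<alpha>_def \<gamma>_def distrib_left) simp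
      finally show ?thesis .
    qed
    then have "ennreal (norm (f x + g x) powr p)
        \<le> ennreal \<alpha> * ennreal (norm (f x) powr p) + ennreal \<gamma> * ennreal (norm (g x) powr p)" for x
      using \<alpha>\<gamma>(1,2) by (metis ennreal_leI ennreal_mult ennreal_plus mult_nonneg_nonneg powr_ge_zero)
    then have "(\<integral>\<^sup>+ x. ennreal (norm (f x + g x) powr p) \<partial>lebesgue)
      \<le> (\<integral>\<^sup>+ x. ennreal \<alpha> * ennreal (norm (f x) powr p) + ennreal \<gamma> * ennreal (norm (g x) powr p) \<partial>lebesgue)"
      by (rule nn_integral_mono)
    also have "\<dots> = (\<integral>\<^sup>+ x. ennreal \<alpha> * ennreal (norm (f x) powr p) \<partial>lebesgue)
        + (\<integral>\<^sup>+ x. ennreal \<gamma> * ennreal (norm (g x) powr p) \<partial>lebesgue)"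
      by (rule nn_integral_add) measurable
    also have "(\<integral>\<^sup>+ x. ennreal \<alpha> * ennreal (norm (f x) powr p) \<partial>lebesgue) = ennreal \<alpha> * ennreal (?a powr p)"
      using nn_integral_eq_Lp_norm[OF f] p by (subst nn_integral_cmult) auto
    also have "(\<integral>\<^sup>+ x. ennreal \<gamma> * ennreal (norm (g x) powr p) \<partial>lebesgue) = ennreal \<gamma> * ennreal (?b powr p)"
      using nn_integral_eq_Lp_norm[OF g] p by (subst nn_integral_cmult) auto
    also have "ennreal \<alpha> * ennreal (?a powr p) + ennreal \<gamma> * ennreal (?b powr p)
        = ennreal (\<alpha> * ?a powr p + \<gamma> * ?b powr p)"
      using \<alpha>\<gamma>(1,2) by (metis ennreal_mult ennreal_plus mult_nonneg_nonneg powr_ge_zero)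
    also have "\<dots> \<le> ennreal (\<alpha> * a powr p + \<gamma> * b powr p)"
      using \<alpha>\<gamma>(1,2) p ab by (intro ennreal_leI add_mono mult_left_mono powr_mono2) auto
    also have "\<alpha> * a powr p + \<gamma> * b powr p = (a + b) powr p" unfolding \<alpha>\<gamma>(3,4) by (simp add: distrib_left[symmetric])
    finally have "ennreal (?c powr p) \<le> ennreal ((a + b) powr p)"
      using nn_integral_eq_Lp_norm[OF Lp_add[OF p f g]] p by simp
    then have "?c powr p \<le> (a + b) powr p" by (simp add: ennreal_le_iff)
    then show ?thesis using p pos powr_less_mono2[of p "a + b" ?c] by (force simp: not_le[symmetric])
  qed
  have "?c \<le> ?a + ?b + e" if "0 < e" for e
    using main[of "?a + e / 2" "?b + e / 2"] that by linarith
  then show ?thesis by (rule field_le_epsilon)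
qed

lemma Lp_norm_scaleR:
  fixes f :: "'a::euclidean_space \<Rightarrow> 'b::real_normed_vector"
  assumes "0 < p" "f \<in> Lp p lebesgue"
  shows "Lp_norm p lebesgue (\<lambda>x. r *\<^sub>R f x) = \<bar>r\<bar> * Lp_norm p lebesgue f"
proof -
  have [measurable]: "(\<lambda>x. norm (f x)) \<in> borel_measurable lebesgue"
    using assms by (auto intro: strongly_measurable_norm_borel simp: Lp_def)
  have "(\<integral>\<^sup>+ x. ennreal (norm (r *\<^sub>R f x) powr p) \<partial>lebesgue) = ennreal (\<bar>r\<bar> powr p) * (\<integral>\<^sup>+ x. ennreal (norm (f x) powr p) \<partial>lebesgue)"
    by (subst nn_integral_cmult[symmetric]) (auto simp: powr_mult ennreal_mult)
  then show ?thesis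
    using assms unfolding Lp_norm_def by (simp add: enn2real_mult powr_mult powr_powr)
qed

lemma Lp_norm_eq_0:
  fixes f :: "'a::euclidean_space \<Rightarrow> 'b::real_normed_vector"
  assumes "0 < p" "f \<in> Lp p lebesgue" "Lp_norm p lebesgue f = 0"
  shows "AE x in lebesgue. f x = 0"
proof -
  have [measurable]: "(\<lambda>x. norm (f x)) \<in> borel_measurable lebesgue"
    using assms by (auto intro: strongly_measurable_norm_borel simp: Lp_def)
  have "(\<integral>\<^sup>+ x. ennreal (norm (f x) powr p) \<partial>lebesgue) = 0"
    using nn_integral_eq_Lp_norm[OF assms(2,1)] assms by simp
  then have "AE x in lebesgue. ennreal (norm (f x) powr p) = 0"
    by (subst (asm) nn_integral_0_iff_AE) auto
  then show ?thesis by eventually_elim (simp add: ennreal_eq_0_iff)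
qed

text \<open>The given simple functions are set to 0 wherever they exceed twice the norm of f. This
  provides the dominating function \<open>3 * norm (f x)\<close>, and at a point with
  \<open>f x \<noteq> 0\<close> the cut is eventually inactive.\<close>

lemma Lp_simple_approximation:
  fixes f :: "'a::euclidean_space \<Rightarrow> 'b::real_normed_vector"
  assumes p: "1 \<le> p" and f: "f \<in> Lp p lebesgue"
  obtains t where "\<And>n::nat. simple_function lebesgue (t n)" "\<And>n x. norm (t n x) \<le> 2 * norm (f x)"
    "(\<lambda>n. \<integral>\<^sup>+ x. ennreal (norm (f x - t n x) powr p) \<partial>lebesgue) \<longlonglongrightarrow> 0"
proof -
  have fm: "strongly_measurable lebesgue f" using f by (simp add: Lp_def)
  then obtain s where s: "\<And>n. simple_function lebesgue (s n)" "AE x in lebesgue. (\<lambda>n. s n x) \<longlonglongrightarrow> f x"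
    unfolding strongly_measurable_def by blast
  note [measurable] = strongly_measurable_norm_borel[OF fm]
  define A where "A n = {x \<in> space lebesgue. norm (s n x) \<le> 2 * norm (f x)}" for n
  have [measurable]: "(\<lambda>x. norm (s n x)) \<in> borel_measurable lebesgue" for n
    using simple_function_compose1[OF s(1), of norm n] by (rule borel_measurable_simple_function)
  have A: "A n \<in> sets lebesgue" for n unfolding A_def by measurable
  define t where "t n x = indicat_real (A n) x *\<^sub>R s n x" for n x
  have tm: "simple_function lebesgue (t n)" for n
    unfolding t_def using A s(1) by (intro simple_function_compose2[where h="\<lambda>a b. a *\<^sub>R b"]) auto
  have tb: "norm (t n x) \<le> 2 * norm (f x)" for n x by (auto simp: t_def A_def indicator_def)
  have "(\<lambda>n. \<integral>\<^sup>+ x. ennreal (norm (f x - t n x) powr p) \<partial>lebesgue) \<longlonglongrightarrow> (\<integral>\<^sup>+ x. 0 \<partial>(lebesgue :: 'a measure))"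
  proof (rule nn_integral_dominated_convergence[where w="\<lambda>x. ennreal (3 powr p) * ennreal (norm (f x) powr p)"])
    show "(\<lambda>x. ennreal (norm (f x - t n x) powr p)) \<in> borel_measurable lebesgue" for n
    proof -
      note [measurable] = strongly_measurable_norm_borel[OF strongly_measurable_diff[OF fm strongly_measurable_simple[OF tm[of n]]]]
      show ?thesis by measurable
    qed
    show "AE x in lebesgue. ennreal (norm (f x - t n x) powr p) \<le> ennreal (3 powr p) * ennreal (norm (f x) powr p)" for n
    proof (intro AE_I2)
      fix x
      have "norm (f x - t n x) \<le> 3 * norm (f x)" using tb[of n x] norm_triangle_ineq4[of "f x" "t n x"] by simp
      then have "norm (f x - t n x) powr p \<le> (3 * norm (f x)) powr p" using p by (intro powr_mono2) auto
      then show "ennreal (norm (f x - t n x) powr p) \<le> ennreal (3 powr p) * ennreal (norm (f x) powr p)"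
        by (simp add: ennreal_mult[symmetric] powr_mult ennreal_leI)
    qed
    show "(\<integral>\<^sup>+ x. ennreal (3 powr p) * ennreal (norm (f x) powr p) \<partial>lebesgue) < \<infinity>"
      using f by (subst nn_integral_cmult) (auto simp: Lp_def ennreal_mult_less_top)
    show "AE x in lebesgue. (\<lambda>n. ennreal (norm (f x - t n x) powr p)) \<longlonglongrightarrow> 0"
      using s(2)
    proof eventually_elim
      case (elim x)
      have "(\<lambda>n. t n x) \<longlonglongrightarrow> f x"
      proof (cases "f x = 0")
        case True
        then have "t n x = 0" for n using tb[of n x] by simp
        then show ?thesis using True by simp
      next
        case False
        have "(\<lambda>n. norm (s n x)) \<longlonglongrightarrow> norm (f x)" using elim by (rule tendsto_norm)
        then have "\<forall>\<^sub>F n in sequentially. norm (s n x) < 2 * norm (f x)"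
          by (rule order_tendstoD) (use False in auto)
        then have "\<forall>\<^sub>F n in sequentially. s n x = t n x"
          by eventually_elim (simp add: t_def A_def)
        then show ?thesis using elim by (rule Lim_transform_eventually[rotated])
      qed
      then have "(\<lambda>n. norm (f x - t n x) powr p) \<longlonglongrightarrow> norm (f x - f x) powr p"
        using p by (intro tendsto_powr2 tendsto_intros) auto
      then show ?case using p by (simp flip: ennreal_0)
    qed
  qed auto
  then show thesis using tm tb by (intro that) auto
qed

section \<open>The Bochner integral\<close>

lemma L1_iff: "f \<in> Lp 1 M \<longleftrightarrow> strongly_measurable M f \<and> (\<integral>\<^sup>+ x. ennreal (norm (f x)) \<partial>M) < \<infinity>"
  by (simp add: Lp_def)

lemma norm_diff_simple_borel:
  fixes f :: "'a::euclidean_space \<Rightarrow> 'b::real_normed_vector"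
  assumes "strongly_measurable lebesgue f" "simple_function lebesgue s"
  shows "(\<lambda>x. norm (f x - s x)) \<in> borel_measurable lebesgue"
    and "(\<lambda>x. ennreal (norm (f x - s x))) \<in> borel_measurable lebesgue"
proof -
  show "(\<lambda>x. norm (f x - s x)) \<in> borel_measurable lebesgue"
    by (rule strongly_measurable_norm_borel[OF strongly_measurable_diff[OF assms(1)
          strongly_measurable_simple[OF assms(2)]]])
  then show "(\<lambda>x. ennreal (norm (f x - s x))) \<in> borel_measurable lebesgue" by measurable
qed

lemma Bochner_integral_eqI:
  fixes f :: "'a::euclidean_space \<Rightarrow> 'b::real_normed_vector"
  assumes "has_Bochner_integral lebesgue f I"
  shows "Bochner_integral lebesgue f = I"
proof (rule Bochner_integral_eq[OF _ assms])
  have "strongly_measurable lebesgue f" using assms by (simp add: has_Bochner_integral_def)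
  then show "(\<lambda>x. norm (f x - s x)) \<in> borel_measurable lebesgue" if "simple_function lebesgue s" for s
    using that by (rule norm_diff_simple_borel(1))
qed

text \<open>The integrals of the approximating simple functions form a Cauchy sequence, and
  completeness of the target provides its limit.\<close>

lemma has_Bochner_integral_Bochner_integral:
  fixes f :: "'a::euclidean_space \<Rightarrow> 'b::banach"
  assumes f: "f \<in> Lp 1 lebesgue"
  shows "has_Bochner_integral lebesgue f (Bochner_integral lebesgue f)"
proof -
  have fm: "strongly_measurable lebesgue f" using f by (simp add: L1_iff)
  obtain t where t: "\<And>n::nat. simple_function lebesgue (t n)" "\<And>n x. norm (t n x) \<le> 2 * norm (f x)"
    "(\<lambda>n. \<integral>\<^sup>+ x. ennreal (norm (f x - t n x) powr 1) \<partial>lebesgue) \<longlonglongrightarrow> 0"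
    using Lp_simple_approximation[OF order.refl f] by blast
  then have lim: "(\<lambda>n. \<integral>\<^sup>+ x. ennreal (norm (f x - t n x)) \<partial>lebesgue) \<longlonglongrightarrow> 0" by simp
  note [measurable] = strongly_measurable_norm_borel[OF fm]
  have sbi: "Bochner_Integration.simple_bochner_integrable lebesgue (t n)" for n
  proof (rule simple_bochner_integrableI_bounded[OF t(1)])
    have "(\<integral>\<^sup>+ x. ennreal (norm (t n x)) \<partial>lebesgue) \<le> (\<integral>\<^sup>+ x. 2 * ennreal (norm (f x)) \<partial>lebesgue)"
    proof (rule nn_integral_mono)
      show "ennreal (norm (t n x)) \<le> 2 * ennreal (norm (f x))" for x
        using ennreal_leI[OF t(2)[of n x]] by (simp add: ennreal_mult)
    qed
    also have "\<dots> = 2 * (\<integral>\<^sup>+ x. ennreal (norm (f x)) \<partial>lebesgue)" by (rule nn_integral_cmult) measurable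
    also have "\<dots> < \<infinity>" using f by (simp add: L1_iff ennreal_mult_less_top)
    finally show "(\<integral>\<^sup>+ x. ennreal (norm (t n x)) \<partial>lebesgue) < \<infinity>" .
  qed
  define I where "I n = Bochner_Integration.simple_bochner_integral lebesgue (t n)" for n
  define e where "e n = (\<integral>\<^sup>+ x. ennreal (norm (f x - t n x)) \<partial>lebesgue)" for n
  have dist: "ennreal (norm (I m - I n)) \<le> e m + e n" for m n
  proof -
    have "ennreal (norm (I m - I n)) \<le> (\<integral>\<^sup>+ x. ennreal (norm (t m x - t n x)) \<partial>lebesgue)"
      unfolding I_def by (rule simple_bochner_integral_bound[OF sbi sbi])
    also have "\<dots> \<le> (\<integral>\<^sup>+ x. ennreal (norm (f x - t m x)) + ennreal (norm (f x - t n x)) \<partial>lebesgue)"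
    proof (rule nn_integral_mono)
      fix x
      have "norm (t m x - t n x) \<le> norm (f x - t m x) + norm (f x - t n x)"
        by (metis norm_minus_commute norm_diff_triangle_le order.refl)
      then show "ennreal (norm (t m x - t n x)) \<le> ennreal (norm (f x - t m x)) + ennreal (norm (f x - t n x))"
        by (metis ennreal_leI ennreal_plus norm_ge_zero)
    qed
    also have "\<dots> = e m + e n"
      unfolding e_def by (intro nn_integral_add norm_diff_simple_borel(2) fm t(1))
    finally show ?thesis .
  qed
  have "Cauchy I"
  proof (rule CauchyI)
    fix r :: real assume "0 < r"
    then have "0 < ennreal (r / 2)" by (simp add: ennreal_less_zero_iff)
    then have "\<forall>\<^sub>F n in sequentially. e n < ennreal (r / 2)"
      using lim unfolding e_def by (rule order_tendstoD(2)[rotated])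
    then obtain N where N: "\<And>n. N \<le> n \<Longrightarrow> e n < ennreal (r / 2)" by (auto simp: eventually_sequentially)
    show "\<exists>M. \<forall>m\<ge>M. \<forall>n\<ge>M. norm (I m - I n) < r"
    proof (intro exI allI impI)
      fix m n assume "N \<le> m" "N \<le> n"
      then have "e m + e n < ennreal (r / 2) + ennreal (r / 2)" by (intro add_strict_mono N)
      also have "\<dots> = ennreal r" using \<open>0 < r\<close> by (simp flip: ennreal_plus)
      finally have "ennreal (norm (I m - I n)) < ennreal r" using dist[of m n] by (rule order_le_less_trans[rotated])
      then show "norm (I m - I n) < r" by (simp add: ennreal_less_iff)
    qed
  qed
  then obtain L where "(\<lambda>n. I n) \<longlonglongrightarrow> L" using Cauchy_convergent_iff convergent_def by blast
  then have "has_Bochner_integral lebesgue f L"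
    unfolding has_Bochner_integral_def using fm sbi lim by (intro conjI exI[of _ t]) (simp_all add: I_def[symmetric])
  then show ?thesis using Bochner_integral_eqI by metis
qed

section \<open>Linearity and norm bound of the Bochner integral\<close>

lemma ennreal_tendsto_0_le:
  fixes a b :: "nat \<Rightarrow> ennreal"
  assumes "\<And>n. a n \<le> b n" "b \<longlonglongrightarrow> 0"
  shows "a \<longlonglongrightarrow> 0"
proof (rule tendsto_sandwich[of "\<lambda>_. 0" a sequentially b])
  show "\<forall>\<^sub>F n in sequentially. a n \<le> b n" using assms(1) by (intro always_eventually allI)
qed (use assms(2) in simp_all)

lemma has_Bochner_integral_linear:
  fixes f :: "'a::euclidean_space \<Rightarrow> 'b::real_normed_vector"
  assumes f: "has_Bochner_integral lebesgue f I" and T: "bounded_linear T"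
  shows "has_Bochner_integral lebesgue (\<lambda>x. T (f x)) (T I)"
proof -
  interpret T: bounded_linear T by (rule T)
  have fm: "strongly_measurable lebesgue f" using f by (simp add: has_Bochner_integral_def)
  obtain s where s: "\<And>n. Bochner_Integration.simple_bochner_integrable lebesgue (s n)"
    "(\<lambda>n. \<integral>\<^sup>+ x. ennreal (norm (f x - s n x)) \<partial>lebesgue) \<longlonglongrightarrow> 0"
    "(\<lambda>n. Bochner_Integration.simple_bochner_integral lebesgue (s n)) \<longlonglongrightarrow> I"
    using f unfolding has_Bochner_integral_def by blast
  obtain K where K: "0 \<le> K" "\<And>x. norm (T x) \<le> norm x * K" using T.nonneg_bounded by blast
  have sm: "simple_function lebesgue (s n)" for n
    using s(1)[of n] by (auto elim: simple_bochner_integrable.cases)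
  have le: "(\<integral>\<^sup>+ x. ennreal (norm (T (f x) - T (s n x))) \<partial>lebesgue) \<le> ennreal K * (\<integral>\<^sup>+ x. ennreal (norm (f x - s n x)) \<partial>lebesgue)" for n
  proof -
    have "(\<integral>\<^sup>+ x. ennreal (norm (T (f x) - T (s n x))) \<partial>lebesgue) \<le> (\<integral>\<^sup>+ x. ennreal K * ennreal (norm (f x - s n x)) \<partial>lebesgue)"
    proof (rule nn_integral_mono)
      fix x
      have "norm (T (f x) - T (s n x)) \<le> K * norm (f x - s n x)"
        using K(2)[of "f x - s n x"] by (simp add: T.diff mult.commute)
      then show "ennreal (norm (T (f x) - T (s n x))) \<le> ennreal K * ennreal (norm (f x - s n x))"
        using K(1) by (simp add: ennreal_mult[symmetric] ennreal_leI)
    qed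
    also have "\<dots> = ennreal K * (\<integral>\<^sup>+ x. ennreal (norm (f x - s n x)) \<partial>lebesgue)"
      by (intro nn_integral_cmult norm_diff_simple_borel(2) fm sm)
    finally show ?thesis .
  qed
  have "(\<lambda>n. ennreal K * (\<integral>\<^sup>+ x. ennreal (norm (f x - s n x)) \<partial>lebesgue)) \<longlonglongrightarrow> ennreal K * 0"
    by (intro ennreal_tendsto_cmult s(2)) simp
  then have "(\<lambda>n. ennreal K * (\<integral>\<^sup>+ x. ennreal (norm (f x - s n x)) \<partial>lebesgue)) \<longlonglongrightarrow> 0" by simp
  then have "(\<lambda>n. \<integral>\<^sup>+ x. ennreal (norm (T (f x) - T (s n x))) \<partial>lebesgue) \<longlonglongrightarrow> 0"
    by (rule ennreal_tendsto_0_le[OF le])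
  moreover have "Bochner_Integration.simple_bochner_integrable lebesgue (\<lambda>x. T (s n x))" for n
    using simple_bochner_integrable_compose2[of "\<lambda>x y. T x" lebesgue "s n" "s n"] s(1) by (simp add: T.zero)
  moreover have "(\<lambda>n. Bochner_Integration.simple_bochner_integral lebesgue (\<lambda>x. T (s n x))) \<longlonglongrightarrow> T I"
    using s(1) T.tendsto[OF s(3)] by (simp add: simple_bochner_integral_linear[OF T.linear_axioms])
  ultimately show ?thesis
    unfolding has_Bochner_integral_def using strongly_measurable_linear[OF T fm]
    by (intro conjI exI[of _ "\<lambda>n x. T (s n x)"]) auto
qed

lemma has_Bochner_integral_add:
  fixes f g :: "'a::euclidean_space \<Rightarrow> 'b::real_normed_vector"
  assumes f: "has_Bochner_integral lebesgue f I" and g: "has_Bochner_integral lebesgue g J"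
  shows "has_Bochner_integral lebesgue (\<lambda>x. f x + g x) (I + J)"
proof -
  have fm: "strongly_measurable lebesgue f" "strongly_measurable lebesgue g"
    using f g by (auto simp: has_Bochner_integral_def)
  obtain s where s: "\<And>n. Bochner_Integration.simple_bochner_integrable lebesgue (s n)"
    "(\<lambda>n. \<integral>\<^sup>+ x. ennreal (norm (f x - s n x)) \<partial>lebesgue) \<longlonglongrightarrow> 0"
    "(\<lambda>n. Bochner_Integration.simple_bochner_integral lebesgue (s n)) \<longlonglongrightarrow> I"
    using f unfolding has_Bochner_integral_def by blast
  obtain t where t: "\<And>n. Bochner_Integration.simple_bochner_integrable lebesgue (t n)"
    "(\<lambda>n. \<integral>\<^sup>+ x. ennreal (norm (g x - t n x)) \<partial>lebesgue) \<longlonglongrightarrow> 0"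
    "(\<lambda>n. Bochner_Integration.simple_bochner_integral lebesgue (t n)) \<longlonglongrightarrow> J"
    using g unfolding has_Bochner_integral_def by blast
  have sm: "simple_function lebesgue (s n)" "simple_function lebesgue (t n)" for n
    using s(1)[of n] t(1)[of n] by (auto elim: simple_bochner_integrable.cases)
  have le: "(\<integral>\<^sup>+ x. ennreal (norm (f x + g x - (s n x + t n x))) \<partial>lebesgue)
      \<le> (\<integral>\<^sup>+ x. ennreal (norm (f x - s n x)) \<partial>lebesgue) + (\<integral>\<^sup>+ x. ennreal (norm (g x - t n x)) \<partial>lebesgue)" for n
  proof -
    have "(\<integral>\<^sup>+ x. ennreal (norm (f x + g x - (s n x + t n x))) \<partial>lebesgue)
        \<le> (\<integral>\<^sup>+ x. ennreal (norm (f x - s n x)) + ennreal (norm (g x - t n x)) \<partial>lebesgue)"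
    proof (rule nn_integral_mono)
      fix x
      show "ennreal (norm (f x + g x - (s n x + t n x))) \<le> ennreal (norm (f x - s n x)) + ennreal (norm (g x - t n x))"
        using ennreal_leI[OF norm_diff_triangle_ineq[of "f x" "g x" "s n x" "t n x"]] by simp
    qed
    also have "\<dots> = (\<integral>\<^sup>+ x. ennreal (norm (f x - s n x)) \<partial>lebesgue) + (\<integral>\<^sup>+ x. ennreal (norm (g x - t n x)) \<partial>lebesgue)"
      by (intro nn_integral_add norm_diff_simple_borel(2) fm sm)
    finally show ?thesis .
  qed
  have "(\<lambda>n. (\<integral>\<^sup>+ x. ennreal (norm (f x - s n x)) \<partial>lebesgue) + (\<integral>\<^sup>+ x. ennreal (norm (g x - t n x)) \<partial>lebesgue)) \<longlonglongrightarrow> 0"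
    using tendsto_add[OF s(2) t(2)] by simp
  then have "(\<lambda>n. \<integral>\<^sup>+ x. ennreal (norm (f x + g x - (s n x + t n x))) \<partial>lebesgue) \<longlonglongrightarrow> 0"
    by (rule ennreal_tendsto_0_le[OF le])
  moreover have "Bochner_Integration.simple_bochner_integrable lebesgue (\<lambda>x. s n x + t n x)" for n
    using simple_bochner_integrable_compose2[of "(+)" lebesgue "s n" "t n"] s(1) t(1) by simp
  moreover have "(\<lambda>n. Bochner_Integration.simple_bochner_integral lebesgue (\<lambda>x. s n x + t n x)) \<longlonglongrightarrow> I + J"
    using tendsto_add[OF s(3) t(3)] by (simp add: simple_bochner_integral_add s(1) t(1))
  ultimately show ?thesis
    unfolding has_Bochner_integral_def using strongly_measurable_add[OF fm]
    by (intro conjI exI[of _ "\<lambda>n x. s n x + t n x"]) auto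
qed

lemma has_Bochner_integral_cong_AE:
  fixes f g :: "'a::euclidean_space \<Rightarrow> 'b::real_normed_vector"
  assumes eq: "AE x in lebesgue. f x = g x"
  shows "has_Bochner_integral lebesgue f I \<longleftrightarrow> has_Bochner_integral lebesgue g I"
proof -
  have sym: "AE x in lebesgue. g x = f x" using eq by eventually_elim simp
  have "(\<integral>\<^sup>+ x. ennreal (norm (f x - s x)) \<partial>lebesgue) = (\<integral>\<^sup>+ x. ennreal (norm (g x - s x)) \<partial>lebesgue)" for s
    by (rule nn_integral_cong_AE) (use eq in \<open>auto elim: eventually_mono\<close>)
  then show ?thesis
    unfolding has_Bochner_integral_def
    using strongly_measurable_cong_AE[OF _ eq] strongly_measurable_cong_AE[OF _ sym] by auto
qed

lemma Bochner_integral_cong_AE: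
  fixes f g :: "'a::euclidean_space \<Rightarrow> 'b::real_normed_vector"
  assumes "AE x in lebesgue. f x = g x"
  shows "Bochner_integral lebesgue f = Bochner_integral lebesgue g"
proof -
  have "has_Bochner_integral lebesgue f = has_Bochner_integral lebesgue g"
    using has_Bochner_integral_cong_AE[OF assms] by blast
  then show ?thesis unfolding Bochner_integral_def by (simp only:)
qed

lemma Bochner_integral_linear:
  fixes f :: "'a::euclidean_space \<Rightarrow> 'b::banach"
  assumes "f \<in> Lp 1 lebesgue" "bounded_linear T"
  shows "Bochner_integral lebesgue (\<lambda>x. T (f x)) = T (Bochner_integral lebesgue f)"
  by (rule Bochner_integral_eqI[OF has_Bochner_integral_linear[OF
        has_Bochner_integral_Bochner_integral[OF assms(1)] assms(2)]])

lemma Bochner_integral_add: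
  fixes f g :: "'a::euclidean_space \<Rightarrow> 'b::banach"
  assumes "f \<in> Lp 1 lebesgue" "g \<in> Lp 1 lebesgue"
  shows "Bochner_integral lebesgue (\<lambda>x. f x + g x) = Bochner_integral lebesgue f + Bochner_integral lebesgue g"
  by (rule Bochner_integral_eqI[OF has_Bochner_integral_add[OF
        has_Bochner_integral_Bochner_integral[OF assms(1)] has_Bochner_integral_Bochner_integral[OF assms(2)]]])

lemma Bochner_integral_scaleR:
  fixes f :: "'a::euclidean_space \<Rightarrow> 'b::banach"
  shows "f \<in> Lp 1 lebesgue \<Longrightarrow> Bochner_integral lebesgue (\<lambda>x. r *\<^sub>R f x) = r *\<^sub>R Bochner_integral lebesgue f"
  by (rule Bochner_integral_linear) (auto intro: bounded_linear_scaleR_right)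

lemma Bochner_integral_diff:
  fixes f g :: "'a::euclidean_space \<Rightarrow> 'b::banach"
  assumes "f \<in> Lp 1 lebesgue" "g \<in> Lp 1 lebesgue"
  shows "Bochner_integral lebesgue (\<lambda>x. f x - g x) = Bochner_integral lebesgue f - Bochner_integral lebesgue g"
  using Bochner_integral_add[OF assms(1) Lp_scaleR[OF _ assms(2), of "-1"]] Bochner_integral_scaleR[OF assms(2), of "-1"]
  by simp

lemma Bochner_integral_zero [simp]:
  "Bochner_integral lebesgue (\<lambda>x::'a::euclidean_space. 0::'b::real_normed_vector) = 0"
proof -
  have sbi: "Bochner_Integration.simple_bochner_integrable lebesgue (\<lambda>x::'a. 0::'b)"
    by (rule simple_bochner_integrable.intros) auto
  have "Bochner_Integration.simple_bochner_integral lebesgue (\<lambda>x::'a. 0::'b) = 0"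
    by (simp add: simple_bochner_integral_def)
  then show ?thesis using Bochner_integral_eqI[OF has_Bochner_integral_simple[OF sbi]] by simp
qed

lemma Lp_zero [simp]: "(\<lambda>x. 0) \<in> Lp p M"
  by (auto simp: Lp_def intro: strongly_measurable_simple)

lemma Lp_sum:
  fixes f :: "'i \<Rightarrow> 'a::euclidean_space \<Rightarrow> 'b::real_normed_vector"
  assumes "1 \<le> p" "\<And>i. i \<in> I \<Longrightarrow> f i \<in> Lp p lebesgue"
  shows "(\<lambda>x. \<Sum>i\<in>I. f i x) \<in> Lp p lebesgue"
  using assms(2) by (induction I rule: infinite_finite_induct) (auto intro: Lp_add[OF assms(1)])

lemma Bochner_integral_sum:
  fixes f :: "'i \<Rightarrow> 'a::euclidean_space \<Rightarrow> 'b::banach"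
  assumes "\<And>i. i \<in> I \<Longrightarrow> f i \<in> Lp 1 lebesgue"
  shows "Bochner_integral lebesgue (\<lambda>x. \<Sum>i\<in>I. f i x) = (\<Sum>i\<in>I. Bochner_integral lebesgue (f i))"
  using assms by (induction I rule: infinite_finite_induct) (auto simp: Bochner_integral_add Lp_sum)

lemma norm_Bochner_integral_le:
  fixes f :: "'a::euclidean_space \<Rightarrow> 'b::banach"
  assumes f: "f \<in> Lp 1 lebesgue"
  shows "ennreal (norm (Bochner_integral lebesgue f)) \<le> (\<integral>\<^sup>+ x. ennreal (norm (f x)) \<partial>lebesgue)"
proof -
  have fm: "strongly_measurable lebesgue f" using f by (simp add: L1_iff)
  obtain s where s: "\<And>n. Bochner_Integration.simple_bochner_integrable lebesgue (s n)"
    "(\<lambda>n. \<integral>\<^sup>+ x. ennreal (norm (f x - s n x)) \<partial>lebesgue) \<longlonglongrightarrow> 0"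
    "(\<lambda>n. Bochner_Integration.simple_bochner_integral lebesgue (s n)) \<longlonglongrightarrow> Bochner_integral lebesgue f"
    using has_Bochner_integral_Bochner_integral[OF f] unfolding has_Bochner_integral_def by blast
  have sm: "simple_function lebesgue (s n)" for n
    using s(1)[of n] by (auto elim: simple_bochner_integrable.cases)
  have le: "ennreal (norm (Bochner_Integration.simple_bochner_integral lebesgue (s n)))
      \<le> (\<integral>\<^sup>+ x. ennreal (norm (f x)) \<partial>lebesgue) + (\<integral>\<^sup>+ x. ennreal (norm (f x - s n x)) \<partial>lebesgue)" for n
  proof -
    have "ennreal (norm (Bochner_Integration.simple_bochner_integral lebesgue (s n)))
        \<le> ennreal (Bochner_Integration.simple_bochner_integral lebesgue (\<lambda>x. norm (s n x)))"
      by (rule ennreal_leI[OF simple_bochner_integral_norm_bound[OF s(1)]])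
    also have "\<dots> = (\<integral>\<^sup>+ x. ennreal (norm (s n x)) \<partial>lebesgue)"
      by (rule nn_integral_norm_simple_finite[OF s(1), symmetric])
    also have "\<dots> \<le> (\<integral>\<^sup>+ x. ennreal (norm (f x)) + ennreal (norm (f x - s n x)) \<partial>lebesgue)"
    proof (rule nn_integral_mono)
      fix x
      have "norm (s n x) \<le> norm (f x) + norm (f x - s n x)"
        using norm_triangle_ineq4[of "f x" "f x - s n x"] by simp
      then show "ennreal (norm (s n x)) \<le> ennreal (norm (f x)) + ennreal (norm (f x - s n x))"
        by (metis ennreal_leI ennreal_plus norm_ge_zero)
    qed
    also have "\<dots> = (\<integral>\<^sup>+ x. ennreal (norm (f x)) \<partial>lebesgue) + (\<integral>\<^sup>+ x. ennreal (norm (f x - s n x)) \<partial>lebesgue)"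
      by (intro nn_integral_add norm_diff_simple_borel(2) fm sm
          measurable_compose[OF strongly_measurable_norm_borel[OF fm] measurable_ennreal])
    finally show ?thesis .
  qed
  have "(\<lambda>n. ennreal (norm (Bochner_Integration.simple_bochner_integral lebesgue (s n)))) \<longlonglongrightarrow> ennreal (norm (Bochner_integral lebesgue f))"
    by (intro tendsto_intros s)
  moreover have "(\<lambda>n. (\<integral>\<^sup>+ x. ennreal (norm (f x)) \<partial>lebesgue) + (\<integral>\<^sup>+ x. ennreal (norm (f x - s n x)) \<partial>lebesgue))
      \<longlonglongrightarrow> (\<integral>\<^sup>+ x. ennreal (norm (f x)) \<partial>lebesgue) + 0"
    by (intro tendsto_add tendsto_const s(2))
  ultimately have "ennreal (norm (Bochner_integral lebesgue f)) \<le> (\<integral>\<^sup>+ x. ennreal (norm (f x)) \<partial>lebesgue) + 0"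
    by (rule LIMSEQ_le) (use le in blast)
  then show ?thesis by simp
qed

lemma L1_real_integrable:
  fixes f :: "'a::euclidean_space \<Rightarrow> real"
  assumes "f \<in> Lp 1 lebesgue"
  shows "integrable lebesgue f"
  using assms strongly_measurable_real[of f] by (auto simp: L1_iff intro!: integrableI_bounded)

text \<open>A bridge between two integrals: the scalar pairings of the form are written with
  \<open>LINT\<close>, but averages are written with \<open>Bochner_integral\<close>.\<close>

lemma Bochner_integral_real:
  fixes f :: "'a::euclidean_space \<Rightarrow> real"
  assumes f: "f \<in> Lp 1 lebesgue"
  shows "Bochner_integral lebesgue f = (LINT x|lebesgue. f x)"
proof -
  obtain s where s: "\<And>n. Bochner_Integration.simple_bochner_integrable lebesgue (s n)"
    "(\<lambda>n. \<integral>\<^sup>+ x. ennreal (norm (f x - s n x)) \<partial>lebesgue) \<longlonglongrightarrow> 0"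
    "(\<lambda>n. Bochner_Integration.simple_bochner_integral lebesgue (s n)) \<longlonglongrightarrow> Bochner_integral lebesgue f"
    using has_Bochner_integral_Bochner_integral[OF f] unfolding has_Bochner_integral_def by blast
  have "has_bochner_integral lebesgue f (Bochner_integral lebesgue f)"
    using strongly_measurable_real[of f] f s by (intro has_bochner_integral.intros[of f lebesgue s]) (auto simp: L1_iff)
  then show ?thesis by (simp add: has_bochner_integral_integral_eq)
qed

lemma Lp_indicator:
  fixes c :: "'b::real_normed_vector"
  assumes "A \<in> lmeasurable"
  shows "(\<lambda>x::'a::euclidean_space. indicat_real A x *\<^sub>R c) \<in> Lp p lebesgue"
proof -
  have A: "A \<in> sets lebesgue" "emeasure lebesgue A < \<infinity>" using assms by (auto simp: fmeasurable_def)
  have "simple_function lebesgue (\<lambda>x. indicat_real A x *\<^sub>R c)"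
    using A(1) by (intro simple_function_compose1[where g="\<lambda>r. r *\<^sub>R c"]) auto
  moreover have "(\<integral>\<^sup>+ x. ennreal (norm (indicat_real A x *\<^sub>R c) powr p) \<partial>lebesgue)
      \<le> (\<integral>\<^sup>+ x. ennreal (norm c powr p) * indicator A x \<partial>lebesgue)"
    by (intro nn_integral_mono) (simp add: indicator_def)
  then have "(\<integral>\<^sup>+ x. ennreal (norm (indicat_real A x *\<^sub>R c) powr p) \<partial>lebesgue) < \<infinity>"
    using A by (auto simp: nn_integral_cmult_indicator ennreal_mult_less_top intro: order_le_less_trans)
  ultimately show ?thesis by (simp add: Lp_def strongly_measurable_simple)
qed

lemma Bochner_integral_indicator:
  fixes c :: "'b::real_normed_vector"
  assumes "A \<in> lmeasurable"
  shows "Bochner_integral lebesgue (\<lambda>x::'a::euclidean_space. indicat_real A x *\<^sub>R c) = measure lebesgue A *\<^sub>R c"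
proof -
  have A: "A \<in> sets lebesgue" "emeasure lebesgue A < \<infinity>" using assms by (auto simp: fmeasurable_def)
  let ?f = "\<lambda>x. indicat_real A x *\<^sub>R c"
  have simp: "simple_function lebesgue ?f"
    using A(1) by (intro simple_function_compose1[where g="\<lambda>r. r *\<^sub>R c"]) auto
  have "emeasure lebesgue {x \<in> space lebesgue. ?f x \<noteq> 0} \<le> emeasure lebesgue A"
    by (rule emeasure_mono) (use A in \<open>auto simp: indicator_def\<close>)
  then have sbi: "Bochner_Integration.simple_bochner_integrable lebesgue ?f"
    using A simp by (intro simple_bochner_integrable.intros) auto
  have "Bochner_Integration.simple_bochner_integral lebesgue ?f
      = (\<Sum>y\<in>indicat_real A ` space lebesgue. measure lebesgue {x \<in> space lebesgue. indicat_real A x = y} *\<^sub>R (y *\<^sub>R c))"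
    by (rule simple_bochner_integral_partition[OF sbi]) (use A in auto)
  also have "\<dots> = (\<Sum>y\<in>{0,1}. measure lebesgue {x \<in> space lebesgue. indicat_real A x = y} *\<^sub>R (y *\<^sub>R c))"
  proof (rule sum.mono_neutral_left)
    show "\<forall>y\<in>{0, 1} - indicat_real A ` space lebesgue.
        measure lebesgue {x \<in> space lebesgue. indicat_real A x = y} *\<^sub>R (y *\<^sub>R c) = 0"
    proof
      fix y assume "y \<in> {0, 1} - indicat_real A ` space lebesgue"
      then have "{x \<in> space lebesgue. indicat_real A x = y} = {}" by blast
      then show "measure lebesgue {x \<in> space lebesgue. indicat_real A x = y} *\<^sub>R (y *\<^sub>R c) = 0"
        by (simp only: measure_empty scaleR_zero_left)
    qed
  qed (auto simp: indicator_def split: if_splits)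
  also have "\<dots> = measure lebesgue {x \<in> space lebesgue. indicat_real A x = 1} *\<^sub>R c" by simp
  also have "{x \<in> space lebesgue. indicat_real A x = 1} = A" by (auto simp: indicator_def)
  finally show ?thesis using Bochner_integral_eqI[OF has_Bochner_integral_simple[OF sbi]] by simp
qed

lemma L1_loc_restrict:
  assumes f: "f \<in> L1_loc" and A: "A \<in> sets lebesgue" "bounded A"
  shows "(\<lambda>x. indicat_real A x *\<^sub>R f x) \<in> Lp 1 lebesgue"
proof -
  have "(\<integral>\<^sup>+ x. ennreal (norm (indicat_real A x *\<^sub>R f x)) \<partial>lebesgue) \<le> (\<integral>\<^sup>+ x\<in>closure A. ennreal (norm (f x)) \<partial>lebesgue)"
    using closure_subset[of A] by (intro nn_integral_mono) (auto simp: indicator_def)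
  also have "\<dots> < \<infinity>" using f A(2) by (simp add: L1_loc_def compact_closure)
  finally show ?thesis using f strongly_measurable_indicator[OF A(1), of f] by (simp add: L1_iff L1_loc_def)
qed

text \<open>On a bounded set \<open>norm u \<le> 1 + norm u powr p\<close>.\<close>

lemma Lp_subset_L1_loc:
  assumes p: "1 \<le> p" and f: "f \<in> Lp p lebesgue"
  shows "f \<in> L1_loc"
  unfolding L1_loc_def
proof (intro CollectI conjI allI impI)
  show fm: "strongly_measurable lebesgue f" using f by (simp add: Lp_def)
  note [measurable] = strongly_measurable_norm_borel[OF fm]
  fix K :: "'a set" assume K: "compact K"
  then have Km: "K \<in> lmeasurable" by (rule lmeasurable_compact)
  then have [measurable]: "K \<in> sets lebesgue" by auto
  have "(\<integral>\<^sup>+ x\<in>K. ennreal (norm (f x)) \<partial>lebesgue) \<le> (\<integral>\<^sup>+ x. indicator K x + ennreal (norm (f x) powr p) \<partial>lebesgue)"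
  proof (rule nn_integral_mono)
    fix x
    have "norm (f x) \<le> 1 + norm (f x) powr p"
    proof (cases "norm (f x) \<le> 1")
      case False
      then have "norm (f x) powr 1 \<le> norm (f x) powr p" using p by (intro powr_mono) auto
      then show ?thesis by simp
    qed (simp add: add_increasing2)
    then have "ennreal (norm (f x)) \<le> 1 + ennreal (norm (f x) powr p)"
      by (metis ennreal_1 ennreal_leI ennreal_plus powr_ge_zero zero_le_one)
    then show "ennreal (norm (f x)) * indicator K x \<le> indicator K x + ennreal (norm (f x) powr p)"
      by (simp add: indicator_def)
  qed
  also have "\<dots> = emeasure lebesgue K + (\<integral>\<^sup>+ x. ennreal (norm (f x) powr p) \<partial>lebesgue)"
    by (subst nn_integral_add) auto
  also have "\<dots> < \<infinity>" using Km f by (auto simp: fmeasurable_def Lp_def)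
  finally show "(\<integral>\<^sup>+ x\<in>K. ennreal (norm (f x)) \<partial>lebesgue) < \<infinity>" .
qed

section \<open>Dyadic cubes\<close>

text \<open>Vanishing is required at every point outside a bounded set, since step functions are
  treated as functions and not as almost everywhere classes.\<close>

definition bounded_support :: "('a::real_normed_vector \<Rightarrow> 'b::zero) \<Rightarrow> bool" where
  "bounded_support f \<longleftrightarrow> bounded {x. f x \<noteq> 0}"

lemma bounded_support_subset:
  "bounded_support f \<Longrightarrow> (\<And>x. f x = 0 \<Longrightarrow> g x = 0) \<Longrightarrow> bounded_support g"
  unfolding bounded_support_def by (erule bounded_subset) blast

lemma bounded_support_combine:
  assumes "bounded_support f" "bounded_support g" "\<And>x. f x = 0 \<Longrightarrow> g x = 0 \<Longrightarrow> h x = 0"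
  shows "bounded_support h"
proof -
  have "bounded ({x. f x \<noteq> 0} \<union> {x. g x \<noteq> 0})" using assms by (simp add: bounded_support_def)
  then show ?thesis unfolding bounded_support_def by (rule bounded_subset) (use assms(3) in blast)
qed

lemma bounded_support_sum:
  assumes "\<And>i. i \<in> I \<Longrightarrow> bounded_support (f i)"
  shows "bounded_support (\<lambda>x. \<Sum>i\<in>I. f i x)"
  using assms
proof (induction I rule: infinite_finite_induct)
  case (insert i I)
  then have "bounded_support (f i)" "bounded_support (\<lambda>x. \<Sum>i\<in>I. f i x)" by auto
  then show ?case by (rule bounded_support_combine) (use insert in auto)
qed (auto simp: bounded_support_def)

lemma half_open_cube_lebesgue:
  fixes a :: "real ^ 'd::finite"
  assumes "0 < l"
  shows "half_open_cube a l \<in> sets lebesgue" and "measure lebesgue (half_open_cube a l) = l ^ CARD('d)"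
proof -
  let ?c = "\<chi> i. a $ i + l"
  have "half_open_cube a l = (\<Inter>i. {x. a $ i \<le> x $ i} \<inter> {x. x $ i < a $ i + l})"
    by (auto simp: half_open_cube_def)
  also have "\<dots> \<in> sets borel"
  proof -
    have "closed {x :: real ^ 'd. a $ i \<le> x $ i}" "open {x :: real ^ 'd. x $ i < a $ i + l}" for i
      by (intro closed_Collect_le open_Collect_less continuous_intros)+
    then show ?thesis by (intro sets.finite_INT) auto
  qed
  finally have m: "half_open_cube a l \<in> sets borel" .
  then show "half_open_cube a l \<in> sets lebesgue" by simp
  have sub: "box a ?c \<subseteq> half_open_cube a l" "half_open_cube a l \<subseteq> cbox a ?c"
    by (auto simp: half_open_cube_def mem_box_cart less_imp_le)
  have "cbox a ?c \<noteq> {}" using assms by (auto simp: interval_ne_empty_cart less_imp_le)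
  then have c: "measure lborel (cbox a ?c) = l ^ CARD('d)"
    using content_cbox_cart[of a ?c] by simp
  have "measure lebesgue (box a ?c) \<le> measure lebesgue (half_open_cube a l)"
    by (rule measure_mono_fmeasurable[OF sub(1)])
      (use m sub(2) in \<open>auto intro: fmeasurableI2[OF lmeasurable_cbox]\<close>)
  moreover have "measure lebesgue (half_open_cube a l) \<le> measure lebesgue (cbox a ?c)"
    by (rule measure_mono_fmeasurable[OF sub(2)]) (use m in auto)
  moreover have "measure lebesgue (box a ?c) = l ^ CARD('d)" "measure lebesgue (cbox a ?c) = l ^ CARD('d)"
    using c by (auto simp: measure_lborel_box_eq measure_lborel_cbox_eq)
  ultimately show "measure lebesgue (half_open_cube a l) = l ^ CARD('d)" by simp
qed

lemma half_open_cube_bounded: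
  fixes a :: "real ^ 'd::finite"
  assumes "x \<in> half_open_cube a l" "y \<in> half_open_cube a l"
  shows "norm (y - x) \<le> real CARD('d) * l"
proof -
  have "norm (y - x) \<le> (\<Sum>i\<in>UNIV. \<bar>(y - x) $ i\<bar>)" by (rule norm_le_l1_cart)
  also have "\<dots> \<le> (\<Sum>i\<in>(UNIV::'d set). l)"
  proof (rule sum_mono)
    fix i
    have "a $ i \<le> x $ i" "x $ i < a $ i + l" "a $ i \<le> y $ i" "y $ i < a $ i + l"
      using assms by (auto simp: half_open_cube_def)
    then show "\<bar>(y - x) $ i\<bar> \<le> l" by simp
  qed
  finally show ?thesis by simp
qed

locale dyadic =
  fixes \<D> :: "int \<Rightarrow> (real ^ 'd::finite) set set"
  assumes dyadic_system: "dyadic_system \<D>"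
begin

definition cube :: "int \<Rightarrow> real ^ 'd \<Rightarrow> (real ^ 'd) set" where
  "cube k x = (THE Q. Q \<in> \<D> k \<and> x \<in> Q)"

definition vol :: "int \<Rightarrow> real" where
  "vol k = (2 powi (- k)) ^ CARD('d)"

lemma partition: "partition_on UNIV (\<D> k)"
  using dyadic_system unfolding dyadic_system_def refines_def by blast

lemma cube_unique:
  assumes "Q \<in> \<D> k" "x \<in> Q" shows "cube k x = Q"
  unfolding cube_def
proof (rule the_equality)
  show "Q' = Q" if "Q' \<in> \<D> k \<and> x \<in> Q'" for Q'
    using disjointD[OF partition_onD2[OF partition], of Q' k Q] that assms by blast
qed (use assms in blast)

lemma cube_in: "cube k x \<in> \<D> k" and cube_self: "x \<in> cube k x"
proof -
  obtain Q where "Q \<in> \<D> k" "x \<in> Q" using partition_onD1[OF partition, of k] by blast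
  then show "cube k x \<in> \<D> k" "x \<in> cube k x" using cube_unique by auto
qed

lemma cube_eq_iff: "y \<in> cube k x \<longleftrightarrow> cube k y = cube k x"
  using cube_unique[OF cube_in] cube_self by metis

lemma cubeE:
  assumes "Q \<in> \<D> k" obtains x where "Q = cube k x"
  using assms cube_unique partition_onD3[OF partition, of k] by (metis ex_in_conv)

lemma cube_Suc_subset: "cube (k + 1) x \<subseteq> cube k x"
proof -
  have "refines UNIV (\<D> (k + 1)) (\<D> k)"
    using dyadic_system unfolding dyadic_system_def by simp
  then have "\<exists>R\<in>\<D> k. cube (k + 1) x \<subseteq> R" unfolding refines_def using cube_in[of "k + 1" x] by simp
  then obtain R where R: "R \<in> \<D> k" "cube (k + 1) x \<subseteq> R" by (rule bexE)
  then have "cube k x = R" using cube_self[of x "k + 1"] by (intro cube_unique) auto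
  then show ?thesis using R by simp
qed

lemma cube_mono:
  assumes "j \<le> k" shows "cube k x \<subseteq> cube j x"
  using assms
proof (induction k rule: int_ge_induct)
  case (step k)
  then show ?case using cube_Suc_subset[of k x] by blast
qed simp

lemma cube_eq_mono: "j \<le> k \<Longrightarrow> cube k x = cube k y \<Longrightarrow> cube j x = cube j y"
  using cube_mono[of j k x] cube_self[of y k] cube_eq_iff by blast

lemma cube_half_open: "\<exists>a. cube k x = half_open_cube a (2 powi (- k))"
  using dyadic_system cube_in unfolding dyadic_system_def by blast

lemma vol_pos: "0 < vol k"
  by (simp add: vol_def)

lemma cube_lmeasurable: "cube k x \<in> lmeasurable" and measure_cube: "measure lebesgue (cube k x) = vol k"
proof -
  obtain a where a: "cube k x = half_open_cube a (2 powi (- k))" using cube_half_open by blast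
  have "(0::real) < 2 powi (- k)" by simp
  note * = half_open_cube_lebesgue[OF this, of a]
  show m: "measure lebesgue (cube k x) = vol k" using * by (simp add: a vol_def)
  \<comment> \<open>\<open>measure\<close> is 0 on sets of infinite measure, so a nonzero value
    shows that \<open>emeasure\<close> is finite.\<close>
  then have "measure lebesgue (cube k x) \<noteq> 0" using vol_pos[of k] by simp
  then have "emeasure lebesgue (cube k x) < \<infinity>"
    unfolding Sigma_Algebra.measure_def by (cases "emeasure lebesgue (cube k x) = \<top>") (simp_all add: less_top)
  then show "cube k x \<in> lmeasurable" using * by (simp add: a fmeasurable_def)
qed

lemma cube_sets [measurable]: "cube k x \<in> sets lebesgue"
  using cube_lmeasurable by (simp add: fmeasurable_def)

lemma emeasure_cube: "emeasure lebesgue (cube k x) = ennreal (vol k)"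
  using emeasure_eq_measure2[OF cube_lmeasurable] by (simp add: measure_cube)

lemma cube_diameter: "y \<in> cube k x \<Longrightarrow> norm (y - x) \<le> real CARD('d) * 2 powi (- k)"
  using cube_half_open[of k x] cube_self half_open_cube_bounded by metis

lemma bounded_cube_hull:
  assumes "bounded B" shows "bounded (\<Union>x\<in>B. cube k x)"
proof -
  obtain R where R: "\<And>x. x \<in> B \<Longrightarrow> norm x \<le> R" using assms bounded_iff by blast
  have "norm y \<le> R + real CARD('d) * 2 powi (- k)" if y: "y \<in> cube k x" "x \<in> B" for x y
    using cube_diameter[OF y(1)] R[OF y(2)] norm_triangle_ineq[of "y - x" x] by simp
  then show ?thesis unfolding bounded_iff by blast
qed

lemma bounded_cube: "bounded (cube k x)"
  using bounded_cube_hull[of "{x}" k] by simp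

text \<open>Cubes of one generation are disjoint and have equal volume, so infinitely many of them
  would exceed the volume of a ball that contains them all.\<close>

lemma finite_cubes:
  assumes "bounded B" shows "finite (cube k ` B)"
proof (rule ccontr)
  assume inf: "infinite (cube k ` B)"
  obtain R where "bounded (\<Union>x\<in>B. cube k x)" "(\<Union>x\<in>B. cube k x) \<subseteq> ball 0 R"
    using bounded_cube_hull[OF assms] bounded_subset_ballD by blast
  obtain n :: nat where n: "measure lebesgue (ball (0 :: real ^ 'd) R) / vol k < real n"
    using reals_Archimedean2 by blast
  obtain C where C: "C \<subseteq> cube k ` B" "finite C" "card C = n"
    using infinite_arbitrarily_large[OF inf] by blast
  have "real n * vol k = (\<Sum>Q\<in>C. measure lebesgue Q)"
  proof -
    have "measure lebesgue Q = vol k" if "Q \<in> C" for Q using C(1) that measure_cube by auto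
    then show ?thesis using C(3) by simp
  qed
  also have "\<dots> = measure lebesgue (\<Union>C)"
  proof (rule measure_Union'[symmetric, OF C(2)])
    show "\<And>S. S \<in> C \<Longrightarrow> S \<in> lmeasurable" using C(1) cube_lmeasurable by blast
    show "pairwise disjnt C"
    proof (rule pairwiseI)
      fix Q R assume "Q \<in> C" "R \<in> C" "Q \<noteq> R"
      moreover obtain x y where "Q = cube k x" "R = cube k y" using C(1) calculation by blast
      ultimately show "disjnt Q R" unfolding disjnt_iff using cube_eq_iff by metis
    qed
  qed
  also have "\<dots> \<le> measure lebesgue (ball (0 :: real ^ 'd) R)"
  proof (rule measure_mono_fmeasurable)
    show "\<Union>C \<subseteq> ball 0 R" using C(1) \<open>(\<Union>x\<in>B. cube k x) \<subseteq> ball 0 R\<close> by blast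
    show "\<Union>C \<in> sets lebesgue" using C(1,2) cube_sets by (intro sets.finite_Union) auto
  qed auto
  finally show False using n vol_pos[of k] by (simp add: field_simps)
qed

text \<open>One point is chosen from every cube of generation k that meets B. These points index
  integrals of step functions and later serve as the atoms of finite martingales.\<close>

lemma cube_representatives:
  assumes "bounded B"
  obtains S where "finite S" "S \<subseteq> B" "inj_on (cube k) S" "cube k ` S = cube k ` B"
proof -
  have "cube k ` B \<subseteq> cube k ` B" by simp
  then have "\<exists>S\<subseteq>B. inj_on (cube k) S \<and> cube k ` B = cube k ` S" by (simp only: subset_image_inj)
  then obtain S where S: "S \<subseteq> B" "inj_on (cube k) S" "cube k ` B = cube k ` S" by (elim exE conjE)
  moreover have "finite S"
    using finite_cubes[OF assms, of k] by (intro finite_imageD[OF _ S(2)]) (simp only: S(3))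
  ultimately show thesis by (intro that[of S] S(3)[symmetric])
qed

subsection \<open>Step functions\<close>

text \<open>Measurability with respect to the sigma-algebra generated by the cubes of generation
  k.\<close>

definition cube_const :: "int \<Rightarrow> (real ^ 'd \<Rightarrow> 'b) \<Rightarrow> bool" where
  "cube_const k f \<longleftrightarrow> (\<forall>x y. cube k x = cube k y \<longrightarrow> f x = f y)"

definition step :: "int \<Rightarrow> (real ^ 'd \<Rightarrow> 'b::zero) \<Rightarrow> bool" where
  "step k f \<longleftrightarrow> cube_const k f \<and> bounded_support f"

lemma cube_constD: "cube_const k f \<Longrightarrow> cube k x = cube k y \<Longrightarrow> f x = f y"
  unfolding cube_const_def by blast

lemma cube_const_mono: "cube_const j f \<Longrightarrow> j \<le> k \<Longrightarrow> cube_const k f"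
  using cube_eq_mono unfolding cube_const_def by blast

lemma cube_const_compose2: "cube_const k f \<Longrightarrow> cube_const k g \<Longrightarrow> cube_const k (\<lambda>x. P (f x) (g x))"
  unfolding cube_const_def by metis

lemma cube_const_compose: "cube_const k f \<Longrightarrow> cube_const k (\<lambda>x. P (f x))"
  unfolding cube_const_def by metis

lemma cube_const_sum: "(\<And>i. i \<in> I \<Longrightarrow> cube_const k (f i)) \<Longrightarrow> cube_const k (\<lambda>x. \<Sum>i\<in>I. f i x)"
  unfolding cube_const_def by (metis (no_types, lifting) sum.cong)

lemma step_mono: "step j f \<Longrightarrow> j \<le> k \<Longrightarrow> step k f"
  unfolding step_def using cube_const_mono by blast

lemma step_compose2:
  assumes "step k f" "step k g" "P 0 0 = 0"
  shows "step k (\<lambda>x. P (f x) (g x))"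
  using assms unfolding step_def
  by (auto intro: cube_const_compose2 bounded_support_combine[of f g])

lemma step_compose: "step k f \<Longrightarrow> P 0 = 0 \<Longrightarrow> step k (\<lambda>x. P (f x))"
  using step_compose2[of k f f "\<lambda>a b. P a"] by simp

lemma step_sum: "(\<And>i. i \<in> I \<Longrightarrow> step k (f i)) \<Longrightarrow> step k (\<lambda>x. \<Sum>i\<in>I. f i x)"
  unfolding step_def by (auto intro: cube_const_sum bounded_support_sum)

text \<open>The finite normal form from which measurability, integrability and integrals of step
  functions are read off.\<close>

lemma cube_const_expand:
  fixes f :: "real ^ 'd \<Rightarrow> 'b::real_vector"
  assumes f: "cube_const k f" "\<And>x. x \<notin> B \<Longrightarrow> f x = 0"
    and S: "finite S" "inj_on (cube k) S" "cube k ` S = cube k ` B"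
  shows "f x = (\<Sum>s\<in>S. indicat_real (cube k s) x *\<^sub>R f s)"
proof (cases "\<exists>s\<in>S. cube k x = cube k s")
  case True
  then obtain s where s: "s \<in> S" "cube k x = cube k s" by blast
  have "(\<Sum>s\<in>S. indicat_real (cube k s) x *\<^sub>R f s) = (\<Sum>t\<in>S. if t = s then f s else 0)"
  proof (rule sum.cong)
    fix t assume "t \<in> S"
    then have "x \<in> cube k t \<longleftrightarrow> t = s"
      using s S(2) cube_eq_iff[of x k t] by (auto dest: inj_onD)
    then show "indicat_real (cube k t) x *\<^sub>R f t = (if t = s then f s else 0)" by (simp add: indicator_def)
  qed simp
  also have "\<dots> = f x" using s S(1) cube_constD[OF f(1) s(2)] by simp
  finally show ?thesis by simp
next
  case False
  then have "indicat_real (cube k s) x = 0" if "s \<in> S" for s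
    using that cube_eq_iff by (auto simp: indicator_def)
  moreover have "x \<notin> B" using False S(3) by (metis image_iff)
  ultimately show ?thesis using f(2) by simp
qed

lemma cube_const_integral:
  fixes f :: "real ^ 'd \<Rightarrow> 'b::banach"
  assumes f: "cube_const k f" "\<And>x. x \<notin> B \<Longrightarrow> f x = 0"
    and S: "finite S" "inj_on (cube k) S" "cube k ` S = cube k ` B"
  shows "f \<in> Lp 1 lebesgue" and "Bochner_integral lebesgue f = vol k *\<^sub>R (\<Sum>s\<in>S. f s)"
proof -
  have eq: "f = (\<lambda>x. \<Sum>s\<in>S. indicat_real (cube k s) x *\<^sub>R f s)"
    using cube_const_expand[OF assms] by blast
  have L: "(\<lambda>x. indicat_real (cube k s) x *\<^sub>R f s) \<in> Lp 1 lebesgue" for s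
    by (rule Lp_indicator[OF cube_lmeasurable])
  show "f \<in> Lp 1 lebesgue" by (subst eq) (rule Lp_sum[OF _ L], simp)
  show "Bochner_integral lebesgue f = vol k *\<^sub>R (\<Sum>s\<in>S. f s)"
    by (subst eq)
      (simp add: Bochner_integral_sum L Bochner_integral_indicator cube_lmeasurable measure_cube scaleR_sum_right)
qed

lemma cube_const_nn_integral:
  fixes f :: "real ^ 'd \<Rightarrow> real"
  assumes f: "cube_const k f" "\<And>x. x \<notin> B \<Longrightarrow> f x = 0" "\<And>x. 0 \<le> f x"
    and S: "finite S" "inj_on (cube k) S" "cube k ` S = cube k ` B"
  shows "(\<integral>\<^sup>+ x. ennreal (f x) \<partial>lebesgue) = ennreal (vol k * (\<Sum>s\<in>S. f s))"
proof -
  have "(\<integral>\<^sup>+ x. ennreal (f x) \<partial>lebesgue) = ennreal (LINT x|lebesgue. f x)"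
    using L1_real_integrable[OF cube_const_integral(1)[OF f(1,2) S]] f(3)
    by (intro nn_integral_eq_integral) auto
  also have "(LINT x|lebesgue. f x) = vol k * (\<Sum>s\<in>S. f s)"
    using cube_const_integral[OF f(1,2) S] Bochner_integral_real[of f] by simp
  finally show ?thesis .
qed

lemma step_representatives:
  assumes "step k f"
  obtains S where "finite S" "inj_on (cube k) S" "cube k ` S = cube k ` {x. f x \<noteq> 0}"
  using cube_representatives[of "{x. f x \<noteq> 0}" k] assms unfolding step_def bounded_support_def by metis

lemma step_Lp:
  fixes f :: "real ^ 'd \<Rightarrow> 'b::real_normed_vector"
  assumes "step k f" "1 \<le> p" shows "f \<in> Lp p lebesgue"
proof -
  obtain S where S: "finite S" "inj_on (cube k) S" "cube k ` S = cube k ` {x. f x \<noteq> 0}"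
    using step_representatives[OF assms(1)] .
  have "f = (\<lambda>x. \<Sum>s\<in>S. indicat_real (cube k s) x *\<^sub>R f s)"
    using cube_const_expand[OF _ _ S] assms(1) unfolding step_def by blast
  also have "\<dots> \<in> Lp p lebesgue" by (rule Lp_sum[OF assms(2) Lp_indicator[OF cube_lmeasurable]])
  finally show ?thesis .
qed

lemma step_simple:
  fixes f :: "real ^ 'd \<Rightarrow> 'b::real_vector"
  assumes "step k f" shows "simple_function lebesgue f"
proof -
  obtain S where S: "finite S" "inj_on (cube k) S" "cube k ` S = cube k ` {x. f x \<noteq> 0}"
    using step_representatives[OF assms(1)] .
  have "f = (\<lambda>x. \<Sum>s\<in>S. indicat_real (cube k s) x *\<^sub>R f s)"
    using cube_const_expand[OF _ _ S] assms(1) unfolding step_def by blast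
  moreover have "simple_function lebesgue (\<lambda>x. \<Sum>s\<in>S. indicat_real (cube k s) x *\<^sub>R f s)"
    by (rule simple_function_sum, rule simple_function_compose1[where g="\<lambda>r. r *\<^sub>R f _"]) simp
  ultimately show ?thesis by simp
qed

subsection \<open>Conditional expectations\<close>

abbreviation E :: "int \<Rightarrow> (real ^ 'd \<Rightarrow> 'b::real_normed_vector) \<Rightarrow> real ^ 'd \<Rightarrow> 'b" where
  "E \<equiv> dyadic_E \<D>"

abbreviation D :: "int \<Rightarrow> (real ^ 'd \<Rightarrow> 'b::real_normed_vector) \<Rightarrow> real ^ 'd \<Rightarrow> 'b" where
  "D \<equiv> dyadic_D \<D>"

lemma E_eq: "E k f x = average f (cube k x)"
proof -
  have "{Q \<in> \<D> k. x \<in> Q} = {cube k x}" using cube_unique cube_in cube_self by blast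
  then show ?thesis by (simp add: dyadic_E_def)
qed

lemma E_cube_const: "cube_const k (E k f)"
  by (simp add: cube_const_def E_eq)

lemma D_cube_const: "cube_const k (D k f)"
  unfolding dyadic_D_def
  by (rule cube_const_compose2[where P="(-)"]) (auto intro: E_cube_const cube_const_mono[OF E_cube_const])

lemma average_cube:
  "average f (cube k x) = (1 / vol k) *\<^sub>R Bochner_integral lebesgue (\<lambda>y. indicat_real (cube k x) y *\<^sub>R f y)"
  by (simp add: average_def measure_cube)

text \<open>Averages see only the almost everywhere class, hence the equality at every point. It
  lets the form be evaluated on step representatives.\<close>

lemma E_cong_AE:
  assumes "AE x in lebesgue. f x = g x" shows "E k f = E k g"
proof
  fix x
  have "AE y in lebesgue. indicat_real (cube k x) y *\<^sub>R f y = indicat_real (cube k x) y *\<^sub>R g y"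
    using assms by eventually_elim simp
  from Bochner_integral_cong_AE[OF this] show "E k f x = E k g x"
    by (simp only: E_eq average_cube)
qed

lemma restrict_cube_L1: "f \<in> L1_loc \<Longrightarrow> (\<lambda>y. indicat_real (cube k x) y *\<^sub>R f y) \<in> Lp 1 lebesgue"
  by (rule L1_loc_restrict[OF _ cube_sets bounded_cube])

lemma E_add:
  fixes f g :: "real ^ 'd \<Rightarrow> 'b::banach"
  assumes "f \<in> L1_loc" "g \<in> L1_loc"
  shows "E k (\<lambda>x. f x + g x) = (\<lambda>x. E k f x + E k g x)"
  using Bochner_integral_add[OF restrict_cube_L1[OF assms(1)] restrict_cube_L1[OF assms(2)]]
  by (simp add: fun_eq_iff E_eq average_cube scaleR_add_right)

lemma E_diff:
  fixes f g :: "real ^ 'd \<Rightarrow> 'b::banach"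
  assumes "f \<in> L1_loc" "g \<in> L1_loc"
  shows "E k (\<lambda>x. f x - g x) = (\<lambda>x. E k f x - E k g x)"
  using Bochner_integral_diff[OF restrict_cube_L1[OF assms(1)] restrict_cube_L1[OF assms(2)]]
  by (simp add: fun_eq_iff E_eq average_cube scaleR_diff_right)

lemma E_linear:
  fixes f :: "real ^ 'd \<Rightarrow> 'b::banach"
  assumes "f \<in> L1_loc" "bounded_linear T"
  shows "E k (\<lambda>x. T (f x)) = (\<lambda>x. T (E k f x))"
proof -
  interpret T: bounded_linear T by (rule assms(2))
  show ?thesis
    using Bochner_integral_linear[OF restrict_cube_L1[OF assms(1)] assms(2)]
    by (simp add: fun_eq_iff E_eq average_cube T.scaleR)
qed

lemma E_scaleR:
  fixes f :: "real ^ 'd \<Rightarrow> 'b::banach"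
  shows "f \<in> L1_loc \<Longrightarrow> E k (\<lambda>x. r *\<^sub>R f x) = (\<lambda>x. r *\<^sub>R E k f x)"
  by (rule E_linear) (auto intro: bounded_linear_scaleR_right)

text \<open>The pull-out property of conditional expectations: on a cube of generation k the factor
  u is a constant.\<close>

lemma E_cube_const_mult:
  fixes P :: "'a::real_normed_vector \<Rightarrow> 'b::banach \<Rightarrow> 'c::real_normed_vector"
  assumes P: "bounded_bilinear P" and u: "cube_const k u" and f: "f \<in> L1_loc"
  shows "E k (\<lambda>x. P (u x) (f x)) = (\<lambda>x. P (u x) (E k f x))"
proof
  fix x
  interpret P: bounded_bilinear P by (rule P)
  have "(\<lambda>y. indicat_real (cube k x) y *\<^sub>R P (u y) (f y)) = (\<lambda>y. P (u x) (indicat_real (cube k x) y *\<^sub>R f y))"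
  proof
    show "indicat_real (cube k x) y *\<^sub>R P (u y) (f y) = P (u x) (indicat_real (cube k x) y *\<^sub>R f y)" for y
      using cube_constD[OF u, of y x] cube_eq_iff[of y k x]
      by (cases "y \<in> cube k x") (simp_all add: P.zero_right)
  qed
  then show "E k (\<lambda>x. P (u x) (f x)) x = P (u x) (E k f x)"
    using Bochner_integral_linear[OF restrict_cube_L1[OF f] P.bounded_linear_right]
    by (simp add: E_eq average_cube P.scaleR_right)
qed

lemma E_self:
  fixes f :: "real ^ 'd \<Rightarrow> 'b::real_normed_vector"
  assumes "cube_const j f" "j \<le> k" shows "E k f = f"
proof
  fix x
  have "(\<lambda>y. indicat_real (cube k x) y *\<^sub>R f y) = (\<lambda>y. indicat_real (cube k x) y *\<^sub>R f x)"
  proof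
    show "indicat_real (cube k x) y *\<^sub>R f y = indicat_real (cube k x) y *\<^sub>R f x" for y
      using cube_constD[OF cube_const_mono[OF assms], of y x] cube_eq_iff[of y k x]
      by (cases "y \<in> cube k x") simp_all
  qed
  then show "E k f x = f x"
    using vol_pos[of k] by (simp add: E_eq average_cube Bochner_integral_indicator cube_lmeasurable measure_cube)
qed

text \<open>A cube of generation j splits into finitely many cubes of generation k, and on each of
  these \<open>E k f\<close> and f have the same integral.\<close>

lemma E_tower:
  fixes f :: "real ^ 'd \<Rightarrow> 'b::banach"
  assumes f: "f \<in> L1_loc" and jk: "j \<le> k" shows "E j (E k f) = E j f"
proof
  fix x
  obtain S where S: "finite S" "S \<subseteq> cube j x" "inj_on (cube k) S" "cube k ` S = cube k ` cube j x"
    using cube_representatives[OF bounded_cube] .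
  have 1: "indicat_real (cube j x) y *\<^sub>R E k f y = (\<Sum>s\<in>S. indicat_real (cube k s) y *\<^sub>R E k f s)" for y
  proof -
    have "indicat_real (cube j x) y *\<^sub>R E k f y = (\<Sum>s\<in>S. indicat_real (cube k s) y *\<^sub>R (indicat_real (cube j x) s *\<^sub>R E k f s))"
    proof (rule cube_const_expand[OF _ _ S(1,3,4)])
      have "cube_const j (indicat_real (cube j x))"
        unfolding cube_const_def by (auto simp: indicator_def cube_eq_iff)
      then have "cube_const k (indicat_real (cube j x))" using jk by (rule cube_const_mono)
      then show "cube_const k (\<lambda>y. indicat_real (cube j x) y *\<^sub>R E k f y)"
        using E_cube_const by (rule cube_const_compose2)
    qed simp
    also have "\<dots> = (\<Sum>s\<in>S. indicat_real (cube k s) y *\<^sub>R E k f s)"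
      by (rule sum.cong) (use S(2) in auto)
    finally show ?thesis .
  qed
  have 2: "indicat_real (cube j x) y *\<^sub>R f y = (\<Sum>s\<in>S. indicat_real (cube k s) y *\<^sub>R f y)" for y
  proof -
    have "indicat_real (cube j x) y = (\<Sum>s\<in>S. indicat_real (cube k s) y *\<^sub>R indicat_real (cube j x) s)"
    proof (rule cube_const_expand[OF _ _ S(1,3,4)])
      have "cube_const j (indicat_real (cube j x))"
        unfolding cube_const_def by (auto simp: indicator_def cube_eq_iff)
      then show "cube_const k (indicat_real (cube j x))" using jk by (rule cube_const_mono)
    qed simp
    also have "\<dots> = (\<Sum>s\<in>S. indicat_real (cube k s) y)"
      by (rule sum.cong) (use S(2) in auto)
    finally show ?thesis by (simp add: scaleR_sum_left)
  qed
  have "Bochner_integral lebesgue (\<lambda>y. indicat_real (cube j x) y *\<^sub>R E k f y) = (\<Sum>s\<in>S. vol k *\<^sub>R E k f s)"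
    unfolding 1 by (subst Bochner_integral_sum)
      (auto simp: Lp_indicator cube_lmeasurable Bochner_integral_indicator measure_cube)
  also have "\<dots> = (\<Sum>s\<in>S. Bochner_integral lebesgue (\<lambda>y. indicat_real (cube k s) y *\<^sub>R f y))"
    using vol_pos[of k] by (simp add: E_eq average_cube)
  also have "\<dots> = Bochner_integral lebesgue (\<lambda>y. indicat_real (cube j x) y *\<^sub>R f y)"
    unfolding 2 using restrict_cube_L1[OF f] by (subst Bochner_integral_sum) auto
  finally show "E j (E k f) x = E j f x" by (simp add: E_eq average_cube)
qed

lemma E_zero [simp]: "E k (\<lambda>x. 0) = (\<lambda>x. 0)"
  by (simp add: fun_eq_iff E_eq average_cube)

lemma E_bounded_support:
  assumes "bounded_support f" shows "bounded_support (E k f)"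
proof -
  have zero: "E k f x = 0" if x: "x \<notin> (\<Union>z\<in>{z. f z \<noteq> 0}. cube k z)" for x
  proof -
    have "indicat_real (cube k x) y *\<^sub>R f y = 0" for y
    proof (cases "y \<in> cube k x \<and> f y \<noteq> 0")
      case True
      then have "x \<in> cube k y" using cube_eq_iff[of y k x] cube_eq_iff[of x k y] by simp
      then show ?thesis using x True by blast
    qed auto
    then have "(\<lambda>y. indicat_real (cube k x) y *\<^sub>R f y) = (\<lambda>y. 0)" by (rule ext)
    then show ?thesis by (simp only: E_eq average_cube Bochner_integral_zero scaleR_zero_right)
  qed
  have "bounded (\<Union>z\<in>{z. f z \<noteq> 0}. cube k z)"
    using assms unfolding bounded_support_def by (rule bounded_cube_hull)
  then show ?thesis
    unfolding bounded_support_def by (rule bounded_subset) (use zero in blast)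
qed

lemma E_step: "bounded_support f \<Longrightarrow> step k (E k f)"
  by (simp add: step_def E_cube_const E_bounded_support)

lemma D_step:
  assumes "bounded_support f" shows "step k (D k f)"
proof -
  have "bounded_support (D k f)"
    using E_bounded_support[OF assms, of k] E_bounded_support[OF assms, of "k - 1"]
    by (rule bounded_support_combine) (simp add: dyadic_D_def)
  then show ?thesis by (simp add: step_def D_cube_const)
qed

lemma step_L1_loc:
  fixes f :: "real ^ 'd \<Rightarrow> 'b::real_normed_vector"
  shows "step k f \<Longrightarrow> f \<in> L1_loc"
  using step_Lp[of k f 1] Lp_subset_L1_loc[of 1 f] by simp

end

section \<open>Density of step functions\<close>

lemma nn_integral_powr_diff_triangle:
  fixes f g h :: "'a::euclidean_space \<Rightarrow> 'b::real_normed_vector"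
  assumes "1 \<le> p" "strongly_measurable lebesgue f" "strongly_measurable lebesgue g" "strongly_measurable lebesgue h"
  shows "(\<integral>\<^sup>+ x. ennreal (norm (f x - h x) powr p) \<partial>lebesgue)
    \<le> 2 powr p * ((\<integral>\<^sup>+ x. ennreal (norm (f x - g x) powr p) \<partial>lebesgue) + (\<integral>\<^sup>+ x. ennreal (norm (g x - h x) powr p) \<partial>lebesgue))"
  using nn_integral_powr_add_le[OF assms(1) strongly_measurable_diff[OF assms(2,3)] strongly_measurable_diff[OF assms(3,4)]]
  by simp

context dyadic
begin

section \<open>Products with step functions, and averages over large cubes\<close>

lemma indicator_representatives:
  assumes S: "finite S" "inj_on (cube k) S" "cube k ` S = cube k ` B"
  shows "(\<Sum>s\<in>S. indicat_real (cube k s) x) = (if cube k x \<in> cube k ` B then 1 else 0)"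
proof -
  have "(if cube k x \<in> cube k ` B then 1 else 0 :: real)
      = (\<Sum>s\<in>S. indicat_real (cube k s) x *\<^sub>R (if cube k s \<in> cube k ` B then 1 else 0))"
  proof (rule cube_const_expand[OF _ _ S(1,2), of _ "{x. cube k x \<in> cube k ` B}"])
    show "cube k ` S = cube k ` {x. cube k x \<in> cube k ` B}" unfolding S(3) by blast
  qed (auto simp: cube_const_def)
  also have "\<dots> = (\<Sum>s\<in>S. indicat_real (cube k s) x)"
    by (rule sum.cong) (use S(3) in auto)
  finally show ?thesis by simp
qed

lemma support_expand:
  fixes f :: "real ^ 'd \<Rightarrow> 'b::real_vector"
  assumes S: "finite S" "inj_on (cube k) S" "cube k ` S = cube k ` B" and f: "\<And>x. x \<notin> B \<Longrightarrow> f x = 0"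
  shows "f x = (\<Sum>s\<in>S. indicat_real (cube k s) x *\<^sub>R f x)"
proof (cases "x \<in> B")
  case True
  then show ?thesis using indicator_representatives[OF S, of x] by (simp add: scaleR_sum_left[symmetric])
qed (use f in simp)

text \<open>A step function has finitely many pieces, so the product is a finite sum of bounded
  linear images of F restricted to cubes. This is why a merely locally integrable b can be paired
  with the kernel.\<close>

lemma step_bilinear_L1:
  fixes P :: "'a::real_normed_vector \<Rightarrow> 'b::real_normed_vector \<Rightarrow> 'c::real_normed_vector"
  assumes P: "bounded_bilinear P" and g: "step k g" and F: "F \<in> L1_loc"
  shows "(\<lambda>x. P (g x) (F x)) \<in> Lp 1 lebesgue" and "bounded_support (\<lambda>x. P (g x) (F x))"
proof -
  interpret P: bounded_bilinear P by (rule P)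
  obtain S where S: "finite S" "inj_on (cube k) S" "cube k ` S = cube k ` {x. g x \<noteq> 0}"
    using step_representatives[OF g] .
  have "P (g x) (F x) = (\<Sum>s\<in>S. P (g s) (indicat_real (cube k s) x *\<^sub>R F x))" for x
  proof -
    have "g x = (\<Sum>s\<in>S. indicat_real (cube k s) x *\<^sub>R g s)"
      using g by (intro cube_const_expand[OF _ _ S]) (auto simp: step_def)
    then have "P (g x) (F x) = P (\<Sum>s\<in>S. indicat_real (cube k s) x *\<^sub>R g s) (F x)" by (rule arg_cong)
    also have "\<dots> = (\<Sum>s\<in>S. P (g s) (indicat_real (cube k s) x *\<^sub>R F x))"
      by (simp only: P.sum_left P.scaleR_left P.scaleR_right)
    finally show ?thesis .
  qed
  moreover have "(\<lambda>x. \<Sum>s\<in>S. P (g s) (indicat_real (cube k s) x *\<^sub>R F x)) \<in> Lp 1 lebesgue"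
    by (rule Lp_sum, simp, rule Lp_linear[OF _ restrict_cube_L1[OF F] P.bounded_linear_right]) simp
  ultimately show "(\<lambda>x. P (g x) (F x)) \<in> Lp 1 lebesgue" by (simp only:)
  have "bounded_support g" using g by (simp add: step_def)
  then show "bounded_support (\<lambda>x. P (g x) (F x))"
    by (rule bounded_support_subset) (simp add: P.zero_left)
qed

text \<open>Because the support is bounded, only finitely many cubes matter; on each of them
  averaging keeps the integral and does not increase the integral of the norm.\<close>

lemma E_integral:
  fixes u :: "real ^ 'd \<Rightarrow> 'b::banach"
  assumes u: "u \<in> Lp 1 lebesgue" "bounded_support u"
  shows "Bochner_integral lebesgue (E k u) = Bochner_integral lebesgue u"
    and "(\<integral>\<^sup>+ x. ennreal (norm (E k u x)) \<partial>lebesgue) \<le> (\<integral>\<^sup>+ x. ennreal (norm (u x)) \<partial>lebesgue)"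
proof -
  define B where "B = (\<Union>x\<in>{x. u x \<noteq> 0}. cube k x)"
  have B: "bounded B" unfolding B_def using u(2) by (intro bounded_cube_hull) (simp add: bounded_support_def)
  obtain S where S: "finite S" "inj_on (cube k) S" "cube k ` S = cube k ` B"
    using cube_representatives[OF B, of k] by metis
  have u0: "u x = 0" if "x \<notin> B" for x using that cube_self unfolding B_def by blast
  have E0: "E k u x = 0" if "x \<notin> B" for x
  proof -
    have "indicat_real (cube k x) y *\<^sub>R u y = 0" for y
    proof (cases "y \<in> cube k x \<and> u y \<noteq> 0")
      case True
      then have "x \<in> cube k y" using cube_eq_iff[of y k x] cube_eq_iff[of x k y] by simp
      then show ?thesis using that True unfolding B_def by blast
    qed auto
    then have "(\<lambda>y. indicat_real (cube k x) y *\<^sub>R u y) = (\<lambda>y. 0)" by (rule ext)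
    then show ?thesis by (simp only: E_eq average_cube Bochner_integral_zero scaleR_zero_right)
  qed
  have uloc: "u \<in> L1_loc" using u(1) by (intro Lp_subset_L1_loc[of 1]) auto
  have Es: "vol k *\<^sub>R E k u s = Bochner_integral lebesgue (\<lambda>y. indicat_real (cube k s) y *\<^sub>R u y)" for s
    using vol_pos[of k] by (simp add: E_eq average_cube)
  have "Bochner_integral lebesgue (E k u) = (\<Sum>s\<in>S. vol k *\<^sub>R E k u s)"
    using cube_const_integral(2)[OF E_cube_const E0 S] by (simp add: scaleR_sum_right)
  also have "\<dots> = Bochner_integral lebesgue (\<lambda>y. \<Sum>s\<in>S. indicat_real (cube k s) y *\<^sub>R u y)"
    unfolding Es using restrict_cube_L1[OF uloc] by (intro Bochner_integral_sum[symmetric])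
  also have "(\<lambda>y. \<Sum>s\<in>S. indicat_real (cube k s) y *\<^sub>R u y) = u"
    by (rule ext, rule support_expand[OF S, of u, OF u0, symmetric])
  finally show "Bochner_integral lebesgue (E k u) = Bochner_integral lebesgue u" .
  have um: "(\<lambda>x. norm (u x)) \<in> borel_measurable lebesgue"
    using u(1) by (intro strongly_measurable_norm_borel) (simp add: L1_iff)
  have "(\<integral>\<^sup>+ x. ennreal (norm (E k u x)) \<partial>lebesgue) = ennreal (vol k * (\<Sum>s\<in>S. norm (E k u s)))"
    by (rule cube_const_nn_integral[OF cube_const_compose[OF E_cube_const] _ _ S]) (auto simp: E0)
  also have "\<dots> = (\<Sum>s\<in>S. ennreal (norm (vol k *\<^sub>R E k u s)))"
    using vol_pos[of k] by (simp add: sum_distrib_left sum_ennreal)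
  also have "\<dots> \<le> (\<Sum>s\<in>S. \<integral>\<^sup>+ x. ennreal (norm (indicat_real (cube k s) x *\<^sub>R u x)) \<partial>lebesgue)"
    unfolding Es by (intro sum_mono norm_Bochner_integral_le restrict_cube_L1 uloc)
  also have "\<dots> = (\<integral>\<^sup>+ x. (\<Sum>s\<in>S. ennreal (norm (indicat_real (cube k s) x *\<^sub>R u x))) \<partial>lebesgue)"
  proof (rule nn_integral_sum[symmetric])
    show "(\<lambda>x. ennreal (norm (indicat_real (cube k s) x *\<^sub>R u x))) \<in> borel_measurable lebesgue" for s
      using um by (simp add: abs_mult) measurable
  qed
  also have "\<dots> = (\<integral>\<^sup>+ x. ennreal (norm (u x)) \<partial>lebesgue)"
  proof (rule nn_integral_cong)
    fix x
    have "(\<Sum>s\<in>S. ennreal (norm (indicat_real (cube k s) x *\<^sub>R u x)))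
        = ennreal (\<Sum>s\<in>S. indicat_real (cube k s) x *\<^sub>R norm (u x))"
      by (simp add: sum_ennreal)
    also have "(\<Sum>s\<in>S. indicat_real (cube k s) x *\<^sub>R norm (u x)) = norm (u x)"
      by (rule support_expand[OF S, of "\<lambda>x. norm (u x)", symmetric]) (simp add: u0)
    finally show "(\<Sum>s\<in>S. ennreal (norm (indicat_real (cube k s) x *\<^sub>R u x))) = ennreal (norm (u x))" .
  qed
  finally show "(\<integral>\<^sup>+ x. ennreal (norm (E k u x)) \<partial>lebesgue) \<le> (\<integral>\<^sup>+ x. ennreal (norm (u x)) \<partial>lebesgue)" .
qed

text \<open>Meant for k tending to minus infinity: the volumes tend to infinity, so averages of an
  integrable function over large cubes vanish uniformly.\<close>

lemma norm_E_le:
  fixes f :: "real ^ 'd \<Rightarrow> 'b::banach"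
  assumes f: "f \<in> Lp 1 lebesgue"
  shows "norm (E k f x) \<le> Lp_norm 1 lebesgue f / vol k"
proof -
  have floc: "f \<in> L1_loc" using f by (intro Lp_subset_L1_loc[of 1]) auto
  have "ennreal (norm (vol k *\<^sub>R E k f x)) \<le> (\<integral>\<^sup>+ y. ennreal (norm (indicat_real (cube k x) y *\<^sub>R f y)) \<partial>lebesgue)"
    using vol_pos[of k] norm_Bochner_integral_le[OF restrict_cube_L1[OF floc, of k x]]
    by (simp add: E_eq average_cube)
  also have "\<dots> \<le> (\<integral>\<^sup>+ y. ennreal (norm (f y)) \<partial>lebesgue)"
    by (intro nn_integral_mono) (simp add: indicator_def)
  also have "\<dots> = ennreal (Lp_norm 1 lebesgue f)"
    using nn_integral_eq_Lp_norm[OF f] by simp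
  finally have "norm (vol k *\<^sub>R E k f x) \<le> Lp_norm 1 lebesgue f" by simp
  then show ?thesis using vol_pos[of k] by (simp add: le_divide_eq mult.commute)
qed

lemma vol_at_bot: "(\<lambda>n. 1 / vol (- int n)) \<longlonglongrightarrow> 0"
proof -
  have "1 / vol (- int n) \<le> (1 / 2) ^ n" for n
  proof -
    have v: "vol (- int n) = (2 ^ n) ^ CARD('d)" by (simp add: vol_def)
    have "(2::real) ^ n \<le> (2 ^ n) ^ CARD('d)"
      using self_le_power[of "2 ^ n :: real" "CARD('d)"] by simp
    then show ?thesis unfolding v by (simp add: power_one_over divide_simps)
  qed
  then have le: "\<forall>\<^sub>F n in sequentially. 1 / vol (- int n) \<le> (1 / 2) ^ n" by (intro always_eventually allI)
  have ge: "\<forall>\<^sub>F n in sequentially. 0 \<le> 1 / vol (- int n)"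
    by (intro always_eventually allI) (simp add: less_imp_le[OF vol_pos])
  have "(\<lambda>n. (1 / 2 :: real) ^ n) \<longlonglongrightarrow> 0" by (rule LIMSEQ_power_zero) simp
  then show ?thesis by (rule tendsto_sandwich[OF ge le tendsto_const])
qed

text \<open>Of the q factors of the norm, \<open>q - 1\<close> are estimated by the uniform bound
  \<open>norm_E_le\<close> and the last one by contractivity in L^1. For q = 1 this fails whenever g
  has a nonzero integral, because averaging preserves the integral.\<close>

lemma E_at_bot:
  fixes g :: "real ^ 'd \<Rightarrow> 'b::banach"
  assumes g: "step K g" and q: "1 < q"
  shows "(\<lambda>n. \<integral>\<^sup>+ x. ennreal (norm (E (- int n) g x) powr q) \<partial>lebesgue) \<longlonglongrightarrow> 0"
proof -
  define N where "N = Lp_norm 1 lebesgue g"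
  have g1: "g \<in> Lp 1 lebesgue" and gb: "bounded_support g" using step_Lp[OF g, of 1] g by (auto simp: step_def)
  have N0: "0 \<le> N" by (simp add: N_def)
  have le: "(\<integral>\<^sup>+ x. ennreal (norm (E k g x) powr q) \<partial>lebesgue) \<le> ennreal ((N / vol k) powr (q - 1) * N)" for k
  proof -
    have [measurable]: "(\<lambda>x. norm (E k g x)) \<in> borel_measurable lebesgue"
      by (rule strongly_measurable_norm_borel[OF strongly_measurable_simple[OF step_simple[OF E_step[OF gb]]]])
    have "(\<integral>\<^sup>+ x. ennreal (norm (E k g x) powr q) \<partial>lebesgue)
        \<le> (\<integral>\<^sup>+ x. ennreal ((N / vol k) powr (q - 1)) * ennreal (norm (E k g x)) \<partial>lebesgue)"
    proof (rule nn_integral_mono)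
      fix x
      have "norm (E k g x) powr q = norm (E k g x) powr (q - 1) * norm (E k g x)"
        using q by (simp add: powr_mult_base mult.commute)
      also have "\<dots> \<le> (N / vol k) powr (q - 1) * norm (E k g x)"
        using norm_E_le[OF g1, of k x] q by (intro mult_right_mono powr_mono2) (auto simp: N_def)
      finally show "ennreal (norm (E k g x) powr q) \<le> ennreal ((N / vol k) powr (q - 1)) * ennreal (norm (E k g x))"
        by (simp add: ennreal_mult[symmetric] ennreal_leI)
    qed
    also have "\<dots> = ennreal ((N / vol k) powr (q - 1)) * (\<integral>\<^sup>+ x. ennreal (norm (E k g x)) \<partial>lebesgue)"
      by (rule nn_integral_cmult) measurable
    also have "\<dots> \<le> ennreal ((N / vol k) powr (q - 1)) * ennreal N"
      using E_integral(2)[OF g1 gb, of k] nn_integral_eq_Lp_norm[OF g1] by (intro mult_left_mono) (simp_all add: N_def)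
    finally show ?thesis by (simp add: ennreal_mult N0)
  qed
  have "(\<lambda>n. (N * (1 / vol (- int n))) powr (q - 1) * N) \<longlonglongrightarrow> (N * 0) powr (q - 1) * N"
  proof (rule tendsto_mult[OF tendsto_powr2 tendsto_const])
    show "(\<lambda>n. N * (1 / vol (- int n))) \<longlonglongrightarrow> N * 0" by (rule tendsto_mult[OF tendsto_const vol_at_bot])
    show "\<forall>\<^sub>F n in sequentially. 0 \<le> N * (1 / vol (- int n))"
      by (intro always_eventually allI mult_nonneg_nonneg N0) (simp add: less_imp_le[OF vol_pos])
  qed (use q in auto)
  then have "(\<lambda>n. ennreal ((N / vol (- int n)) powr (q - 1) * N)) \<longlonglongrightarrow> 0"
    by (simp add: ennreal_0[symmetric] tendsto_ennrealI del: ennreal_0)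
  then show ?thesis by (rule ennreal_tendsto_0_le[OF le])
qed

section \<open>From indicators of sets of finite measure to all of L^p\<close>

definition step_approximable :: "real \<Rightarrow> (real ^ 'd \<Rightarrow> 'b::real_normed_vector) \<Rightarrow> bool" where
  "step_approximable p f \<longleftrightarrow> strongly_measurable lebesgue f \<and>
     (\<forall>e>0. \<exists>K s. step K s \<and> (\<integral>\<^sup>+ x. ennreal (norm (f x - s x) powr p) \<partial>lebesgue) < ennreal e)"

lemma step_approximable_trans:
  fixes f :: "real ^ 'd \<Rightarrow> 'b::real_normed_vector"
  assumes p: "1 \<le> p" and f: "strongly_measurable lebesgue f"
    and g: "\<And>e. 0 < e \<Longrightarrow> \<exists>g. step_approximable p g \<and> (\<integral>\<^sup>+ x. ennreal (norm (f x - g x) powr p) \<partial>lebesgue) < ennreal e"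
  shows "step_approximable p f"
  unfolding step_approximable_def
proof (intro conjI allI impI f)
  fix e :: real assume e: "0 < e"
  \<comment> \<open>\<open>2 powr p\<close> is the constant in the triangle inequality for p-th
    powers.\<close>
  define \<delta> where "\<delta> = e / (2 * 2 powr p)"
  have \<delta>: "0 < \<delta>" "2 powr p * (\<delta> + \<delta>) = e" using e by (auto simp: \<delta>_def)
  obtain g where g: "step_approximable p g" "(\<integral>\<^sup>+ x. ennreal (norm (f x - g x) powr p) \<partial>lebesgue) < ennreal \<delta>"
    using g[OF \<delta>(1)] by blast
  obtain K s where s: "step K s" "(\<integral>\<^sup>+ x. ennreal (norm (g x - s x) powr p) \<partial>lebesgue) < ennreal \<delta>"
    using g(1) \<delta>(1) unfolding step_approximable_def by blast
  have m: "strongly_measurable lebesgue g" "strongly_measurable lebesgue s"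
    using g(1) step_simple[OF s(1)] by (auto simp: step_approximable_def intro: strongly_measurable_simple)
  have "(\<integral>\<^sup>+ x. ennreal (norm (f x - s x) powr p) \<partial>lebesgue) \<le> 2 powr p *
      ((\<integral>\<^sup>+ x. ennreal (norm (f x - g x) powr p) \<partial>lebesgue) + (\<integral>\<^sup>+ x. ennreal (norm (g x - s x) powr p) \<partial>lebesgue))"
    by (rule nn_integral_powr_diff_triangle[OF p f m])
  also have "\<dots> < ennreal (2 powr p) * (ennreal \<delta> + ennreal \<delta>)"
    using g(2) s(2) by (intro ennreal_mult_strict_left_mono add_strict_mono) auto
  also have "\<dots> = ennreal e" using \<delta> by (simp add: ennreal_mult[symmetric] ennreal_plus[symmetric] del: ennreal_plus)
  finally show "\<exists>K s. step K s \<and> (\<integral>\<^sup>+ x. ennreal (norm (f x - s x) powr p) \<partial>lebesgue) < ennreal e"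
    using s(1) by blast
qed

lemma step_approximable_add:
  fixes f g :: "real ^ 'd \<Rightarrow> 'b::real_normed_vector"
  assumes p: "1 \<le> p" and f: "step_approximable p f" and g: "step_approximable p g"
  shows "step_approximable p (\<lambda>x. f x + g x)"
  unfolding step_approximable_def
proof (intro conjI allI impI)
  have m: "strongly_measurable lebesgue f" "strongly_measurable lebesgue g"
    using f g by (auto simp: step_approximable_def)
  then show "strongly_measurable lebesgue (\<lambda>x. f x + g x)" by (rule strongly_measurable_add)
  fix e :: real assume e: "0 < e"
  define \<delta> where "\<delta> = e / (2 * 2 powr p)"
  have \<delta>: "0 < \<delta>" "2 powr p * (\<delta> + \<delta>) = e" using e by (auto simp: \<delta>_def)
  obtain J s where s: "step J s" "(\<integral>\<^sup>+ x. ennreal (norm (f x - s x) powr p) \<partial>lebesgue) < ennreal \<delta>"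
    using f \<delta>(1) unfolding step_approximable_def by blast
  obtain K t where t: "step K t" "(\<integral>\<^sup>+ x. ennreal (norm (g x - t x) powr p) \<partial>lebesgue) < ennreal \<delta>"
    using g \<delta>(1) unfolding step_approximable_def by blast
  have sm: "strongly_measurable lebesgue s" "strongly_measurable lebesgue t"
    using step_simple[OF s(1)] step_simple[OF t(1)] by (auto intro: strongly_measurable_simple)
  have "(\<integral>\<^sup>+ x. ennreal (norm (f x + g x - (s x + t x)) powr p) \<partial>lebesgue) \<le> 2 powr p *
      ((\<integral>\<^sup>+ x. ennreal (norm (f x - s x) powr p) \<partial>lebesgue) + (\<integral>\<^sup>+ x. ennreal (norm (g x - t x) powr p) \<partial>lebesgue))"
    using nn_integral_powr_add_le[OF p strongly_measurable_diff[OF m(1) sm(1)] strongly_measurable_diff[OF m(2) sm(2)]]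
    by (simp add: algebra_simps)
  also have "\<dots> < ennreal (2 powr p) * (ennreal \<delta> + ennreal \<delta>)"
    using s(2) t(2) by (intro ennreal_mult_strict_left_mono add_strict_mono) auto
  also have "\<dots> = ennreal e" using \<delta> by (simp add: ennreal_mult[symmetric] ennreal_plus[symmetric] del: ennreal_plus)
  finally show "\<exists>K s. step K s \<and> (\<integral>\<^sup>+ x. ennreal (norm (f x + g x - s x) powr p) \<partial>lebesgue) < ennreal e"
    using step_compose2[OF step_mono[OF s(1), of "max J K"] step_mono[OF t(1), of "max J K"], of "(+)"]
    by (intro exI[of _ "max J K"] exI[of _ "\<lambda>x. s x + t x"]) auto
qed

lemma step_approximable_zero: "step_approximable p (\<lambda>x. 0)"
  unfolding step_approximable_def
  by (auto intro!: exI[of _ 0] exI[of _ "\<lambda>x. 0"] strongly_measurable_simple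
      simp: step_def cube_const_def bounded_support_def)

lemma step_approximable_sum:
  assumes "1 \<le> p" "finite I" "\<And>i. i \<in> I \<Longrightarrow> step_approximable p (f i)"
  shows "step_approximable p (\<lambda>x. \<Sum>i\<in>I. f i x)"
  using assms(2,3)
  by (induction I rule: finite_induct) (auto intro: step_approximable_add[OF assms(1)] step_approximable_zero)

text \<open>An open set is the increasing union of the unions of the cubes of generation \<open>n\<close> that
  it contains.\<close>

lemma lmeasurable_step_approximation:
  assumes A: "A \<in> lmeasurable" and e: "0 < e"
  obtains K B where "step K (indicat_real B)" "B \<in> lmeasurable" "emeasure lebesgue ((A - B) \<union> (B - A)) < ennreal e"
proof -
  obtain U where U': "open U" "A \<subseteq> U" "U - A \<in> lmeasurable" "emeasure lebesgue (U - A) < ennreal (e / 2)"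
    using sets_lebesgue_outer_open[of A "e / 2"] fmeasurableD[OF A] e by (metis half_gt_zero)
  have "A \<union> (U - A) \<in> lmeasurable" using A U'(3) by (rule fmeasurable.Un)
  moreover have "A \<union> (U - A) = U" using U'(2) by blast
  ultimately have U: "open U" "A \<subseteq> U" "U \<in> lmeasurable" "emeasure lebesgue (U - A) < ennreal (e / 2)"
    using U' by simp_all
  \<comment> \<open>The intersection with a ball keeps the union of cubes bounded; radius and
    generation grow together.\<close>
  define B where "B n = {x. cube (int n) x \<subseteq> U \<inter> ball 0 (real n)}" for n
  have cc: "cube_const (int n) (indicat_real (B n))" for n
    unfolding cube_const_def by (auto simp: B_def indicator_def)
  have sub: "B n \<subseteq> U \<inter> ball 0 (real n)" for n using cube_self by (auto simp: B_def)
  have st: "step (int n) (indicat_real (B n))" for n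
    unfolding step_def bounded_support_def using cc
  proof
    have "{x. indicat_real (B n) x \<noteq> 0} \<subseteq> ball 0 (real n)" using sub by (auto simp: indicator_def)
    then show "bounded {x. indicat_real (B n) x \<noteq> 0}" using bounded_ball bounded_subset by blast
  qed
  have Bm: "B n \<in> sets lebesgue" for n
  proof -
    have "indicat_real (B n) \<in> borel_measurable lebesgue"
      by (rule borel_measurable_simple_function[OF step_simple[OF st]])
    then show ?thesis by (simp add: borel_measurable_indicator_iff)
  qed
  have mono: "B m \<subseteq> B n" if "m \<le> n" for m n
  proof
    fix x assume "x \<in> B m"
    then have "cube (int m) x \<subseteq> U \<inter> ball 0 (real m)" by (simp add: B_def)
    moreover have "cube (int n) x \<subseteq> cube (int m) x" using that by (intro cube_mono) simp
    moreover have "ball (0 :: real ^ 'd) (real m) \<subseteq> ball 0 (real n)" using that by (intro subset_ball) simp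
    ultimately show "x \<in> B n" unfolding B_def by blast
  qed
  have un: "(\<Union>n. B n) = U"
  proof (intro subset_antisym subsetI)
    fix x assume "x \<in> U"
    then obtain r where r: "0 < r" "ball x r \<subseteq> U" using U(1) openE by blast
    \<comment> \<open>Since \<open>2 ^ n\<close> exceeds n, the diameter bound of a cube of
      generation n is below r and at most the dimension; so the cube at x stays inside U and inside
      the ball of radius n.\<close>
    obtain n :: nat where n: "real CARD('d) / r < real n" "norm x + real CARD('d) < real n"
      using reals_Archimedean2[of "max (real CARD('d) / r) (norm x + real CARD('d))"] by auto
    have "n > 0" using n(2) norm_ge_zero[of x] by (cases n) (simp_all add: not_less[symmetric])
    have "real n \<le> 2 ^ n" using of_nat_less_two_power[of n] by (simp add: less_imp_le)
    have dn: "real CARD('d) * 2 powi (- int n) < r"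
    proof -
      have "real CARD('d) < real n * r" using n(1) r(1) by (simp add: divide_less_eq)
      also have "\<dots> \<le> 2 ^ n * r" using \<open>real n \<le> 2 ^ n\<close> r(1) by (intro mult_right_mono) auto
      finally show ?thesis by (simp add: power_int_minus field_simps)
    qed
    have d1: "real CARD('d) * 2 powi (- int n) \<le> real CARD('d)"
      by (intro mult_left_le) (auto simp: power_int_minus inverse_le_1_iff)
    have "y \<in> U \<inter> ball 0 (real n)" if "y \<in> cube (int n) x" for y
    proof
      have nd: "norm (y - x) \<le> real CARD('d) * 2 powi (- int n)" by (rule cube_diameter[OF that])
      then show "y \<in> U" using dn r(2) by (auto simp: dist_norm norm_minus_commute intro!: subsetD[OF r(2)])
      have "norm y \<le> norm (y - x) + norm x" by (metis diff_add_cancel norm_triangle_ineq)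
      then have "norm y < real n" using nd d1 n(2) by linarith
      then show "y \<in> ball 0 (real n)" by simp
    qed
    then have "cube (int n) x \<subseteq> U \<inter> ball 0 (real n)" by blast
    then show "x \<in> (\<Union>n. B n)" unfolding B_def by blast
  qed (use sub in blast)
  have lim: "(\<lambda>n. emeasure lebesgue (U - B n)) \<longlonglongrightarrow> emeasure lebesgue (\<Inter>n. U - B n)"
  proof (rule Lim_emeasure_decseq)
    show "range (\<lambda>n. U - B n) \<subseteq> sets lebesgue" using U(3) Bm by auto
    show "decseq (\<lambda>n. U - B n)" unfolding decseq_def using mono by blast
    show "emeasure lebesgue (U - B n) \<noteq> \<infinity>" for n
    proof -
      have "emeasure lebesgue (U - B n) \<le> emeasure lebesgue U" using U(3) by (intro emeasure_mono) auto
      also have "\<dots> < \<infinity>" using U(3) unfolding fmeasurable_def by blast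
      finally show ?thesis by simp
    qed
  qed
  have "(\<Inter>n. U - B n) = {}" using un by blast
  then have "(\<lambda>n. emeasure lebesgue (U - B n)) \<longlonglongrightarrow> 0" using lim by (simp only: emeasure_empty)
  then have "\<forall>\<^sub>F n in sequentially. emeasure lebesgue (U - B n) < ennreal (e / 2)"
    by (rule order_tendstoD) (use e in \<open>simp add: ennreal_less_zero_iff\<close>)
  then obtain n where n: "emeasure lebesgue (U - B n) < ennreal (e / 2)"
    by (auto simp: eventually_sequentially)
  have "emeasure lebesgue ((A - B n) \<union> (B n - A)) \<le> emeasure lebesgue ((U - B n) \<union> (U - A))"
    using U A Bm sub by (intro emeasure_mono) auto
  also have "\<dots> \<le> emeasure lebesgue (U - B n) + emeasure lebesgue (U - A)"
    using U A Bm by (intro emeasure_subadditive) auto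
  also have "\<dots> < ennreal (e / 2) + ennreal (e / 2)" using n U(4) by (rule add_strict_mono)
  also have "\<dots> = ennreal e" using e by (simp flip: ennreal_plus)
  finally have "emeasure lebesgue ((A - B n) \<union> (B n - A)) < ennreal e" .
  moreover have "B n \<in> lmeasurable"
    using sub by (intro fmeasurableI2[OF U(3) _ Bm]) auto
  ultimately show thesis using st by (intro that[of "int n" "B n"])
qed

lemma step_approximable_indicator:
  fixes v :: "'b::real_normed_vector"
  assumes p: "1 \<le> p" and A: "A \<in> lmeasurable"
  shows "step_approximable p (\<lambda>x. indicat_real A x *\<^sub>R v)"
  unfolding step_approximable_def
proof (intro conjI allI impI)
  show "strongly_measurable lebesgue (\<lambda>x. indicat_real A x *\<^sub>R v)"
    using Lp_indicator[OF A, of v 1] by (simp add: L1_iff)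
  fix e :: real assume e: "0 < e"
  \<comment> \<open>The summand 1 keeps c positive when v is 0.\<close>
  define c where "c = norm v powr p + 1"
  have c: "0 < c" by (simp add: c_def add_nonneg_pos)
  obtain K B where B: "step K (indicat_real B)" "B \<in> lmeasurable" "emeasure lebesgue ((A - B) \<union> (B - A)) < ennreal (e / c)"
    using lmeasurable_step_approximation[OF A, of "e / c"] e c by (metis divide_pos_pos)
  define C where "C = (A - B) \<union> (B - A)"
  have C: "C \<in> sets lebesgue" using A B(2) by (auto simp: C_def fmeasurable_def)
  have "(\<integral>\<^sup>+ x. ennreal (norm (indicat_real A x *\<^sub>R v - indicat_real B x *\<^sub>R v) powr p) \<partial>lebesgue)
      \<le> (\<integral>\<^sup>+ x. ennreal c * indicator C x \<partial>lebesgue)"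
    by (intro nn_integral_mono) (auto simp: indicator_def C_def c_def ennreal_leI)
  also have "\<dots> = ennreal c * emeasure lebesgue C" using C by (simp add: nn_integral_cmult_indicator)
  also have "\<dots> < ennreal c * ennreal (e / c)"
    using B(3) c by (intro ennreal_mult_strict_left_mono) (auto simp: C_def)
  also have "\<dots> = ennreal e" using c e by (simp add: ennreal_mult[symmetric])
  finally show "\<exists>K s. step K s \<and> (\<integral>\<^sup>+ x. ennreal (norm (indicat_real A x *\<^sub>R v - s x) powr p) \<partial>lebesgue) < ennreal e"
    using step_compose[OF B(1), of "\<lambda>r. r *\<^sub>R v"] by (intro exI[of _ K] exI[of _ "\<lambda>x. indicat_real B x *\<^sub>R v"]) auto
qed

lemma step_dense:
  fixes f :: "real ^ 'd \<Rightarrow> 'b::real_normed_vector"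
  assumes p: "1 \<le> p" and f: "f \<in> Lp p lebesgue"
  shows "step_approximable p f"
proof (rule step_approximable_trans[OF p])
  show fm: "strongly_measurable lebesgue f" using f by (simp add: Lp_def)
  fix e :: real assume "0 < e"
  obtain t where t: "\<And>n::nat. simple_function lebesgue (t n)" "\<And>n x. norm (t n x) \<le> 2 * norm (f x)"
    "(\<lambda>n. \<integral>\<^sup>+ x. ennreal (norm (f x - t n x) powr p) \<partial>lebesgue) \<longlonglongrightarrow> 0"
    using Lp_simple_approximation[OF p f] by blast
  have "\<forall>\<^sub>F n in sequentially. (\<integral>\<^sup>+ x. ennreal (norm (f x - t n x) powr p) \<partial>lebesgue) < ennreal e"
    using t(3) by (rule order_tendstoD) (use \<open>0 < e\<close> in \<open>simp add: ennreal_less_zero_iff\<close>)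
  then obtain n where n: "(\<integral>\<^sup>+ x. ennreal (norm (f x - t n x) powr p) \<partial>lebesgue) < ennreal e"
    by (auto simp: eventually_sequentially)
  define s where "s = t n"
  have s: "simple_function lebesgue s" using t(1) by (simp add: s_def)
  have fin: "finite (range s)" using s by (simp add: simple_function_def)
  \<comment> \<open>Where s takes the value v, the bound on the approximants gives
    \<open>norm (f x) \<ge> norm v / 2\<close>; by Chebyshev's inequality the level set has finite
    measure.\<close>
  have lm: "{x. s x = v} \<in> lmeasurable" if "v \<noteq> 0" for v
  proof -
    have m: "{x. s x = v} \<in> sets lebesgue"
      using simple_functionD(2)[OF s, of "{v}"] by (simp add: vimage_def)
    have "ennreal ((norm v / 2) powr p) * emeasure lebesgue {x. s x = v}
        = (\<integral>\<^sup>+ x. ennreal ((norm v / 2) powr p) * indicator {x. s x = v} x \<partial>lebesgue)"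
      using m by (simp add: nn_integral_cmult_indicator)
    also have "\<dots> \<le> (\<integral>\<^sup>+ x. ennreal (norm (f x) powr p) \<partial>lebesgue)"
    proof (rule nn_integral_mono)
      fix x
      have "(norm v / 2) powr p \<le> norm (f x) powr p" if "s x = v"
        using t(2)[of n x] that p by (intro powr_mono2) (auto simp: s_def)
      then show "ennreal ((norm v / 2) powr p) * indicator {x. s x = v} x \<le> ennreal (norm (f x) powr p)"
        by (simp add: indicator_def ennreal_leI)
    qed
    also have "\<dots> < \<infinity>" using f by (simp add: Lp_def)
    finally have "emeasure lebesgue {x. s x = v} < \<infinity>"
      using that by (auto simp: ennreal_mult_less_top ennreal_eq_0_iff)
    then show ?thesis using m by (simp add: fmeasurable_def)
  qed
  have "step_approximable p (\<lambda>x. \<Sum>v\<in>range s - {0}. indicat_real {x. s x = v} x *\<^sub>R v)"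
    using fin lm by (intro step_approximable_sum[OF p] step_approximable_indicator[OF p]) auto
  also have "(\<lambda>x. \<Sum>v\<in>range s - {0}. indicat_real {x. s x = v} x *\<^sub>R v) = s"
  proof
    fix x
    have "(\<Sum>v\<in>range s - {0}. indicat_real {x. s x = v} x *\<^sub>R v) = (\<Sum>v\<in>range s - {0}. if v = s x then s x else 0)"
      by (rule sum.cong) (auto simp: indicator_def)
    also have "\<dots> = s x" using fin by (auto simp: sum.delta)
    finally show "(\<Sum>v\<in>range s - {0}. indicat_real {x. s x = v} x *\<^sub>R v) = s x" .
  qed
  finally have "step_approximable p s" .
  then show "\<exists>g. step_approximable p g \<and> (\<integral>\<^sup>+ x. ennreal (norm (f x - g x) powr p) \<partial>lebesgue) < ennreal e"
    using n by (auto simp: s_def)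
qed

end

section \<open>Norms by duality\<close>

lemma Lp_norm_tendsto_0:
  assumes p: "0 < p" and lim: "(\<lambda>n. \<integral>\<^sup>+ x. ennreal (norm (f n x) powr p) \<partial>M) \<longlonglongrightarrow> 0"
  shows "(\<lambda>n::nat. Lp_norm p M (f n)) \<longlonglongrightarrow> 0"
proof -
  have "(\<lambda>n. enn2real (\<integral>\<^sup>+ x. ennreal (norm (f n x) powr p) \<partial>M)) \<longlonglongrightarrow> 0"
    by (rule tendsto_enn2real) (use lim in simp_all)
  then have "(\<lambda>n. enn2real (\<integral>\<^sup>+ x. ennreal (norm (f n x) powr p) \<partial>M) powr (1 / p)) \<longlonglongrightarrow> 0 powr (1 / p)"
    using p by (intro tendsto_powr2) auto
  then show ?thesis by (simp add: Lp_norm_def)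
qed

lemma Lp_norm_le_root:
  assumes "0 < p" "0 \<le> c" "(\<integral>\<^sup>+ x. ennreal (norm (f x) powr p) \<partial>M) \<le> ennreal c"
  shows "Lp_norm p M f \<le> c powr (1 / p)"
proof -
  have "enn2real (\<integral>\<^sup>+ x. ennreal (norm (f x) powr p) \<partial>M) \<le> c"
    using assms(2,3) by (simp add: enn2real_leI)
  then show ?thesis unfolding Lp_norm_def using assms(1) by (intro powr_mono2) auto
qed

lemma abs_pairing_le:
  fixes F :: "'a::euclidean_space \<Rightarrow> 'y::real_normed_vector" and g :: "'a \<Rightarrow> 'y \<Rightarrow>\<^sub>L real"
  assumes F: "F \<in> Lp 1 lebesgue" and g: "\<And>x. norm (g x) \<le> c" "strongly_measurable lebesgue g"
  shows "\<bar>LINT x|lebesgue. blinfun_apply (g x) (F x)\<bar> \<le> c * Lp_norm 1 lebesgue F"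
proof -
  have c: "0 \<le> c" using order.trans[OF norm_ge_zero g(1)] .
  have Fm: "strongly_measurable lebesgue F" using F by (simp add: L1_iff)
  note [measurable] = strongly_measurable_norm_borel[OF Fm]
  have m: "strongly_measurable lebesgue (\<lambda>x. blinfun_apply (g x) (F x))"
    by (rule strongly_measurable_bilinear[OF bounded_bilinear_blinfun_apply g(2) Fm])
  have le: "\<bar>blinfun_apply (g x) (F x)\<bar> \<le> c * norm (F x)" for x
    using order.trans[OF norm_blinfun mult_right_mono[OF g(1) norm_ge_zero]] by simp
  have "(\<integral>\<^sup>+ x. ennreal \<bar>blinfun_apply (g x) (F x)\<bar> \<partial>lebesgue) \<le> (\<integral>\<^sup>+ x. ennreal c * ennreal (norm (F x)) \<partial>lebesgue)"
    using ennreal_leI[OF le] by (intro nn_integral_mono) (simp add: ennreal_mult[symmetric] c)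
  also have "\<dots> = ennreal c * (\<integral>\<^sup>+ x. ennreal (norm (F x)) \<partial>lebesgue)" by (rule nn_integral_cmult) measurable
  also have "\<dots> = ennreal (c * Lp_norm 1 lebesgue F)"
    using nn_integral_eq_Lp_norm[OF F] by (simp add: ennreal_mult c)
  finally have bound: "(\<integral>\<^sup>+ x. ennreal \<bar>blinfun_apply (g x) (F x)\<bar> \<partial>lebesgue) \<le> ennreal (c * Lp_norm 1 lebesgue F)" .
  have int: "integrable lebesgue (\<lambda>x. blinfun_apply (g x) (F x))"
    using strongly_measurable_real[OF m] bound by (intro integrableI_bounded) (auto intro: order_le_less_trans)
  have "\<bar>LINT x|lebesgue. blinfun_apply (g x) (F x)\<bar> \<le> (LINT x|lebesgue. \<bar>blinfun_apply (g x) (F x)\<bar>)"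
    using integral_abs_bound[of lebesgue "\<lambda>x. blinfun_apply (g x) (F x)"] by simp
  moreover have "ennreal (LINT x|lebesgue. \<bar>blinfun_apply (g x) (F x)\<bar>) \<le> ennreal (c * Lp_norm 1 lebesgue F)"
    using bound nn_integral_eq_integral[OF integrable_abs[OF int]] by simp
  then have "(LINT x|lebesgue. \<bar>blinfun_apply (g x) (F x)\<bar>) \<le> c * Lp_norm 1 lebesgue F"
    using c by (simp add: ennreal_le_iff)
  ultimately show ?thesis by linarith
qed

context dyadic
begin

text \<open>The normal form of a function with finite expansion: no detail below a certain scale,
  and zero averages from a certain scale upwards.\<close>

definition good :: "(real ^ 'd \<Rightarrow> 'b::real_normed_vector) \<Rightarrow> bool" where
  "good f \<longleftrightarrow> (\<exists>m K. m \<le> K \<and> step K f \<and> E m f = (\<lambda>x. 0))"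

lemma E_zero_mono:
  fixes f :: "real ^ 'd \<Rightarrow> 'b::banach"
  assumes "f \<in> L1_loc" "E m f = (\<lambda>x. 0)" "j \<le> m"
  shows "E j f = (\<lambda>x. 0)"
  using E_tower[OF assms(1,3)] by (simp add: assms(2))

lemma good_diff_E:
  fixes g :: "real ^ 'd \<Rightarrow> 'b::banach"
  assumes g: "step K g" and l: "l \<le> K"
  shows "good (\<lambda>x. g x - E l g x)" and "step K (\<lambda>x. g x - E l g x)"
proof -
  have Eg: "step l (E l g)" using g by (intro E_step) (simp add: step_def)
  show st: "step K (\<lambda>x. g x - E l g x)"
    using step_compose2[OF g step_mono[OF Eg l], of "(-)"] by simp
  have "E l (\<lambda>x. g x - E l g x) = (\<lambda>x. E l g x - E l (E l g) x)"
    by (rule E_diff[OF step_L1_loc[OF g] step_L1_loc[OF Eg]])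
  then have "E l (\<lambda>x. g x - E l g x) = (\<lambda>x. 0)" by (simp add: E_self[OF E_cube_const order.refl])
  then show "good (\<lambda>x. g x - E l g x)" unfolding good_def using st l by blast
qed

text \<open>A step function is eventually reproduced exactly. The rest of F is small in L^1 and
  stays small after averaging.\<close>

lemma E_tendsto_L1:
  fixes F :: "real ^ 'd \<Rightarrow> 'b::banach"
  assumes F: "F \<in> Lp 1 lebesgue" "bounded_support F"
  shows "(\<lambda>n. \<integral>\<^sup>+ x. ennreal (norm (E (int n) F x - F x)) \<partial>lebesgue) \<longlonglongrightarrow> 0"
proof (rule tendsto_zero_ennreal)
  fix e :: real assume e: "0 < e"
  have Fm: "strongly_measurable lebesgue F" using F by (simp add: L1_iff)
  obtain K s where s: "step K s" "(\<integral>\<^sup>+ x. ennreal (norm (F x - s x) powr 1) \<partial>lebesgue) < ennreal (e / 2)"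
    using step_dense[OF order.refl F(1)] half_gt_zero[OF e] unfolding step_approximable_def by blast
  then have sF: "(\<integral>\<^sup>+ x. ennreal (norm (F x - s x)) \<partial>lebesgue) < ennreal (e / 2)" by simp
  have s1: "s \<in> Lp 1 lebesgue" "s \<in> L1_loc" using step_Lp[OF s(1)] step_L1_loc[OF s(1)] by auto
  have F1: "F \<in> L1_loc" using F(1) by (intro Lp_subset_L1_loc[of 1]) auto
  define u where "u x = F x - s x" for x
  have u: "u \<in> Lp 1 lebesgue" unfolding u_def using F(1) s1 by (intro Lp_diff) auto
  have ub: "bounded_support u"
    using F(2) s(1)[unfolded step_def, THEN conjunct2] by (rule bounded_support_combine) (simp add: u_def)
  have um: "(\<lambda>x. ennreal (norm (E k u x))) \<in> borel_measurable lebesgue" "(\<lambda>x. ennreal (norm (u x))) \<in> borel_measurable lebesgue" for k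
    using strongly_measurable_norm_borel[OF strongly_measurable_simple[OF step_simple[OF E_step[OF ub, of k]]]]
      strongly_measurable_norm_borel[of u] u by (auto simp: L1_iff)
  have bound: "(\<integral>\<^sup>+ x. ennreal (norm (E (int n) F x - F x)) \<partial>lebesgue) < ennreal e" if n: "nat K \<le> n" for n
  proof -
    have "E (int n) s = s" using s(1) n by (intro E_self[of K]) (auto simp: step_def)
    then have "E (int n) F x - F x = E (int n) u x - u x" for x
      using E_diff[OF F1 s1(2), of "int n"] by (simp add: u_def[abs_def])
    then have "(\<integral>\<^sup>+ x. ennreal (norm (E (int n) F x - F x)) \<partial>lebesgue)
        \<le> (\<integral>\<^sup>+ x. ennreal (norm (E (int n) u x)) + ennreal (norm (u x)) \<partial>lebesgue)"
      using ennreal_leI[OF norm_triangle_ineq4] by (intro nn_integral_mono) (simp flip: ennreal_plus)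
    also have "\<dots> = (\<integral>\<^sup>+ x. ennreal (norm (E (int n) u x)) \<partial>lebesgue) + (\<integral>\<^sup>+ x. ennreal (norm (u x)) \<partial>lebesgue)"
      by (intro nn_integral_add um)
    also have "\<dots> \<le> (\<integral>\<^sup>+ x. ennreal (norm (u x)) \<partial>lebesgue) + (\<integral>\<^sup>+ x. ennreal (norm (u x)) \<partial>lebesgue)"
      by (intro add_mono E_integral(2)[OF u ub] order.refl)
    also have "\<dots> < ennreal (e / 2) + ennreal (e / 2)" using sF unfolding u_def by (intro add_strict_mono)
    also have "\<dots> = ennreal e" using e by (simp flip: ennreal_plus)
    finally show ?thesis .
  qed
  then show "\<forall>\<^sub>F n in sequentially. (\<integral>\<^sup>+ x. ennreal (norm (E (int n) F x - F x)) \<partial>lebesgue) < ennreal e"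
    unfolding eventually_sequentially by blast
qed

text \<open>Supplies the almost everywhere limit for Fatou's lemma in the duality argument.\<close>

lemma E_AE_subsequence:
  fixes F :: "real ^ 'd \<Rightarrow> 'b::banach"
  assumes F: "F \<in> Lp 1 lebesgue" "bounded_support F"
  obtains r :: "nat \<Rightarrow> nat" where "AE x in lebesgue. (\<lambda>n. E (int (r n)) F x) \<longlonglongrightarrow> F x"
proof -
  let ?h = "\<lambda>n x. norm (E (int n) F x - F x)"
  have h1: "(\<lambda>x. E (int n) F x - F x) \<in> Lp 1 lebesgue" for n
    using step_Lp[OF E_step[OF F(2), of "int n"], of 1] F(1) by (intro Lp_diff) auto
  have int: "integrable lebesgue (?h n)" for n
    using h1[of n] by (intro L1_real_integrable) (auto simp: L1_iff intro: strongly_measurable_norm)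
  have "ennreal (LINT x|lebesgue. ?h n x) = (\<integral>\<^sup>+ x. ennreal (?h n x) \<partial>lebesgue)" for n
    by (rule nn_integral_eq_integral[symmetric, OF int]) simp
  then have "(\<lambda>n. ennreal (LINT x|lebesgue. ?h n x)) \<longlonglongrightarrow> 0" using E_tendsto_L1[OF F] by simp
  then have "(\<lambda>n. LINT x|lebesgue. norm (?h n x)) \<longlonglongrightarrow> 0" by (simp add: ennreal_tendsto_0_iff)
  from tendsto_L1_AE_subseq[OF int this]
  obtain r where "AE x in lebesgue. (\<lambda>n. ?h (r n) x) \<longlonglongrightarrow> 0" by blast
  then have "AE x in lebesgue. (\<lambda>n. E (int (r n)) F x) \<longlonglongrightarrow> F x"
    by eventually_elim (simp add: tendsto_norm_zero_iff Lim_null[of _ "F _"])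
  then show thesis by (rule that)
qed

text \<open>A step function g is approximated by the good functions \<open>g - E l g\<close> with l
  tending to minus infinity. The correction \<open>E l g\<close> vanishes uniformly, so its pairing
  with the integrable F vanishes, and its L^q norm vanishes because q exceeds 1.\<close>

lemma Lp_norm_dual_step:
  fixes F :: "real ^ 'd \<Rightarrow> 'y::banach"
  assumes q: "1 < q" and F: "F \<in> Lp 1 lebesgue" and C: "0 \<le> C"
    and bound: "\<And>g :: real ^ 'd \<Rightarrow> 'y \<Rightarrow>\<^sub>L real. good g \<Longrightarrow>
      \<bar>LINT x|lebesgue. blinfun_apply (g x) (F x)\<bar> \<le> C * Lp_norm q lebesgue g"
    and g: "step K (g :: real ^ 'd \<Rightarrow> 'y \<Rightarrow>\<^sub>L real)"
  shows "\<bar>LINT x|lebesgue. blinfun_apply (g x) (F x)\<bar> \<le> C * Lp_norm q lebesgue g"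
proof -
  define N where "N = Lp_norm 1 lebesgue g"
  define M where "M = Lp_norm 1 lebesgue F"
  have F1: "F \<in> L1_loc" using F by (intro Lp_subset_L1_loc[of 1]) auto
  have g1: "g \<in> Lp 1 lebesgue" and gb: "bounded_support g" using step_Lp[OF g] g by (auto simp: step_def)
  have le: "\<bar>LINT x|lebesgue. blinfun_apply (g x) (F x)\<bar>
      \<le> C * (Lp_norm q lebesgue g + Lp_norm q lebesgue (E (- int n) g)) + N * (1 / vol (- int n)) * M"
    if n: "nat (- K) \<le> n" for n
  proof -
    define l where "l = - int n"
    have l: "l \<le> K" using n by (simp add: l_def)
    have Eg: "step l (E l g)" by (rule E_step[OF gb])
    have Eq: "E l g \<in> Lp q lebesgue" "g \<in> Lp q lebesgue" using step_Lp[OF Eg] step_Lp[OF g] q by auto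
    have i1: "integrable lebesgue (\<lambda>x. blinfun_apply (g x - E l g x) (F x))"
      by (rule L1_real_integrable[OF step_bilinear_L1(1)[OF bounded_bilinear_blinfun_apply good_diff_E(2)[OF g l] F1]])
    have i2: "integrable lebesgue (\<lambda>x. blinfun_apply (E l g x) (F x))"
      by (rule L1_real_integrable[OF step_bilinear_L1(1)[OF bounded_bilinear_blinfun_apply Eg F1]])
    have "(LINT x|lebesgue. blinfun_apply (g x) (F x))
        = (LINT x|lebesgue. blinfun_apply (g x - E l g x) (F x) + blinfun_apply (E l g x) (F x))"
      by (simp add: blinfun.diff_left)
    also have "\<dots> = (LINT x|lebesgue. blinfun_apply (g x - E l g x) (F x)) + (LINT x|lebesgue. blinfun_apply (E l g x) (F x))"
      by (rule Bochner_Integration.integral_add[OF i1 i2])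
    finally have eq: "(LINT x|lebesgue. blinfun_apply (g x) (F x))
        = (LINT x|lebesgue. blinfun_apply (g x - E l g x) (F x)) + (LINT x|lebesgue. blinfun_apply (E l g x) (F x))" .
    have b1: "\<bar>LINT x|lebesgue. blinfun_apply (g x - E l g x) (F x)\<bar>
        \<le> C * Lp_norm q lebesgue (\<lambda>x. g x - E l g x)"
      by (rule bound[OF good_diff_E(1)[OF g l]])
    have "Lp_norm q lebesgue (\<lambda>x. g x + (- 1) *\<^sub>R E l g x) \<le> Lp_norm q lebesgue g + Lp_norm q lebesgue (\<lambda>x. (- 1) *\<^sub>R E l g x)"
      using q Eq Lp_scaleR[of q "E l g" "- 1"] by (intro Lp_norm_triangle) auto
    then have "Lp_norm q lebesgue (\<lambda>x. g x - E l g x) \<le> Lp_norm q lebesgue g + Lp_norm q lebesgue (E l g)"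
      using Lp_norm_scaleR[OF _ Eq(1), of "- 1"] q by simp
    then have b1': "C * Lp_norm q lebesgue (\<lambda>x. g x - E l g x) \<le> C * (Lp_norm q lebesgue g + Lp_norm q lebesgue (E l g))"
      using C by (rule mult_left_mono)
    have b2: "\<bar>LINT x|lebesgue. blinfun_apply (E l g x) (F x)\<bar> \<le> N / vol l * M"
      unfolding M_def N_def using norm_E_le[OF g1] strongly_measurable_simple[OF step_simple[OF Eg]]
      by (intro abs_pairing_le[OF F]) auto
    show ?thesis using eq b1 b1' b2 unfolding l_def by (simp add: abs_le_iff)
  qed
  have "(\<lambda>n. C * (Lp_norm q lebesgue g + Lp_norm q lebesgue (E (- int n) g)) + N * (1 / vol (- int n)) * M)
      \<longlonglongrightarrow> C * (Lp_norm q lebesgue g + 0) + N * 0 * M"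
    using q by (intro tendsto_intros vol_at_bot Lp_norm_tendsto_0 E_at_bot[OF g]) auto
  then have "\<bar>LINT x|lebesgue. blinfun_apply (g x) (F x)\<bar> \<le> C * (Lp_norm q lebesgue g + 0) + N * 0 * M"
    by (rule LIMSEQ_le_const) (use le in blast)
  then show ?thesis by simp
qed

text \<open>At generation \<open>n\<close> the inequality is tested against the step function
  \<open>norm (E n F) powr (p - 1)\<close> times a norming functional of \<open>E n F\<close>.\<close>

lemma Lp_norm_by_duality:
  fixes F :: "real ^ 'd \<Rightarrow> 'y::banach"
  assumes p: "1 < p" "1 < q" "1 / p + 1 / q = 1" and F: "F \<in> Lp 1 lebesgue" "bounded_support F" and C: "0 \<le> C"
    and bound: "\<And>g :: real ^ 'd \<Rightarrow> 'y \<Rightarrow>\<^sub>L real. good g \<Longrightarrow>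
      \<bar>LINT x|lebesgue. blinfun_apply (g x) (F x)\<bar> \<le> C * Lp_norm q lebesgue g"
  shows "F \<in> Lp p lebesgue" and "Lp_norm p lebesgue F \<le> C"
proof -
  have F1: "F \<in> L1_loc" using F(1) by (intro Lp_subset_L1_loc[of 1]) auto
  have pq: "(p - 1) * q = p"
  proof -
    have "p * q * (1 / p + 1 / q) = p * q" by (simp only: p(3) mult_1_right)
    then show ?thesis using p(1,2) by (simp add: distrib_left left_diff_distrib)
  qed
  have "\<forall>v::'y. \<exists>\<phi>::'y \<Rightarrow>\<^sub>L real. norm \<phi> \<le> 1 \<and> blinfun_apply \<phi> v = norm v"
    using norming_functional by metis
  then obtain Y where Y: "\<And>v. norm (Y v :: 'y \<Rightarrow>\<^sub>L real) \<le> 1" "\<And>v. blinfun_apply (Y v) v = norm v"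
    by metis
  have main: "(\<integral>\<^sup>+ x. ennreal (norm (E k F x) powr p) \<partial>lebesgue) \<le> ennreal (C powr p)" for k
  proof -
    define a where "a = Lp_norm p lebesgue (E k F)"
    have st: "step k (E k F)" by (rule E_step[OF F(2)])
    have EL: "E k F \<in> Lp p lebesgue" using step_Lp[OF st] p by simp
    have Ia: "(\<integral>\<^sup>+ x. ennreal (norm (E k F x) powr p) \<partial>lebesgue) = ennreal (a powr p)"
      unfolding a_def using nn_integral_eq_Lp_norm[OF EL] p by simp
    define g where "g x = (norm (E k F x) powr (p - 1)) *\<^sub>R Y (E k F x)" for x
    have g: "step k g"
      unfolding g_def using p by (intro step_compose[OF st, where P="\<lambda>v. (norm v powr (p - 1)) *\<^sub>R Y v"]) simp
    have norm_g: "Lp_norm q lebesgue g \<le> (a powr p) powr (1 / q)"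
    proof (rule Lp_norm_le_root)
      have "(\<integral>\<^sup>+ x. ennreal (norm (g x) powr q) \<partial>lebesgue) \<le> (\<integral>\<^sup>+ x. ennreal (norm (E k F x) powr p) \<partial>lebesgue)"
      proof (intro nn_integral_mono ennreal_leI)
        fix x
        have "norm (g x) \<le> norm (E k F x) powr (p - 1)"
          using Y(1)[of "E k F x"] by (simp add: g_def mult_left_le)
        then have "norm (g x) powr q \<le> (norm (E k F x) powr (p - 1)) powr q" using p by (intro powr_mono2) auto
        then show "norm (g x) powr q \<le> norm (E k F x) powr p" by (simp add: powr_powr pq)
      qed
      then show "(\<integral>\<^sup>+ x. ennreal (norm (g x) powr q) \<partial>lebesgue) \<le> ennreal (a powr p)" by (simp only: Ia)
    qed (use p in auto)
    \<comment> \<open>Averaging at generation k keeps the integral and passes through g, which is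
      constant on these cubes; this replaces F by \<open>E k F\<close>, where the functional in g is
      norming.\<close>
    have "(LINT x|lebesgue. blinfun_apply (g x) (F x)) = Bochner_integral lebesgue (\<lambda>x. blinfun_apply (g x) (F x))"
      by (rule Bochner_integral_real[symmetric, OF step_bilinear_L1(1)[OF bounded_bilinear_blinfun_apply g F1]])
    also have "\<dots> = Bochner_integral lebesgue (E k (\<lambda>x. blinfun_apply (g x) (F x)))"
      by (rule E_integral(1)[symmetric, OF step_bilinear_L1[OF bounded_bilinear_blinfun_apply g F1]])
    also have "E k (\<lambda>x. blinfun_apply (g x) (F x)) = (\<lambda>x. blinfun_apply (g x) (E k F x))"
      using g by (intro E_cube_const_mult[OF bounded_bilinear_blinfun_apply _ F1]) (simp add: step_def)
    also have "\<dots> = (\<lambda>x. norm (E k F x) powr p)"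
      using p by (simp add: g_def blinfun.scaleR_left Y(2) powr_mult_base mult.commute fun_eq_iff)
    also have "Bochner_integral lebesgue (\<lambda>x. norm (E k F x) powr p) = (LINT x|lebesgue. norm (E k F x) powr p)"
      using p by (intro Bochner_integral_real step_Lp[OF step_compose[OF st]]) auto
    also have "\<dots> = a powr p"
    proof -
      have "integrable lebesgue (\<lambda>x. norm (E k F x) powr p)"
        using p by (intro L1_real_integrable step_Lp[OF step_compose[OF st]]) auto
      then have "ennreal (LINT x|lebesgue. norm (E k F x) powr p) = ennreal (a powr p)"
        using Ia nn_integral_eq_integral[of lebesgue "\<lambda>x. norm (E k F x) powr p"] by simp
      then show ?thesis by simp
    qed
    finally have "a powr p \<le> C * Lp_norm q lebesgue g"
      using Lp_norm_dual_step[OF p(2) F(1) C bound g] by simp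
    also have "\<dots> \<le> C * (a powr p) powr (1 / q)" using norm_g C by (rule mult_left_mono)
    finally have ineq: "a powr p \<le> C * (a powr p) powr (1 / q)" .
    \<comment> \<open>The norm a of a step function is finite, and \<open>p - p / q = 1\<close>, so
      cancelling leaves the first power of a.\<close>
    have "a \<le> C"
    proof (cases "a = 0")
      case False
      then have a: "0 < a" by (simp add: a_def less_le)
      have "a powr p = a powr (p * (1 / q) + 1)"
      proof -
        have "p * (1 / p + 1 / q) = p" by (simp only: p(3) mult_1_right)
        then show ?thesis using p(1) by (simp add: distrib_left add.commute)
      qed
      also have "\<dots> = a * (a powr p) powr (1 / q)" using a by (simp add: powr_add powr_powr)
      finally have "a * (a powr p) powr (1 / q) \<le> C * (a powr p) powr (1 / q)" using ineq by simp
      then show ?thesis by (rule mult_right_le_imp_le) (use a in simp)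
    qed (use C in simp)
    then show ?thesis unfolding Ia using p by (intro ennreal_leI powr_mono2) (auto simp: a_def)
  qed
  obtain r where r: "AE x in lebesgue. (\<lambda>n. E (int (r n)) F x) \<longlonglongrightarrow> F x"
    using E_AE_subsequence[OF F] by blast
  \<comment> \<open>Fatou's lemma carries the uniform bound from the averages to F, so membership in
    L^p and the norm estimate come together.\<close>
  have "(\<integral>\<^sup>+ x. ennreal (norm (F x) powr p) \<partial>lebesgue)
      = (\<integral>\<^sup>+ x. liminf (\<lambda>n. ennreal (norm (E (int (r n)) F x) powr p)) \<partial>lebesgue)"
  proof (rule nn_integral_cong_AE)
    show "AE x in lebesgue. ennreal (norm (F x) powr p) = liminf (\<lambda>n. ennreal (norm (E (int (r n)) F x) powr p))"
      using r
    proof eventually_elim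
      case (elim x)
      have "(\<lambda>n. ennreal (norm (E (int (r n)) F x) powr p)) \<longlonglongrightarrow> ennreal (norm (F x) powr p)"
        using elim p by (intro tendsto_ennrealI tendsto_powr2 tendsto_norm) auto
      then show ?case by (intro lim_imp_Liminf[symmetric]) auto
    qed
  qed
  also have "\<dots> \<le> liminf (\<lambda>n. \<integral>\<^sup>+ x. ennreal (norm (E (int (r n)) F x) powr p) \<partial>lebesgue)"
  proof (rule nn_integral_liminf)
    show "(\<lambda>x. ennreal (norm (E (int (r n)) F x) powr p)) \<in> borel_measurable lebesgue" for n
      using borel_measurable_simple_function[OF step_simple[OF step_compose[OF E_step[OF F(2), of "int (r n)"], of "\<lambda>v. norm v powr p"]]] p
      by (auto intro: measurable_compose[OF _ measurable_ennreal])
  qed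
  also have "\<dots> \<le> liminf (\<lambda>n::nat. ennreal (C powr p))"
    using main by (intro Liminf_mono always_eventually allI)
  also have "\<dots> = ennreal (C powr p)" by (simp add: Liminf_const)
  finally have fin: "(\<integral>\<^sup>+ x. ennreal (norm (F x) powr p) \<partial>lebesgue) \<le> ennreal (C powr p)" .
  then show FL: "F \<in> Lp p lebesgue"
    using F(1) by (auto simp: Lp_def intro: order_le_less_trans)
  have "Lp_norm p lebesgue F \<le> (C powr p) powr (1 / p)"
    using fin p by (intro Lp_norm_le_root) auto
  then show "Lp_norm p lebesgue F \<le> C" using p C by (simp add: powr_powr)
qed

end

section \<open>The kernel of the form\<close>

text \<open>The elementary tensor of u and \<phi>, realised as a functional on operators.\<close>

definition tensor :: "'x::real_normed_vector \<Rightarrow> ('y::real_normed_vector \<Rightarrow>\<^sub>L real) \<Rightarrow> ('x \<Rightarrow>\<^sub>L 'y) \<Rightarrow>\<^sub>L real" where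
  "tensor u \<phi> = Blinfun (\<lambda>T. blinfun_apply \<phi> (blinfun_apply T u))"

lemma tensor_apply [simp]: "blinfun_apply (tensor u \<phi>) T = blinfun_apply \<phi> (blinfun_apply T u)"
proof -
  have "bounded_linear (\<lambda>T :: 'a \<Rightarrow>\<^sub>L 'b. blinfun_apply \<phi> (blinfun_apply T u))"
    by (intro bounded_linear_compose[OF blinfun.bounded_linear_right] blinfun.bounded_linear_left)
  then show ?thesis by (simp add: tensor_def bounded_linear_Blinfun_apply)
qed

lemma norm_tensor_le: "norm (tensor u \<phi>) \<le> norm u * norm \<phi>"
proof (rule norm_blinfun_bound)
  fix T :: "'a \<Rightarrow>\<^sub>L 'b"
  have "norm (blinfun_apply \<phi> (blinfun_apply T u)) \<le> norm \<phi> * (norm T * norm u)"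
    by (rule order.trans[OF norm_blinfun mult_left_mono[OF norm_blinfun]]) simp
  then show "norm (blinfun_apply (tensor u \<phi>) T) \<le> norm u * norm \<phi> * norm T" by (simp add: mult_ac)
qed simp

lemma bounded_bilinear_tensor: "bounded_bilinear tensor"
  by (rule bounded_bilinear.intro)
    (auto intro!: blinfun_eqI exI[of _ 1] norm_tensor_le
      simp: blinfun.add_left blinfun.add_right blinfun.scaleR_left blinfun.scaleR_right)

text \<open>A finite window for the discrete inequalities: generations m to m + n, a bounded union B
  of cubes of generation m, and in S one point for each cube of generation m + n inside B. Functions
  in the frame are determined by their values on S.\<close>

locale dyadic_frame = dyadic \<D> for \<D> :: "int \<Rightarrow> (real ^ 'd::finite) set set" +
  fixes m :: int and n :: nat and B S :: "(real ^ 'd) set"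
  assumes bounded_B: "bounded B" and B_cubes: "x \<in> B \<Longrightarrow> cube m x \<subseteq> B"
    and S: "finite S" "S \<subseteq> B" "inj_on (cube (m + int n)) S" "cube (m + int n) ` S = cube (m + int n) ` B"
begin

definition K :: int where "K = m + int n"

definition in_frame :: "(real ^ 'd \<Rightarrow> 'b::zero) \<Rightarrow> bool" where
  "in_frame f \<longleftrightarrow> cube_const K f \<and> (\<forall>x. x \<notin> B \<longrightarrow> f x = 0)"

lemmas SK = S(1) S(3)[folded K_def] S(4)[folded K_def]

lemma in_frame_step: "in_frame f \<Longrightarrow> step K f"
  using bounded_B unfolding in_frame_def step_def bounded_support_def by (auto elim: bounded_subset)

lemma cube_subset_B: "x \<in> B \<Longrightarrow> m \<le> k \<Longrightarrow> cube k x \<subseteq> B"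
  using B_cubes cube_mono by blast

lemma E_outside:
  assumes f: "\<And>x. x \<notin> B \<Longrightarrow> f x = 0" and k: "m \<le> k" and x: "x \<notin> B"
  shows "E k f x = 0"
proof -
  have "indicat_real (cube k x) y *\<^sub>R f y = 0" for y
  proof (cases "y \<in> cube k x \<and> y \<in> B")
    case True
    then have "x \<in> cube k y" using cube_eq_iff[of y k x] cube_eq_iff[of x k y] by simp
    then show ?thesis using x True cube_subset_B[of y k] k by blast
  qed (use f in auto)
  then have "(\<lambda>y. indicat_real (cube k x) y *\<^sub>R f y) = (\<lambda>y. 0)" by (rule ext)
  then show ?thesis by (simp only: E_eq average_cube Bochner_integral_zero scaleR_zero_right)
qed

lemma in_frame_E:
  assumes "in_frame f" "m \<le> k" "k \<le> K" shows "in_frame (E k f)"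
  using assms E_outside[of f k] cube_const_mono[OF E_cube_const, of k K f] by (simp add: in_frame_def)

lemma in_frame_D:
  assumes "in_frame f" "m < k" "k \<le> K" shows "in_frame (D k f)"
  using in_frame_E[OF assms(1), of k] in_frame_E[OF assms(1), of "k - 1"] assms
    cube_const_mono[OF D_cube_const, of k K f] by (simp add: in_frame_def dyadic_D_def)

lemma in_frame_combine:
  assumes "in_frame f" "in_frame g" "P 0 0 = 0" shows "in_frame (\<lambda>x. P (f x) (g x))"
  using assms cube_const_compose2[of K f g P] by (simp add: in_frame_def)

lemma in_frame_sum:
  assumes "\<And>i. i \<in> I \<Longrightarrow> in_frame (f i)" shows "in_frame (\<lambda>x. \<Sum>i\<in>I. f i x)"
  using assms cube_const_sum[of I K f] unfolding in_frame_def by simp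

text \<open>Translates averages over cubes into class sums over the atoms, all of which have mass
  \<open>vol K\<close>.\<close>

lemma class_sum:
  fixes u :: "real ^ 'd \<Rightarrow> 'b::banach"
  assumes u: "in_frame u" and j: "j \<le> K"
  shows "vol j *\<^sub>R E j u x = vol K *\<^sub>R (\<Sum>y\<in>{y\<in>S. cube j y = cube j x}. u y)"
proof -
  have "cube_const j (indicat_real (cube j x))"
    unfolding cube_const_def by (auto simp: indicator_def cube_eq_iff)
  then have c: "cube_const K (\<lambda>y. indicat_real (cube j x) y *\<^sub>R u y)"
    using u cube_const_mono[OF _ j] unfolding in_frame_def by (auto intro: cube_const_compose2)
  have "vol j *\<^sub>R E j u x = Bochner_integral lebesgue (\<lambda>y. indicat_real (cube j x) y *\<^sub>R u y)"
    using vol_pos[of j] by (simp add: E_eq average_cube)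
  also have "\<dots> = vol K *\<^sub>R (\<Sum>y\<in>S. indicat_real (cube j x) y *\<^sub>R u y)"
    by (rule cube_const_integral(2)[OF c _ SK]) (use u in \<open>simp add: in_frame_def\<close>)
  also have "(\<Sum>y\<in>S. indicat_real (cube j x) y *\<^sub>R u y) = (\<Sum>y\<in>{y\<in>S. cube j y = cube j x}. u y)"
    by (rule sum.mono_neutral_cong_right) (use S(1) in \<open>auto simp: indicator_def cube_eq_iff\<close>)
  finally show ?thesis .
qed

text \<open>This is \<open>class_sum\<close> for the indicator of B, whose average over the cube at
  x is 1 because B is a union of cubes of generation m.\<close>

lemma class_card:
  assumes j: "m \<le> j" "j \<le> K" and x: "x \<in> B"
  shows "vol j = vol K * real (card {y\<in>S. cube j y = cube j x})"
proof -
  have cB: "cube_const m (indicat_real B)"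
    unfolding cube_const_def
  proof (intro allI impI)
    fix x y assume "cube m x = cube m y"
    then have "x \<in> B \<longleftrightarrow> y \<in> B" using B_cubes cube_self by blast
    then show "indicat_real B x = indicat_real B y" by (simp add: indicator_def)
  qed
  have "in_frame (indicat_real B)"
    unfolding in_frame_def using cube_const_mono[OF cB, of K] by (auto simp: K_def)
  from class_sum[OF this j(2), of x]
  have "vol j * E j (indicat_real B) x = vol K * (\<Sum>y\<in>{y\<in>S. cube j y = cube j x}. indicat_real B y)" by simp
  moreover have "E j (indicat_real B) x = 1" using E_self[OF cB j(1)] x by simp
  moreover have "(\<Sum>y\<in>{y\<in>S. cube j y = cube j x}. indicat_real B y) = real (card {y\<in>S. cube j y = cube j x})"
    using S(2) by (subst sum.cong[OF refl, of _ _ "\<lambda>_. 1"]) auto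
  ultimately show ?thesis by simp
qed

lemma Doob:
  fixes f :: "real ^ 'd \<Rightarrow> 'b::banach"
  assumes p: "1 < p" "1 < q" "1 / p + 1 / q = 1" and f: "in_frame f"
  shows "(\<Sum>x\<in>S. (MAX i\<in>{..n}. norm (E (m + int i) f x)) powr p) \<le> q powr p * (\<Sum>x\<in>S. norm (f x) powr p)"
proof -
  \<comment> \<open>\<open>Doob_maximal_finite\<close> wants labels for all indices, so the
    generation is frozen from n on.\<close>
  define lev where "lev i = m + int (min i n)" for i
  have lev: "m \<le> lev i" "lev i \<le> K" "lev i \<le> lev (Suc i)" for i by (auto simp: lev_def K_def)
  have "(\<Sum>x\<in>S. (MAX i\<in>{..n}. norm (E (lev i) f x)) powr p) \<le> q powr p * (\<Sum>x\<in>S. norm (f x) powr p)"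
  proof (rule Doob_maximal_finite[OF p S(1), where \<pi>="\<lambda>i. cube (lev i)"])
    show "cube (lev j) x = cube (lev j) y" if "cube (lev (Suc j)) x = cube (lev (Suc j)) y" for j x y
      using cube_eq_mono[OF lev(3) that] .
    show "norm (E (lev j) f x) = norm (E (lev j) f y)" if "cube (lev j) x = cube (lev j) y" for j x y
      by (simp only: cube_constD[OF E_cube_const that])
    show "(\<Sum>y\<in>{y\<in>S. cube (lev j) y = cube (lev j) x}. norm (E (lev j) f y))
        \<le> (\<Sum>y\<in>{y\<in>S. cube (lev j) y = cube (lev j) x}. norm (f y))" if x: "x \<in> S" for j x
    proof -
      let ?C = "{y\<in>S. cube (lev j) y = cube (lev j) x}"
      have "(\<Sum>y\<in>?C. norm (E (lev j) f y)) = (\<Sum>y\<in>?C. norm (E (lev j) f x))"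
      proof (rule sum.cong)
        fix y assume "y \<in> ?C"
        then have "E (lev j) f y = E (lev j) f x" by (intro cube_constD[OF E_cube_const]) auto
        then show "norm (E (lev j) f y) = norm (E (lev j) f x)" by simp
      qed simp
      also have "\<dots> = real (card ?C) * norm (E (lev j) f x)" by simp
      finally have "vol K * (\<Sum>y\<in>?C. norm (E (lev j) f y)) = norm (vol (lev j) *\<^sub>R E (lev j) f x)"
        using class_card[OF lev(1,2), of x j] x S(2) vol_pos[of "lev j"] by (auto simp: mult.assoc)
      also have "\<dots> = vol K * norm (\<Sum>y\<in>?C. f y)"
        using class_sum[OF f lev(2)] vol_pos[of K] by simp
      also have "\<dots> \<le> vol K * (\<Sum>y\<in>?C. norm (f y))"
        using vol_pos[of K] norm_sum[of f ?C] by simp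
      finally show ?thesis using vol_pos[of K] by simp
    qed
  qed auto
  moreover have "(MAX i\<in>{..n}. norm (E (lev i) f x)) = (MAX i\<in>{..n}. norm (E (m + int i) f x))" for x
    by (rule arg_cong[where f=Max], rule image_cong) (auto simp: lev_def min_def)
  ultimately show ?thesis by simp
qed

lemma telescope: "(\<Sum>i<l. D (m + 1 + int i) f x) = E (m + int l) f x - E m f x"
  by (induction l) (simp_all add: dyadic_D_def algebra_simps)

lemma E_D_zero:
  fixes f :: "real ^ 'd \<Rightarrow> 'b::banach"
  assumes "f \<in> L1_loc" "bounded_support f" "j < k"
  shows "E j (D k f) = (\<lambda>x. 0)"
proof -
  have st: "E k f \<in> L1_loc" "E (k - 1) f \<in> L1_loc" using step_L1_loc[OF E_step[OF assms(2)]] by auto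
  have "E j (D k f) = (\<lambda>x. E j (E k f) x - E j (E (k - 1) f) x)"
    unfolding dyadic_D_def[abs_def] by (rule E_diff[OF st])
  also have "E j (E k f) = E j f" using assms by (intro E_tower) auto
  also have "E j (E (k - 1) f) = E j f" using assms by (intro E_tower) auto
  finally show ?thesis by simp
qed

text \<open>All masses are 1 since cubes of one generation have equal volume. The difference with
  index i and its label both belong to generation \<open>m + 1 + i\<close>, as the differences start
  one generation after m.\<close>

lemma mds:
  fixes f :: "real ^ 'd \<Rightarrow> 'b::banach"
  assumes f: "in_frame f"
  shows "finite_mds S (\<lambda>_. 1) (\<lambda>i. cube (m + 1 + int i)) n (\<lambda>i. D (m + 1 + int i) f)"
  unfolding finite_mds_def
proof (intro conjI allI impI ballI)
  show "cube (m + 1 + int k) x = cube (m + 1 + int k) y"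
    if "cube (m + 1 + int (Suc k)) x = cube (m + 1 + int (Suc k)) y" for k x y
    by (rule cube_eq_mono[OF _ that]) simp
  show "D (m + 1 + int k) f x = D (m + 1 + int k) f y" if "cube (m + 1 + int k) x = cube (m + 1 + int k) y" for k x y
    by (rule cube_constD[OF D_cube_const that])
  fix k x assume k: "Suc k < n" and "x \<in> S"
  have fL: "f \<in> L1_loc" "bounded_support f" using in_frame_step[OF f] step_L1_loc by (auto simp: step_def)
  have "in_frame (D (m + 1 + int (Suc k)) f)" using k by (intro in_frame_D[OF f]) (auto simp: K_def)
  then have "vol K *\<^sub>R (\<Sum>y\<in>{y\<in>S. cube (m + 1 + int k) y = cube (m + 1 + int k) x}. D (m + 1 + int (Suc k)) f y)
      = vol (m + 1 + int k) *\<^sub>R E (m + 1 + int k) (D (m + 1 + int (Suc k)) f) x"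
    using k by (intro class_sum[symmetric]) (auto simp: K_def)
  also have "E (m + 1 + int k) (D (m + 1 + int (Suc k)) f) = (\<lambda>x. 0)"
    by (rule E_D_zero[OF fL]) simp
  finally show "(\<Sum>y\<in>{y\<in>S. cube (m + 1 + int k) y = cube (m + 1 + int k) x}. 1 *\<^sub>R D (m + 1 + int (Suc k)) f y) = 0"
    using vol_pos[of K] by simp
qed (use S(1) in auto)

lemma Lp_norm_frame:
  assumes "in_frame f" "0 < p"
  shows "Lp_norm p lebesgue f = (vol K * (\<Sum>x\<in>S. norm (f x) powr p)) powr (1 / p)"
proof -
  have c: "cube_const K (\<lambda>x. norm (f x) powr p)"
    using assms(1) by (intro cube_const_compose[where P="\<lambda>v. norm v powr p"]) (simp add: in_frame_def)
  have "(\<integral>\<^sup>+ x. ennreal (norm (f x) powr p) \<partial>lebesgue) = ennreal (vol K * (\<Sum>x\<in>S. norm (f x) powr p))"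
    by (rule cube_const_nn_integral[OF c _ _ SK]) (use assms in \<open>auto simp: in_frame_def\<close>)
  then show ?thesis using vol_pos[of K] by (simp add: Lp_norm_def sum_nonneg)
qed

text \<open>The kernel of the form: the pairing of \<open>b\<close> with \<open>kernel f g\<close> is the summand of the form,
  and its conditional expectation of generation \<open>m + i\<close> is the partial sum up to \<open>i\<close>.\<close>

definition kernel_term ::
    "(real ^ 'd \<Rightarrow> 'x::banach) \<Rightarrow> (real ^ 'd \<Rightarrow> 'y::banach \<Rightarrow>\<^sub>L real) \<Rightarrow> nat \<Rightarrow> real ^ 'd \<Rightarrow> ('x \<Rightarrow>\<^sub>L 'y) \<Rightarrow>\<^sub>L real" where
  "kernel_term f g i x = tensor (E (m + int i) f x) (D (m + 1 + int i) g x) + tensor (D (m + 1 + int i) f x) (E (m + int i) g x)"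

definition kernel ::
    "(real ^ 'd \<Rightarrow> 'x::banach) \<Rightarrow> (real ^ 'd \<Rightarrow> 'y::banach \<Rightarrow>\<^sub>L real) \<Rightarrow> real ^ 'd \<Rightarrow> ('x \<Rightarrow>\<^sub>L 'y) \<Rightarrow>\<^sub>L real" where
  "kernel f g x = (\<Sum>i<n. kernel_term f g i x)"

text \<open>The discrete product rule: the increment of \<open>E f \<otimes> E g\<close> consists of
  the two mixed terms of the kernel and the product of the two differences. The initial term
  disappears because f has zero averages at generation m.\<close>

lemma kernel_partial_sum:
  assumes "E m f = (\<lambda>x. 0)"
  shows "(\<Sum>i<l. kernel_term f g i x)
    = tensor (E (m + int l) f x) (E (m + int l) g x) - (\<Sum>i<l. tensor (D (m + 1 + int i) f x) (D (m + 1 + int i) g x))"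
proof (induction l)
  case 0
  then show ?case using assms by (simp add: bounded_bilinear.zero_left[OF bounded_bilinear_tensor])
next
  case (Suc l)
  interpret T: bounded_bilinear "tensor :: 'a \<Rightarrow> ('b \<Rightarrow>\<^sub>L real) \<Rightarrow> _" by (rule bounded_bilinear_tensor)
  have e: "E (m + int (Suc l)) f x = E (m + int l) f x + D (m + 1 + int l) f x"
    "E (m + int (Suc l)) g x = E (m + int l) g x + D (m + 1 + int l) g x"
    by (simp_all add: dyadic_D_def algebra_simps)
  show ?case
    unfolding sum.lessThan_Suc Suc.IH e kernel_term_def[of f g l] by (simp add: T.add_left T.add_right)
qed

lemma kernel_term_frame:
  assumes f: "in_frame f" and g: "in_frame g" and i: "i < n"
  shows "in_frame (kernel_term f g i)" and "step (m + 1 + int i) (kernel_term f g i)"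
proof -
  interpret T: bounded_bilinear "tensor :: 'a \<Rightarrow> ('b \<Rightarrow>\<^sub>L real) \<Rightarrow> _" by (rule bounded_bilinear_tensor)
  have lev: "m \<le> m + int i" "m + int i \<le> K" "m < m + 1 + int i" "m + 1 + int i \<le> K" using i by (auto simp: K_def)
  note fr = in_frame_E[OF f lev(1,2)] in_frame_E[OF g lev(1,2)] in_frame_D[OF f lev(3,4)] in_frame_D[OF g lev(3,4)]
  show 1: "in_frame (kernel_term f g i)"
    unfolding kernel_term_def[abs_def]
    by (intro in_frame_combine[where P="(+)"] in_frame_combine[where P=tensor] fr) (simp_all add: T.zero_left)
  have "cube_const (m + 1 + int i) (E (m + int i) f)" "cube_const (m + 1 + int i) (E (m + int i) g)"
    using cube_const_mono[OF E_cube_const, of "m + int i" "m + 1 + int i"] by auto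
  then have "cube_const (m + 1 + int i) (kernel_term f g i)"
    unfolding kernel_term_def[abs_def]
    by (intro cube_const_compose2[where P="(+)"] cube_const_compose2[where P=tensor] D_cube_const)
  then show "step (m + 1 + int i) (kernel_term f g i)"
    using in_frame_step[OF 1] by (simp add: step_def)
qed

lemma kernel_frame: "in_frame f \<Longrightarrow> in_frame g \<Longrightarrow> in_frame (kernel f g)"
  unfolding kernel_def[abs_def] by (intro in_frame_sum kernel_term_frame) auto

text \<open>Each summand of the term is a product of a factor constant on cubes of generation
  \<open>m + i\<close>, which is pulled out, and a difference of the next generation, which has mean
  zero there. So the terms are themselves martingale differences.\<close>

lemma E_kernel_term:
  assumes f: "in_frame f" and g: "in_frame g" and i: "i < n"
  shows "E j (kernel_term f g i) = (if m + int i < j then kernel_term f g i else (\<lambda>x. 0))"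
proof (cases "m + int i < j")
  case True
  then show ?thesis
    using kernel_term_frame(2)[OF assms] E_self[of "m + 1 + int i" "kernel_term f g i" j] by (simp add: step_def)
next
  case False
  have L: "f \<in> L1_loc" "bounded_support f" "g \<in> L1_loc" "bounded_support g"
    using in_frame_step[OF f] in_frame_step[OF g] step_L1_loc by (auto simp: step_def)
  interpret T: bounded_bilinear "tensor :: 'a \<Rightarrow> ('b \<Rightarrow>\<^sub>L real) \<Rightarrow> _" by (rule bounded_bilinear_tensor)
  let ?k = "m + int i"
  note bl = bounded_bilinear_tensor
  have st: "step ?k (E ?k f)" "step ?k (E ?k g)" "step (?k + 1) (D (?k + 1) f)" "step (?k + 1) (D (?k + 1) g)"
    using E_step D_step L by auto
  have t1: "step (?k + 1) (\<lambda>x. tensor (E ?k f x) (D (?k + 1) g x))"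
    using step_compose2[OF step_mono[OF st(1)] st(4), of tensor] by (simp add: T.zero_left)
  have t2: "step (?k + 1) (\<lambda>x. tensor (D (?k + 1) f x) (E ?k g x))"
    using step_compose2[OF st(3) step_mono[OF st(2)], of tensor] by (simp add: T.zero_left)
  have "E ?k (\<lambda>x. tensor (E ?k f x) (D (?k + 1) g x)) = (\<lambda>x. tensor (E ?k f x) (E ?k (D (?k + 1) g) x))"
    by (rule E_cube_const_mult[OF bl E_cube_const step_L1_loc[OF st(4)]])
  then have z1: "E ?k (\<lambda>x. tensor (E ?k f x) (D (?k + 1) g x)) = (\<lambda>x. 0)"
    using E_D_zero[OF L(3,4), of ?k "?k + 1"] by (simp add: T.zero_right)
  have "E ?k (\<lambda>x. tensor (D (?k + 1) f x) (E ?k g x)) = (\<lambda>x. tensor (E ?k (D (?k + 1) f) x) (E ?k g x))"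
    by (rule E_cube_const_mult[OF bounded_bilinear.flip[OF bl] E_cube_const step_L1_loc[OF st(3)]])
  then have z2: "E ?k (\<lambda>x. tensor (D (?k + 1) f x) (E ?k g x)) = (\<lambda>x. 0)"
    using E_D_zero[OF L(1,2), of ?k "?k + 1"] by (simp add: T.zero_left)
  have kt: "kernel_term f g i = (\<lambda>x. tensor (E ?k f x) (D (?k + 1) g x) + tensor (D (?k + 1) f x) (E ?k g x))"
    by (simp add: kernel_term_def fun_eq_iff add_ac)
  have "E ?k (kernel_term f g i) = (\<lambda>x. 0)"
    unfolding kt E_add[OF step_L1_loc[OF t1] step_L1_loc[OF t2]] z1 z2 by simp
  then show ?thesis
    using E_zero_mono[OF step_L1_loc[OF kernel_term_frame(2)[OF assms]], of ?k j] False by simp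
qed

lemma E_sum_steps:
  fixes f :: "'i \<Rightarrow> real ^ 'd \<Rightarrow> 'b::banach"
  assumes "finite I" "\<And>i. i \<in> I \<Longrightarrow> step k (f i)"
  shows "E j (\<lambda>x. \<Sum>i\<in>I. f i x) = (\<lambda>x. \<Sum>i\<in>I. E j (f i) x)"
  using assms
proof (induction I rule: finite_induct)
  case (insert i I)
  have "step k (\<lambda>x. \<Sum>i\<in>I. f i x)" using insert by (intro step_sum) auto
  then show ?case using insert E_add[OF step_L1_loc step_L1_loc, of k "f i"] by simp
qed simp

lemma E_kernel:
  assumes f: "in_frame f" and g: "in_frame g"
  shows "E j (kernel f g) x = (\<Sum>i\<in>{i. i < n \<and> m + int i < j}. kernel_term f g i x)"
proof -
  have "E j (kernel f g) = (\<lambda>x. \<Sum>i<n. E j (kernel_term f g i) x)"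
    unfolding kernel_def[abs_def]
    using in_frame_step[OF kernel_term_frame(1)[OF f g]] by (intro E_sum_steps) auto
  then have "E j (kernel f g) x = (\<Sum>i<n. if m + int i < j then kernel_term f g i x else 0)"
    by (simp add: E_kernel_term[OF f g] if_distrib[where f="\<lambda>h. h x"] cong: if_cong)
  also have "\<dots> = (\<Sum>i\<in>{i. i < n \<and> m + int i < j}. kernel_term f g i x)"
    by (rule sum.mono_neutral_cong_right) auto
  finally show ?thesis .
qed

lemma E_kernel_partial:
  assumes f: "in_frame f" and g: "in_frame g"
  obtains l where "l \<le> n" "\<And>x. E j (kernel f g) x = (\<Sum>i<l. kernel_term f g i x)"
proof
  \<comment> \<open>For j up to m the sum is empty because \<open>nat\<close> truncates at 0; from
    generation m + n on it is the whole kernel.\<close>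
  define l where "l = min n (nat (j - m))"
  show "l \<le> n" by (simp add: l_def)
  have "{i. i < n \<and> m + int i < j} = {..<l}" by (auto simp: l_def)
  then show "E j (kernel f g) x = (\<Sum>i<l. kernel_term f g i x)" for x by (simp add: E_kernel[OF f g])
qed

text \<open>A single function G dominates the averages of the kernel for all generations at once. It
  is constant on the cubes of generation K inside B, so its integral is a finite sum, and Hoelder's
  inequality separates f from g in both of its summands.\<close>

lemma H1_enorm_kernel:
  fixes f :: "real ^ 'd \<Rightarrow> 'x::banach" and g :: "real ^ 'd \<Rightarrow> 'y::banach \<Rightarrow>\<^sub>L real"
  assumes p: "1 < p" "1 < q" "1 / p + 1 / q = 1" and f: "in_frame f" "E m f = (\<lambda>x. 0)"
    and g: "in_frame g" "E m g = (\<lambda>x. 0)"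
    and X: "UMD_bound TYPE('x) p \<beta>X" and Y: "UMD_bound TYPE('y) p \<beta>Y"
  shows "H1_enorm \<D> (kernel f g) \<le> ennreal ((p * q + \<beta>X * \<beta>Y) * Lp_norm p lebesgue f * Lp_norm q lebesgue g)"
proof -
  define Mf where "Mf x = (MAX i\<in>{..n}. norm (E (m + int i) f x))" for x
  define Mg where "Mg x = (MAX i\<in>{..n}. norm (E (m + int i) g x))" for x
  define df where "df A x = (\<Sum>k<n. sign_of A k *\<^sub>R D (m + 1 + int k) f x)" for A x
  define dg where "dg A x = (\<Sum>k<n. sign_of A k *\<^sub>R D (m + 1 + int k) g x)" for A x
  define Rf where "Rf x = (\<Sum>A\<in>Pow {..<n}. (1 / 2 ^ n) * norm (df A x) powr p) powr (1 / p)" for x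
  define Rg where "Rg x = (\<Sum>A\<in>Pow {..<n}. (1 / 2 ^ n) * norm (dg A x) powr q) powr (1 / q)" for x
  define G where "G x = Mf x * Mg x + Rf x * Rg x" for x
  have \<beta>: "0 \<le> \<beta>X" "0 \<le> \<beta>Y" using X Y by (auto simp: UMD_bound_def)
  have Mf_ge: "norm (E (m + int i) f x) \<le> Mf x" if "i \<le> n" for i x
    unfolding Mf_def using that by (intro Max_ge) auto
  have Mg_ge: "norm (E (m + int i) g x) \<le> Mg x" if "i \<le> n" for i x
    unfolding Mg_def using that by (intro Max_ge) auto
  have M0: "0 \<le> Mf x" "0 \<le> Mg x" for x
    using order.trans[OF norm_ge_zero Mf_ge[of 0]] order.trans[OF norm_ge_zero Mg_ge[of 0]] by auto
  have R0: "0 \<le> Rf x" "0 \<le> Rg x" for x by (simp_all add: Rf_def Rg_def)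
  have pointwise: "norm (E j (kernel f g) x) \<le> G x" for j x
  proof -
    obtain l where l: "l \<le> n" "E j (kernel f g) x = (\<Sum>i<l. kernel_term f g i x)"
      using E_kernel_partial[OF f(1) g(1)] by metis
    have "norm (E j (kernel f g) x) \<le> norm (tensor (E (m + int l) f x) (E (m + int l) g x))
        + norm (\<Sum>i<l. tensor (D (m + 1 + int i) f x) (D (m + 1 + int i) g x))"
      unfolding l(2) kernel_partial_sum[OF f(2)] by (rule norm_triangle_ineq4)
    also have "\<dots> \<le> Mf x * Mg x + Rf x * Rg x"
    proof (rule add_mono)
      show "norm (tensor (E (m + int l) f x) (E (m + int l) g x)) \<le> Mf x * Mg x"
        using Mf_ge[OF l(1)] Mg_ge[OF l(1)] M0 by (intro order.trans[OF norm_tensor_le] mult_mono) auto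
      show "norm (\<Sum>i<l. tensor (D (m + 1 + int i) f x) (D (m + 1 + int i) g x)) \<le> Rf x * Rg x"
        unfolding Rf_def Rg_def df_def dg_def
        by (rule diagonal_sum_le_random_signs[OF bounded_bilinear_tensor norm_tensor_le p l(1)])
    qed
    finally show ?thesis by (simp add: G_def)
  qed
  have fr: "in_frame (E (m + int i) f)" "in_frame (E (m + int i) g)" if "i \<le> n" for i
    using that f(1) g(1) by (auto intro!: in_frame_E simp: K_def)
  have frD: "in_frame (D (m + 1 + int i) f)" "in_frame (D (m + 1 + int i) g)" if "i < n" for i
    using that f(1) g(1) by (auto intro!: in_frame_D simp: K_def)
  have G_const: "cube_const K G"
    unfolding cube_const_def
  proof (intro allI impI)
    fix x y assume xy: "cube K x = cube K y"
    have "E (m + int i) f x = E (m + int i) f y" "E (m + int i) g x = E (m + int i) g y" if "i \<le> n" for i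
      using fr[OF that] cube_constD[OF _ xy] by (auto simp: in_frame_def)
    then have "Mf x = Mf y" "Mg x = Mg y" unfolding Mf_def Mg_def by (auto intro!: arg_cong[where f=Max] image_cong)
    moreover have "D (m + 1 + int i) f x = D (m + 1 + int i) f y" "D (m + 1 + int i) g x = D (m + 1 + int i) g y" if "i < n" for i
      using frD[OF that] cube_constD[OF _ xy] by (auto simp: in_frame_def)
    then have "df A x = df A y" "dg A x = dg A y" for A unfolding df_def dg_def by (auto intro!: sum.cong)
    then have "Rf x = Rf y" "Rg x = Rg y" unfolding Rf_def Rg_def by simp_all
    ultimately show "G x = G y" by (simp add: G_def)
  qed
  have G_out: "G x = 0" if x: "x \<notin> B" for x
  proof -
    have "Mf x = (MAX i\<in>{..n}. 0)" unfolding Mf_def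
      using fr x by (intro arg_cong[where f=Max] image_cong) (auto simp: in_frame_def)
    then have "Mf x = 0" by simp
    moreover have "df A x = 0" for A unfolding df_def
      using frD x by (intro sum.neutral) (auto simp: in_frame_def)
    then have "Rf x = 0" using p by (simp add: Rf_def)
    ultimately show ?thesis by (simp add: G_def)
  qed
  have telf: "(\<Sum>k<n. D (m + 1 + int k) f x) = f x" for x
    using telescope[of f x n] f E_self[of K f K] by (simp add: K_def in_frame_def)
  have telg: "(\<Sum>k<n. D (m + 1 + int k) g x) = g x" for x
    using telescope[of g x n] g E_self[of K g K] by (simp add: K_def in_frame_def)
  define Nf where "Nf = (\<Sum>x\<in>S. norm (f x) powr p) powr (1 / p)"
  define Ng where "Ng = (\<Sum>x\<in>S. norm (g x) powr q) powr (1 / q)"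
  have N0: "0 \<le> Nf" "0 \<le> Ng" by (simp_all add: Nf_def Ng_def)
  have sum_powr: "(\<Sum>x\<in>S. norm (f x) powr p) = Nf powr p" "(\<Sum>x\<in>S. norm (g x) powr q) = Ng powr q"
    using p by (simp_all add: Nf_def Ng_def powr_powr sum_nonneg)
  have root: "c powr (1 / r) \<le> \<beta> * N" if "c \<le> (\<beta> * N) powr r" "0 \<le> \<beta>" "0 \<le> N" "0 \<le> c" "1 < r" for c \<beta> N r :: real
  proof -
    have "c powr (1 / r) \<le> ((\<beta> * N) powr r) powr (1 / r)" using that by (intro powr_mono2) auto
    then show ?thesis using that by (simp add: powr_powr)
  qed
  have q': "1 / q + 1 / p = 1" using p(3) by simp
  \<comment> \<open>Doob's constant is q in L^p and, in the next estimate, p in L^q; their product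
    is the term \<open>p * q\<close>.\<close>
  have MfS: "(\<Sum>x\<in>S. 1 * Mf x powr p) powr (1 / p) \<le> q * Nf"
    using Doob[OF p f(1)] p N0 by (intro root) (auto simp: Mf_def sum_powr powr_mult intro!: sum_nonneg)
  have MgS: "(\<Sum>x\<in>S. 1 * Mg x powr q) powr (1 / q) \<le> p * Ng"
    using Doob[OF p(2,1) q' g(1)] p N0 by (intro root) (auto simp: Mg_def sum_powr powr_mult intro!: sum_nonneg)
  have dfS: "(\<Sum>x\<in>S. norm (df A x) powr p) \<le> (\<beta>X * Nf) powr p" for A
  proof -
    have "(\<Sum>x\<in>S. 1 * norm (df A x) powr p) powr (1 / p) \<le> \<beta>X * (\<Sum>x\<in>S. 1 * norm (\<Sum>k<n. D (m + 1 + int k) f x) powr p) powr (1 / p)"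
      unfolding df_def using p(1) by (intro UMD_bound_finite[OF X _ mds[OF f(1)]] sign_of_cases) simp
    then have "(\<Sum>x\<in>S. norm (df A x) powr p) powr (1 / p) \<le> \<beta>X * Nf" by (simp add: telf Nf_def)
    then have "((\<Sum>x\<in>S. norm (df A x) powr p) powr (1 / p)) powr p \<le> (\<beta>X * Nf) powr p"
      using p by (intro powr_mono2) auto
    then show ?thesis using p by (simp add: powr_powr sum_nonneg)
  qed
  have dgS: "(\<Sum>x\<in>S. norm (dg A x) powr q) \<le> (\<beta>Y * Ng) powr q" for A
  proof -
    have "(\<Sum>x\<in>S. 1 * norm (dg A x) powr q) powr (1 / q) \<le> \<beta>Y * (\<Sum>x\<in>S. 1 * norm (\<Sum>k<n. D (m + 1 + int k) g x) powr q) powr (1 / q)"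
      unfolding dg_def by (intro UMD_bound_finite_dual[OF Y p mds[OF g(1)]] sign_of_cases)
    then have "(\<Sum>x\<in>S. norm (dg A x) powr q) powr (1 / q) \<le> \<beta>Y * Ng" by (simp add: telg Ng_def)
    then have "((\<Sum>x\<in>S. norm (dg A x) powr q) powr (1 / q)) powr q \<le> (\<beta>Y * Ng) powr q"
      using p by (intro powr_mono2) auto
    then show ?thesis using p by (simp add: powr_powr sum_nonneg)
  qed
  \<comment> \<open>The UMD estimates hold for each fixed sign pattern, so summing over atoms first
    and averaging over the patterns afterwards keeps the constant.\<close>
  have average: "(\<Sum>x\<in>S. \<Sum>A\<in>Pow {..<n}. (1 / 2 ^ n) * h A x) \<le> c"
    if "\<And>A. (\<Sum>x\<in>S. h A x) \<le> c" for h :: "nat set \<Rightarrow> real ^ 'd \<Rightarrow> real" and c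
  proof -
    have "(\<Sum>x\<in>S. \<Sum>A\<in>Pow {..<n}. (1 / 2 ^ n) * h A x) = (\<Sum>A\<in>Pow {..<n}. (1 / 2 ^ n) * (\<Sum>x\<in>S. h A x))"
      by (subst sum.swap) (simp add: sum_distrib_left)
    also have "\<dots> \<le> (\<Sum>A\<in>Pow {..<n}. (1 / 2 ^ n) * c)" using that by (intro sum_mono mult_left_mono) auto
    also have "\<dots> = c" by (simp add: card_Pow)
    finally show ?thesis .
  qed
  have RfS: "(\<Sum>x\<in>S. 1 * Rf x powr p) powr (1 / p) \<le> \<beta>X * Nf"
  proof (rule root)
    have "(\<Sum>x\<in>S. 1 * Rf x powr p) = (\<Sum>x\<in>S. \<Sum>A\<in>Pow {..<n}. (1 / 2 ^ n) * norm (df A x) powr p)"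
      using p by (intro sum.cong) (auto simp: Rf_def powr_powr abs_of_nonneg sum_nonneg)
    also have "\<dots> \<le> (\<beta>X * Nf) powr p" by (rule average[OF dfS])
    finally show "(\<Sum>x\<in>S. 1 * Rf x powr p) \<le> (\<beta>X * Nf) powr p" .
  qed (use p \<beta> N0 in \<open>auto intro!: sum_nonneg\<close>)
  have RgS: "(\<Sum>x\<in>S. 1 * Rg x powr q) powr (1 / q) \<le> \<beta>Y * Ng"
  proof (rule root)
    have "(\<Sum>x\<in>S. 1 * Rg x powr q) = (\<Sum>x\<in>S. \<Sum>A\<in>Pow {..<n}. (1 / 2 ^ n) * norm (dg A x) powr q)"
      using p by (intro sum.cong) (auto simp: Rg_def powr_powr abs_of_nonneg sum_nonneg)
    also have "\<dots> \<le> (\<beta>Y * Ng) powr q" by (rule average[OF dgS])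
    finally show "(\<Sum>x\<in>S. 1 * Rg x powr q) \<le> (\<beta>Y * Ng) powr q" .
  qed (use p \<beta> N0 in \<open>auto intro!: sum_nonneg\<close>)
  have "(\<Sum>x\<in>S. G x) = (\<Sum>x\<in>S. 1 * Mf x * Mg x) + (\<Sum>x\<in>S. 1 * Rf x * Rg x)"
    by (simp add: G_def sum.distrib)
  also have "\<dots> \<le> (q * Nf) * (p * Ng) + (\<beta>X * Nf) * (\<beta>Y * Ng)"
  proof (rule add_mono)
    have "(\<Sum>x\<in>S. 1 * Mf x * Mg x) \<le> (\<Sum>x\<in>S. 1 * Mf x powr p) powr (1 / p) * (\<Sum>x\<in>S. 1 * Mg x powr q) powr (1 / q)"
      by (rule weighted_Holder_sum[OF p S(1)]) (use M0 in auto)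
    also have "\<dots> \<le> (q * Nf) * (p * Ng)" using MfS MgS p N0 by (intro mult_mono) auto
    finally show "(\<Sum>x\<in>S. 1 * Mf x * Mg x) \<le> (q * Nf) * (p * Ng)" .
    have "(\<Sum>x\<in>S. 1 * Rf x * Rg x) \<le> (\<Sum>x\<in>S. 1 * Rf x powr p) powr (1 / p) * (\<Sum>x\<in>S. 1 * Rg x powr q) powr (1 / q)"
      by (rule weighted_Holder_sum[OF p S(1)]) (use R0 in auto)
    also have "\<dots> \<le> (\<beta>X * Nf) * (\<beta>Y * Ng)" using RfS RgS \<beta> N0 by (intro mult_mono) auto
    finally show "(\<Sum>x\<in>S. 1 * Rf x * Rg x) \<le> (\<beta>X * Nf) * (\<beta>Y * Ng)" .
  qed
  also have "\<dots> = (p * q + \<beta>X * \<beta>Y) * (Nf * Ng)" by (simp add: algebra_simps)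
  finally have sumG: "(\<Sum>x\<in>S. G x) \<le> (p * q + \<beta>X * \<beta>Y) * (Nf * Ng)" .
  \<comment> \<open>The common mass \<open>vol K\<close> of the atoms is split into its powers 1 / p
    and 1 / q, one for each norm.\<close>
  have "vol K * (Nf * Ng) = Lp_norm p lebesgue f * Lp_norm q lebesgue g"
  proof -
    have "Lp_norm p lebesgue f = vol K powr (1 / p) * Nf"
      using Lp_norm_frame[OF f(1), of p] p by (simp add: Nf_def powr_mult)
    moreover have "Lp_norm q lebesgue g = vol K powr (1 / q) * Ng"
      using Lp_norm_frame[OF g(1), of q] p by (simp add: Ng_def powr_mult)
    moreover have "vol K powr (1 / p) * vol K powr (1 / q) = vol K"
      using p(3) vol_pos[of K] by (simp add: powr_add[symmetric])
    moreover have "(vol K powr (1 / p) * Nf) * (vol K powr (1 / q) * Ng)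
        = (vol K powr (1 / p) * vol K powr (1 / q)) * (Nf * Ng)" by (simp only: mult_ac)
    ultimately show ?thesis by simp
  qed
  then have "(p * q + \<beta>X * \<beta>Y) * (vol K * (Nf * Ng)) = (p * q + \<beta>X * \<beta>Y) * (Lp_norm p lebesgue f * Lp_norm q lebesgue g)"
    by (rule arg_cong)
  then have final: "vol K * (\<Sum>x\<in>S. G x) \<le> (p * q + \<beta>X * \<beta>Y) * Lp_norm p lebesgue f * Lp_norm q lebesgue g"
    using mult_left_mono[OF sumG less_imp_le[OF vol_pos[of K]]]
    by (simp only: mult.left_commute[of "vol K" "p * q + \<beta>X * \<beta>Y"] mult.assoc)
  have "H1_enorm \<D> (kernel f g) \<le> (\<integral>\<^sup>+ x. ennreal (G x) \<partial>lebesgue)"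
    unfolding H1_enorm_def using pointwise by (intro nn_integral_mono SUP_least ennreal_leI)
  also have "\<dots> = ennreal (vol K * (\<Sum>x\<in>S. G x))"
    using M0 R0 by (intro cube_const_nn_integral[OF G_const G_out _ SK]) (auto simp: G_def)
  also have "\<dots> \<le> ennreal ((p * q + \<beta>X * \<beta>Y) * Lp_norm p lebesgue f * Lp_norm q lebesgue g)"
    by (rule ennreal_leI[OF final])
  finally show ?thesis .
qed

end

section \<open>Boundedness of the form\<close>

text \<open>The canonical embedding into the bidual, through which b becomes dual-valued. Its
  isometry, a consequence of norming functionals, keeps the BMO norm unchanged.\<close>

definition double_dual :: "'a::real_normed_vector \<Rightarrow> ('a \<Rightarrow>\<^sub>L real) \<Rightarrow>\<^sub>L real" where
  "double_dual v = Blinfun (\<lambda>e. blinfun_apply e v)"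

lemma double_dual_apply [simp]: "blinfun_apply (double_dual v) e = blinfun_apply e v"
  by (simp add: double_dual_def bounded_linear_Blinfun_apply blinfun.bounded_linear_left)

lemma norm_double_dual: "norm (double_dual v) = norm v"
proof (rule antisym)
  show "norm (double_dual v) \<le> norm v"
  proof (rule norm_blinfun_bound)
    show "norm (blinfun_apply (double_dual v) e) \<le> norm v * norm e" for e
      using norm_blinfun[of e v] by (simp add: mult.commute)
  qed simp
  obtain \<phi> :: "'a \<Rightarrow>\<^sub>L real" where \<phi>: "norm \<phi> \<le> 1" "blinfun_apply \<phi> v = norm v"
    by (rule norming_functional)
  have "norm v = norm (blinfun_apply (double_dual v) \<phi>)" using \<phi>(2) by simp
  also have "\<dots> \<le> norm (double_dual v) * norm \<phi>" by (rule norm_blinfun)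
  also have "\<dots> \<le> norm (double_dual v) * 1" using \<phi>(1) by (intro mult_left_mono) auto
  finally show "norm v \<le> norm (double_dual v)" by simp
qed

lemma bounded_linear_double_dual: "bounded_linear double_dual"
  by (rule bounded_linear_intro[of _ 1])
    (auto intro!: blinfun_eqI simp: blinfun.add_left blinfun.add_right blinfun.scaleR_left blinfun.scaleR_right norm_double_dual)

context dyadic_frame
begin

lemma sym_paraproduct_form_eq:
  fixes f :: "real ^ 'd \<Rightarrow> 'x::banach" and g :: "real ^ 'd \<Rightarrow> 'y::banach \<Rightarrow>\<^sub>L real"
  assumes f: "in_frame f" "E m f = (\<lambda>x. 0)" and g: "in_frame g" "E m g = (\<lambda>x. 0)" and b: "b \<in> L1_loc"
  shows "sym_paraproduct_form \<D> b f g = (LINT s|lebesgue. blinfun_apply (kernel f g s) (b s))"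
proof -
  define c where "c k = (LINT s|lebesgue.
     blinfun_apply (D k g s) (blinfun_apply (b s) (E (k - 1) f s)) +
     blinfun_apply (E (k - 1) g s) (blinfun_apply (b s) (D k f s)))" for k
  have L: "f \<in> L1_loc" "g \<in> L1_loc" using in_frame_step[OF f(1)] in_frame_step[OF g(1)] step_L1_loc by auto
  \<comment> \<open>Up to generation m all averages of f and g vanish, and from K on both functions
    are reproduced by averaging; so no other differences exist.\<close>
  have D0: "D k f = (\<lambda>x. 0)" "D k g = (\<lambda>x. 0)" if "k \<le> m \<or> K < k" for k
  proof -
    have "E k f = E (k - 1) f \<and> E k g = E (k - 1) g"
    proof (cases "k \<le> m")
      case True
      then show ?thesis
        using E_zero_mono[OF L(1) f(2), of k] E_zero_mono[OF L(1) f(2), of "k - 1"]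
          E_zero_mono[OF L(2) g(2), of k] E_zero_mono[OF L(2) g(2), of "k - 1"] by simp
    next
      case False
      then have "K \<le> k - 1" using that by simp
      then show ?thesis
        using f(1) g(1) E_self[of K f k] E_self[of K f "k - 1"] E_self[of K g k] E_self[of K g "k - 1"]
        by (simp add: in_frame_def)
    qed
    then show "D k f = (\<lambda>x. 0)" "D k g = (\<lambda>x. 0)" by (simp_all add: dyadic_D_def fun_eq_iff)
  qed
  have c0: "c k = 0" if "k \<notin> (\<lambda>i. m + 1 + int i) ` {..<n}" for k
  proof -
    have "k \<le> m \<or> K < k"
    proof (rule ccontr)
      assume "\<not> ?thesis"
      then have "k = m + 1 + int (nat (k - m - 1))" "nat (k - m - 1) < n" by (auto simp: K_def)
      then show False using that by blast
    qed
    then show ?thesis by (simp add: c_def D0)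
  qed
  have summand: "integrable lebesgue (\<lambda>s. blinfun_apply (kernel_term f g i s) (b s))"
    "c (m + 1 + int i) = (LINT s|lebesgue. blinfun_apply (kernel_term f g i s) (b s))" if "i < n" for i
  proof -
    show "integrable lebesgue (\<lambda>s. blinfun_apply (kernel_term f g i s) (b s))"
      by (rule L1_real_integrable[OF step_bilinear_L1(1)[OF bounded_bilinear_blinfun_apply kernel_term_frame(2)[OF f(1) g(1) that] b]])
    have i: "m + 1 + int i - 1 = m + int i" by simp
    show "c (m + 1 + int i) = (LINT s|lebesgue. blinfun_apply (kernel_term f g i s) (b s))"
      unfolding c_def i kernel_term_def by (simp add: blinfun.add_left)
  qed
  have "sym_paraproduct_form \<D> b f g = (\<Sum>\<^sub>\<infinity>k\<in>UNIV. c k)"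
    by (simp add: sym_paraproduct_form_def c_def)
  also have "\<dots> = (\<Sum>\<^sub>\<infinity>k\<in>(\<lambda>i. m + 1 + int i) ` {..<n}. c k)"
    using c0 by (intro infsum_cong_neutral) auto
  also have "\<dots> = (\<Sum>k\<in>(\<lambda>i. m + 1 + int i) ` {..<n}. c k)" by (rule infsum_finite) simp
  also have "\<dots> = (\<Sum>i<n. c (m + 1 + int i))"
    by (subst sum.reindex) (auto simp: inj_on_def)
  also have "\<dots> = (\<Sum>i<n. (LINT s|lebesgue. blinfun_apply (kernel_term f g i s) (b s)))"
    by (rule sum.cong) (simp_all add: summand(2))
  also have "\<dots> = (LINT s|lebesgue. (\<Sum>i<n. blinfun_apply (kernel_term f g i s) (b s)))"
    by (rule Bochner_Integration.integral_sum[symmetric]) (simp add: summand(1))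
  also have "\<dots> = (LINT s|lebesgue. blinfun_apply (kernel f g s) (b s))"
    by (simp add: kernel_def blinfun.sum_left)
  finally show ?thesis .
qed

end

text \<open>Provides the nonzero vectors needed for the sign of the duality constant and for the
  lower bounds of the UMD constants.\<close>

lemma BMO_norm_pos_nontrivial:
  fixes b :: "'a::euclidean_space \<Rightarrow> 'b::real_normed_vector"
  assumes "0 < BMO_norm \<D> b" shows "\<exists>v::'b. v \<noteq> 0"
proof (rule ccontr)
  assume "\<not> ?thesis"
  then have z: "norm w = 0" for w :: 'b by simp
  have "BMO_enorm \<D> b \<le> 0" unfolding BMO_enorm_def z by (rule SUP_least) simp
  then show False using assms by (simp add: BMO_norm_def)
qed

context dyadic
begin

section \<open>The duality inequality for good functions\<close>

lemma BMO_double_dual: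
  fixes b :: "real ^ 'd \<Rightarrow> 'b::banach"
  assumes b: "b \<in> BMO \<D>"
  shows "(\<lambda>x. double_dual (b x)) \<in> BMO \<D>" and "BMO_norm \<D> (\<lambda>x. double_dual (b x)) = BMO_norm \<D> b"
proof -
  have bL: "b \<in> L1_loc" using b by (simp add: BMO_def)
  interpret J: bounded_linear "double_dual :: 'b \<Rightarrow> _" by (rule bounded_linear_double_dual)
  have JL: "(\<lambda>x. double_dual (b x)) \<in> L1_loc"
    using bL strongly_measurable_linear[OF bounded_linear_double_dual] by (auto simp: L1_loc_def norm_double_dual)
  have av: "average (\<lambda>x. double_dual (b x)) Q = double_dual (average b Q)" if Q: "Q \<in> (\<Union>k. \<D> k)" for Q
  proof -
    obtain k x where x: "Q = cube k x" using Q cubeE by blast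
    show ?thesis
      using fun_cong[OF E_linear[OF bL bounded_linear_double_dual, of k], of x] by (simp add: E_eq x)
  qed
  have "(\<integral>\<^sup>+ x\<in>Q. ennreal (norm (double_dual (b x) - average (\<lambda>x. double_dual (b x)) Q)) \<partial>lebesgue)
      = (\<integral>\<^sup>+ x\<in>Q. ennreal (norm (b x - average b Q)) \<partial>lebesgue)" if "Q \<in> (\<Union>k. \<D> k)" for Q
    unfolding av[OF that] J.diff[symmetric] norm_double_dual ..
  then have "BMO_enorm \<D> (\<lambda>x. double_dual (b x)) = BMO_enorm \<D> b"
    unfolding BMO_enorm_def by (intro SUP_cong) simp_all
  then show "(\<lambda>x. double_dual (b x)) \<in> BMO \<D>" "BMO_norm \<D> (\<lambda>x. double_dual (b x)) = BMO_norm \<D> b"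
    using b JL by (simp_all add: BMO_def BMO_norm_def)
qed

text \<open>The averages of h vanish up to generation m and equal h from K on; so the maximal
  function is at most a finite sum of norms of integrable averages.\<close>

lemma good_H1:
  fixes h :: "real ^ 'd \<Rightarrow> 'b::banach"
  assumes h: "good h" shows "h \<in> H1 \<D>"
proof -
  obtain m K where mK: "m \<le> K" "step K h" "E m h = (\<lambda>x. 0)" using h unfolding good_def by blast
  define n where "n = nat (K - m)"
  have hL: "h \<in> L1_loc" "h \<in> Lp 1 lebesgue" "bounded_support h"
    using step_L1_loc[OF mK(2)] step_Lp[OF mK(2), of 1] mK(2) by (auto simp: step_def)
  have le: "norm (E k h x) \<le> (\<Sum>i\<le>n. norm (E (m + int i) h x))" for k x
  proof -
    obtain i where i: "i \<le> n" "norm (E k h x) \<le> norm (E (m + int i) h x)"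
    proof (cases "k \<le> m")
      case True
      then show ?thesis using that[of 0] E_zero_mono[OF hL(1) mK(3), of k] by simp
    next
      case False
      have "E (max k K) h = h" "E K h = h" using mK(2) by (auto intro!: E_self[of K] simp: step_def)
      then have "E k h = E (min k K) h" by (cases "k \<le> K") (auto simp: max_def min_def)
      moreover have "m + int (nat (min k K - m)) = min k K" using False mK(1) by simp
      ultimately show ?thesis using that[of "nat (min k K - m)"] mK(1) by (simp add: n_def)
    qed
    have "norm (E (m + int i) h x) \<le> (\<Sum>i\<le>n. norm (E (m + int i) h x))"
      using i(1) by (intro member_le_sum) auto
    then show ?thesis using i(2) by simp
  qed
  have "H1_enorm \<D> h \<le> (\<integral>\<^sup>+ x. (\<Sum>i\<le>n. ennreal (norm (E (m + int i) h x))) \<partial>lebesgue)"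
    unfolding H1_enorm_def using ennreal_leI[OF le] by (intro nn_integral_mono SUP_least) (simp add: sum_ennreal)
  also have "\<dots> = (\<Sum>i\<le>n. \<integral>\<^sup>+ x. ennreal (norm (E (m + int i) h x)) \<partial>lebesgue)"
  proof (rule nn_integral_sum)
    show "(\<lambda>x. ennreal (norm (E (m + int i) h x))) \<in> borel_measurable lebesgue" for i
      by (rule measurable_compose[OF strongly_measurable_norm_borel[OF strongly_measurable_simple[OF step_simple[OF E_step[OF hL(3)]]]] measurable_ennreal])
  qed
  also have "\<dots> < \<infinity>"
  proof -
    have "E (m + int i) h \<in> Lp 1 lebesgue" for i using step_Lp[OF E_step[OF hL(3)]] by simp
    then have "(\<integral>\<^sup>+ x. ennreal (norm (E (m + int i) h x)) \<partial>lebesgue) = ennreal (Lp_norm 1 lebesgue (E (m + int i) h))" for i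
      using nn_integral_eq_Lp_norm[of "E (m + int i) h" 1 lebesgue] by simp
    then show ?thesis by (simp add: sum_ennreal)
  qed
  finally show ?thesis using hL(2) by (simp add: H1_def)
qed

text \<open>The window runs from the coarser of the two lower generations to the finer of the two
  upper ones, and B is the hull of both supports by cubes of the coarsest generation.\<close>

lemma good_frame:
  fixes f :: "real ^ 'd \<Rightarrow> 'b::banach" and g :: "real ^ 'd \<Rightarrow> 'c::banach"
  assumes f: "good f" and g: "good g"
  obtains m n B S where "dyadic_frame \<D> m n B S" "dyadic_frame.in_frame \<D> m n B f" "dyadic_frame.in_frame \<D> m n B g"
    "E m f = (\<lambda>x. 0)" "E m g = (\<lambda>x. 0)"
proof -
  obtain m1 K1 where 1: "m1 \<le> K1" "step K1 f" "E m1 f = (\<lambda>x. 0)" using f unfolding good_def by blast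
  obtain m2 K2 where 2: "m2 \<le> K2" "step K2 g" "E m2 g = (\<lambda>x. 0)" using g unfolding good_def by blast
  define m where "m = min m1 m2"
  define n where "n = nat (max K1 K2 - m)"
  define Z where "Z = {x. f x \<noteq> 0} \<union> {x. g x \<noteq> 0}"
  define B where "B = (\<Union>z\<in>Z. cube m z)"
  have mn: "m + int n = max K1 K2" using 1(1) 2(1) by (auto simp: n_def m_def)
  have B: "bounded B"
    unfolding B_def using 1(2) 2(2) by (intro bounded_cube_hull) (simp add: Z_def step_def bounded_support_def)
  obtain S where S: "finite S" "S \<subseteq> B" "inj_on (cube (m + int n)) S" "cube (m + int n) ` S = cube (m + int n) ` B"
    using cube_representatives[OF B] .
  have fr: "dyadic_frame \<D> m n B S"
  proof
    show "cube m x \<subseteq> B" if "x \<in> B" for x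
      using that cube_eq_iff unfolding B_def by blast
  qed (use B S in auto)
  have off: "f x = 0" "g x = 0" if "x \<notin> B" for x
    using that cube_self[of x m] unfolding B_def Z_def by blast+
  show thesis
  proof (rule that[OF fr])
    show "dyadic_frame.in_frame \<D> m n B f" "dyadic_frame.in_frame \<D> m n B g"
      unfolding dyadic_frame.in_frame_def[OF fr] dyadic_frame.K_def[OF fr] mn
      using 1(2) 2(2) off cube_const_mono[of K1 f "max K1 K2"] cube_const_mono[of K2 g "max K1 K2"]
      by (auto simp: step_def)
    show "E m f = (\<lambda>x. 0)" "E m g = (\<lambda>x. 0)"
      using E_zero_mono[OF step_L1_loc[OF 1(2)] 1(3)] E_zero_mono[OF step_L1_loc[OF 2(2)] 2(3)]
      by (auto simp: m_def)
  qed
qed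

text \<open>The duality hypothesis fixes no sign for c. It is tested with a Haar-like function: the
  indicator of a cube minus its average over the parent cube, times a nonzero functional. The H^1
  norm of this function is positive, and \<open>0 \<le> \<bar>L\<bar>\<close> forces c to be
  nonnegative.\<close>

lemma duality_constant_nonneg:
  fixes b :: "real ^ 'd \<Rightarrow> 'b::banach"
  assumes c: "H1_BMO_duality_constant TYPE('d) TYPE('b \<Rightarrow>\<^sub>L real) c" and b: "b \<in> BMO \<D>" "0 < BMO_norm \<D> b"
  shows "0 \<le> c"
proof -
  obtain v :: 'b where v: "v \<noteq> 0" using BMO_norm_pos_nontrivial[OF b(2)] by blast
  obtain e :: "'b \<Rightarrow>\<^sub>L real" where e: "blinfun_apply e v = norm v" by (rule norming_functional)
  have e0: "e \<noteq> 0" using e v by auto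
  define u where "u x = indicat_real (cube 0 0) x *\<^sub>R e" for x
  have "cube_const 0 u" unfolding cube_const_def u_def by (auto simp: indicator_def cube_eq_iff)
  moreover have "bounded_support u"
    unfolding bounded_support_def u_def by (rule bounded_subset[OF bounded_cube[of 0 0]]) (auto simp: indicator_def)
  ultimately have u: "step 0 u" by (simp add: step_def)
  define h where "h x = u x - E (- 1) u x" for x
  have h: "good h" "step 0 h" unfolding h_def using good_diff_E[OF u, of "- 1"] by auto
  have sub: "cube 0 0 \<subseteq> cube (- 1) 0" by (rule cube_mono) simp
  have "vol (- 1) *\<^sub>R E (- 1) u 0 = vol 0 *\<^sub>R e"
  proof -
    have "(\<lambda>y. indicat_real (cube (- 1) 0) y *\<^sub>R u y) = u"
      using sub by (auto simp: u_def indicator_def fun_eq_iff)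
    then show ?thesis
      using vol_pos[of "- 1"]
      by (simp add: E_eq average_cube Bochner_integral_indicator[OF cube_lmeasurable] measure_cube u_def[abs_def])
  qed
  moreover have "vol 0 < vol (- 1)" by (simp add: vol_def)
  ultimately have h0: "h 0 \<noteq> 0"
  proof -
    assume eq: "vol (- 1) *\<^sub>R E (- 1) u 0 = vol 0 *\<^sub>R e" and less: "vol 0 < vol (- 1)"
    have "u 0 = e" using cube_self by (simp add: u_def)
    then have "h 0 = 0 \<Longrightarrow> vol (- 1) *\<^sub>R e = vol 0 *\<^sub>R e" using eq by (simp add: h_def)
    then show ?thesis using e0 less by auto
  qed
  have hH: "h \<in> H1 \<D>" by (rule good_H1[OF h(1)])
  have "0 < H1_norm \<D> h"
  proof -
    have E0: "E 0 h = h" using h(2) by (intro E_self[of 0]) (auto simp: step_def)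
    have "ennreal (norm (h 0)) * emeasure lebesgue (cube 0 0) = (\<integral>\<^sup>+ x. ennreal (norm (h 0)) * indicator (cube 0 0) x \<partial>lebesgue)"
      by (simp add: nn_integral_cmult_indicator)
    also have "\<dots> \<le> (\<integral>\<^sup>+ x. ennreal (norm (h x)) \<partial>lebesgue)"
    proof (rule nn_integral_mono)
      fix x
      have "h x = h 0" if "x \<in> cube 0 0"
        using h(2) that cube_eq_iff[of x 0 0] cube_constD[of 0 h x 0] by (simp add: step_def)
      then show "ennreal (norm (h 0)) * indicator (cube 0 0) x \<le> ennreal (norm (h x))"
        by (simp add: indicator_def)
    qed
    also have "\<dots> \<le> H1_enorm \<D> h"
      unfolding H1_enorm_def
    proof (rule nn_integral_mono)
      fix x
      have "ennreal (norm (h x)) = ennreal (norm (E 0 h x))" by (simp add: E0)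
      also have "\<dots> \<le> (SUP k. ennreal (norm (E k h x)))" by (rule SUP_upper) simp
      finally show "ennreal (norm (h x)) \<le> (SUP k. ennreal (norm (E k h x)))" .
    qed
    finally have "ennreal (norm (h 0) * vol 0) \<le> H1_enorm \<D> h"
      using vol_pos[of 0] by (simp add: emeasure_cube ennreal_mult)
    moreover have "0 < norm (h 0) * vol 0" using h0 vol_pos[of 0] by simp
    moreover have "H1_enorm \<D> h < \<infinity>" using hH by (simp add: H1_def)
    ultimately show ?thesis
      unfolding H1_norm_def by (auto simp: enn2real_positive_iff less_top intro: order_less_le_trans[of 0 "ennreal (norm (h 0) * vol 0)"])
  qed
  moreover obtain L where "\<bar>L\<bar> \<le> c * BMO_norm \<D> (\<lambda>x. double_dual (b x)) * H1_norm \<D> h"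
    using c dyadic_system BMO_double_dual(1)[OF b(1)] hH unfolding H1_BMO_duality_constant_def by blast
  then have "0 \<le> c * (BMO_norm \<D> b * H1_norm \<D> h)"
    using abs_ge_zero order.trans by (fastforce simp: BMO_double_dual(2)[OF b(1)] mult.assoc)
  moreover have "0 < BMO_norm \<D> b * H1_norm \<D> h" using b(2) calculation(1) by (rule mult_pos_pos)
  ultimately show ?thesis by (metis zero_le_mult_iff not_le)
qed

text \<open>A step function h pairs integrably with the locally integrable b, so by dominated
  convergence the limit of the truncated integrals is the plain integral.\<close>

lemma duality_bound:
  fixes b :: "real ^ 'd \<Rightarrow> 'b::banach" and h :: "real ^ 'd \<Rightarrow> 'b \<Rightarrow>\<^sub>L real"
  assumes c: "H1_BMO_duality_constant TYPE('d) TYPE('b \<Rightarrow>\<^sub>L real) c" and b: "b \<in> BMO \<D>" and h: "good h"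
  shows "\<bar>LINT x|lebesgue. blinfun_apply (h x) (b x)\<bar> \<le> c * BMO_norm \<D> b * H1_norm \<D> h"
proof -
  have bL: "b \<in> L1_loc" using b by (simp add: BMO_def)
  obtain K where st: "step K h" using h unfolding good_def by blast
  define b' where "b' x = double_dual (b x)" for x
  obtain L where L: "(\<lambda>N::nat. LINT x|lebesgue. min 1 (real N / norm (b' x)) * blinfun_apply (b' x) (h x)) \<longlonglongrightarrow> L"
    "\<bar>L\<bar> \<le> c * BMO_norm \<D> b' * H1_norm \<D> h"
    using c dyadic_system BMO_double_dual(1)[OF b] good_H1[OF h]
    unfolding H1_BMO_duality_constant_def b'_def[abs_def] by blast
  have int: "integrable lebesgue (\<lambda>x. blinfun_apply (h x) (b x))"
    by (rule L1_real_integrable[OF step_bilinear_L1(1)[OF bounded_bilinear_blinfun_apply st bL]])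
  have [measurable]: "(\<lambda>x. blinfun_apply (h x) (b x)) \<in> borel_measurable lebesgue" using int by (rule borel_measurable_integrable)
  have [measurable]: "(\<lambda>x. norm (b x)) \<in> borel_measurable lebesgue"
    using bL by (intro strongly_measurable_norm_borel) (simp add: L1_loc_def)
  have "(\<lambda>N::nat. LINT x|lebesgue. min 1 (real N / norm (b' x)) * blinfun_apply (b' x) (h x))
      \<longlonglongrightarrow> (LINT x|lebesgue. blinfun_apply (h x) (b x))"
  proof (rule integral_dominated_convergence[where w="\<lambda>x. norm (blinfun_apply (h x) (b x))"])
    show "(\<lambda>x. min 1 (real N / norm (b' x)) * blinfun_apply (b' x) (h x)) \<in> borel_measurable lebesgue" for N
      unfolding b'_def norm_double_dual double_dual_apply by measurable
    show "AE x in lebesgue. norm (min 1 (real N / norm (b' x)) * blinfun_apply (b' x) (h x)) \<le> norm (blinfun_apply (h x) (b x))" for N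
      by (intro AE_I2) (auto simp: b'_def abs_mult intro!: mult_left_le_one_le)
    show "AE x in lebesgue. (\<lambda>N. min 1 (real N / norm (b' x)) * blinfun_apply (b' x) (h x)) \<longlonglongrightarrow> blinfun_apply (h x) (b x)"
    proof (intro AE_I2)
      fix x
      show "(\<lambda>N. min 1 (real N / norm (b' x)) * blinfun_apply (b' x) (h x)) \<longlonglongrightarrow> blinfun_apply (h x) (b x)"
      proof (cases "b x = 0")
        case False
        obtain N0 :: nat where N0: "norm (b x) \<le> real N0" using real_arch_simple by blast
        have "min 1 (real N / norm (b' x)) * blinfun_apply (b' x) (h x) = blinfun_apply (h x) (b x)" if "N0 \<le> N" for N
        proof -
          have "norm (b x) \<le> real N" using N0 that by linarith
          then have "1 \<le> real N / norm (b x)" using False by (simp add: le_divide_eq)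
          then show ?thesis by (simp add: b'_def norm_double_dual min_absorb1)
        qed
        then show ?thesis by (intro tendsto_eventually) (auto simp: eventually_sequentially)
      qed (simp add: b'_def)
    qed
    show "integrable lebesgue (\<lambda>x. norm (blinfun_apply (h x) (b x)))" using int by simp
  qed simp
  then have "L = (LINT x|lebesgue. blinfun_apply (h x) (b x))" using L(1) LIMSEQ_unique by blast
  then show ?thesis using L(2) BMO_double_dual(2)[OF b] by (simp add: b'_def[abs_def])
qed

lemma sym_paraproduct_form_bound:
  fixes b :: "real ^ 'd \<Rightarrow> 'x::banach \<Rightarrow>\<^sub>L 'y::banach"
  assumes c: "H1_BMO_duality_constant TYPE('d) TYPE(('x \<Rightarrow>\<^sub>L 'y) \<Rightarrow>\<^sub>L real) c" and b: "b \<in> BMO \<D>"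
    and p: "1 < p" "1 < q" "1 / p + 1 / q = 1"
    and X: "UMD_bound TYPE('x) p \<beta>X" and Y: "UMD_bound TYPE('y) p \<beta>Y"
    and f: "good f" and g: "good g"
  shows "\<bar>sym_paraproduct_form \<D> b f g\<bar>
    \<le> (c * (p * q + \<beta>X * \<beta>Y) * BMO_norm \<D> b) * Lp_norm p lebesgue f * Lp_norm q lebesgue g"
proof -
  have bL: "b \<in> L1_loc" using b by (simp add: BMO_def)
  have BMO0: "0 \<le> BMO_norm \<D> b" by (simp add: BMO_norm_def)
  obtain m n B S where fr: "dyadic_frame \<D> m n B S"
    and ff: "dyadic_frame.in_frame \<D> m n B f" "E m f = (\<lambda>x. 0)"
    and gg: "dyadic_frame.in_frame \<D> m n B g" "E m g = (\<lambda>x. 0)"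
    using good_frame[OF f g] by metis
  interpret fr: dyadic_frame \<D> m n B S by (rule fr)
  have "E m (fr.kernel f g) = (\<lambda>x. 0)"
    using fr.E_kernel[OF ff(1) gg(1), of m] by (simp add: fun_eq_iff)
  then have k: "good (fr.kernel f g)"
    unfolding good_def using fr.in_frame_step[OF fr.kernel_frame[OF ff(1) gg(1)]]
    by (intro exI[of _ m] exI[of _ fr.K]) (auto simp: fr.K_def)
  let ?R = "(p * q + \<beta>X * \<beta>Y) * Lp_norm p lebesgue f * Lp_norm q lebesgue g"
  have R0: "0 \<le> ?R"
    using X Y p by (auto simp: UMD_bound_def intro!: mult_nonneg_nonneg add_nonneg_nonneg)
  have H: "H1_norm \<D> (fr.kernel f g) \<le> ?R"
    unfolding H1_norm_def using fr.H1_enorm_kernel[OF p ff gg X Y] R0 by (intro enn2real_leI)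
  have "\<bar>sym_paraproduct_form \<D> b f g\<bar> \<le> c * BMO_norm \<D> b * H1_norm \<D> (fr.kernel f g)"
    unfolding fr.sym_paraproduct_form_eq[OF ff gg bL] by (rule duality_bound[OF c b k])
  also have "\<dots> \<le> c * BMO_norm \<D> b * ?R"
  \<comment> \<open>Inserting the bound for the H^1 norm requires a nonnegative factor in front. The
    sign of c is available only if b has positive BMO norm; otherwise both sides are 0.\<close>
  proof (cases "BMO_norm \<D> b = 0")
    case False
    then have "0 < BMO_norm \<D> b" using BMO0 by simp
    then have "0 \<le> c" by (rule duality_constant_nonneg[OF c b])
    then show ?thesis using H BMO0 by (intro mult_left_mono) auto
  qed simp
  finally show ?thesis by (simp add: mult_ac)
qed

end

section \<open>Representation of the form\<close>

text \<open>The weights \<open>2 ^ n\<close> turn the geometric decay in \<open>L\<^sup>p\<close> into a pointwise one.\<close>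

lemma Lp_rapid_Cauchy_converges:
  fixes s :: "nat \<Rightarrow> 'a::euclidean_space \<Rightarrow> 'b::banach"
  assumes p: "1 \<le> p" and s: "\<And>n. simple_function lebesgue (s n)" "\<And>n. s n \<in> Lp p lebesgue"
    and M: "0 \<le> M" and rapid: "\<And>n. Lp_norm p lebesgue (\<lambda>x. s (Suc n) x - s n x) \<le> M * (1 / 4) ^ n"
  obtains h where "h \<in> Lp p lebesgue" "(\<lambda>n. Lp_norm p lebesgue (\<lambda>x. h x - s n x)) \<longlonglongrightarrow> 0"
proof -
  have diffL: "(\<lambda>x. s m x - s n x) \<in> Lp p lebesgue" for m n by (rule Lp_diff[OF p s(2) s(2)])
  have m: "(\<lambda>x. ennreal (norm (s k x - s n x) powr p)) \<in> borel_measurable lebesgue" for k n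
  proof -
    have "(\<lambda>x. norm (s k x - s n x)) \<in> borel_measurable lebesgue"
      by (rule norm_diff_simple_borel(1)[OF strongly_measurable_simple[OF s(1)] s(1)])
    then show ?thesis by measurable
  qed
  define a where "a n x = norm (s (Suc n) x - s n x)" for n x
  \<comment> \<open>The decay with ratio 1 / 4 against the weight \<open>2 ^ n\<close> leaves
    \<open>(1 / 2) ^ n\<close>, and as p is at least 1 its p-th power is no larger; so the series of
    integrals converges.\<close>
  have bound: "(\<integral>\<^sup>+ x. ennreal ((2 ^ n) powr p) * ennreal (a n x powr p) \<partial>lebesgue) \<le> ennreal (M powr p * (1 / 2) ^ n)" for n
  proof -
    have "(\<integral>\<^sup>+ x. ennreal ((2 ^ n) powr p) * ennreal (a n x powr p) \<partial>lebesgue)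
        = ennreal ((2 ^ n) powr p) * ennreal (Lp_norm p lebesgue (\<lambda>x. s (Suc n) x - s n x) powr p)"
      unfolding a_def using nn_integral_eq_Lp_norm[OF diffL] p by (subst nn_integral_cmult[OF m]) simp
    also have "\<dots> \<le> ennreal ((2 ^ n) powr p) * ennreal ((M * (1 / 4) ^ n) powr p)"
      using rapid p by (intro mult_left_mono ennreal_leI powr_mono2) auto
    also have "\<dots> = ennreal ((2 ^ n * (M * (1 / 4) ^ n)) powr p)"
      by (simp only: ennreal_mult[symmetric] powr_ge_zero powr_mult[symmetric])
    also have "2 ^ n * (M * (1 / 4) ^ n) = M * (1 / 2) ^ n"
    proof -
      have q: "(1 / 4 :: real) ^ n = (1 / 2) ^ n * (1 / 2) ^ n" "(2 :: real) ^ n * (1 / 2) ^ n = 1"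
        by (simp_all flip: power_mult_distrib)
      have "2 ^ n * (M * ((1 / 2) ^ n * (1 / 2) ^ n)) = M * (1 / 2) ^ n * (2 ^ n * (1 / 2) ^ n)"
        by (simp only: mult_ac)
      then show ?thesis by (simp only: q mult_1_right)
    qed
    also have "(M * (1 / 2) ^ n) powr p = M powr p * ((1 / 2) ^ n) powr p" by (rule powr_mult)
    also have "ennreal \<dots> \<le> ennreal (M powr p * (1 / 2) ^ n)"
    proof (intro ennreal_leI mult_left_mono)
      have "((1 / 2 :: real) ^ n) powr p \<le> ((1 / 2) ^ n) powr 1"
        using p by (intro powr_mono') (auto simp: power_le_one)
      then show "((1 / 2 :: real) ^ n) powr p \<le> (1 / 2) ^ n" by simp
    qed simp
    finally show ?thesis .
  qed
  have tm: "(\<lambda>x. ennreal ((2 ^ n) powr p) * ennreal (a n x powr p)) \<in> borel_measurable lebesgue" for n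
    unfolding a_def by (intro borel_measurable_times_ennreal m) simp
  have "(\<integral>\<^sup>+ x. (\<Sum>n. ennreal ((2 ^ n) powr p) * ennreal (a n x powr p)) \<partial>lebesgue)
      = (\<Sum>n. \<integral>\<^sup>+ x. ennreal ((2 ^ n) powr p) * ennreal (a n x powr p) \<partial>lebesgue)"
    by (rule nn_integral_suminf[OF tm])
  also have "\<dots> \<le> (\<Sum>n. ennreal (M powr p * (1 / 2) ^ n))" using bound by (intro suminf_le) auto
  also have "\<dots> < \<infinity>"
  proof -
    have "summable (\<lambda>n. M powr p * (1 / 2 :: real) ^ n)" by (intro summable_mult summable_geometric) simp
    then show ?thesis by (simp add: ennreal_suminf_neq_top less_top)
  qed
  finally have fin: "(\<integral>\<^sup>+ x. (\<Sum>n. ennreal ((2 ^ n) powr p) * ennreal (a n x powr p)) \<partial>lebesgue) < \<infinity>" .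
  have "(\<lambda>x. \<Sum>n. ennreal ((2 ^ n) powr p) * ennreal (a n x powr p)) \<in> borel_measurable lebesgue"
    by (rule borel_measurable_suminf_order[OF tm])
  then have "AE x in lebesgue. (\<Sum>n. ennreal ((2 ^ n) powr p) * ennreal (a n x powr p)) \<noteq> \<infinity>"
    by (rule nn_integral_PInf_AE) (rule less_imp_neq[OF fin])
  then have conv: "AE x in lebesgue. convergent (\<lambda>n. s n x)"
  proof eventually_elim
    case (elim x)
    obtain c where c: "0 \<le> c" "(\<Sum>n. ennreal ((2 ^ n) powr p) * ennreal (a n x powr p)) = ennreal c"
      using elim by (cases "\<Sum>n. ennreal ((2 ^ n) powr p) * ennreal (a n x powr p)") auto
    have le: "a n x \<le> c powr (1 / p) * (1 / 2) ^ n" for n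
    proof -
      have "(\<Sum>n\<in>{n}. ennreal ((2 ^ n) powr p) * ennreal (a n x powr p)) \<le> ennreal c"
        unfolding c(2)[symmetric] by (rule sum_le_suminf) auto
      then have "(2 ^ n * a n x) powr p \<le> c"
        using c(1) by (simp add: ennreal_mult[symmetric] powr_mult)
      then have "((2 ^ n * a n x) powr p) powr (1 / p) \<le> c powr (1 / p)" using p by (intro powr_mono2) auto
      then have "2 ^ n * a n x \<le> c powr (1 / p)" using p by (simp add: powr_powr a_def)
      then show ?thesis by (simp add: power_one_over field_simps)
    qed
    have geo: "summable (\<lambda>n. c powr (1 / p) * (1 / 2 :: real) ^ n)"
      by (intro summable_mult summable_geometric) simp
    have "summable (\<lambda>n. s (Suc n) x - s n x)"
      by (rule summable_comparison_test'[OF geo]) (rule le[unfolded a_def])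
    then have "convergent (\<lambda>n. \<Sum>i<n. s (Suc i) x - s i x)" by (simp add: summable_iff_convergent)
    then have "convergent (\<lambda>n. s n x - s 0 x)" by (simp only: sum_lessThan_telescope[of "\<lambda>i. s i x"])
    then have "convergent (\<lambda>n. (s n x - s 0 x) + s 0 x)" by (intro convergent_add convergent_const)
    then show ?case by simp
  qed
  define h where "h x = lim (\<lambda>n. s n x)" for x
  have lim: "AE x in lebesgue. (\<lambda>n. s n x) \<longlonglongrightarrow> h x"
    using conv by eventually_elim (simp add: h_def convergent_LIMSEQ_iff)
  have hm: "strongly_measurable lebesgue h"
    unfolding strongly_measurable_def using s(1) lim by blast
  \<comment> \<open>The factor 2 is a round bound for the geometric sum 4 / 3.\<close>
  have tail: "Lp_norm p lebesgue (\<lambda>x. s (n + k) x - s n x) \<le> 2 * M * (1 / 4) ^ n" for n k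
  proof -
    have "Lp_norm p lebesgue (\<lambda>x. s (n + k) x - s n x) \<le> (\<Sum>i<k. M * (1 / 4) ^ (n + i))"
    proof (induction k)
      case 0
      have "Lp_norm p lebesgue (\<lambda>x::'a. 0::'b) = 0" using p by (simp add: Lp_norm_def)
      then show ?case by simp
    next
      case (Suc k)
      have "Lp_norm p lebesgue (\<lambda>x. s (n + Suc k) x - s n x)
          = Lp_norm p lebesgue (\<lambda>x. (s (n + k) x - s n x) + (s (Suc (n + k)) x - s (n + k) x))" by simp
      also have "\<dots> \<le> Lp_norm p lebesgue (\<lambda>x. s (n + k) x - s n x) + Lp_norm p lebesgue (\<lambda>x. s (Suc (n + k)) x - s (n + k) x)"
        by (rule Lp_norm_triangle[OF p diffL diffL])
      also have "\<dots> \<le> (\<Sum>i<k. M * (1 / 4) ^ (n + i)) + M * (1 / 4) ^ (n + k)" using Suc rapid by (intro add_mono)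
      finally show ?case by simp
    qed
    also have "\<dots> = M * (1 / 4) ^ n * (\<Sum>i<k. (1 / 4) ^ i)" by (simp add: power_add sum_distrib_left mult_ac)
    also have "\<dots> \<le> M * (1 / 4) ^ n * 2"
    proof (intro mult_left_mono)
      have "(\<Sum>i<k. (1 / 4 :: real) ^ i) = (1 - (1 / 4) ^ k) * (4 / 3)" by (simp add: sum_gp_strict)
      also have "\<dots> \<le> 1 * (4 / 3)" by (intro mult_right_mono) auto
      finally show "(\<Sum>i<k. (1 / 4 :: real) ^ i) \<le> 2" by simp
    qed (use M in auto)
    finally show ?thesis by (simp add: mult_ac)
  qed
  \<comment> \<open>Fatou's lemma in k turns the uniform tail estimate into an estimate for the
    pointwise limit h.\<close>
  have close: "(\<integral>\<^sup>+ x. ennreal (norm (h x - s n x) powr p) \<partial>lebesgue) \<le> ennreal ((2 * M * (1 / 4) ^ n) powr p)" for n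
  proof -
    have "(\<integral>\<^sup>+ x. ennreal (norm (h x - s n x) powr p) \<partial>lebesgue)
        = (\<integral>\<^sup>+ x. liminf (\<lambda>k. ennreal (norm (s (n + k) x - s n x) powr p)) \<partial>lebesgue)"
    proof (rule nn_integral_cong_AE)
      show "AE x in lebesgue. ennreal (norm (h x - s n x) powr p) = liminf (\<lambda>k. ennreal (norm (s (n + k) x - s n x) powr p))"
        using lim
      proof eventually_elim
        case (elim x)
        then have "(\<lambda>k. s (n + k) x) \<longlonglongrightarrow> h x" using LIMSEQ_ignore_initial_segment[of "\<lambda>k. s k x" "h x" n] by (simp add: add.commute)
        then have "(\<lambda>k. ennreal (norm (s (n + k) x - s n x) powr p)) \<longlonglongrightarrow> ennreal (norm (h x - s n x) powr p)"
          using p by (intro tendsto_ennrealI tendsto_powr2 tendsto_norm tendsto_diff tendsto_const) auto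
        then show ?case by (intro lim_imp_Liminf[symmetric]) auto
      qed
    qed
    also have "\<dots> \<le> liminf (\<lambda>k. \<integral>\<^sup>+ x. ennreal (norm (s (n + k) x - s n x) powr p) \<partial>lebesgue)"
      by (rule nn_integral_liminf[OF m])
    also have "\<dots> \<le> liminf (\<lambda>k::nat. ennreal ((2 * M * (1 / 4) ^ n) powr p))"
    proof (intro Liminf_mono always_eventually allI)
      fix k
      show "(\<integral>\<^sup>+ x. ennreal (norm (s (n + k) x - s n x) powr p) \<partial>lebesgue) \<le> ennreal ((2 * M * (1 / 4) ^ n) powr p)"
        using nn_integral_eq_Lp_norm[OF diffL, of "n + k" n] tail[of n k] p by (simp add: ennreal_leI powr_mono2)
    qed
    also have "\<dots> = ennreal ((2 * M * (1 / 4) ^ n) powr p)" by (simp add: Liminf_const)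
    finally show ?thesis .
  qed
  have "(\<lambda>x. h x - s 0 x) \<in> Lp p lebesgue"
    using close[of 0] strongly_measurable_diff[OF hm strongly_measurable_simple[OF s(1)]]
    by (auto simp: Lp_def intro: order_le_less_trans)
  from Lp_add[OF p this s(2)[of 0]] have "h \<in> Lp p lebesgue" by simp
  moreover have "(\<lambda>n. Lp_norm p lebesgue (\<lambda>x. h x - s n x)) \<longlonglongrightarrow> 0"
  proof (rule tendsto_sandwich[OF _ _ tendsto_const])
    have "Lp_norm p lebesgue (\<lambda>x. h x - s n x) \<le> 2 * M * (1 / 4) ^ n" for n
    proof -
      have "Lp_norm p lebesgue (\<lambda>x. h x - s n x) \<le> ((2 * M * (1 / 4) ^ n) powr p) powr (1 / p)"
        using close p by (intro Lp_norm_le_root) auto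
      then show ?thesis using p M by (simp add: powr_powr)
    qed
    then show "\<forall>\<^sub>F n in sequentially. Lp_norm p lebesgue (\<lambda>x. h x - s n x) \<le> 2 * M * (1 / 4) ^ n"
      by (intro always_eventually allI)
    have "(\<lambda>n. 2 * M * (1 / 4 :: real) ^ n) \<longlonglongrightarrow> 2 * M * 0"
      by (intro tendsto_mult tendsto_const LIMSEQ_power_zero) simp
    then show "(\<lambda>n. 2 * M * (1 / 4 :: real) ^ n) \<longlonglongrightarrow> 0" by simp
  qed simp
  ultimately show thesis by (rule that)
qed

context dyadic
begin

section \<open>Good functions as a dense class containing all admissible arguments\<close>

lemma good_combine:
  fixes f g :: "real ^ 'd \<Rightarrow> 'b::banach"
  assumes f: "good f" and g: "good g"
  shows "good (\<lambda>x. f x + r *\<^sub>R g x)"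
proof -
  obtain m1 K1 where 1: "m1 \<le> K1" "step K1 f" "E m1 f = (\<lambda>x. 0)" using f unfolding good_def by blast
  obtain m2 K2 where 2: "m2 \<le> K2" "step K2 g" "E m2 g = (\<lambda>x. 0)" using g unfolding good_def by blast
  let ?m = "min m1 m2" and ?K = "max K1 K2"
  have st: "step ?K f" "step ?K (\<lambda>x. r *\<^sub>R g x)"
    using step_mono[OF 1(2)] step_compose[OF step_mono[OF 2(2), of ?K], of "\<lambda>v. r *\<^sub>R v"] by auto
  have "step ?K (\<lambda>x. f x + r *\<^sub>R g x)" using step_compose2[OF st, of "(+)"] by simp
  moreover have "E ?m f = (\<lambda>x. 0)" "E ?m g = (\<lambda>x. 0)"
    using E_zero_mono[OF step_L1_loc[OF 1(2)] 1(3)] E_zero_mono[OF step_L1_loc[OF 2(2)] 2(3)] by auto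
  then have "E ?m (\<lambda>x. f x + r *\<^sub>R g x) = (\<lambda>x. 0)"
    using E_add[OF step_L1_loc[OF st(1)] step_L1_loc[OF st(2)]] E_scaleR[OF step_L1_loc[OF 2(2)]] by simp
  moreover have "?m \<le> ?K" using 1(1) by auto
  ultimately show ?thesis unfolding good_def by blast
qed

lemma good_Lp: "good f \<Longrightarrow> 1 \<le> p \<Longrightarrow> f \<in> Lp p lebesgue"
  unfolding good_def using step_Lp by blast

text \<open>Step functions are dense, and subtracting the average over very large cubes changes them
  little in L^p because p exceeds 1.\<close>

lemma good_dense:
  fixes f :: "real ^ 'd \<Rightarrow> 'b::banach"
  assumes p: "1 < p" and f: "f \<in> Lp p lebesgue" and e: "0 < e"
  obtains g where "good g" "Lp_norm p lebesgue (\<lambda>x. f x - g x) < e"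
proof -
  define \<delta> where "\<delta> = (e / 3) powr p"
  have \<delta>: "0 < \<delta>" "\<delta> powr (1 / p) = e / 3" using e p by (simp_all add: \<delta>_def powr_powr)
  obtain K s where s: "step K s" "(\<integral>\<^sup>+ x. ennreal (norm (f x - s x) powr p) \<partial>lebesgue) < ennreal \<delta>"
    using step_dense[OF less_imp_le[OF p] f] \<delta>(1) unfolding step_approximable_def by blast
  have 1: "Lp_norm p lebesgue (\<lambda>x. f x - s x) \<le> e / 3"
    unfolding \<delta>(2)[symmetric] by (rule Lp_norm_le_root) (use s(2) \<delta>(1) p in auto)
  have "(\<lambda>n. Lp_norm p lebesgue (E (- int n) s)) \<longlonglongrightarrow> 0"
    using p by (intro Lp_norm_tendsto_0 E_at_bot[OF s(1)]) auto
  then have "\<forall>\<^sub>F n in sequentially. Lp_norm p lebesgue (E (- int n) s) < e / 3"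
    by (rule order_tendstoD) (use e in simp)
  then obtain N where N: "\<And>n. N \<le> n \<Longrightarrow> Lp_norm p lebesgue (E (- int n) s) < e / 3"
    by (auto simp: eventually_sequentially)
  define l where "l = - int (max N (nat (- K)))"
  have l: "l \<le> K" "Lp_norm p lebesgue (E l s) < e / 3" using N by (auto simp: l_def)
  have L: "s \<in> Lp p lebesgue" "E l s \<in> Lp p lebesgue"
    using s(1) p by (auto intro!: step_Lp[OF s(1)] step_Lp[OF E_step] simp: step_def)
  have "Lp_norm p lebesgue (\<lambda>x. (f x - s x) + E l s x) \<le> Lp_norm p lebesgue (\<lambda>x. f x - s x) + Lp_norm p lebesgue (E l s)"
    using p L f by (intro Lp_norm_triangle Lp_diff) auto
  then have "Lp_norm p lebesgue (\<lambda>x. f x - (s x - E l s x)) < e"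
    using 1 l(2) e by (simp add: algebra_simps)
  then show thesis using good_diff_E(1)[OF s(1) l(1)] that by blast
qed

text \<open>The sum of the finitely many differences is constant on the cubes of the finest
  generation involved. Compactness of the support of f yields bounded support, and finiteness of the
  expansion yields zero averages at coarse generations.\<close>

lemma finite_expansion_good:
  fixes f :: "real ^ 'd \<Rightarrow> 'b::banach"
  assumes r: "1 \<le> r" and f: "f \<in> Lp_c r" "finite_dyadic_expansion \<D> f"
  obtains f' where "good f'" "AE x in lebesgue. f x = f' x"
proof -
  define J where "J = {k. \<exists>x. D k f x \<noteq> 0}"
  have J: "finite J" "AE x in lebesgue. f x = (\<Sum>k\<in>J. D k f x)"
    using f(2) unfolding finite_dyadic_expansion_def by (auto simp: Let_def J_def)
  obtain C where C: "compact C" "AE x in lebesgue. x \<notin> C \<longrightarrow> f x = 0" and fr: "f \<in> Lp r lebesgue"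
    using f(1) unfolding Lp_c_def by blast
  have Cs: "C \<in> sets lebesgue" "bounded C" using C(1) fmeasurableD[OF lmeasurable_compact] compact_imp_bounded by blast+
  have "AE x in lebesgue. indicat_real C x *\<^sub>R f x = f x" using C(2) by eventually_elim (auto simp: indicator_def)
  then have f1: "f \<in> Lp 1 lebesgue"
    by (rule Lp_cong_AE[OF L1_loc_restrict[OF Lp_subset_L1_loc[OF r fr] Cs]])
  define f' where "f' x = (\<Sum>k\<in>J. D k f x)" for x
  \<comment> \<open>Inserting 0 covers an empty J; m is then placed strictly below all members of
    J.\<close>
  define K where "K = Max (insert 0 J)"
  define m where "m = min (Min (insert 0 J)) K - 1"
  have cK: "cube_const K f'"
    unfolding f'_def[abs_def] using J(1)
    by (intro cube_const_sum cube_const_mono[OF D_cube_const]) (simp add: K_def)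
  have AEf: "AE x in lebesgue. f x = f' x" using J(2) by (simp add: f'_def)
  \<comment> \<open>On the cube of x the function f' has a constant nonzero value. If that cube
    missed C, then f would vanish almost everywhere on a set of positive measure and still agree
    with f' there.\<close>
  have supp: "x \<in> (\<Union>z\<in>C. cube K z)" if x: "f' x \<noteq> 0" for x
  proof (rule ccontr)
    assume out: "x \<notin> (\<Union>z\<in>C. cube K z)"
    have "AE y in lebesgue. \<not> y \<in> cube K x"
      using AEf C(2)
    proof eventually_elim
      case (elim y)
      show ?case
      proof
        assume y: "y \<in> cube K x"
        then have "x \<in> cube K y" unfolding cube_eq_iff by (rule sym)
        then have "y \<notin> C" using out by blast
        moreover have "f' y = f' x" using y unfolding cube_eq_iff by (rule cube_constD[OF cK])
        ultimately show False using elim x by simp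
      qed
    qed
    then have "emeasure lebesgue {y \<in> space lebesgue. y \<in> cube K x} = 0" by (rule emeasure_eq_0_AE)
    then show False using emeasure_cube[of K x] vol_pos[of K] by simp
  qed
  have "bounded_support f'"
    unfolding bounded_support_def
    by (rule bounded_subset[OF bounded_cube_hull[OF Cs(2), of K]]) (use supp in blast)
  then have st: "step K f'" using cK by (simp add: step_def)
  have E_eq': "E j f = E m f" if "j \<le> m" for j
    using that
  proof (induction j rule: int_le_induct)
    case (step i)
    have "i < Min (insert 0 J)" using step(1) by (simp add: m_def)
    then have "i \<notin> J" using Min_le[of "insert 0 J" i] J(1) by fastforce
    then have "D i f = (\<lambda>x. 0)" by (auto simp: J_def)
    then have "E i f = E (i - 1) f" by (simp add: dyadic_D_def fun_eq_iff)
    then show ?case using step by simp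
  qed simp
  \<comment> \<open>No differences occur from m downwards, so these averages all coincide, while by
    \<open>norm_E_le\<close> they tend to 0.\<close>
  have "E m f x = 0" for x
  proof -
    have le: "norm (E m f x) \<le> Lp_norm 1 lebesgue f * (1 / vol (- int n))" if "nat (- m) \<le> n" for n
      using norm_E_le[OF f1, of "- int n" x] E_eq'[of "- int n"] that by simp
    have "(\<lambda>n. Lp_norm 1 lebesgue f * (1 / vol (- int n))) \<longlonglongrightarrow> Lp_norm 1 lebesgue f * 0"
      by (intro tendsto_mult tendsto_const vol_at_bot)
    then have "norm (E m f x) \<le> Lp_norm 1 lebesgue f * 0" by (rule LIMSEQ_le_const) (use le in blast)
    then show ?thesis by simp
  qed
  then have "E m f' = (\<lambda>x. 0)" using E_cong_AE[OF AEf, of m] by (simp add: fun_eq_iff)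
  moreover have "m \<le> K" by (simp add: m_def)
  ultimately have "good f'" unfolding good_def using st by blast
  then show thesis using AEf by (rule that)
qed

text \<open>Self-adjointness of averaging: by the pull-out property both sides are the pairing of
  \<open>E k g\<close> with \<open>E k u\<close>.\<close>

lemma E_adjoint:
  fixes u :: "real ^ 'd \<Rightarrow> 'y::banach" and g :: "real ^ 'd \<Rightarrow> 'y \<Rightarrow>\<^sub>L real"
  assumes u: "u \<in> Lp 1 lebesgue" "bounded_support u" and g: "step K g"
  shows "(LINT x|lebesgue. blinfun_apply (g x) (E k u x)) = (LINT x|lebesgue. blinfun_apply (E k g x) (u x))"
proof -
  have uL: "u \<in> L1_loc" using u(1) by (intro Lp_subset_L1_loc[of 1]) auto
  have Eu: "step k (E k u)" by (rule E_step[OF u(2)])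
  have Eg: "step k (E k g)" using g by (intro E_step) (simp add: step_def)
  note bl = bounded_bilinear_blinfun_apply
  have "(LINT x|lebesgue. blinfun_apply (g x) (E k u x)) = Bochner_integral lebesgue (\<lambda>x. blinfun_apply (g x) (E k u x))"
    by (rule Bochner_integral_real[symmetric, OF step_bilinear_L1(1)[OF bl g step_L1_loc[OF Eu]]])
  also have "\<dots> = Bochner_integral lebesgue (E k (\<lambda>x. blinfun_apply (g x) (E k u x)))"
    by (rule E_integral(1)[symmetric, OF step_bilinear_L1[OF bl g step_L1_loc[OF Eu]]])
  also have "E k (\<lambda>x. blinfun_apply (g x) (E k u x)) = (\<lambda>x. blinfun_apply (E k g x) (E k u x))"
    by (rule E_cube_const_mult[OF bounded_bilinear.flip[OF bl] E_cube_const step_L1_loc[OF g]])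
  also have "\<dots> = E k (\<lambda>x. blinfun_apply (E k g x) (u x))"
    by (rule E_cube_const_mult[symmetric, OF bl E_cube_const uL])
  also have "Bochner_integral lebesgue \<dots> = Bochner_integral lebesgue (\<lambda>x. blinfun_apply (E k g x) (u x))"
    by (rule E_integral(1)[OF step_bilinear_L1[OF bl Eg uL]])
  also have "\<dots> = (LINT x|lebesgue. blinfun_apply (E k g x) (u x))"
    by (rule Bochner_integral_real[OF step_bilinear_L1(1)[OF bl Eg uL]])
  finally show ?thesis .
qed

lemma pairing_integrable:
  fixes u :: "real ^ 'd \<Rightarrow> 'y::banach" and g :: "real ^ 'd \<Rightarrow> 'y \<Rightarrow>\<^sub>L real"
  assumes "u \<in> L1_loc" "step K g"
  shows "integrable lebesgue (\<lambda>x. blinfun_apply (g x) (u x))"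
  by (rule L1_real_integrable[OF step_bilinear_L1(1)[OF bounded_bilinear_blinfun_apply assms(2,1)]])

lemma D_adjoint:
  fixes u :: "real ^ 'd \<Rightarrow> 'y::banach" and g :: "real ^ 'd \<Rightarrow> 'y \<Rightarrow>\<^sub>L real"
  assumes u: "u \<in> Lp 1 lebesgue" "bounded_support u" and g: "step K g"
  shows "(LINT x|lebesgue. blinfun_apply (g x) (D k u x)) = (LINT x|lebesgue. blinfun_apply (D k g x) (u x))"
proof -
  have uL: "u \<in> L1_loc" using u(1) by (intro Lp_subset_L1_loc[of 1]) auto
  have gb: "bounded_support g" using g by (simp add: step_def)
  have i1: "integrable lebesgue (\<lambda>x. blinfun_apply (g x) (E j u x))" for j
    by (rule pairing_integrable[OF step_L1_loc[OF E_step[OF u(2)]] g])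
  have i2: "integrable lebesgue (\<lambda>x. blinfun_apply (E j g x) (u x))" for j
    by (rule pairing_integrable[OF uL E_step[OF gb]])
  show ?thesis
    unfolding dyadic_D_def blinfun.diff_left blinfun.diff_right
    by (simp only: Bochner_Integration.integral_diff[OF i1 i1] Bochner_Integration.integral_diff[OF i2 i2] E_adjoint[OF u g])
qed

text \<open>The summand of generation \<open>k\<close> of the form, moved to the side of \<open>f\<close>.\<close>

definition paraproduct_term ::
    "(real ^ 'd \<Rightarrow> 'x::banach \<Rightarrow>\<^sub>L 'y::banach) \<Rightarrow> (real ^ 'd \<Rightarrow> 'x) \<Rightarrow> int \<Rightarrow> real ^ 'd \<Rightarrow> 'y" where
  "paraproduct_term b f k x = D k (\<lambda>s. blinfun_apply (b s) (E (k - 1) f s)) x + E (k - 1) (\<lambda>s. blinfun_apply (b s) (D k f s)) x"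

lemma mult_step_L1:
  fixes b :: "real ^ 'd \<Rightarrow> 'x::banach \<Rightarrow>\<^sub>L 'y::banach"
  assumes "b \<in> L1_loc" "step k u"
  shows "(\<lambda>s. blinfun_apply (b s) (u s)) \<in> Lp 1 lebesgue" "bounded_support (\<lambda>s. blinfun_apply (b s) (u s))"
  using step_bilinear_L1[OF bounded_bilinear.flip[OF bounded_bilinear_blinfun_apply] assms(2,1)] by auto

lemma paraproduct_term_step:
  fixes b :: "real ^ 'd \<Rightarrow> 'x::banach \<Rightarrow>\<^sub>L 'y::banach"
  assumes b: "b \<in> L1_loc" and f: "bounded_support f"
  shows "step k (paraproduct_term b f k)"
  using step_compose2[OF D_step[OF mult_step_L1(2)[OF b E_step[OF f, of "k - 1"]], of k]
      step_mono[OF E_step[OF mult_step_L1(2)[OF b D_step[OF f, of k]], of "k - 1"], of k], of "(+)"]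
  by (simp add: paraproduct_term_def[abs_def])

lemma pairing_paraproduct_term:
  fixes b :: "real ^ 'd \<Rightarrow> 'x::banach \<Rightarrow>\<^sub>L 'y::banach" and g :: "real ^ 'd \<Rightarrow> 'y \<Rightarrow>\<^sub>L real"
  assumes b: "b \<in> L1_loc" and f: "bounded_support f" and g: "step K g"
  shows "(LINT s|lebesgue. blinfun_apply (D k g s) (blinfun_apply (b s) (E (k - 1) f s)) +
     blinfun_apply (E (k - 1) g s) (blinfun_apply (b s) (D k f s)))
    = (LINT s|lebesgue. blinfun_apply (g s) (paraproduct_term b f k s))"
proof -
  have gb: "bounded_support g" using g by (simp add: step_def)
  note u = mult_step_L1[OF b E_step[OF f, of "k - 1"]] and v = mult_step_L1[OF b D_step[OF f, of k]]
  have uL: "(\<lambda>s. blinfun_apply (b s) (E (k - 1) f s)) \<in> L1_loc" "(\<lambda>s. blinfun_apply (b s) (D k f s)) \<in> L1_loc"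
    using u(1) v(1) by (auto intro!: Lp_subset_L1_loc[of 1])
  have "(LINT s|lebesgue. blinfun_apply (D k g s) (blinfun_apply (b s) (E (k - 1) f s)) +
       blinfun_apply (E (k - 1) g s) (blinfun_apply (b s) (D k f s)))
      = (LINT s|lebesgue. blinfun_apply (D k g s) (blinfun_apply (b s) (E (k - 1) f s)))
        + (LINT s|lebesgue. blinfun_apply (E (k - 1) g s) (blinfun_apply (b s) (D k f s)))"
    by (rule Bochner_Integration.integral_add[OF pairing_integrable[OF uL(1) D_step[OF gb]] pairing_integrable[OF uL(2) E_step[OF gb]]])
  also have "\<dots> = (LINT s|lebesgue. blinfun_apply (g s) (D k (\<lambda>s. blinfun_apply (b s) (E (k - 1) f s)) s))
        + (LINT s|lebesgue. blinfun_apply (g s) (E (k - 1) (\<lambda>s. blinfun_apply (b s) (D k f s)) s))"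
    by (simp only: D_adjoint[OF u g] E_adjoint[OF v g])
  also have "\<dots> = (LINT s|lebesgue. blinfun_apply (g s) (D k (\<lambda>s. blinfun_apply (b s) (E (k - 1) f s)) s)
        + blinfun_apply (g s) (E (k - 1) (\<lambda>s. blinfun_apply (b s) (D k f s)) s))"
    by (rule Bochner_Integration.integral_add[symmetric, OF pairing_integrable[OF step_L1_loc[OF D_step[OF u(2)]] g]
          pairing_integrable[OF step_L1_loc[OF E_step[OF v(2)]] g]])
  finally show ?thesis by (simp add: paraproduct_term_def blinfun.add_right)
qed

text \<open>Every summand contains f through \<open>E (k - 1) f\<close> or \<open>D k f\<close>, so
  up to generation m the zero averages of f kill it; beyond m + n the differences of both arguments
  vanish.\<close>

lemma sym_paraproduct_form_eq_sum:
  fixes b :: "real ^ 'd \<Rightarrow> 'x::banach \<Rightarrow>\<^sub>L 'y::banach" and g :: "real ^ 'd \<Rightarrow> 'y \<Rightarrow>\<^sub>L real"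
  assumes b: "b \<in> L1_loc" and f: "step (m + int n) f" "E m f = (\<lambda>x. 0)" and g: "step (m + int n) g"
  shows "sym_paraproduct_form \<D> b f g
    = (\<Sum>i<n. (LINT s|lebesgue. blinfun_apply (g s) (paraproduct_term b f (m + 1 + int i) s)))"
proof -
  have fL: "f \<in> L1_loc" "bounded_support f" using step_L1_loc[OF f(1)] f(1) by (auto simp: step_def)
  define c where "c k = (LINT s|lebesgue.
     blinfun_apply (D k g s) (blinfun_apply (b s) (E (k - 1) f s)) +
     blinfun_apply (E (k - 1) g s) (blinfun_apply (b s) (D k f s)))" for k
  have c0: "c k = 0" if k: "k \<notin> (\<lambda>i. m + 1 + int i) ` {..<n}" for k
  proof (cases "k \<le> m")
    case True
    then have "E k f = (\<lambda>x. 0)" "E (k - 1) f = (\<lambda>x. 0)"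
      using E_zero_mono[OF fL(1) f(2)] by auto
    then show ?thesis by (simp add: c_def dyadic_D_def)
  next
    case False
    have "m + int n < k"
    proof (rule ccontr)
      assume "\<not> m + int n < k"
      then have "k = m + 1 + int (nat (k - m - 1))" "nat (k - m - 1) < n" using False by auto
      then show False using k by blast
    qed
    then have "E k f = f" "E (k - 1) f = f" "E k g = g" "E (k - 1) g = g"
      using f(1) g by (auto intro!: E_self[of "m + int n"] simp: step_def)
    then show ?thesis by (simp add: c_def dyadic_D_def)
  qed
  have "sym_paraproduct_form \<D> b f g = (\<Sum>\<^sub>\<infinity>k\<in>UNIV. c k)"
    by (simp add: sym_paraproduct_form_def c_def)
  also have "\<dots> = (\<Sum>\<^sub>\<infinity>k\<in>(\<lambda>i. m + 1 + int i) ` {..<n}. c k)"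
    using c0 by (intro infsum_cong_neutral) auto
  also have "\<dots> = (\<Sum>k\<in>(\<lambda>i. m + 1 + int i) ` {..<n}. c k)" by (rule infsum_finite) simp
  also have "\<dots> = (\<Sum>i<n. c (m + 1 + int i))"
    by (subst sum.reindex) (auto simp: inj_on_def)
  finally show ?thesis unfolding c_def pairing_paraproduct_term[OF b fL(2) g] .
qed

text \<open>For \<open>k > K\<close> the term of generation \<open>k\<close> is \<open>D k (b f)\<close>; these terms sum up to
  \<open>b f - E K (b f)\<close>.\<close>

definition represents ::
    "(real ^ 'd \<Rightarrow> 'x::banach \<Rightarrow>\<^sub>L 'y::banach) \<Rightarrow> (real ^ 'd \<Rightarrow> 'x) \<Rightarrow> (real ^ 'd \<Rightarrow> 'y) \<Rightarrow> bool" where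
  "represents b f F \<longleftrightarrow> good f \<and> F \<in> Lp 1 lebesgue \<and> bounded_support F \<and>
     (\<forall>g :: real ^ 'd \<Rightarrow> 'y \<Rightarrow>\<^sub>L real. good g \<longrightarrow> (LINT s|lebesgue. blinfun_apply (g s) (F s)) = sym_paraproduct_form \<D> b f g)"

text \<open>The number of nonzero terms grows with the generation of g, but the representing
  function must not depend on g; the closed form of the tail achieves this. Only integrability is
  obtained here, as b is merely locally integrable; membership in L^p comes from duality.\<close>

lemma represents_exists:
  fixes b :: "real ^ 'd \<Rightarrow> 'x::banach \<Rightarrow>\<^sub>L 'y::banach"
  assumes b: "b \<in> L1_loc" and f: "good f"
  obtains F where "represents b f F"
proof -
  obtain m K where mK: "m \<le> K" "step K f" "E m f = (\<lambda>x. 0)" using f unfolding good_def by blast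
  define n where "n = nat (K - m)"
  have K: "m + int n = K" using mK(1) by (simp add: n_def)
  have fb: "bounded_support f" using mK(2) by (simp add: step_def)
  define u where "u s = blinfun_apply (b s) (f s)" for s
  have u: "u \<in> Lp 1 lebesgue" "bounded_support u" unfolding u_def[abs_def] by (rule mult_step_L1[OF b mK(2)])+
  have uL: "u \<in> L1_loc" using u(1) by (intro Lp_subset_L1_loc[of 1]) auto
  define U where "U k = paraproduct_term b f k" for k
  have U: "step k (U k)" for k unfolding U_def by (rule paraproduct_term_step[OF b fb])
  have U_tail: "U k = D k u" if "K < k" for k
  proof -
    have "E (k - 1) f = f" "E k f = f" using mK(2) that by (auto intro!: E_self[of K] simp: step_def)
    then show ?thesis
      by (simp add: U_def paraproduct_term_def fun_eq_iff u_def[abs_def] dyadic_D_def)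
  qed
  define F where "F s = (\<Sum>i<n. U (m + 1 + int i) s) + (u s - E K u s)" for s
  have stU: "step K (\<lambda>s. \<Sum>i<n. U (m + 1 + int i) s)"
    using step_mono[OF U] K by (intro step_sum) auto
  have F1: "F \<in> Lp 1 lebesgue"
    unfolding F_def[abs_def] using step_Lp[OF stU, of 1] step_Lp[OF E_step[OF u(2)], of 1] u(1) by (intro Lp_add Lp_diff) auto
  have "bounded_support (\<lambda>s. u s - E K u s)"
    using u(2) E_bounded_support[OF u(2), of K] by (rule bounded_support_combine) simp
  then have Fb: "bounded_support F"
    using stU[unfolded step_def, THEN conjunct2] by (rule bounded_support_combine) (simp add: F_def)
  have "(LINT s|lebesgue. blinfun_apply (g s) (F s)) = sym_paraproduct_form \<D> b f g"
    if g: "good g" for g :: "real ^ 'd \<Rightarrow> 'y \<Rightarrow>\<^sub>L real"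
  proof -
    obtain K' where st: "step K' g" using g unfolding good_def by blast
    \<comment> \<open>Beyond the finer of the generations of f and g no term contributes to the
      form.\<close>
    define N where "N = nat (max K K' - m)"
    have N: "m + int N = max K K'" "n \<le> N" using mK(1) by (auto simp: N_def n_def)
    have gN: "step (m + int N) g" "step (m + int N) f" using step_mono[OF st] step_mono[OF mK(2)] N by auto
    have tele: "(\<Sum>i<l. U (m + 1 + int i) s) = (\<Sum>i<n. U (m + 1 + int i) s) + (E (m + int l) u s - E K u s)"
      if "n \<le> l" for l s
      using that
    proof (induction l rule: dec_induct)
      case base
      show ?case by (simp add: K)
    next
      case (step l)
      have "K < m + 1 + int l" using step(1) K by simp
      then have "U (m + 1 + int l) s = E (m + int (Suc l)) u s - E (m + int l) u s"
        by (simp add: U_tail dyadic_D_def algebra_simps)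
      then show ?case using step by simp
    qed
    have i1: "integrable lebesgue (\<lambda>s. blinfun_apply (g s) (U k s))" for k
      by (rule pairing_integrable[OF step_L1_loc[OF U] st])
    have i2: "integrable lebesgue (\<lambda>s. blinfun_apply (g s) (\<Sum>i<n. U (m + 1 + int i) s))"
      by (rule pairing_integrable[OF step_L1_loc[OF stU] st])
    have i3: "integrable lebesgue (\<lambda>s. blinfun_apply (g s) (E k u s))" for k
      by (rule pairing_integrable[OF step_L1_loc[OF E_step[OF u(2)]] st])
    have i4: "integrable lebesgue (\<lambda>s. blinfun_apply (g s) (u s))"
      by (rule pairing_integrable[OF uL st])
    have "sym_paraproduct_form \<D> b f g = (\<Sum>i<N. (LINT s|lebesgue. blinfun_apply (g s) (U (m + 1 + int i) s)))"
      unfolding U_def by (rule sym_paraproduct_form_eq_sum[OF b gN(2) mK(3) gN(1)])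
    also have "\<dots> = (LINT s|lebesgue. (\<Sum>i<N. blinfun_apply (g s) (U (m + 1 + int i) s)))"
      by (rule Bochner_Integration.integral_sum[symmetric]) (rule i1)
    also have "\<dots> = (LINT s|lebesgue. blinfun_apply (g s) (\<Sum>i<n. U (m + 1 + int i) s)
        + (blinfun_apply (g s) (E (m + int N) u s) - blinfun_apply (g s) (E K u s)))"
      unfolding blinfun.sum_right[symmetric] tele[OF N(2)] blinfun.add_right blinfun.diff_right ..
    also have "\<dots> = (LINT s|lebesgue. blinfun_apply (g s) (\<Sum>i<n. U (m + 1 + int i) s))
        + ((LINT s|lebesgue. blinfun_apply (g s) (E (m + int N) u s)) - (LINT s|lebesgue. blinfun_apply (g s) (E K u s)))"
      by (simp only: Bochner_Integration.integral_add[OF i2 Bochner_Integration.integrable_diff[OF i3 i3]]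
          Bochner_Integration.integral_diff[OF i3 i3])
    \<comment> \<open>g is constant on the cubes of generation m + N, so averaging u at that
      generation does not change the pairing.\<close>
    also have "(LINT s|lebesgue. blinfun_apply (g s) (E (m + int N) u s)) = (LINT s|lebesgue. blinfun_apply (g s) (u s))"
      using E_adjoint[OF u st, of "m + int N"] E_self[of "m + int N" g "m + int N"] gN(1) by (simp add: step_def)
    also have "(LINT s|lebesgue. blinfun_apply (g s) (\<Sum>i<n. U (m + 1 + int i) s))
        + ((LINT s|lebesgue. blinfun_apply (g s) (u s)) - (LINT s|lebesgue. blinfun_apply (g s) (E K u s)))
        = (LINT s|lebesgue. blinfun_apply (g s) (F s))"
      unfolding F_def blinfun.add_right blinfun.diff_right
      by (simp only: Bochner_Integration.integral_add[OF i2 Bochner_Integration.integrable_diff[OF i4 i3]]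
          Bochner_Integration.integral_diff[OF i4 i3])
    finally show ?thesis ..
  qed
  then have "represents b f F" unfolding represents_def using f F1 Fb by blast
  then show thesis by (rule that)
qed

end

section \<open>Extension by density\<close>

lemma Lp_norm_combine_le:
  fixes f g :: "'a::euclidean_space \<Rightarrow> 'b::real_normed_vector"
  assumes p: "1 \<le> p" and f: "f \<in> Lp p lebesgue" and g: "g \<in> Lp p lebesgue"
  shows "Lp_norm p lebesgue (\<lambda>x. f x + r *\<^sub>R g x) \<le> Lp_norm p lebesgue f + \<bar>r\<bar> * Lp_norm p lebesgue g"
  using Lp_norm_triangle[OF p f Lp_scaleR[OF _ g, of r]] Lp_norm_scaleR[OF _ g, of r] p by simp

lemma Lp_norm_diff_triangle:
  fixes f g h :: "'a::euclidean_space \<Rightarrow> 'b::real_normed_vector"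
  assumes p: "1 \<le> p" and L: "f \<in> Lp p lebesgue" "g \<in> Lp p lebesgue" "h \<in> Lp p lebesgue"
  shows "Lp_norm p lebesgue (\<lambda>x. f x - h x) \<le> Lp_norm p lebesgue (\<lambda>x. f x - g x) + Lp_norm p lebesgue (\<lambda>x. g x - h x)"
  using Lp_norm_triangle[OF p Lp_diff[OF p L(1,2)] Lp_diff[OF p L(2,3)]] by simp

lemma Lp_norm_diff_commute: "Lp_norm p M (\<lambda>x. f x - g x) = Lp_norm p M (\<lambda>x. g x - f x)"
  unfolding Lp_norm_def by (simp only: norm_minus_commute)

context dyadic
begin

section \<open>Linearity of the form and of its representation\<close>

lemma E_combine:
  fixes f g :: "real ^ 'd \<Rightarrow> 'b::banach"
  assumes f: "f \<in> Lp 1 lebesgue" and g: "g \<in> Lp 1 lebesgue"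
  shows "E k (\<lambda>x. f x + r *\<^sub>R g x) = (\<lambda>x. E k f x + r *\<^sub>R E k g x)"
proof -
  have L: "f \<in> L1_loc" "g \<in> L1_loc" "(\<lambda>x. r *\<^sub>R g x) \<in> L1_loc"
    using f g Lp_scaleR[of 1 g r] by (auto intro!: Lp_subset_L1_loc[of 1])
  show ?thesis using E_add[OF L(1,3), of k] E_scaleR[OF L(2), of k r] by simp
qed

lemma D_combine:
  fixes f g :: "real ^ 'd \<Rightarrow> 'b::banach"
  assumes f: "f \<in> Lp 1 lebesgue" and g: "g \<in> Lp 1 lebesgue"
  shows "D k (\<lambda>x. f x + r *\<^sub>R g x) = (\<lambda>x. D k f x + r *\<^sub>R D k g x)"
  unfolding dyadic_D_def[abs_def] E_combine[OF f g] by (simp add: algebra_simps)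

lemma paraproduct_term_combine:
  fixes b :: "real ^ 'd \<Rightarrow> 'x::banach \<Rightarrow>\<^sub>L 'y::banach"
  assumes b: "b \<in> L1_loc" and f: "step K f" and g: "step K g"
  shows "paraproduct_term b (\<lambda>x. f x + r *\<^sub>R g x) k
    = (\<lambda>x. paraproduct_term b f k x + r *\<^sub>R paraproduct_term b g k x)"
proof -
  have L: "f \<in> Lp 1 lebesgue" "g \<in> Lp 1 lebesgue" using step_Lp[OF f] step_Lp[OF g] by auto
  have bs: "bounded_support f" "bounded_support g" using f g by (auto simp: step_def)
  note m = mult_step_L1(1)[OF b E_step[OF bs(1)]] mult_step_L1(1)[OF b E_step[OF bs(2)]]
    mult_step_L1(1)[OF b D_step[OF bs(1)]] mult_step_L1(1)[OF b D_step[OF bs(2)]]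
  show ?thesis
    unfolding paraproduct_term_def[abs_def] E_combine[OF L] D_combine[OF L] blinfun.add_right blinfun.scaleR_right
      D_combine[OF m(1,2)] E_combine[OF m(3,4)]
    by (simp add: algebra_simps)
qed

text \<open>In a common window of generations the form is a finite sum of pairings with
  \<open>paraproduct_term\<close>, which is linear in f.\<close>

lemma sym_paraproduct_form_combine:
  fixes b :: "real ^ 'd \<Rightarrow> 'x::banach \<Rightarrow>\<^sub>L 'y::banach" and h :: "real ^ 'd \<Rightarrow> 'y \<Rightarrow>\<^sub>L real"
  assumes b: "b \<in> L1_loc" and f: "good f" and g: "good g" and h: "good h"
  shows "sym_paraproduct_form \<D> b (\<lambda>x. f x + r *\<^sub>R g x) h
    = sym_paraproduct_form \<D> b f h + r * sym_paraproduct_form \<D> b g h"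
proof -
  obtain m1 K1 where 1: "m1 \<le> K1" "step K1 f" "E m1 f = (\<lambda>x. 0)" using f unfolding good_def by blast
  obtain m2 K2 where 2: "m2 \<le> K2" "step K2 g" "E m2 g = (\<lambda>x. 0)" using g unfolding good_def by blast
  obtain K3 where 3: "step K3 h" using h unfolding good_def by blast
  define m where "m = min m1 m2"
  define n where "n = nat (max K1 (max K2 K3) - m)"
  have K: "m + int n = max K1 (max K2 K3)" using 1(1) by (auto simp: n_def m_def)
  have st: "step (m + int n) f" "step (m + int n) g" "step (m + int n) h"
    using step_mono[OF 1(2)] step_mono[OF 2(2)] step_mono[OF 3] K by auto
  have st': "step (m + int n) (\<lambda>x. f x + r *\<^sub>R g x)"
    using step_compose2[OF st(1) step_compose[OF st(2), of "\<lambda>v. r *\<^sub>R v"], of "(+)"] by simp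
  have L: "f \<in> Lp 1 lebesgue" "g \<in> Lp 1 lebesgue" using step_Lp[OF st(1)] step_Lp[OF st(2)] by auto
  have z: "E m f = (\<lambda>x. 0)" "E m g = (\<lambda>x. 0)"
    using E_zero_mono[OF step_L1_loc[OF 1(2)] 1(3)] E_zero_mono[OF step_L1_loc[OF 2(2)] 2(3)] by (auto simp: m_def)
  have z': "E m (\<lambda>x. f x + r *\<^sub>R g x) = (\<lambda>x. 0)" unfolding E_combine[OF L] z by simp
  have bs: "bounded_support f" "bounded_support g" using st by (auto simp: step_def)
  have i: "integrable lebesgue (\<lambda>s. blinfun_apply (h s) (paraproduct_term b f k s))"
    "integrable lebesgue (\<lambda>s. blinfun_apply (h s) (paraproduct_term b g k s))" for k
    using pairing_integrable[OF step_L1_loc[OF paraproduct_term_step[OF b bs(1)]] 3]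
      pairing_integrable[OF step_L1_loc[OF paraproduct_term_step[OF b bs(2)]] 3] by auto
  have "(LINT s|lebesgue. blinfun_apply (h s) (paraproduct_term b (\<lambda>x. f x + r *\<^sub>R g x) k s))
      = (LINT s|lebesgue. blinfun_apply (h s) (paraproduct_term b f k s)) + r * (LINT s|lebesgue. blinfun_apply (h s) (paraproduct_term b g k s))" for k
    unfolding paraproduct_term_combine[OF b st(1,2)] blinfun.add_right blinfun.scaleR_right real_scaleR_def
    by (simp add: Bochner_Integration.integral_add[OF i(1) Bochner_Integration.integrable_mult_right[OF i(2)]])
  then show ?thesis
    unfolding sym_paraproduct_form_eq_sum[OF b st' z' st(3)] sym_paraproduct_form_eq_sum[OF b st(1) z(1) st(3)]
      sym_paraproduct_form_eq_sum[OF b st(2) z(2) st(3)]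
    by (simp add: sum.distrib sum_distrib_left)
qed

lemma represents_combine:
  fixes b :: "real ^ 'd \<Rightarrow> 'x::banach \<Rightarrow>\<^sub>L 'y::banach"
  assumes b: "b \<in> L1_loc" and f: "represents b f F" and g: "represents b g G"
  shows "represents b (\<lambda>x. f x + r *\<^sub>R g x) (\<lambda>x. F x + r *\<^sub>R G x)"
proof -
  have gd: "good f" "good g" and L: "F \<in> Lp 1 lebesgue" "G \<in> Lp 1 lebesgue"
    and bs: "bounded_support F" "bounded_support G"
    and eq: "\<And>h :: real ^ 'd \<Rightarrow> 'y \<Rightarrow>\<^sub>L real. good h \<Longrightarrow> (LINT s|lebesgue. blinfun_apply (h s) (F s)) = sym_paraproduct_form \<D> b f h"
      "\<And>h :: real ^ 'd \<Rightarrow> 'y \<Rightarrow>\<^sub>L real. good h \<Longrightarrow> (LINT s|lebesgue. blinfun_apply (h s) (G s)) = sym_paraproduct_form \<D> b g h"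
    using f g unfolding represents_def by blast+
  have L': "(\<lambda>x. F x + r *\<^sub>R G x) \<in> Lp 1 lebesgue" using L by (intro Lp_add Lp_scaleR) auto
  have bs': "bounded_support (\<lambda>x. F x + r *\<^sub>R G x)"
    using bs by (rule bounded_support_combine) simp
  have loc: "F \<in> L1_loc" "G \<in> L1_loc" using L by (auto intro!: Lp_subset_L1_loc[of 1])
  have "(LINT s|lebesgue. blinfun_apply (h s) (F s + r *\<^sub>R G s)) = sym_paraproduct_form \<D> b (\<lambda>x. f x + r *\<^sub>R g x) h"
    if h: "good h" for h :: "real ^ 'd \<Rightarrow> 'y \<Rightarrow>\<^sub>L real"
  proof -
    obtain K where st: "step K h" using h unfolding good_def by blast
    note i = pairing_integrable[OF loc(1) st] pairing_integrable[OF loc(2) st]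
    have "(LINT s|lebesgue. blinfun_apply (h s) (F s + r *\<^sub>R G s))
        = (LINT s|lebesgue. blinfun_apply (h s) (F s)) + r * (LINT s|lebesgue. blinfun_apply (h s) (G s))"
      unfolding blinfun.add_right blinfun.scaleR_right real_scaleR_def
      by (simp add: Bochner_Integration.integral_add[OF i(1) Bochner_Integration.integrable_mult_right[OF i(2)]])
    then show ?thesis using eq[OF h] sym_paraproduct_form_combine[OF b gd h, of r] by simp
  qed
  then show ?thesis unfolding represents_def using good_combine[OF gd] L' bs' by blast
qed

lemma sym_paraproduct_form_cong_AE:
  fixes b :: "real ^ 'd \<Rightarrow> 'x::banach \<Rightarrow>\<^sub>L 'y::banach" and g g' :: "real ^ 'd \<Rightarrow> 'y \<Rightarrow>\<^sub>L real"
  assumes "AE x in lebesgue. f x = f' x" "AE x in lebesgue. g x = g' x"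
  shows "sym_paraproduct_form \<D> b f g = sym_paraproduct_form \<D> b f' g'"
proof -
  have "E k f = E k f'" "E k g = E k g'" for k
    using assms by (auto intro: E_cong_AE)
  then have "D k f = D k f'" "D k g = D k g'" for k by (simp_all add: dyadic_D_def fun_eq_iff)
  with \<open>\<And>k. E k f = E k f'\<close> \<open>\<And>k. E k g = E k g'\<close> show ?thesis
    unfolding sym_paraproduct_form_def by (simp only:)
qed

text \<open>Represented pairs of functions form a linear relation, bounded by C through duality. Its
  closure in L^p is single-valued almost everywhere by the bound, and defined everywhere by density
  and completeness.\<close>

lemma sym_paraproduct_extension:
  fixes b :: "real ^ 'd \<Rightarrow> 'x::banach \<Rightarrow>\<^sub>L 'y::banach"
  assumes p: "1 < p" "1 < q" "1 / p + 1 / q = 1" and b: "b \<in> L1_loc" and C: "0 \<le> C"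
    and bound: "\<And>f (g :: real ^ 'd \<Rightarrow> 'y \<Rightarrow>\<^sub>L real). good f \<Longrightarrow> good g \<Longrightarrow>
      \<bar>sym_paraproduct_form \<D> b f g\<bar> \<le> C * Lp_norm p lebesgue f * Lp_norm q lebesgue g"
  obtains T where "extends_sym_paraproduct p q \<D> b T" "Lp_operator_norm p lebesgue T \<le> C"
proof -
  have p1: "1 \<le> p" "0 < p" using p by auto
  have rep: "F \<in> Lp p lebesgue" "Lp_norm p lebesgue F \<le> C * Lp_norm p lebesgue f" "f \<in> Lp p lebesgue"
    if R: "represents b f F" for f F
  proof -
    have r: "good f" "F \<in> Lp 1 lebesgue" "bounded_support F" using R unfolding represents_def by blast+
    have c: "0 \<le> C * Lp_norm p lebesgue f" using C by simp
    have bd: "\<bar>LINT x|lebesgue. blinfun_apply (g x) (F x)\<bar> \<le> C * Lp_norm p lebesgue f * Lp_norm q lebesgue g"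
      if "good g" for g :: "real ^ 'd \<Rightarrow> 'y \<Rightarrow>\<^sub>L real"
      using R that bound[OF r(1) that] unfolding represents_def by simp
    show "F \<in> Lp p lebesgue" "Lp_norm p lebesgue F \<le> C * Lp_norm p lebesgue f"
      using Lp_norm_by_duality[OF p r(2,3) c bd] by auto
    show "f \<in> Lp p lebesgue" by (rule good_Lp[OF r(1) p1(1)])
  qed
  \<comment> \<open>The closure in L^p of the graph formed by the represented pairs.\<close>
  define cl where "cl f h \<longleftrightarrow> f \<in> Lp p lebesgue \<and> h \<in> Lp p lebesgue \<and>
    (\<exists>u U. (\<forall>n::nat. represents b (u n) (U n)) \<and> (\<lambda>n. Lp_norm p lebesgue (\<lambda>x. f x - u n x)) \<longlonglongrightarrow> 0 \<and>
      (\<lambda>n. Lp_norm p lebesgue (\<lambda>x. h x - U n x)) \<longlonglongrightarrow> 0)" for f h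
  have zero_norm: "Lp_norm p lebesgue (\<lambda>x::real ^ 'd. 0 :: 'z::real_normed_vector) = 0"
    using p1 by (simp add: Lp_norm_def)
  have cl_rep: "cl f F" if "represents b f F" for f F
    unfolding cl_def
  proof (intro conjI exI allI)
    show "f \<in> Lp p lebesgue" "F \<in> Lp p lebesgue" using rep[OF that] by auto
    show "represents b ((\<lambda>_. f) n) ((\<lambda>_. F) n)" for n :: nat using that .
  qed (simp_all add: zero_norm)
  have cl_combine: "cl (\<lambda>x. f x + r *\<^sub>R f' x) (\<lambda>x. h x + r *\<^sub>R h' x)" if A: "cl f h" "cl f' h'" for f h f' h' r
  proof -
    have L: "f \<in> Lp p lebesgue" "h \<in> Lp p lebesgue" "f' \<in> Lp p lebesgue" "h' \<in> Lp p lebesgue"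
      using A by (auto simp: cl_def)
    obtain u U where u: "\<And>n::nat. represents b (u n) (U n)" "(\<lambda>n. Lp_norm p lebesgue (\<lambda>x. f x - u n x)) \<longlonglongrightarrow> 0"
      "(\<lambda>n. Lp_norm p lebesgue (\<lambda>x. h x - U n x)) \<longlonglongrightarrow> 0" using A(1) unfolding cl_def by blast
    obtain u' U' where u': "\<And>n::nat. represents b (u' n) (U' n)" "(\<lambda>n. Lp_norm p lebesgue (\<lambda>x. f' x - u' n x)) \<longlonglongrightarrow> 0"
      "(\<lambda>n. Lp_norm p lebesgue (\<lambda>x. h' x - U' n x)) \<longlonglongrightarrow> 0" using A(2) unfolding cl_def by blast
    have lim: "(\<lambda>n. Lp_norm p lebesgue (\<lambda>x. (g x + r *\<^sub>R g' x) - (v n x + r *\<^sub>R v' n x))) \<longlonglongrightarrow> 0"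
      if "g \<in> Lp p lebesgue" "g' \<in> Lp p lebesgue" "\<And>n. v n \<in> Lp p lebesgue" "\<And>n. v' n \<in> Lp p lebesgue"
        "(\<lambda>n. Lp_norm p lebesgue (\<lambda>x. g x - v n x)) \<longlonglongrightarrow> 0" "(\<lambda>n. Lp_norm p lebesgue (\<lambda>x. g' x - v' n x)) \<longlonglongrightarrow> 0"
      for g g' and v v' :: "nat \<Rightarrow> real ^ 'd \<Rightarrow> 'z::real_normed_vector"
    proof (rule tendsto_sandwich[OF _ _ tendsto_const])
      have "Lp_norm p lebesgue (\<lambda>x. (g x + r *\<^sub>R g' x) - (v n x + r *\<^sub>R v' n x))
          \<le> Lp_norm p lebesgue (\<lambda>x. g x - v n x) + \<bar>r\<bar> * Lp_norm p lebesgue (\<lambda>x. g' x - v' n x)" for n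
        using Lp_norm_combine_le[OF p1(1) Lp_diff[OF p1(1) that(1,3)] Lp_diff[OF p1(1) that(2,4)], of n r n]
        by (simp add: algebra_simps)
      then show "\<forall>\<^sub>F n in sequentially. Lp_norm p lebesgue (\<lambda>x. (g x + r *\<^sub>R g' x) - (v n x + r *\<^sub>R v' n x))
          \<le> Lp_norm p lebesgue (\<lambda>x. g x - v n x) + \<bar>r\<bar> * Lp_norm p lebesgue (\<lambda>x. g' x - v' n x)"
        by (intro always_eventually allI)
      show "(\<lambda>n. Lp_norm p lebesgue (\<lambda>x. g x - v n x) + \<bar>r\<bar> * Lp_norm p lebesgue (\<lambda>x. g' x - v' n x)) \<longlonglongrightarrow> 0"
        using tendsto_add[OF that(5) tendsto_mult[OF tendsto_const that(6)], of "\<bar>r\<bar>"] by simp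
    qed simp
    show ?thesis
      unfolding cl_def
    proof (intro conjI exI allI)
      show "(\<lambda>x. f x + r *\<^sub>R f' x) \<in> Lp p lebesgue" "(\<lambda>x. h x + r *\<^sub>R h' x) \<in> Lp p lebesgue"
        using L p1 by (auto intro!: Lp_add Lp_scaleR)
      show "represents b ((\<lambda>n x. u n x + r *\<^sub>R u' n x) n) ((\<lambda>n x. U n x + r *\<^sub>R U' n x) n)" for n
        by (rule represents_combine[OF b u(1) u'(1)])
      show "(\<lambda>n. Lp_norm p lebesgue (\<lambda>x. (f x + r *\<^sub>R f' x) - (\<lambda>n x. u n x + r *\<^sub>R u' n x) n x)) \<longlonglongrightarrow> 0"
        by (rule lim[OF L(1,3) rep(3)[OF u(1)] rep(3)[OF u'(1)] u(2) u'(2)])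
      show "(\<lambda>n. Lp_norm p lebesgue (\<lambda>x. (h x + r *\<^sub>R h' x) - (\<lambda>n x. U n x + r *\<^sub>R U' n x) n x)) \<longlonglongrightarrow> 0"
        by (rule lim[OF L(2,4) rep(1)[OF u(1)] rep(1)[OF u'(1)] u(3) u'(3)])
    qed
  qed
  have cl_bound: "Lp_norm p lebesgue h \<le> C * Lp_norm p lebesgue f" if A: "cl f h" for f h
  proof -
    have L: "f \<in> Lp p lebesgue" "h \<in> Lp p lebesgue" using A by (auto simp: cl_def)
    obtain u U where u: "\<And>n::nat. represents b (u n) (U n)" "(\<lambda>n. Lp_norm p lebesgue (\<lambda>x. f x - u n x)) \<longlonglongrightarrow> 0"
      "(\<lambda>n. Lp_norm p lebesgue (\<lambda>x. h x - U n x)) \<longlonglongrightarrow> 0" using A unfolding cl_def by blast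
    have le: "Lp_norm p lebesgue h \<le> Lp_norm p lebesgue (\<lambda>x. h x - U n x)
        + C * (Lp_norm p lebesgue (\<lambda>x. f x - u n x) + Lp_norm p lebesgue f)" for n
    proof -
      have 1: "Lp_norm p lebesgue h \<le> Lp_norm p lebesgue (\<lambda>x. h x - U n x) + Lp_norm p lebesgue (U n)"
        using Lp_norm_triangle[OF p1(1) Lp_diff[OF p1(1) L(2) rep(1)[OF u(1)]] rep(1)[OF u(1)], of n n] by simp
      have 2: "Lp_norm p lebesgue (U n) \<le> C * Lp_norm p lebesgue (u n)" by (rule rep(2)[OF u(1)])
      have "Lp_norm p lebesgue (u n) \<le> Lp_norm p lebesgue (\<lambda>x. u n x - f x) + Lp_norm p lebesgue f"
        using Lp_norm_triangle[OF p1(1) Lp_diff[OF p1(1) rep(3)[OF u(1)] L(1)] L(1), of n] by simp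
      then have "Lp_norm p lebesgue (u n) \<le> Lp_norm p lebesgue (\<lambda>x. f x - u n x) + Lp_norm p lebesgue f"
        unfolding Lp_norm_diff_commute[of p lebesgue f "u n"] .
      from mult_left_mono[OF this C] 1 2 show ?thesis by linarith
    qed
    have "(\<lambda>n. Lp_norm p lebesgue (\<lambda>x. h x - U n x)
        + C * (Lp_norm p lebesgue (\<lambda>x. f x - u n x) + Lp_norm p lebesgue f)) \<longlonglongrightarrow> 0 + C * (0 + Lp_norm p lebesgue f)"
      by (intro tendsto_intros u)
    then have "Lp_norm p lebesgue h \<le> 0 + C * (0 + Lp_norm p lebesgue f)"
      by (rule LIMSEQ_le_const) (use le in blast)
    then show ?thesis by simp
  qed
  \<comment> \<open>The difference of the two pairs again lies in the closed graph, and the bound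
    forces its second component to have norm 0.\<close>
  have cl_unique: "AE x in lebesgue. h x = h' x" if A: "cl f h" "cl f' h'" and eq: "AE x in lebesgue. f x = f' x" for f h f' h'
  proof -
    have c: "cl (\<lambda>x. f x - f' x) (\<lambda>x. h x - h' x)" using cl_combine[OF A, of "- 1"] by simp
    have "AE x in lebesgue. f x - f' x = 0" using eq by eventually_elim simp
    from Lp_norm_cong_AE[OF this] have "Lp_norm p lebesgue (\<lambda>x. f x - f' x) = 0" by (rule trans[OF _ zero_norm])
    then have "Lp_norm p lebesgue (\<lambda>x. h x - h' x) = 0"
      using cl_bound[OF c] by (simp add: order_antisym)
    then have "AE x in lebesgue. h x - h' x = 0"
      using c p1 by (intro Lp_norm_eq_0[of p]) (auto simp: cl_def)
    then show ?thesis by eventually_elim simp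
  qed
  have cl_total: "\<exists>h. cl f h" if f: "f \<in> Lp p lebesgue" for f
  proof -
    have "\<exists>u. good u \<and> Lp_norm p lebesgue (\<lambda>x. f x - u x) < (1 / 4) ^ n" for n :: nat
    proof -
      have e: "0 < (1 / 4 :: real) ^ n" by simp
      show ?thesis by (rule good_dense[OF p(1) f e]) blast
    qed
    then obtain u where u: "\<And>n. good (u n)" "\<And>n. Lp_norm p lebesgue (\<lambda>x. f x - u n x) < (1 / 4) ^ n" by metis
    have "\<exists>F. represents b (u n) F" for n using represents_exists[OF b u(1)] by metis
    then obtain U where U: "\<And>n. represents b (u n) (U n)" by metis
    \<comment> \<open>The representing functions U n need not be simple, as
      \<open>Lp_rapid_Cauchy_converges\<close> demands, so they are replaced by step functions
      within the same error.\<close>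
    have "\<exists>s. good s \<and> Lp_norm p lebesgue (\<lambda>x. U n x - s x) < (1 / 4) ^ n" for n
    proof -
      have e: "0 < (1 / 4 :: real) ^ n" by simp
      show ?thesis by (rule good_dense[OF p(1) rep(1)[OF U] e]) blast
    qed
    then obtain s where s: "\<And>n. good (s n)" "\<And>n. Lp_norm p lebesgue (\<lambda>x. U n x - s n x) < (1 / 4) ^ n" by metis
    have sL: "s n \<in> Lp p lebesgue" for n by (rule good_Lp[OF s(1) p1(1)])
    have UL: "U n \<in> Lp p lebesgue" and uL: "u n \<in> Lp p lebesgue" for n using rep[OF U] by auto
    \<comment> \<open>Replacing U by s at two consecutive indices costs at most 2 units of
      \<open>(1 / 4) ^ n\<close>; passing from u to U costs C times another 2 units.\<close>
    have "Lp_norm p lebesgue (\<lambda>x. s (Suc n) x - s n x) \<le> (2 + 2 * C) * (1 / 4) ^ n" for n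
    proof -
      have q4: "(1 / 4 :: real) ^ Suc n \<le> (1 / 4) ^ n" by simp
      have 1: "Lp_norm p lebesgue (\<lambda>x. s (Suc n) x - s n x)
          \<le> Lp_norm p lebesgue (\<lambda>x. s (Suc n) x - U (Suc n) x) + Lp_norm p lebesgue (\<lambda>x. U (Suc n) x - s n x)"
        by (rule Lp_norm_diff_triangle[OF p1(1) sL UL sL])
      have 2: "Lp_norm p lebesgue (\<lambda>x. U (Suc n) x - s n x)
          \<le> Lp_norm p lebesgue (\<lambda>x. U (Suc n) x - U n x) + Lp_norm p lebesgue (\<lambda>x. U n x - s n x)"
        by (rule Lp_norm_diff_triangle[OF p1(1) UL UL sL])
      have 3: "Lp_norm p lebesgue (\<lambda>x. U (Suc n) x - U n x) \<le> C * Lp_norm p lebesgue (\<lambda>x. u (Suc n) x - u n x)"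
        using rep(2)[OF represents_combine[OF b U U], of "Suc n" "- 1" n] by simp
      have 4: "Lp_norm p lebesgue (\<lambda>x. u (Suc n) x - u n x)
          \<le> Lp_norm p lebesgue (\<lambda>x. u (Suc n) x - f x) + Lp_norm p lebesgue (\<lambda>x. f x - u n x)"
        by (rule Lp_norm_diff_triangle[OF p1(1) uL f uL])
      have 5: "Lp_norm p lebesgue (\<lambda>x. s (Suc n) x - U (Suc n) x) < (1 / 4) ^ Suc n"
        "Lp_norm p lebesgue (\<lambda>x. u (Suc n) x - f x) < (1 / 4) ^ Suc n"
        unfolding Lp_norm_diff_commute[of p lebesgue "s (Suc n)" "U (Suc n)"] Lp_norm_diff_commute[of p lebesgue "u (Suc n)" f]
        by (rule s(2) u(2))+
      have "Lp_norm p lebesgue (\<lambda>x. u (Suc n) x - u n x) \<le> 2 * (1 / 4) ^ n"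
        using 4 5(2) u(2)[of n] q4 by linarith
      from mult_left_mono[OF this C] have "Lp_norm p lebesgue (\<lambda>x. s (Suc n) x - s n x) \<le> 2 * (1 / 4) ^ n + C * (2 * (1 / 4) ^ n)"
        using 1 2 3 5(1) s(2)[of n] q4 by linarith
      then show ?thesis by (simp add: algebra_simps)
    qed
    moreover have "simple_function lebesgue (s n)" for n using s(1)[of n] step_simple unfolding good_def by blast
    ultimately obtain h where h: "h \<in> Lp p lebesgue" "(\<lambda>n. Lp_norm p lebesgue (\<lambda>x. h x - s n x)) \<longlonglongrightarrow> 0"
      using Lp_rapid_Cauchy_converges[OF p1(1), of s "2 + 2 * C"] sL C by auto
    have q0: "(\<lambda>n. (1 / 4 :: real) ^ n) \<longlonglongrightarrow> 0" by (rule LIMSEQ_power_zero) simp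
    have fu: "(\<lambda>n. Lp_norm p lebesgue (\<lambda>x. f x - u n x)) \<longlonglongrightarrow> 0"
    proof (rule tendsto_sandwich[OF _ _ tendsto_const q0])
      show "\<forall>\<^sub>F n in sequentially. Lp_norm p lebesgue (\<lambda>x. f x - u n x) \<le> (1 / 4) ^ n"
        by (intro always_eventually allI less_imp_le u(2))
    qed simp
    have hU: "(\<lambda>n. Lp_norm p lebesgue (\<lambda>x. h x - U n x)) \<longlonglongrightarrow> 0"
    proof (rule tendsto_sandwich[OF _ _ tendsto_const])
      have "Lp_norm p lebesgue (\<lambda>x. h x - U n x) \<le> Lp_norm p lebesgue (\<lambda>x. h x - s n x) + (1 / 4) ^ n" for n
        using Lp_norm_diff_triangle[OF p1(1) h(1) sL UL, of n n] s(2)[of n] Lp_norm_diff_commute[of p lebesgue "s n" "U n"] by linarith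
      then show "\<forall>\<^sub>F n in sequentially. Lp_norm p lebesgue (\<lambda>x. h x - U n x) \<le> Lp_norm p lebesgue (\<lambda>x. h x - s n x) + (1 / 4) ^ n"
        by (intro always_eventually allI)
      show "(\<lambda>n. Lp_norm p lebesgue (\<lambda>x. h x - s n x) + (1 / 4) ^ n) \<longlonglongrightarrow> 0"
        using tendsto_add[OF h(2) q0] by simp
    qed simp
    show ?thesis unfolding cl_def using f h(1) U fu hU by blast
  qed
  \<comment> \<open>The choice of values is determined only up to null sets, which suffices because
    linearity is required almost everywhere.\<close>
  define T where "T f = (SOME h. cl f h)" for f
  have T: "cl f (T f)" if "f \<in> Lp p lebesgue" for f
    unfolding T_def by (rule someI_ex[OF cl_total[OF that]])
  have TL: "T f \<in> Lp p lebesgue" if "f \<in> Lp p lebesgue" for f using T[OF that] by (simp add: cl_def)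
  have Tb: "Lp_norm p lebesgue (T f) \<le> C * Lp_norm p lebesgue f" if "f \<in> Lp p lebesgue" for f
    by (rule cl_bound[OF T[OF that]])
  have "bounded_Lp_operator p lebesgue T"
    unfolding bounded_Lp_operator_def
  proof (intro conjI ballI allI impI)
    fix f g :: "real ^ 'd \<Rightarrow> 'x" and r :: real
    assume f: "f \<in> Lp p lebesgue"
    show "T f \<in> Lp p lebesgue" by (rule TL[OF f])
    \<comment> \<open>A multiple of f is written as f plus \<open>r - 1\<close> times f, to fit the
      shape of \<open>cl_combine\<close>.\<close>
    have "cl (\<lambda>x. f x + (r - 1) *\<^sub>R f x) (\<lambda>x. T f x + (r - 1) *\<^sub>R T f x)" by (rule cl_combine[OF T[OF f] T[OF f]])
    then have c: "cl (\<lambda>x. r *\<^sub>R f x) (\<lambda>x. r *\<^sub>R T f x)" by (simp add: scaleR_left_diff_distrib)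
    show "AE x in lebesgue. T (\<lambda>x. r *\<^sub>R f x) x = r *\<^sub>R T f x"
      by (rule cl_unique[OF T c]) (use f p1 in \<open>auto intro: Lp_scaleR\<close>)
    assume g: "g \<in> Lp p lebesgue"
    show "AE x in lebesgue. T f x = T g x" if "AE x in lebesgue. f x = g x"
      by (rule cl_unique[OF T[OF f] T[OF g] that])
    have c: "cl (\<lambda>x. f x + g x) (\<lambda>x. T f x + T g x)" using cl_combine[OF T[OF f] T[OF g], of 1] by simp
    show "AE x in lebesgue. T (\<lambda>x. f x + g x) x = T f x + T g x"
      by (rule cl_unique[OF T c]) (use f g p1 in \<open>auto intro: Lp_add\<close>)
  next
    show "\<exists>C. \<forall>f\<in>Lp p lebesgue. Lp_norm p lebesgue (T f) \<le> C * Lp_norm p lebesgue f"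
      using Tb by blast
  qed
  moreover have "(LINT s|lebesgue. blinfun_apply (g s) (T f s)) = sym_paraproduct_form \<D> b f g"
    if f: "f \<in> Lp_c p" "finite_dyadic_expansion \<D> f" and g: "g \<in> Lp_c q" "finite_dyadic_expansion \<D> g" for f g
  proof -
    \<comment> \<open>Both sides depend only on almost everywhere classes, so the arguments may be
      replaced by good representatives, for which the form is already represented.\<close>
    obtain f' where f': "good f'" "AE x in lebesgue. f x = f' x" using finite_expansion_good[OF p1(1) f] .
    obtain g' where g': "good g'" "AE x in lebesgue. g x = g' x" using finite_expansion_good[OF less_imp_le[OF p(2)] g] .
    obtain F where F: "represents b f' F" using represents_exists[OF b f'(1)] .
    have fL: "f \<in> Lp p lebesgue" and gL: "g \<in> Lp q lebesgue" using f g by (auto simp: Lp_c_def)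
    have AE: "AE x in lebesgue. T f x = F x" by (rule cl_unique[OF T[OF fL] cl_rep[OF F] f'(2)])
    have "(LINT s|lebesgue. blinfun_apply (g s) (T f s)) = (LINT s|lebesgue. blinfun_apply (g' s) (F s))"
    proof (rule integral_cong_AE)
      have m: "(\<lambda>s. blinfun_apply (u s) (v s)) \<in> borel_measurable lebesgue"
        if "strongly_measurable lebesgue u" "strongly_measurable lebesgue v"
        for u :: "real ^ 'd \<Rightarrow> 'y \<Rightarrow>\<^sub>L real" and v
        by (rule strongly_measurable_real[OF strongly_measurable_bilinear[OF bounded_bilinear_blinfun_apply that]])
      show "(\<lambda>s. blinfun_apply (g s) (T f s)) \<in> borel_measurable lebesgue"
        using gL TL[OF fL] by (intro m) (auto simp: Lp_def)
      show "(\<lambda>s. blinfun_apply (g' s) (F s)) \<in> borel_measurable lebesgue"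
        using good_Lp[OF g'(1), of 1] rep(1)[OF F] by (intro m) (auto simp: Lp_def)
      show "AE s in lebesgue. blinfun_apply (g s) (T f s) = blinfun_apply (g' s) (F s)"
        using AE g'(2) by eventually_elim simp
    qed
    also have "\<dots> = sym_paraproduct_form \<D> b f' g'" using F g'(1) unfolding represents_def by blast
    also have "\<dots> = sym_paraproduct_form \<D> b f g" by (rule sym_paraproduct_form_cong_AE[OF f'(2) g'(2), symmetric])
    finally show ?thesis .
  qed
  ultimately have "extends_sym_paraproduct p q \<D> b T"
    unfolding extends_sym_paraproduct_def by blast
  moreover have "Lp_operator_norm p lebesgue T \<le> C"
    unfolding Lp_operator_norm_def
    by (rule cInf_lower) (use C Tb in \<open>auto intro!: bdd_belowI[of _ 0]\<close>)
  ultimately show thesis by (rule that)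
qed

end

theorem theorem3p2:
  fixes \<D> :: "int \<Rightarrow> (real ^ 'd::finite) set set"
    and b :: "real ^ 'd \<Rightarrow> 'x::banach \<Rightarrow>\<^sub>L 'y::banach"
    and p p' c\<^sub>d :: real
  assumes "UMD TYPE('x)" and "UMD TYPE('y)"
    and "1 < p" and "1 / p + 1 / p' = 1"
    and "dyadic_system \<D>"
    and "b \<in> BMO \<D>"
    and "H1_BMO_duality_constant TYPE('d) TYPE(('x \<Rightarrow>\<^sub>L 'y) \<Rightarrow>\<^sub>L real) c\<^sub>d"
  shows "(\<exists>T. extends_sym_paraproduct p p' \<D> b T \<and>
            Lp_operator_norm p lebesgue T
              \<le> c\<^sub>d * (p * p' + UMD_const p TYPE('x) * UMD_const p TYPE('y)) * BMO_norm \<D> b) \<and>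
         c\<^sub>d * (p * p' + UMD_const p TYPE('x) * UMD_const p TYPE('y)) * BMO_norm \<D> b
           \<le> (100 * c\<^sub>d) * UMD_const p TYPE('x) * UMD_const p TYPE('y) * BMO_norm \<D> b"
proof -
  interpret dyadic \<D> by (unfold_locales) (rule assms(5))
  define \<beta>X where "\<beta>X = UMD_const p TYPE('x)"
  define \<beta>Y where "\<beta>Y = UMD_const p TYPE('y)"
  have X: "UMD_bound TYPE('x) p \<beta>X"
    using assms(1,3) UMD_bound_UMD_const unfolding UMD_def \<beta>X_def by blast
  have Y: "UMD_bound TYPE('y) p \<beta>Y"
    using assms(2,3) UMD_bound_UMD_const unfolding UMD_def \<beta>Y_def by blast
  have \<beta>: "0 \<le> \<beta>X" "0 \<le> \<beta>Y" using X Y by (auto simp: UMD_bound_def)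
  have p': "1 < p'"
  proof -
    have "0 < 1 / p" "1 / p < 1" using assms(3) by simp_all
    then have "0 < 1 / p'" "1 / p' < 1" using assms(4) by linarith+
    then show ?thesis by (simp add: divide_less_eq_1 zero_less_divide_iff)
  qed
  define C where "C = c\<^sub>d * (p * p' + \<beta>X * \<beta>Y) * BMO_norm \<D> b"
  have pos: "0 < p * p' + \<beta>X * \<beta>Y" using assms(3) p' \<beta> by (intro add_pos_nonneg) auto
  have BMO0: "0 \<le> BMO_norm \<D> b" by (simp add: BMO_norm_def)
  \<comment> \<open>If b has BMO norm 0, then C is 0 regardless of the sign of the duality
    constant.\<close>
  have c: "BMO_norm \<D> b = 0 \<or> 0 \<le> c\<^sub>d"
    using duality_constant_nonneg[OF assms(7,6)] BMO0 by linarith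
  have C: "0 \<le> C" unfolding C_def using c pos BMO0 by auto
  have bL: "b \<in> L1_loc" using assms(6) by (simp add: BMO_def)
  have "\<bar>sym_paraproduct_form \<D> b f g\<bar> \<le> C * Lp_norm p lebesgue f * Lp_norm p' lebesgue g"
    if "good f" "good g" for f and g :: "real ^ 'd \<Rightarrow> 'y \<Rightarrow>\<^sub>L real"
    unfolding C_def by (rule sym_paraproduct_form_bound[OF assms(7,6,3) p' assms(4) X Y that])
  then obtain T where T: "extends_sym_paraproduct p p' \<D> b T" "Lp_operator_norm p lebesgue T \<le> C"
    using sym_paraproduct_extension[OF assms(3) p' assms(4) bL C] by blast
  have "C \<le> (100 * c\<^sub>d) * \<beta>X * \<beta>Y * BMO_norm \<D> b"
  proof (cases "BMO_norm \<D> b = 0")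
    case False
    then have "0 < BMO_norm \<D> b" using BMO0 by simp
    \<comment> \<open>A nonzero operator v and a vector x outside its kernel show that X and Y are
      both nontrivial, as the lower bound for the product of the UMD constants requires.\<close>
    then obtain v :: "'x \<Rightarrow>\<^sub>L 'y" where "v \<noteq> 0" using BMO_norm_pos_nontrivial by blast
    then obtain x where x: "blinfun_apply v x \<noteq> 0" by (metis blinfun_eqI zero_blinfun.rep_eq)
    then have "x \<noteq> 0" by auto
    have "p * p' + \<beta>X * \<beta>Y \<le> 100 * \<beta>X * \<beta>Y"
      by (rule UMD_const_product_lower_bound[OF X Y assms(3) p' assms(4) \<open>x \<noteq> 0\<close> x])
    moreover have "0 \<le> c\<^sub>d" using c False by simp
    ultimately have "c\<^sub>d * (p * p' + \<beta>X * \<beta>Y) * BMO_norm \<D> b \<le> c\<^sub>d * (100 * \<beta>X * \<beta>Y) * BMO_norm \<D> b"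
      using BMO0 by (intro mult_right_mono mult_left_mono)
    then show ?thesis by (simp add: C_def mult_ac)
  qed (simp add: C_def)
  then show ?thesis using T unfolding C_def \<beta>X_def \<beta>Y_def by blast
qed

end
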